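(* Let $X$ be a projective variety over an algebraically closed field of characteristic zero. If $E$ and $F$ are vector bundles on $X$, then $$\mathbb{B}_{+}(E\otimes F)\subseteq\mathbb{B}_{+}(E)\cup\mathbb{B}_{-}(F)\quad\text{and}\quad \mathbb{B}_{-}(E\otimes F)\subseteq\mathbb{B}_{-}(E)\cup\mathbb{B}_{-}(F).$$ It follows that if $E$ and $F$ are both V-big (respectively both V-psef), then $E\otimes F$ is V-big (respectively V-psef). Furthermore, if $E$ is V-big and $F$ is V-psef, then $E\otimes F$ is V-big.
   Context: A vector bundle is a locally free sheaf of finite positive rank. Write $S^m=\mathrm{Sym}^m$. For a vector bundle $V$ on $X$, $\mathrm{Bs}(V)$ is the set of (scheme-theoretic) points $x\in X$ such that $H^0(X,V)\to V(x)=V\otimes\kappa(x)$ is not surjective. For any ample line bundle $A$ on $X$ (the definitions do not depend on the choice), the augmented and diminished base loci are $$\mathbb{B}_+(V)=\bigcap_{q\geq 1}\bigcap_{m\geq 1}\mathrm{Bs}(S^mS^qV\otimes A^{-m}),\qquad \mathbb{B}_-(V)=\bigcup_{q\geq 1}\bigcap_{m\geq 1}\mathrm{Bs}(S^mS^qV\otimes A^{m}).$$ $V$ is V-big if $\mathbb{B}_+(V)\neq X$ and V-psef if $\mathbb{B}_-(V)\neq X$. *)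

theory Defs
  imports
    "HOL-Library.Multiset"
    "HOL-Library.Poly_Mapping"
    "HOL-Computational_Algebra.Polynomial"
    "HOL-Analysis.Abstract_Topology"
    "HOL-Algebra.QuotRing"
    "HOL-Algebra.Module"
begin

section \<open>Modules given by generators and relations\<close>

definition module_span ::
  "('a, 'c) ring_scheme \<Rightarrow> ('a, 'm, 'd) module_scheme \<Rightarrow> 'm set \<Rightarrow> 'm set" where
  "module_span R M S = \<Inter>{N. submodule N R M \<and> S \<subseteq> N}"

text \<open>The \<open>mult\<close> and \<open>one\<close> fields of a module record carry no information; they are left
  \<open>undefined\<close> throughout.\<close>

definition free_module :: "('a, 'c) ring_scheme \<Rightarrow> 'b set \<Rightarrow> ('a, 'b \<Rightarrow> 'a) module" where
  "free_module R B =
    \<lparr>carrier = {f. (\<forall>b. f b \<in> carrier R) \<and> (\<forall>b. b \<notin> B \<longrightarrow> f b = \<zero>\<^bsub>R\<^esub>)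
       \<and> finite {b. f b \<noteq> \<zero>\<^bsub>R\<^esub>}},
     mult = undefined, one = undefined,
     zero = (\<lambda>_. \<zero>\<^bsub>R\<^esub>), add = (\<lambda>f g b. f b \<oplus>\<^bsub>R\<^esub> g b),
     smult = (\<lambda>r f b. r \<otimes>\<^bsub>R\<^esub> f b)\<rparr>"

definition free_gen :: "('a, 'c) ring_scheme \<Rightarrow> 'b \<Rightarrow> 'b \<Rightarrow> 'a" where
  "free_gen R b = (\<lambda>c. if c = b then \<one>\<^bsub>R\<^esub> else \<zero>\<^bsub>R\<^esub>)"

definition quotient_module ::
  "('a, 'c) ring_scheme \<Rightarrow> ('a, 'm, 'd) module_scheme \<Rightarrow> 'm set \<Rightarrow> ('a, 'm set) module" where
  "quotient_module R M N =
    \<lparr>carrier = a_rcosets\<^bsub>M\<^esub> N, mult = undefined, one = undefined,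
     zero = N, add = set_add M,
     smult = (\<lambda>r C. \<Union>c\<in>C. N +>\<^bsub>M\<^esub> (r \<odot>\<^bsub>M\<^esub> c))\<rparr>"

definition presented_module ::
  "('a, 'c) ring_scheme \<Rightarrow> 'b set \<Rightarrow> ('b \<Rightarrow> 'a) set \<Rightarrow> ('a, ('b \<Rightarrow> 'a) set) module" where
  "presented_module R B K =
    quotient_module R (free_module R B) (module_span R (free_module R B) K)"

definition presented_class ::
  "('a, 'c) ring_scheme \<Rightarrow> 'b set \<Rightarrow> ('b \<Rightarrow> 'a) set \<Rightarrow> ('b \<Rightarrow> 'a) \<Rightarrow> ('b \<Rightarrow> 'a) set" where
  "presented_class R B K f = module_span R (free_module R B) K +>\<^bsub>free_module R B\<^esub> f"

text \<open>The map induced by a ring homomorphism \<open>\<rho>\<close> and a map \<open>h\<close> of generators that is compatible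
  with the relations: \<open>\<Sum>\<^sub>b f(b) b\<close> goes to \<open>\<Sum>\<^sub>b \<rho>(f(b)) h(b)\<close>.\<close>

definition presented_map ::
  "('a, 'c) ring_scheme \<Rightarrow> ('a2, 'c2) ring_scheme \<Rightarrow> 'b2 set \<Rightarrow> ('b2 \<Rightarrow> 'a2) set \<Rightarrow>
   ('b \<Rightarrow> 'b2) \<Rightarrow> ('a \<Rightarrow> 'a2) \<Rightarrow> ('b \<Rightarrow> 'a) set \<Rightarrow> ('b2 \<Rightarrow> 'a2) set" where
  "presented_map R R' B' K' h \<rho> C =
    (\<Union>f\<in>C. presented_class R' B' K'
      (\<lambda>c. finsum R' (\<lambda>b. \<rho> (f b)) {b. f b \<noteq> \<zero>\<^bsub>R\<^esub> \<and> h b = c}))"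

definition bilinear_rels ::
  "('a, 'c) ring_scheme \<Rightarrow> ('a, 'm, 'd) module_scheme \<Rightarrow> ('a, 'n, 'e) module_scheme \<Rightarrow>
   ('m \<times> 'n \<Rightarrow> 'a) set" where
  "bilinear_rels R M N =
    (let F = free_module R (carrier M \<times> carrier N); g = free_gen R in
      {g (x \<oplus>\<^bsub>M\<^esub> x', y) \<ominus>\<^bsub>F\<^esub> (g (x, y) \<oplus>\<^bsub>F\<^esub> g (x', y)) | x x' y.
         x \<in> carrier M \<and> x' \<in> carrier M \<and> y \<in> carrier N} \<union>
      {g (x, y \<oplus>\<^bsub>N\<^esub> y') \<ominus>\<^bsub>F\<^esub> (g (x, y) \<oplus>\<^bsub>F\<^esub> g (x, y')) | x y y'.
         x \<in> carrier M \<and> y \<in> carrier N \<and> y' \<in> carrier N} \<union>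
      {g (r \<odot>\<^bsub>M\<^esub> x, y) \<ominus>\<^bsub>F\<^esub> r \<odot>\<^bsub>F\<^esub> g (x, y) | r x y.
         r \<in> carrier R \<and> x \<in> carrier M \<and> y \<in> carrier N} \<union>
      {g (x, r \<odot>\<^bsub>N\<^esub> y) \<ominus>\<^bsub>F\<^esub> r \<odot>\<^bsub>F\<^esub> g (x, y) | r x y.
         r \<in> carrier R \<and> x \<in> carrier M \<and> y \<in> carrier N})"

definition tensor_module ::
  "('a, 'c) ring_scheme \<Rightarrow> ('a, 'm, 'd) module_scheme \<Rightarrow> ('a, 'n, 'e) module_scheme \<Rightarrow>
   ('a, ('m \<times> 'n \<Rightarrow> 'a) set) module" where
  "tensor_module R M N =
    presented_module R (carrier M \<times> carrier N) (bilinear_rels R M N)"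

definition tensor_elem ::
  "('a, 'c) ring_scheme \<Rightarrow> ('a, 'm, 'd) module_scheme \<Rightarrow> ('a, 'n, 'e) module_scheme \<Rightarrow>
   'm \<Rightarrow> 'n \<Rightarrow> ('m \<times> 'n \<Rightarrow> 'a) set" where
  "tensor_elem R M N x y =
    presented_class R (carrier M \<times> carrier N) (bilinear_rels R M N) (free_gen R (x, y))"

definition words :: "nat \<Rightarrow> ('a, 'm, 'd) module_scheme \<Rightarrow> 'm list set" where
  "words n M = {xs. length xs = n \<and> set xs \<subseteq> carrier M}"

definition multilinear_rels ::
  "('a, 'c) ring_scheme \<Rightarrow> nat \<Rightarrow> ('a, 'm, 'd) module_scheme \<Rightarrow> ('m list \<Rightarrow> 'a) set" where
  "multilinear_rels R n M =
    (let F = free_module R (words n M); g = free_gen R in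
      {g (xs[i := x \<oplus>\<^bsub>M\<^esub> y]) \<ominus>\<^bsub>F\<^esub> (g (xs[i := x]) \<oplus>\<^bsub>F\<^esub> g (xs[i := y])) | xs i x y.
         xs \<in> words n M \<and> i < n \<and> x \<in> carrier M \<and> y \<in> carrier M} \<union>
      {g (xs[i := r \<odot>\<^bsub>M\<^esub> x]) \<ominus>\<^bsub>F\<^esub> r \<odot>\<^bsub>F\<^esub> g (xs[i := x]) | xs i r x.
         xs \<in> words n M \<and> i < n \<and> r \<in> carrier R \<and> x \<in> carrier M})"

definition symmetry_rels ::
  "('a, 'c) ring_scheme \<Rightarrow> nat \<Rightarrow> ('a, 'm, 'd) module_scheme \<Rightarrow> ('m list \<Rightarrow> 'a) set" where
  "symmetry_rels R n M =
    {free_gen R xs \<ominus>\<^bsub>free_module R (words n M)\<^esub> free_gen R ys | xs ys.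
       xs \<in> words n M \<and> ys \<in> words n M \<and> mset xs = mset ys}"


section \<open>Ringed spaces and sheaves of modules\<close>

text \<open>Only the values of \<open>Osec\<close>, \<open>Ores\<close>, \<open>Msec\<close> and \<open>Mres\<close> at open sets matter;
  \<open>Ores X U V\<close> is the restriction from \<open>U\<close> to \<open>V \<subseteq> U\<close>.\<close>

record ('p, 'a) ringed =
  Top :: "'p topology"
  Osec :: "'p set \<Rightarrow> 'a ring"
  Ores :: "'p set \<Rightarrow> 'p set \<Rightarrow> 'a \<Rightarrow> 'a"

record ('p, 'a, 'm) presheaf =
  Msec :: "'p set \<Rightarrow> ('a, 'm) module"
  Mres :: "'p set \<Rightarrow> 'p set \<Rightarrow> 'm \<Rightarrow> 'm"

abbreviation points :: "('p, 'a) ringed \<Rightarrow> 'p set" where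
  "points X \<equiv> topspace (Top X)"

definition sheaf_of_sets ::
  "'p topology \<Rightarrow> ('p set \<Rightarrow> 's set) \<Rightarrow> ('p set \<Rightarrow> 'p set \<Rightarrow> 's \<Rightarrow> 's) \<Rightarrow> bool" where
  "sheaf_of_sets T F r \<longleftrightarrow>
    (\<forall>U V. openin T U \<and> openin T V \<and> V \<subseteq> U \<longrightarrow> r U V \<in> F U \<rightarrow> F V) \<and>
    (\<forall>U. openin T U \<longrightarrow> (\<forall>s\<in>F U. r U U s = s)) \<and>
    (\<forall>U V W. openin T U \<and> openin T V \<and> openin T W \<and> W \<subseteq> V \<and> V \<subseteq> U \<longrightarrow>
       (\<forall>s\<in>F U. r V W (r U V s) = r U W s)) \<and>
    (\<forall>\<U> s. (\<forall>U\<in>\<U>. openin T U \<and> s U \<in> F U) \<and>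
       (\<forall>U\<in>\<U>. \<forall>V\<in>\<U>. r U (U \<inter> V) (s U) = r V (U \<inter> V) (s V)) \<longrightarrow>
       (\<exists>!t. t \<in> F (\<Union>\<U>) \<and> (\<forall>U\<in>\<U>. r (\<Union>\<U>) U t = s U)))"

definition ringed_space :: "('p, 'a) ringed \<Rightarrow> bool" where
  "ringed_space X \<longleftrightarrow>
    sheaf_of_sets (Top X) (\<lambda>U. carrier (Osec X U)) (Ores X) \<and>
    (\<forall>U. openin (Top X) U \<longrightarrow> cring (Osec X U)) \<and>
    (\<forall>U V. openin (Top X) U \<and> openin (Top X) V \<and> V \<subseteq> U \<longrightarrow>
       Ores X U V \<in> ring_hom (Osec X U) (Osec X V))"

definition module_sheaf :: "('p, 'a) ringed \<Rightarrow> ('p, 'a, 'm) presheaf \<Rightarrow> bool" where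
  "module_sheaf X M \<longleftrightarrow>
    sheaf_of_sets (Top X) (\<lambda>U. carrier (Msec M U)) (Mres M) \<and>
    (\<forall>U. openin (Top X) U \<longrightarrow> module (Osec X U) (Msec M U)) \<and>
    (\<forall>U V. openin (Top X) U \<and> openin (Top X) V \<and> V \<subseteq> U \<longrightarrow>
       (\<forall>s\<in>carrier (Msec M U). \<forall>t\<in>carrier (Msec M U).
          Mres M U V (s \<oplus>\<^bsub>Msec M U\<^esub> t) = Mres M U V s \<oplus>\<^bsub>Msec M V\<^esub> Mres M U V t) \<and>
       (\<forall>r\<in>carrier (Osec X U). \<forall>s\<in>carrier (Msec M U).
          Mres M U V (r \<odot>\<^bsub>Msec M U\<^esub> s) = Ores X U V r \<odot>\<^bsub>Msec M V\<^esub> Mres M U V s))"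

subsection \<open>Stalks\<close>

text \<open>A germ is an equivalence class of pairs of an open neighbourhood and a section over it.\<close>

definition germ ::
  "'p topology \<Rightarrow> ('p set \<Rightarrow> 's set) \<Rightarrow> ('p set \<Rightarrow> 'p set \<Rightarrow> 's \<Rightarrow> 's) \<Rightarrow>
   'p \<Rightarrow> 'p set \<Rightarrow> 's \<Rightarrow> ('p set \<times> 's) set" where
  "germ T F r x U s =
    {(V, t). openin T V \<and> x \<in> V \<and> t \<in> F V \<and>
       (\<exists>W. openin T W \<and> x \<in> W \<and> W \<subseteq> U \<inter> V \<and> r U W s = r V W t)}"

definition Ogerm :: "('p, 'a) ringed \<Rightarrow> 'p \<Rightarrow> 'p set \<Rightarrow> 'a \<Rightarrow> ('p set \<times> 'a) set" where
  "Ogerm X = germ (Top X) (\<lambda>U. carrier (Osec X U)) (Ores X)"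

definition Mgerm ::
  "('p, 'a) ringed \<Rightarrow> ('p, 'a, 'm) presheaf \<Rightarrow> 'p \<Rightarrow> 'p set \<Rightarrow> 'm \<Rightarrow> ('p set \<times> 'm) set" where
  "Mgerm X M = germ (Top X) (\<lambda>U. carrier (Msec M U)) (Mres M)"

definition Ostalk :: "('p, 'a) ringed \<Rightarrow> 'p \<Rightarrow> ('p set \<times> 'a) set ring" where
  "Ostalk X x =
    \<lparr>carrier = {Ogerm X x U s | U s. openin (Top X) U \<and> x \<in> U \<and> s \<in> carrier (Osec X U)},
     mult = (\<lambda>G H. \<Union>(U, s)\<in>G. \<Union>(V, t)\<in>H.
       Ogerm X x (U \<inter> V) (Ores X U (U \<inter> V) s \<otimes>\<^bsub>Osec X (U \<inter> V)\<^esub> Ores X V (U \<inter> V) t)),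
     one = Ogerm X x (points X) \<one>\<^bsub>Osec X (points X)\<^esub>,
     zero = Ogerm X x (points X) \<zero>\<^bsub>Osec X (points X)\<^esub>,
     add = (\<lambda>G H. \<Union>(U, s)\<in>G. \<Union>(V, t)\<in>H.
       Ogerm X x (U \<inter> V) (Ores X U (U \<inter> V) s \<oplus>\<^bsub>Osec X (U \<inter> V)\<^esub> Ores X V (U \<inter> V) t))\<rparr>"

definition Mstalk ::
  "('p, 'a) ringed \<Rightarrow> ('p, 'a, 'm) presheaf \<Rightarrow> 'p \<Rightarrow>
   (('p set \<times> 'a) set, ('p set \<times> 'm) set) module" where
  "Mstalk X M x =
    \<lparr>carrier = {Mgerm X M x U s | U s. openin (Top X) U \<and> x \<in> U \<and> s \<in> carrier (Msec M U)},
     mult = undefined, one = undefined,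
     zero = Mgerm X M x (points X) \<zero>\<^bsub>Msec M (points X)\<^esub>,
     add = (\<lambda>G H. \<Union>(U, s)\<in>G. \<Union>(V, t)\<in>H.
       Mgerm X M x (U \<inter> V) (Mres M U (U \<inter> V) s \<oplus>\<^bsub>Msec M (U \<inter> V)\<^esub> Mres M V (U \<inter> V) t)),
     smult = (\<lambda>G H. \<Union>(U, r)\<in>G. \<Union>(V, t)\<in>H.
       Mgerm X M x (U \<inter> V) (Ores X U (U \<inter> V) r \<odot>\<^bsub>Msec M (U \<inter> V)\<^esub> Mres M V (U \<inter> V) t))\<rparr>"

subsection \<open>Sheafification\<close>

definition locally_in :: "'p topology \<Rightarrow> ('p set \<Rightarrow> ('p \<Rightarrow> 'b) set) \<Rightarrow> 'p set \<Rightarrow> ('p \<Rightarrow> 'b) \<Rightarrow> bool"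
  where
  "locally_in T D U s \<longleftrightarrow>
    (\<forall>x\<in>U. \<exists>V. openin T V \<and> x \<in> V \<and> V \<subseteq> U \<and> (\<exists>t\<in>D V. \<forall>y\<in>V. s y = t y))"

definition sheafify ::
  "('p, 'a) ringed \<Rightarrow> ('p, 'a, 'm) presheaf \<Rightarrow> ('p, 'a, 'p \<Rightarrow> ('p set \<times> 'm) set) presheaf" where
  "sheafify X P =
    \<lparr>Msec = (\<lambda>U.
      \<lparr>carrier = {s \<in> Pi\<^sub>E U (\<lambda>x. carrier (Mstalk X P x)).
         locally_in (Top X) (\<lambda>V. {\<lambda>y. Mgerm X P y V t | t. t \<in> carrier (Msec P V)}) U s},
       mult = undefined, one = undefined,
       zero = (\<lambda>x\<in>U. \<zero>\<^bsub>Mstalk X P x\<^esub>),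
       add = (\<lambda>s t. \<lambda>x\<in>U. s x \<oplus>\<^bsub>Mstalk X P x\<^esub> t x),
       smult = (\<lambda>r s. \<lambda>x\<in>U. Ogerm X x U r \<odot>\<^bsub>Mstalk X P x\<^esub> s x)\<rparr>),
     Mres = (\<lambda>U V s. restrict s V)\<rparr>"

subsection \<open>Tensor products, tensor powers, symmetric powers and duals\<close>

definition presented_presheaf ::
  "('p, 'a) ringed \<Rightarrow> ('p set \<Rightarrow> 'b set) \<Rightarrow> ('p set \<Rightarrow> ('b \<Rightarrow> 'a) set) \<Rightarrow>
   ('p set \<Rightarrow> 'p set \<Rightarrow> 'b \<Rightarrow> 'b) \<Rightarrow> ('p, 'a, ('b \<Rightarrow> 'a) set) presheaf" where
  "presented_presheaf X B K h =
    \<lparr>Msec = (\<lambda>U. presented_module (Osec X U) (B U) (K U)),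
     Mres = (\<lambda>U V. presented_map (Osec X U) (Osec X V) (B V) (K V) (h U V) (Ores X U V))\<rparr>"

definition tensor_sheaf where
  "tensor_sheaf X M N = sheafify X (presented_presheaf X
    (\<lambda>U. carrier (Msec M U) \<times> carrier (Msec N U))
    (\<lambda>U. bilinear_rels (Osec X U) (Msec M U) (Msec N U))
    (\<lambda>U V. map_prod (Mres M U V) (Mres N U V)))"

definition tensor_power where
  "tensor_power X n M = sheafify X (presented_presheaf X
    (\<lambda>U. words n (Msec M U))
    (\<lambda>U. multilinear_rels (Osec X U) n (Msec M U))
    (\<lambda>U V. map (Mres M U V)))"

definition sym_power where
  "sym_power X n M = sheafify X (presented_presheaf X
    (\<lambda>U. words n (Msec M U))
    (\<lambda>U. multilinear_rels (Osec X U) n (Msec M U) \<union> symmetry_rels (Osec X U) n (Msec M U))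
    (\<lambda>U V. map (Mres M U V)))"

definition linear_maps ::
  "('a, 'c) ring_scheme \<Rightarrow> ('a, 'm, 'd) module_scheme \<Rightarrow> ('a, 'n, 'e) module_scheme \<Rightarrow>
   ('m \<Rightarrow> 'n) set" where
  "linear_maps R M N =
    {f \<in> carrier M \<rightarrow>\<^sub>E carrier N.
      (\<forall>x\<in>carrier M. \<forall>y\<in>carrier M. f (x \<oplus>\<^bsub>M\<^esub> y) = f x \<oplus>\<^bsub>N\<^esub> f y) \<and>
      (\<forall>r\<in>carrier R. \<forall>x\<in>carrier M. f (r \<odot>\<^bsub>M\<^esub> x) = r \<odot>\<^bsub>N\<^esub> f x)}"

definition opens_below :: "('p, 'a) ringed \<Rightarrow> 'p set \<Rightarrow> 'p set set" where
  "opens_below X U = {V. openin (Top X) V \<and> V \<subseteq> U}"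

text \<open>The morphisms \<open>M|\<^sub>U \<rightarrow> N|\<^sub>U\<close>. The values outside the relevant domains are normalised, so that
  equality of morphisms is equality of functions.\<close>

definition sheaf_homs ::
  "('p, 'a) ringed \<Rightarrow> 'p set \<Rightarrow> ('p, 'a, 'm) presheaf \<Rightarrow> ('p, 'a, 'n) presheaf \<Rightarrow>
   ('p set \<Rightarrow> 'm \<Rightarrow> 'n) set" where
  "sheaf_homs X U M N =
    {\<phi> \<in> Pi\<^sub>E (opens_below X U) (\<lambda>V. linear_maps (Osec X V) (Msec M V) (Msec N V)).
      \<forall>V\<in>opens_below X U. \<forall>W\<in>opens_below X V. \<forall>s\<in>carrier (Msec M V).
        \<phi> W (Mres M V W s) = Mres N V W (\<phi> V s)}"

definition structure_module :: "('p, 'a) ringed \<Rightarrow> ('p, 'a, 'a) presheaf" where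
  "structure_module X =
    \<lparr>Msec = (\<lambda>U. \<lparr>carrier = carrier (Osec X U), mult = undefined, one = undefined,
       zero = \<zero>\<^bsub>Osec X U\<^esub>, add = add (Osec X U), smult = mult (Osec X U)\<rparr>),
     Mres = Ores X\<rparr>"

definition dual_sheaf ::
  "('p, 'a) ringed \<Rightarrow> ('p, 'a, 'm) presheaf \<Rightarrow> ('p, 'a, 'p set \<Rightarrow> 'm \<Rightarrow> 'a) presheaf" where
  "dual_sheaf X M =
    \<lparr>Msec = (\<lambda>U.
      \<lparr>carrier = sheaf_homs X U M (structure_module X),
       mult = undefined, one = undefined,
       zero = (\<lambda>V\<in>opens_below X U. \<lambda>s\<in>carrier (Msec M V). \<zero>\<^bsub>Osec X V\<^esub>),
       add = (\<lambda>\<phi> \<psi>. \<lambda>V\<in>opens_below X U. \<lambda>s\<in>carrier (Msec M V). \<phi> V s \<oplus>\<^bsub>Osec X V\<^esub> \<psi> V s),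
       smult = (\<lambda>r \<phi>. \<lambda>V\<in>opens_below X U. \<lambda>s\<in>carrier (Msec M V).
         Ores X U V r \<otimes>\<^bsub>Osec X V\<^esub> \<phi> V s)\<rparr>),
     Mres = (\<lambda>U V \<phi>. restrict \<phi> (opens_below X V))\<rparr>"

subsection \<open>Vector bundles\<close>

definition free_sheaf :: "('p, 'a) ringed \<Rightarrow> nat \<Rightarrow> ('p, 'a, nat \<Rightarrow> 'a) presheaf" where
  "free_sheaf X n =
    \<lparr>Msec = (\<lambda>U.
      \<lparr>carrier = {..<n} \<rightarrow>\<^sub>E carrier (Osec X U), mult = undefined, one = undefined,
       zero = (\<lambda>i\<in>{..<n}. \<zero>\<^bsub>Osec X U\<^esub>),
       add = (\<lambda>f g. \<lambda>i\<in>{..<n}. f i \<oplus>\<^bsub>Osec X U\<^esub> g i),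
       smult = (\<lambda>r f. \<lambda>i\<in>{..<n}. r \<otimes>\<^bsub>Osec X U\<^esub> f i)\<rparr>),
     Mres = (\<lambda>U V f. \<lambda>i\<in>{..<n}. Ores X U V (f i))\<rparr>"

definition isomorphic_over ::
  "('p, 'a) ringed \<Rightarrow> 'p set \<Rightarrow> ('p, 'a, 'm) presheaf \<Rightarrow> ('p, 'a, 'n) presheaf \<Rightarrow> bool" where
  "isomorphic_over X U M N \<longleftrightarrow>
    (\<exists>\<phi>\<in>sheaf_homs X U M N. \<forall>V\<in>opens_below X U.
       bij_betw (\<phi> V) (carrier (Msec M V)) (carrier (Msec N V)))"

definition vector_bundle :: "('p, 'a) ringed \<Rightarrow> ('p, 'a, 'm) presheaf \<Rightarrow> bool" where
  "vector_bundle X M \<longleftrightarrow> module_sheaf X M \<and>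
    (\<forall>x\<in>points X. \<exists>U n. openin (Top X) U \<and> x \<in> U \<and> 0 < n \<and> isomorphic_over X U M (free_sheaf X n))"

definition line_bundle :: "('p, 'a) ringed \<Rightarrow> ('p, 'a, 'm) presheaf \<Rightarrow> bool" where
  "line_bundle X M \<longleftrightarrow> module_sheaf X M \<and>
    (\<forall>x\<in>points X. \<exists>U. openin (Top X) U \<and> x \<in> U \<and> isomorphic_over X U M (free_sheaf X 1))"

subsection \<open>Fibres\<close>

text \<open>The maximal ideal of a local ring is its set of nonunits. The residue field is regarded as a
  module over the local ring; its \<open>one\<close> field is kept since \<open>s \<otimes> 1\<close> is needed.\<close>

definition maximal_ideal :: "('p, 'a) ringed \<Rightarrow> 'p \<Rightarrow> ('p set \<times> 'a) set set" where
  "maximal_ideal X x = carrier (Ostalk X x) - Units (Ostalk X x)"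

definition residue_field ::
  "('p, 'a) ringed \<Rightarrow> 'p \<Rightarrow> (('p set \<times> 'a) set, ('p set \<times> 'a) set set) module" where
  "residue_field X x = ring.extend (Ostalk X x Quot maximal_ideal X x)
    (module.fields (\<lambda>r c. (maximal_ideal X x +>\<^bsub>Ostalk X x\<^esub> r)
       \<otimes>\<^bsub>Ostalk X x Quot maximal_ideal X x\<^esub> c))"

definition fibre where
  "fibre X M x = tensor_module (Ostalk X x) (Mstalk X M x) (residue_field X x)"

text \<open>The value \<open>s(x) = s\<^sub>x \<otimes> 1\<close> in \<open>M(x) = M\<^sub>x \<otimes> \<kappa>(x)\<close> of a global section \<open>s\<close>.\<close>

definition fibre_value where
  "fibre_value X M x s = tensor_elem (Ostalk X x) (Mstalk X M x) (residue_field X x)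
    (Mgerm X M x (points X) s) \<one>\<^bsub>residue_field X x\<^esub>"


section \<open>Schemes\<close>

definition morphism ::
  "('p, 'a) ringed \<Rightarrow> ('q, 'b) ringed \<Rightarrow> ('p \<Rightarrow> 'q) \<Rightarrow> ('q set \<Rightarrow> 'b \<Rightarrow> 'a) \<Rightarrow> bool" where
  "morphism X Y f \<phi> \<longleftrightarrow> continuous_map (Top X) (Top Y) f \<and>
    (\<forall>V. openin (Top Y) V \<longrightarrow>
       \<phi> V \<in> ring_hom (Osec Y V) (Osec X (f -` V \<inter> points X))) \<and>
    (\<forall>V W. openin (Top Y) V \<and> openin (Top Y) W \<and> W \<subseteq> V \<longrightarrow> (\<forall>s\<in>carrier (Osec Y V).
       \<phi> W (Ores Y V W s) = Ores X (f -` V \<inter> points X) (f -` W \<inter> points X) (\<phi> V s)))"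

definition local_morphism ::
  "('p, 'a) ringed \<Rightarrow> ('q, 'b) ringed \<Rightarrow> ('p \<Rightarrow> 'q) \<Rightarrow> ('q set \<Rightarrow> 'b \<Rightarrow> 'a) \<Rightarrow> bool" where
  "local_morphism X Y f \<phi> \<longleftrightarrow> morphism X Y f \<phi> \<and>
    (\<forall>x\<in>points X. \<forall>V. openin (Top Y) V \<and> f x \<in> V \<longrightarrow> (\<forall>s\<in>carrier (Osec Y V).
       Ogerm X x (f -` V \<inter> points X) (\<phi> V s) \<in> Units (Ostalk X x) \<longrightarrow>
       Ogerm Y (f x) V s \<in> Units (Ostalk Y (f x))))"

definition isomorphic_spaces :: "('p, 'a) ringed \<Rightarrow> ('q, 'b) ringed \<Rightarrow> bool" where
  "isomorphic_spaces X Y \<longleftrightarrow> (\<exists>f \<phi>. morphism X Y f \<phi> \<and> homeomorphic_map (Top X) (Top Y) f \<and>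
    (\<forall>V. openin (Top Y) V \<longrightarrow>
       bij_betw (\<phi> V) (carrier (Osec Y V)) (carrier (Osec X (f -` V \<inter> points X)))))"

subsection \<open>Spec and Proj\<close>

definition fraction :: "('a, 'c) ring_scheme \<Rightarrow> 'a set \<Rightarrow> 'a \<Rightarrow> 'a \<Rightarrow> ('a \<times> 'a) set" where
  "fraction R S a s = {(b, t). b \<in> carrier R \<and> t \<in> S \<and>
     (\<exists>u\<in>S. u \<otimes>\<^bsub>R\<^esub> (a \<otimes>\<^bsub>R\<^esub> t) = u \<otimes>\<^bsub>R\<^esub> (b \<otimes>\<^bsub>R\<^esub> s))}"

text \<open>The subring of the localisation \<open>S\<inverse>R\<close> formed by the fractions \<open>a/s\<close> with \<open>(a, s) \<in> D\<close>.\<close>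

definition fraction_ring ::
  "('a, 'c) ring_scheme \<Rightarrow> 'a set \<Rightarrow> ('a \<times> 'a) set \<Rightarrow> ('a \<times> 'a) set ring" where
  "fraction_ring R S D =
    \<lparr>carrier = {fraction R S a s | a s. (a, s) \<in> D},
     mult = (\<lambda>P Q. \<Union>(a, s)\<in>P. \<Union>(b, t)\<in>Q. fraction R S (a \<otimes>\<^bsub>R\<^esub> b) (s \<otimes>\<^bsub>R\<^esub> t)),
     one = fraction R S \<one>\<^bsub>R\<^esub> \<one>\<^bsub>R\<^esub>, zero = fraction R S \<zero>\<^bsub>R\<^esub> \<one>\<^bsub>R\<^esub>,
     add = (\<lambda>P Q. \<Union>(a, s)\<in>P. \<Union>(b, t)\<in>Q.
       fraction R S ((a \<otimes>\<^bsub>R\<^esub> t) \<oplus>\<^bsub>R\<^esub> (b \<otimes>\<^bsub>R\<^esub> s)) (s \<otimes>\<^bsub>R\<^esub> t))\<rparr>"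

definition function_space ::
  "'p topology \<Rightarrow> ('p \<Rightarrow> 'b ring) \<Rightarrow> ('p set \<Rightarrow> ('p \<Rightarrow> 'b) set) \<Rightarrow> ('p, 'p \<Rightarrow> 'b) ringed" where
  "function_space T L D =
    \<lparr>Top = T,
     Osec = (\<lambda>U.
      \<lparr>carrier = {s \<in> Pi\<^sub>E U (\<lambda>p. carrier (L p)). locally_in T D U s},
       mult = (\<lambda>s t. \<lambda>p\<in>U. s p \<otimes>\<^bsub>L p\<^esub> t p), one = (\<lambda>p\<in>U. \<one>\<^bsub>L p\<^esub>),
       zero = (\<lambda>p\<in>U. \<zero>\<^bsub>L p\<^esub>), add = (\<lambda>s t. \<lambda>p\<in>U. s p \<oplus>\<^bsub>L p\<^esub> t p)\<rparr>),
     Ores = (\<lambda>U V s. restrict s V)\<rparr>"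

definition Spec_topology :: "'a ring \<Rightarrow> 'a set topology" where
  "Spec_topology R =
    topology (\<lambda>U. \<exists>E\<subseteq>carrier R. U = {p. primeideal p R \<and> \<not> E \<subseteq> p})"

definition Spec :: "'a ring \<Rightarrow> ('a set, 'a set \<Rightarrow> ('a \<times> 'a) set) ringed" where
  "Spec R = function_space (Spec_topology R)
    (\<lambda>p. fraction_ring R (carrier R - p) (carrier R \<times> (carrier R - p)))
    (\<lambda>V. {\<lambda>p. fraction R (carrier R - p) a s | a s.
       a \<in> carrier R \<and> s \<in> carrier R \<and> (\<forall>p\<in>V. s \<notin> p)})"

text \<open>\<open>G d\<close> is the homogeneous part of degree \<open>d\<close> of the graded ring \<open>R\<close>. The points of \<open>Proj\<close> are
  the homogeneous prime ideals that do not contain the irrelevant ideal.\<close>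

definition Proj_points :: "'a ring \<Rightarrow> (nat \<Rightarrow> 'a set) \<Rightarrow> 'a set set" where
  "Proj_points R G = {p. primeideal p R \<and> p = Idl\<^bsub>R\<^esub> (p \<inter> (\<Union>d. G d)) \<and>
     \<not> (\<Union>d\<in>{1..}. G d) \<subseteq> p}"

definition Proj_topology :: "'a ring \<Rightarrow> (nat \<Rightarrow> 'a set) \<Rightarrow> 'a set topology" where
  "Proj_topology R G =
    topology (\<lambda>U. \<exists>E\<subseteq>(\<Union>d. G d). U = {p \<in> Proj_points R G. \<not> E \<subseteq> p})"

definition Proj ::
  "'a ring \<Rightarrow> (nat \<Rightarrow> 'a set) \<Rightarrow> ('a set, 'a set \<Rightarrow> ('a \<times> 'a) set) ringed" where
  "Proj R G = function_space (Proj_topology R G)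
    (\<lambda>p. fraction_ring R ((\<Union>d. G d) - p) (\<Union>d. G d \<times> (G d - p)))
    (\<lambda>V. {\<lambda>p. fraction R ((\<Union>d. G d) - p) a s | a s d.
       a \<in> G d \<and> s \<in> G d \<and> (\<forall>p\<in>V. s \<notin> p)})"

text \<open>\<open>\<P>\<^sup>n = Proj K[x\<^sub>0,\<dots>,x\<^sub>n]\<close>; monomials are finitely supported exponent vectors.\<close>

definition polynomial_ring :: "nat \<Rightarrow> ((nat \<Rightarrow>\<^sub>0 nat) \<Rightarrow>\<^sub>0 'k :: field) ring" where
  "polynomial_ring n =
    \<lparr>carrier = {f. \<forall>e\<in>Poly_Mapping.keys f. Poly_Mapping.keys e \<subseteq> {..n}},
     mult = (*), one = 1, zero = 0, add = (+)\<rparr>"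

definition homogeneous_part :: "nat \<Rightarrow> nat \<Rightarrow> ((nat \<Rightarrow>\<^sub>0 nat) \<Rightarrow>\<^sub>0 'k :: field) set" where
  "homogeneous_part n d = {f \<in> carrier (polynomial_ring n).
     \<forall>e\<in>Poly_Mapping.keys f. (\<Sum>i\<in>Poly_Mapping.keys e. Poly_Mapping.lookup e i) = d}"

definition projective_space where
  "projective_space (_ :: 'k :: field itself) n =
    Proj (polynomial_ring n :: ((nat \<Rightarrow>\<^sub>0 nat) \<Rightarrow>\<^sub>0 'k) ring) (homogeneous_part n)"

subsection \<open>Projective varieties\<close>

definition open_subspace :: "('p, 'a) ringed \<Rightarrow> 'p set \<Rightarrow> ('p, 'a) ringed" where
  "open_subspace X U = X\<lparr>Top := subtopology (Top X) U\<rparr>"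

text \<open>An affine open subscheme \<open>U\<close> is isomorphic to the spectrum of its ring of sections, so there
  is no loss in taking the ring on the type of the sections.\<close>

definition affine_open :: "('p, 'a) ringed \<Rightarrow> 'p set \<Rightarrow> bool" where
  "affine_open X U \<longleftrightarrow> openin (Top X) U \<and>
    (\<exists>R :: 'a ring. cring R \<and> isomorphic_spaces (open_subspace X U) (Spec R))"

definition is_scheme :: "('p, 'a) ringed \<Rightarrow> bool" where
  "is_scheme X \<longleftrightarrow> ringed_space X \<and> (\<forall>x\<in>points X. \<exists>U. x \<in> U \<and> affine_open X U)"

definition integral_scheme :: "('p, 'a) ringed \<Rightarrow> bool" where
  "integral_scheme X \<longleftrightarrow> is_scheme X \<and> points X \<noteq> {} \<and>
    (\<forall>U. openin (Top X) U \<and> U \<noteq> {} \<longrightarrow> domain (Osec X U))"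

definition closed_immersion ::
  "('p, 'a) ringed \<Rightarrow> ('q, 'b) ringed \<Rightarrow> ('p \<Rightarrow> 'q) \<Rightarrow> ('q set \<Rightarrow> 'b \<Rightarrow> 'a) \<Rightarrow> bool" where
  "closed_immersion X Y f \<phi> \<longleftrightarrow> local_morphism X Y f \<phi> \<and>
    embedding_map (Top X) (Top Y) f \<and> closedin (Top Y) (f ` points X) \<and>
    (\<forall>V y. openin (Top Y) V \<and> y \<in> V \<longrightarrow> (\<forall>s\<in>carrier (Osec X (f -` V \<inter> points X)).
       \<exists>W. openin (Top Y) W \<and> y \<in> W \<and> W \<subseteq> V \<and> (\<exists>t\<in>carrier (Osec Y W).
         \<phi> W t = Ores X (f -` V \<inter> points X) (f -` W \<inter> points X) s)))"

text \<open>The structure morphism of \<open>X\<close> to \<open>Spec K\<close> is the composite of the closed immersion with the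
  projection of \<open>\<P>\<^sup>n\<close> and need not be recorded, as base loci do not refer to it.\<close>

definition projective_variety :: "'k :: field itself \<Rightarrow> ('p, 'a) ringed \<Rightarrow> bool" where
  "projective_variety K X \<longleftrightarrow> integral_scheme X \<and>
    (\<exists>n f \<phi>. closed_immersion X (projective_space K n) f \<phi>)"

text \<open>The definition of EGA II, 4.5: the sets \<open>X\<^sub>s\<close> that are affine, with \<open>s\<close> a global section of some
  \<open>L\<^sup>n\<close> and \<open>n \<ge> 1\<close>, cover \<open>X\<close>.\<close>

definition nonvanishing_locus where
  "nonvanishing_locus X L s = {x \<in> points X. fibre_value X L x s \<noteq> \<zero>\<^bsub>fibre X L x\<^esub>}"

definition ample_line_bundle :: "('p, 'a) ringed \<Rightarrow> ('p, 'a, 'm) presheaf \<Rightarrow> bool" where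
  "ample_line_bundle X L \<longleftrightarrow> line_bundle X L \<and> compact_space (Top X) \<and>
    (\<forall>x\<in>points X. \<exists>n\<ge>1. \<exists>s\<in>carrier (Msec (tensor_power X n L) (points X)).
       x \<in> nonvanishing_locus X (tensor_power X n L) s \<and>
       affine_open X (nonvanishing_locus X (tensor_power X n L) s))"


section \<open>Base loci\<close>

text \<open>Surjectivity of the evaluation at \<open>x\<close> means that \<open>H\<^sup>0(X, V) \<otimes> \<kappa>(x) \<rightarrow> V(x)\<close> is surjective, i.e.\ that
  the values of global sections span \<open>V(x)\<close>: at a nonclosed point no finite-dimensional
  \<open>K\<close>-vector space surjects onto \<open>V(x)\<close>. The span is the same over \<open>\<O>\<^sub>x\<close> and over \<open>\<kappa>(x)\<close>.\<close>

definition base_locus :: "('p, 'a) ringed \<Rightarrow> ('p, 'a, 'm) presheaf \<Rightarrow> 'p set" where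
  "base_locus X V = {x \<in> points X.
     module_span (Ostalk X x) (fibre X V x)
       (fibre_value X V x ` carrier (Msec V (points X))) \<noteq> carrier (fibre X V x)}"

text \<open>\<open>A\<close> is the auxiliary ample line bundle; the loci do not depend on it, so it is kept as a parameter
  instead of being chosen. The negative power \<open>A\<^sup>-\<^sup>m\<close> is the \<open>m\<close>-th tensor power of the dual of \<open>A\<close>.\<close>

definition augmented_base_locus ::
  "('p, 'a) ringed \<Rightarrow> ('p, 'a, 'l) presheaf \<Rightarrow> ('p, 'a, 'm) presheaf \<Rightarrow> 'p set" where
  "augmented_base_locus X A V = (\<Inter>q\<in>{1..}. \<Inter>m\<in>{1..}.
     base_locus X (tensor_sheaf X (sym_power X m (sym_power X q V))
       (tensor_power X m (dual_sheaf X A))))"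

definition diminished_base_locus ::
  "('p, 'a) ringed \<Rightarrow> ('p, 'a, 'l) presheaf \<Rightarrow> ('p, 'a, 'm) presheaf \<Rightarrow> 'p set" where
  "diminished_base_locus X A V = (\<Union>q\<in>{1..}. \<Inter>m\<in>{1..}.
     base_locus X (tensor_sheaf X (sym_power X m (sym_power X q V)) (tensor_power X m A)))"

definition V_big :: "('p, 'a) ringed \<Rightarrow> ('p, 'a, 'l) presheaf \<Rightarrow> ('p, 'a, 'm) presheaf \<Rightarrow> bool" where
  "V_big X A V \<longleftrightarrow> augmented_base_locus X A V \<noteq> points X"

definition V_psef :: "('p, 'a) ringed \<Rightarrow> ('p, 'a, 'l) presheaf \<Rightarrow> ('p, 'a, 'm) presheaf \<Rightarrow> bool" where
  "V_psef X A V \<longleftrightarrow> diminished_base_locus X A V \<noteq> points X"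

end

theory Submission
  imports Defs "HOL-Combinatorics.List_Permutation"
begin

text \<open>Global generation is studied on stalks: by Nakayama, \<open>x\<close> lies outside the base locus of a bundle
  iff the germs of its global sections generate the stalk at \<open>x\<close>. If
  \<open>S\<^sup>mS\<^sup>qV \<otimes> A\<^sup>c\<close> is generated at \<open>x\<close>, symmetrisation shows that the pure tensors
  \<open>v\<^sup>m\<^sup>q \<otimes> a\<close> in \<open>T\<^sup>m\<^sup>qV \<otimes> A\<^sup>c\<close> are combinations of global sections, and by a
  combinatorial argument in characteristic zero the same holds, after passing to large multiples,
  for all pure tensors in \<open>T\<^sup>NV \<otimes> A\<^sup>n\<close>. For \<open>V = E\<close> and \<open>V = F\<close> such tensors can be multiplied and
  permuted into \<open>S\<^sup>MS\<^sup>Q(E \<otimes> F) \<otimes> A\<^sup>n\<close>, where opposite twists cancel by contraction. The statements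
  on V-big and V-psef bundles follow by looking at the generic point.\<close>

syntax "_index" :: "logic \<Rightarrow> index"  ("\<^sub>_" [1000] 1000)
abbreviation "cr \<equiv> carrier"

section \<open>Spans and linear maps\<close>

lemma (in abelian_group) minus_eq_zero_iff:
 assumes "x:cr G" "y:cr G"
 shows "x \<ominus> y = \<zero> \<longleftrightarrow> x = y"
 using assms by (metis a_minus_def add.inv_closed add.inv_inv minus_equality r_neg)

context module
begin

text \<open>Negatives come for free, since minus x is the product of minus one with x.\<close>

lemma submod_if_c:
 assumes "H <= cr M" and "\<zero>\<^sub>M:H"
 and "!!x y. x:H ==> y:H ==> x \<oplus>\<^sub>M y:H"
 and "!!r x. r:cr R ==> x:H ==> r \<odot>\<^sub>M x:H"
 shows "submodule H R M"
proof (rule submoduleI)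
 fix x assume x: "x:H"
 with assms(1) have "\<ominus>\<^sub>M x = (\<ominus> \<one>) \<odot>\<^sub>M x"
 by (simp add: smult_l_minus subsetD)
 with x assms(4) show "\<ominus>\<^sub>M x:H" by simp
qed (use assms in auto)

lemma submod_zero: "submodule H R M ==> \<zero>\<^sub>M:H"
 using submodule.axioms(1)[THEN subgroup.one_closed] by fastforce

lemma submod_minus: "submodule H R M ==> x:H ==> y:H ==> x \<ominus>\<^sub>M y:H"
 by (simp add: a_minus_def submoduleE)

lemma zero_submod: "submodule {\<zero>\<^sub>M} R M"
 by (rule submod_if_c) auto

lemma span_submod:
 assumes "S <= cr M"
 shows "submodule (module_span R M S) R M"
proof (rule submod_if_c)
 show "module_span R M S <= cr M"
 using carrier_is_submodule assms by (auto simp: module_span_def)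
qed (auto simp: module_span_def submod_zero submoduleE)

lemma span_superset: "S <= module_span R M S"
 by (auto simp: module_span_def)

lemma span_base: "x:S ==> x:module_span R M S"
 using span_superset by blast

lemma span_least: "submodule H R M ==> S <= H ==> module_span R M S <= H"
 by (auto simp: module_span_def)

lemma span_mono: "S <= S' ==> module_span R M S <= module_span R M S'"
 by (auto simp: module_span_def)

lemma span_sub: "S <= cr M ==> module_span R M S <= cr M"
 using span_least[OF carrier_is_submodule] .

lemma span_zero: "\<zero>\<^sub>M:module_span R M S"
 by (auto simp: module_span_def submod_zero)

lemma span_smult: "r:cr R ==> x:module_span R M S ==> r \<odot>\<^sub>M x:module_span R M S"
 by (auto simp: module_span_def submoduleE)

lemma span_add:
 "x:module_span R M S ==> y:module_span R M S ==> x \<oplus>\<^sub>M y:module_span R M S"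
 by (auto simp: module_span_def submoduleE)

lemma span_induct [consumes 1, case_names base zero add smult]:
 assumes x: "x:module_span R M S" and S: "!!x. x:S ==> x:cr M & P x"
 and "P \<zero>\<^sub>M"
 and "!!x y. x:cr M ==> y:cr M ==> P x ==> P y ==> P (x \<oplus>\<^sub>M y)"
 and "!!r x. r:cr R ==> x:cr M ==> P x ==> P (r \<odot>\<^sub>M x)"
 shows "P x"
proof -
 have "submodule {x:cr M. P x} R M"
 by (rule submod_if_c) (use assms in auto)
 from span_least[OF this, of S] S x show ?thesis by auto
qed

lemma submod_finsum:
 assumes "submodule H R M" "finite A" "!!i. i:A ==> f i:H"
 shows "finsum M f A:H"
 using assms(2,3)
proof (induction rule: finite_induct)
 case empty
 thus ?case by (simp add: submod_zero assms(1))
next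
 case (insert a A)
 hence "f:A \<rightarrow> cr M" "f a:cr M"
 using submoduleE(1)[OF assms(1)] by auto
 with insert show ?case by (simp add: submoduleE[OF assms(1)])
qed

end

text \<open>In contrast to \<open>linear_maps\<close>, no value is prescribed outside the carrier,
  so that composites, sums and plain lambda terms are linear maps without restriction.\<close>

definition lin ::
 "('a, 'c) ring_scheme => ('a, 'm, 'd) module_scheme => ('a, 'n, 'e) module_scheme => ('m => 'n) set"
 where "lin R M N = {f:cr M \<rightarrow> cr N.
 (!x:cr M. !y:cr M. f (x \<oplus>\<^sub>M y) = f x \<oplus>\<^sub>N f y) &
 (!r:cr R. !x:cr M. f (r \<odot>\<^sub>M x) = r \<odot>\<^sub>N f x)}"

lemma linI:
 assumes "!!x. x:cr M ==> f x:cr N"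
 and "!!x y. x:cr M ==> y:cr M ==> f (x \<oplus>\<^sub>M y) = f x \<oplus>\<^sub>N f y"
 and "!!r x. r:cr R ==> x:cr M ==> f (r \<odot>\<^sub>M x) = r \<odot>\<^sub>N f x"
 shows "f:lin R M N"
 using assms by (auto simp: lin_def)

lemma linD:
 assumes "f:lin R M N"
 shows "x:cr M ==> f x:cr N"
 and "x:cr M ==> y:cr M ==> f (x \<oplus>\<^sub>M y) = f x \<oplus>\<^sub>N f y"
 and "r:cr R ==> x:cr M ==> f (r \<odot>\<^sub>M x) = r \<odot>\<^sub>N f x"
 using assms by (auto simp: lin_def)

lemma lin_compose:
 assumes "f:lin R M N" "g:lin R N L"
 shows "(%x. g (f x)):lin R M L"
 by (rule linI) (simp_all add: linD[OF assms(1)] linD[OF assms(2)])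

locale two_mods = M: module R M + N: module R N for R and M and N
begin

lemma lin_zero:
 assumes "f:lin R M N" shows "f \<zero>\<^sub>M = \<zero>\<^sub>N"
proof -
 have "f (\<zero>\<^sub>R \<odot>\<^sub>M \<zero>\<^sub>M) = \<zero>\<^sub>R \<odot>\<^sub>N f \<zero>\<^sub>M"
 using linD(3)[OF assms] by blast
 thus ?thesis using linD(1)[OF assms] by simp
qed

lemma lin_uminus:
 assumes f: "f:lin R M N" and x: "x:cr M"
 shows "f (\<ominus>\<^sub>M x) = \<ominus>\<^sub>N f x"
proof -
 have "f (\<ominus>\<^sub>M x) = f ((\<ominus>\<^sub>R \<one>\<^sub>R) \<odot>\<^sub>M x)"
 using x by (simp add: M.smult_l_minus)
 also have "\<dots> = \<ominus>\<^sub>N f x"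
 using x by (simp add: N.smult_l_minus linD[OF f])
 finally show ?thesis .
qed

lemma lin_minus:
 assumes f: "f:lin R M N" and x: "x:cr M" "y:cr M"
 shows "f (x \<ominus>\<^sub>M y) = f x \<ominus>\<^sub>N f y"
 using x by (simp add: a_minus_def linD[OF f] lin_uminus[OF f])

lemma lin_const_zero: "(%x. \<zero>\<^sub>N):lin R M N"
 by (rule linI) auto

lemma lin_add:
 assumes f: "f:lin R M N" and g: "g:lin R M N"
 shows "(%x. f x \<oplus>\<^sub>N g x):lin R M N"
 by (rule linI) (simp_all add: linD[OF f] linD[OF g] N.smult_r_distr N.M.a_ac)

lemma lin_smult:
 assumes f: "f:lin R M N" and r: "r:cr R"
 shows "(%x. r \<odot>\<^sub>N f x):lin R M N"
 by (rule linI)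
 (simp_all add: linD[OF f] r N.smult_r_distr N.smult_assoc1[symmetric] M.R.m_comm)

lemma lin_finsum:
 assumes "finite A" and "!!i. i:A ==> f i:lin R M N"
 shows "(%x. finsum N (%i. f i x) A):lin R M N"
proof (rule linI)
 have c: "(%i. f i x):A \<rightarrow> cr N" if "x:cr M" for x
 using assms(2) linD(1) that by fastforce
 show "finsum N (%i. f i x) A:cr N" if "x:cr M" for x
 using c[OF that] by (rule N.finsum_closed)
 show "finsum N (%i. f i (x \<oplus>\<^sub>M y)) A = finsum N (%i. f i x) A \<oplus>\<^sub>N finsum N (%i. f i y) A"
 if xy: "x:cr M" "y:cr M" for x y
 proof -
 have "finsum N (%i. f i (x \<oplus>\<^sub>M y)) A = finsum N (%i. f i x \<oplus>\<^sub>N f i y) A"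
 by (rule N.finsum_cong')
 (use xy c[of x] c[of y] in \<open>auto simp: linD(2)[OF assms(2)] Pi_iff\<close>)
 thus ?thesis using c xy by (simp add: N.finsum_addf)
 qed
 show "finsum N (%i. f i (r \<odot>\<^sub>M x)) A = r \<odot>\<^sub>N finsum N (%i. f i x) A"
 if "r:cr R" "x:cr M" for r x
 proof -
 have "finsum N (%i. f i (r \<odot>\<^sub>M x)) A = finsum N (%i. r \<odot>\<^sub>N f i x) A"
 by (rule N.finsum_cong') (use that c[of x] in \<open>auto simp: linD(3)[OF assms(2)] Pi_iff\<close>)
 thus ?thesis using c that assms(1) by (simp add: N.finsum_smult_ldistr)
 qed
qed

lemma submod_vimage:
 assumes f: "f:lin R M N" and K: "submodule K R N"
 shows "submodule {x:cr M. f x:K} R M"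
 by (rule M.submod_if_c)
 (auto simp: linD[OF f] lin_zero[OF f] N.submod_zero[OF K] N.submoduleE[OF K])

lemma submod_equaliser:
 assumes f: "f:lin R M N" and g: "g:lin R M N"
 shows "submodule {x:cr M. f x = g x} R M"
 by (rule M.submod_if_c)
 (auto simp: linD[OF f] linD[OF g] lin_zero[OF f] lin_zero[OF g])

lemma lin_span:
 assumes f: "f:lin R M N" and K: "submodule K R N" and S: "S <= cr M"
 and "!!x. x:S ==> f x:K" and "x:module_span R M S"
 shows "f x:K"
 using M.span_least[OF submod_vimage[OF f K], of S] assms by auto

lemma lin_eq_on_span:
 assumes f: "f:lin R M N" and g: "g:lin R M N" and S: "S <= cr M"
 and "!!x. x:S ==> f x = g x" and "x:module_span R M S"
 shows "f x = g x"
 using M.span_least[OF submod_equaliser[OF f g], of S] assms by auto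

end

subsection \<open>Extension of linear and multilinear maps from generators\<close>

text \<open>Generators may satisfy relations, so a function of pairs of generators need not extend.
  The last two hypotheses provide a linear extension in each variable while the other one is a
  generator. A linear map is determined by its values on generators, which makes the extension in
  the second variable depend linearly on the first.\<close>

lemma bil_extension:
 assumes "module R L" "module R M" "module R N"
 and L: "cr L = module_span R L (ga ` C)" "ga ` C <= cr L"
 and M: "cr M = module_span R M (de ` D)" "de ` D <= cr M"
 and ex1: "!!d. d:D ==> EX ph:lin R L N. !c:C. ph (ga c) = g c d"
 and ex2: "!!c. c:C ==> EX ph:lin R M N. !d:D. ph (de d) = g c d"
 shows "EX G. (!y:cr M. (%x. G x y):lin R L N) & (!x:cr L. G x:lin R M N) &
 (!c:C. !d:D. G (ga c) (de d) = g c d)"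
proof -
 interpret LN: two_mods R L N using assms(1,3) by (simp add: two_mods_def)
 interpret MN: two_mods R M N using assms(2,3) by (simp add: two_mods_def)
 obtain ph where ph: "!!d. d:D ==> ph d:lin R L N" "!!c d. c:C ==> d:D ==> ph d (ga c) = g c d"
 using ex1 by metis
 \<comment> \<open>The elements \<open>x\<close> for which the second variable can be extended form
   a submodule that contains the generators of \<open>L\<close>.\<close>
 have "EX ps:lin R M N. !d:D. ps (de d) = ph d x" if "x:cr L" for x
 using that[unfolded L(1)]
 proof (induction rule: LN.M.span_induct)
 case (base x)
 thus ?case using L(2) ex2 ph(2) by fastforce
 next
 case zero
 show ?case by (rule bexI[OF _ MN.lin_const_zero]) (simp add: LN.lin_zero ph(1))
 next
 case (add x y)
 then obtain ps ch where "ps:lin R M N" "ch:lin R M N"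
 and "!d:D. ps (de d) = ph d x" "!d:D. ch (de d) = ph d y" by blast
 with add show ?case
 by (intro bexI[OF _ MN.lin_add[of ps ch]]) (simp_all add: linD(2)[OF ph(1)])
 next
 case (smult r x)
 then obtain ps where "ps:lin R M N" "!d:D. ps (de d) = ph d x" by blast
 with smult show ?case
 by (intro bexI[OF _ MN.lin_smult[of ps r]]) (simp_all add: linD(3)[OF ph(1)])
 qed
 then obtain G where G: "!!x. x:cr L ==> G x:lin R M N"
 "!!x d. x:cr L ==> d:D ==> G x (de d) = ph d x" by metis
 have eq: "ps y = ch y" if "y:cr M" "ps:lin R M N" "ch:lin R M N"
 "!!d. d:D ==> ps (de d) = ch (de d)" for ps ch y
 using MN.lin_eq_on_span[OF that(2,3) M(2), of y] that(1,4) M(1) by blast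
 \<comment> \<open>Linearity in \<open>x\<close> is an identity between linear maps in
   \<open>y\<close>, tested on the generators of \<open>M\<close>.\<close>
 have "(%x. G x y):lin R L N" if y: "y:cr M" for y
 proof (rule linI)
 show "G x y:cr N" if "x:cr L" for x
 using linD(1)[OF G(1)[OF that] y] .
 show "G (x \<oplus>\<^sub>L x') y = G x y \<oplus>\<^sub>N G x' y" if "x:cr L" "x':cr L" for x x'
 using y
 by (rule eq) (use that in \<open>simp_all add: G linD(2)[OF ph(1)] MN.lin_add\<close>)
 show "G (r \<odot>\<^sub>L x) y = r \<odot>\<^sub>N G x y" if "r:cr R" "x:cr L" for r x
 using y
 by (rule eq) (use that in \<open>simp_all add: G linD(3)[OF ph(1)] MN.lin_smult\<close>)
 qed
 with G ph(2) L(2) show ?thesis by (intro exI[of _ G]) auto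
qed

text \<open>Multilinearity is linearity under updating a list at one position, which keeps the arity
  \<open>n\<close> an ordinary number. For \<open>n = 0\<close> only the value at the empty list is
  constrained.\<close>

definition mlt ::
 "('a, 'c) ring_scheme => nat => ('a, 'm, 'd) module_scheme => ('a, 'n, 'e) module_scheme =>
 ('m list => 'n) => bool"
 where "mlt R n M N g \<longleftrightarrow> g:words n M \<rightarrow> cr N &
 (!xs:words n M. !i<n. (%x. g (xs[i := x])):lin R M N)"

lemma w_update: "xs:words n M ==> x:cr M ==> xs[i := x]:words n M"
 using set_update_subset_insert by (fastforce simp: words_def)

lemma words_nth: "xs:words n M ==> i < n ==> xs ! i:cr M"
 by (auto simp: words_def)

lemma w_Cons: "x # xs:words (Suc n) M \<longleftrightarrow> x:cr M & xs:words n M"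
 by (auto simp: words_def)

lemma w_append: "xs:words m M ==> ys:words n M ==> xs @ ys:words (m + n) M"
 by (auto simp: words_def)

lemma w_SucE:
 assumes "xs:words (Suc n) M"
 obtains y ys where "xs = y # ys" "y:cr M" "ys:words n M"
 using assms by (cases xs) (auto simp: words_def)

lemma mltD:
 assumes "mlt R n M N g"
 shows "xs:words n M ==> g xs:cr N"
 and "xs:words n M ==> i < n ==> (%x. g (xs[i := x])):lin R M N"
 using assms by (auto simp: mlt_def)

lemma mlt_Cons:
 assumes "mlt R (Suc n) M N g" "x:cr M"
 shows "mlt R n M N (%xs. g (x # xs))"
 unfolding mlt_def
proof (intro conjI ballI allI impI)
 show "(%xs. g (x # xs)):words n M \<rightarrow> cr N"
 using assms by (auto simp: mlt_def w_Cons)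
 show "(%y. g (x # xs[i := y])):lin R M N" if "xs:words n M" "i < n" for xs i
 using mltD(2)[OF assms(1), of "x # xs" "Suc i"] that assms(2) by (simp add: w_Cons)
qed

context module
begin

text \<open>An induction principle for words: \<open>P\<close> has to hold on words of generators,
  and in each slot the admissible letters have to form a submodule. It serves membership, equality
  and existence statements alike.\<close>

lemma w_span_induct:
 assumes S: "S <= cr M" "cr M = module_span R M S"
 and base: "!!ss. length ss = n ==> set ss <= S ==> P ss"
 and slot: "!!xs i. xs:words n M ==> i < n ==> submodule {x:cr M. P (xs[i := x])} R M"
 and xs: "xs:words n M"
 shows "P xs"
proof -
 \<comment> \<open>The first \<open>j\<close> slots are already arbitrary, the later ones still hold
   generators; \<open>j\<close> runs from 0 to \<open>n\<close>.\<close>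
 have "P xs" if "j <= n" "xs:words n M" "!i. j <= i & i < n --> xs ! i:S" for j xs
 using that
 proof (induction j arbitrary: xs)
 case 0
 thus ?case by (intro base) (auto simp: words_def in_set_conv_nth)
 next
 case (Suc j)
 have "S <= {x:cr M. P (xs[j := x])}"
 proof
 fix x assume x: "x:S"
 have "xs[j := x] ! i:S" if "j <= i" "i < n" for i
 using Suc.prems that x by (cases "i = j") (auto simp: words_def)
 thus "x:{x:cr M. P (xs[j := x])}"
 using S(1) x Suc.prems by (auto intro!: Suc.IH w_update)
 qed
 hence "cr M <= {x:cr M. P (xs[j := x])}"
 unfolding S(2) using span_least[OF slot] Suc.prems S(2) by simp
 thus ?case
 using Suc.prems by (metis (mono_tags, lifting) Suc_le_lessD list_update_id mem_Collect_eq subsetD words_nth)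
 qed
 from this[OF order.refl xs] show ?thesis by (meson leD)
qed

end

context two_mods
begin

lemma mlt_in_submod:
 assumes S: "S <= cr M" "cr M = module_span R M S"
 and g: "mlt R n M N g" and K: "submodule K R N"
 and base: "!!ss. length ss = n ==> set ss <= S ==> g ss:K" and xs: "xs:words n M"
 shows "g xs:K"
 using M.w_span_induct[OF S, where P = "%xs. g xs:K", OF base _ xs]
 submod_vimage[OF mltD(2)[OF g] K] by blast

lemma mlt_eqI:
 assumes S: "S <= cr M" "cr M = module_span R M S"
 and g: "mlt R n M N g" and h: "mlt R n M N h"
 and base: "!!ss. length ss = n ==> set ss <= S ==> g ss = h ss" and xs: "xs:words n M"
 shows "g xs = h xs"
 using M.w_span_induct[OF S, where P = "%xs. g xs = h xs", OF base _ xs]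
 submod_equaliser[OF mltD(2)[OF g] mltD(2)[OF h]] by blast

text \<open>\<open>ga\<close> need not be injective and its values may satisfy relations; the
  hypothesis \<open>ex\<close> on single slots is what makes \<open>g\<close> well defined on words
  of generators. The first letter is split off: the remaining letters are extended by induction, and
  the first one afterwards.\<close>

lemma mlt_extension:
 assumes M: "cr M = module_span R M (ga ` D)" "ga ` D <= cr M"
 and ex: "!!ds i. length ds = n ==> set ds <= D ==> i < n ==>
 EX ph:lin R M N. !d:D. ph (ga d) = g (ds[i := d])"
 and g: "!!ds. length ds = n ==> set ds <= D ==> g ds:cr N"
 shows "EX G. mlt R n M N G & (!ds. length ds = n --> set ds <= D --> G (map ga ds) = g ds)"
 using ex g
proof (induction n arbitrary: g)
 case 0
 thus ?case
 by (intro exI[of _ "%_. g []"]) (auto simp: mlt_def)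
next
 case (Suc n)
 have "EX G. mlt R n M N G & (!ds. length ds = n --> set ds <= D --> G (map ga ds) = g (d # ds))"
 if "d:D" for d
 proof (rule Suc.IH)
 show "EX ph:lin R M N. !e:D. ph (ga e) = g (d # ds[i := e])"
 if "length ds = n" "set ds <= D" "i < n" for ds i
 using Suc.prems(1)[of "d # ds" "Suc i"] that \<open>d:D\<close> by simp
 show "g (d # ds):cr N" if "length ds = n" "set ds <= D" for ds
 using Suc.prems(2)[of "d # ds"] that \<open>d:D\<close> by simp
 qed
 then obtain H where H: "!!d. d:D ==> mlt R n M N (H d)"
 "!!d ds. d:D ==> length ds = n ==> set ds <= D ==> H d (map ga ds) = g (d # ds)"
 by metis
 \<comment> \<open>Extension in the first letter is known when the remaining letters are generators
   and spreads to all words \<open>xs\<close> one slot at a time.\<close>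
 have "EX ph:lin R M N. !d:D. ph (ga d) = H d xs" if xs: "xs:words n M" for xs
 proof (rule M.w_span_induct[OF M(2,1) _ _ xs])
 fix ss assume "length ss = n" "set ss <= ga ` D"
 moreover from this have "ss:map ga ` lists D"
 by (auto simp flip: lists_image)
 ultimately obtain ds where ds: "ss = map ga ds" "set ds <= D" "length ds = n"
 by (auto simp: lists_eq_set)
 show "EX ph:lin R M N. !d:D. ph (ga d) = H d ss"
 \<comment> \<open>The hypothesis on single slots speaks of full words of generators, so some letter
   \<open>d0\<close> is needed to occupy the first slot.\<close>
 proof (cases "D = {}")
 case True
 thus ?thesis using lin_const_zero by auto
 next
 case False
 then obtain d0 where "d0:D" by auto
 hence "EX ph:lin R M N. !d:D. ph (ga d) = g (d # ds)"
 using Suc.prems(1)[of "d0 # ds" 0] ds by simp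
 thus ?thesis unfolding ds(1) using H(2) ds(2,3) by metis
 qed
 next
 fix ys i assume ys: "ys:words n M" "i < n"
 note lin = linD[OF mltD(2)[OF H(1) ys]]
 show "submodule {x:cr M. EX ph:lin R M N. !d:D. ph (ga d) = H d (ys[i := x])} R M"
 proof (rule M.submod_if_c)
 have "\<zero>\<^sub>N = H d (ys[i := \<zero>\<^sub>M])" if "d:D" for d
 using lin_zero[OF mltD(2)[OF H(1)[OF that] ys]] by simp
 thus "\<zero>\<^sub>M:{x:cr M. EX ph:lin R M N. !d:D. ph (ga d) = H d (ys[i := x])}"
 using lin_const_zero by (auto intro!: bexI[of _ "%x. \<zero>\<^sub>N"])
 next
 fix x y
 assume "x:{x:cr M. EX ph:lin R M N. !d:D. ph (ga d) = H d (ys[i := x])}"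
 "y:{x:cr M. EX ph:lin R M N. !d:D. ph (ga d) = H d (ys[i := x])}"
 then obtain ph ps where "x:cr M" "y:cr M" "ph:lin R M N" "ps:lin R M N"
 "!d:D. ph (ga d) = H d (ys[i := x])" "!d:D. ps (ga d) = H d (ys[i := y])" by auto
 thus "x \<oplus>\<^sub>M y:{x:cr M. EX ph:lin R M N. !d:D. ph (ga d) = H d (ys[i := x])}"
 using lin_add[of ph ps] lin(2) by (auto intro!: bexI[of _ "%x. ph x \<oplus>\<^sub>N ps x"])
 next
 fix r x
 assume r: "r:cr R"
 and "x:{x:cr M. EX ph:lin R M N. !d:D. ph (ga d) = H d (ys[i := x])}"
 then obtain ph where "x:cr M" "ph:lin R M N"
 "!d:D. ph (ga d) = H d (ys[i := x])" by auto
 with r show "r \<odot>\<^sub>M x:{x:cr M. EX ph:lin R M N. !d:D. ph (ga d) = H d (ys[i := x])}"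
 using lin_smult[of ph r] lin(3) by (auto intro!: bexI[of _ "%x. r \<odot>\<^sub>N ph x"])
 qed auto
 qed
 then obtain ph where ph: "!!xs. xs:words n M ==> ph xs:lin R M N"
 "!!xs d. xs:words n M ==> d:D ==> ph xs (ga d) = H d xs" by metis
 have eq: "f x = f' x" if "x:cr M" "f:lin R M N" "f':lin R M N"
 "!!d. d:D ==> f (ga d) = f' (ga d)" for f f' x
 using lin_eq_on_span[OF that(2,3) M(2), of x] that(1,4) M(1) by blast
 define G where "G = (%xs. ph (tl xs) (hd xs))"
 have "mlt R (Suc n) M N G"
 unfolding mlt_def
 proof (intro conjI ballI allI impI)
 show "G:words (Suc n) M \<rightarrow> cr N"
 using ph(1) linD(1) by (force simp: G_def elim!: w_SucE)
 fix xs i assume xs: "xs:words (Suc n) M" and i: "i < Suc n"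
 obtain y ys where y: "xs = y # ys" "y:cr M" "ys:words n M"
 using xs by (rule w_SucE)
 show "(%x. G (xs[i := x])):lin R M N"
 proof (cases i)
 case 0
 thus ?thesis using ph(1) y by (simp add: G_def)
 next
 case (Suc j)
 with i have j: "j < n" by simp
 note lin = linD[OF mltD(2)[OF H(1) y(3) j]]
 have "(%x. ph (ys[j := x]) y):lin R M N"
 proof (rule linI)
 show "ph (ys[j := x]) y:cr N" if "x:cr M" for x
 using that y ph(1) linD(1) w_update by meson
 show "ph (ys[j := x \<oplus>\<^sub>M x']) y = ph (ys[j := x]) y \<oplus>\<^sub>N ph (ys[j := x']) y"
 if "x:cr M" "x':cr M" for x x'
 using y(2) by (rule eq) (use that y in \<open>simp_all add: ph w_update lin(2) lin_add\<close>)
 show "ph (ys[j := r \<odot>\<^sub>M x]) y = r \<odot>\<^sub>N ph (ys[j := x]) y"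
 if "r:cr R" "x:cr M" for r x
 using y(2) by (rule eq) (use that y in \<open>simp_all add: ph w_update lin(3) lin_smult\<close>)
 qed
 thus ?thesis using y Suc by (simp add: G_def)
 qed
 qed
 moreover have "G (map ga ds) = g ds" if len: "length ds = Suc n" and sub: "set ds <= D" for ds
 proof -
 obtain e es where ds: "ds = e # es" using len by (cases ds) auto
 have "map ga es:words n M" using len sub ds M(2) by (auto simp: words_def)
 thus ?thesis using len sub ds ph(2) H(2) by (simp add: G_def)
 qed
 ultimately show ?case by blast
qed

end


section \<open>Free, quotient and presented modules\<close>

lemma cr_free:
 "f:cr (free_module R B) \<longleftrightarrow> (!b. f b:cr R) & (!b. b ~: B --> f b = \<zero>\<^sub>R) &
 finite {b. f b ~= \<zero>\<^sub>R}"
 by (simp add: free_module_def)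

lemma free_simps:
 "\<zero>\<^sub>(free_module R B) = (%_. \<zero>\<^sub>R)"
 "f \<oplus>\<^sub>(free_module R B) g = (%b. f b \<oplus>\<^sub>R g b)"
 "r \<odot>\<^sub>(free_module R B) f = (%b. r \<otimes>\<^sub>R f b)"
 by (simp_all add: free_module_def)

text \<open>The linear extension of \<open>g\<close> to a free module; summation over the support
  keeps the basis \<open>B\<close> out of the formula.\<close>

definition flift where
 "flift R N g f = finsum N (%b. f b \<odot>\<^sub>N g b) {b. f b ~= \<zero>\<^sub>R}"

context cring
begin

lemma free_module: "module R (free_module R B)"
proof (rule moduleI)
 show "abelian_group (free_module R B)"
 proof (rule abelian_groupI)
 fix f g assume f: "f:cr (free_module R B)" and g: "g:cr (free_module R B)"
 have "finite ({b. f b ~= \<zero>} Un {b. g b ~= \<zero>})"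
 using f g by (simp add: cr_free)
 hence "finite {b. f b \<oplus> g b ~= \<zero>}"
 by (rule rev_finite_subset) auto
 thus "f \<oplus>\<^sub>(free_module R B) g:cr (free_module R B)"
 using f g by (simp add: cr_free free_simps)
 next
 fix f assume f: "f:cr (free_module R B)"
 have "finite {b. \<ominus> f b ~= \<zero>}"
 by (rule rev_finite_subset[of "{b. f b ~= \<zero>}"]) (use f in \<open>auto simp: cr_free\<close>)
 thus "EX g:cr (free_module R B). g \<oplus>\<^sub>(free_module R B) f = \<zero>\<^sub>(free_module R B)"
 using f by (intro bexI[of _ "%b. \<ominus> f b"])
 (auto simp: cr_free free_simps l_neg)
 qed (auto simp: cr_free free_simps a_ac)
next
 fix r f assume r: "r:cr R" and f: "f:cr (free_module R B)"
 have "finite {b. r \<otimes> f b ~= \<zero>}"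
 by (rule rev_finite_subset[of "{b. f b ~= \<zero>}"]) (use r f in \<open>auto simp: cr_free\<close>)
 thus "r \<odot>\<^sub>(free_module R B) f:cr (free_module R B)"
 using r f by (auto simp: cr_free free_simps)
qed (auto simp: cr_free free_simps l_distr r_distr m_assoc is_cring)

lemma free_gen_c: "b:B ==> free_gen R b:cr (free_module R B)"
proof -
 have "finite {c. (if c = b then \<one> else \<zero>) ~= \<zero>}"
 by (rule rev_finite_subset[of "{b}"]) auto
 thus "b:B ==> free_gen R b:cr (free_module R B)"
 by (auto simp: free_gen_def cr_free)
qed

lemma free_span:
 "cr (free_module R B) = module_span R (free_module R B) (free_gen R ` B)"
proof -
 interpret F: module R "free_module R B" by (rule free_module)
 have "f:module_span R (free_module R B) (free_gen R ` B)"
 if "finite A" "f:cr (free_module R B)" "{b. f b ~= \<zero>} <= A" for f A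
 using that
 proof (induction A arbitrary: f rule: finite_induct)
 case empty
 hence "f = \<zero>\<^sub>(free_module R B)" by (auto simp: free_simps)
 thus ?case by (simp add: F.span_zero)
 next
 case (insert a A)
 define g where "g = f(a := \<zero>)"
 have g: "g:cr (free_module R B)"
 using insert.prems(1) by (auto simp: g_def cr_free elim!: rev_finite_subset)
 have "f = g \<oplus>\<^sub>(free_module R B) f a \<odot>\<^sub>(free_module R B) free_gen R a"
 using insert.prems(1)
 by (auto simp: g_def free_simps free_gen_def cr_free)
 moreover have "g:module_span R (free_module R B) (free_gen R ` B)"
 by (rule insert.IH[OF g]) (use insert.prems(2) in \<open>auto simp: g_def\<close>)
 moreover have "f a \<odot>\<^sub>(free_module R B) free_gen R a
 :module_span R (free_module R B) (free_gen R ` B)"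
 proof (cases "a:B")
 case True
 thus ?thesis
 using insert.prems(1) by (intro F.span_smult F.span_base) (auto simp: cr_free)
 next
 case False
 hence "f a \<odot>\<^sub>(free_module R B) free_gen R a = \<zero>\<^sub>(free_module R B)"
 using insert.prems(1) by (auto simp: cr_free free_simps free_gen_def)
 thus ?thesis by (simp add: F.span_zero)
 qed
 ultimately show ?case by (metis F.span_add)
 qed
 thus ?thesis
 using F.span_sub[of "free_gen R ` B"] free_gen_c
 by (force simp: cr_free)
qed

text \<open>Any finite set between the support and \<open>B\<close> may index the sum, so that two
  elements can be summed over a common set.\<close>

lemma flift_eq:
 assumes N: "module R N" and g: "g:B \<rightarrow> cr N" and f: "f:cr (free_module R B)"
 and A: "finite A" "{b. f b ~= \<zero>} <= A" "A <= B"
 shows "flift R N g f = finsum N (%b. f b \<odot>\<^sub>N g b) A"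
proof -
 interpret N: module R N by (rule N)
 have f': "f b:cr R" for b using f by (simp add: cr_free)
 show ?thesis unfolding flift_def
 by (rule N.M.add.finprod_mono_neutral_cong_left) (use A g f' in \<open>auto simp: subset_iff Pi_iff\<close>)
qed

lemma flift_hom:
 assumes N: "module R N" and g: "g:B \<rightarrow> cr N"
 shows "flift R N g:lin R (free_module R B) N"
proof (rule linI)
 interpret N: module R N by (rule N)
 interpret F: module R "free_module R B" by (rule free_module)
 have supp: "{b. f b ~= \<zero>} <= B" "finite {b. f b ~= \<zero>}" "!!b. f b:cr R"
 if "f:cr (free_module R B)" for f
 using that by (auto simp: cr_free)
 fix f assume f: "f:cr (free_module R B)"
 show "flift R N g f:cr N"
 unfolding flift_def by (rule N.M.finsum_closed) (use supp[OF f] g in auto)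
 show "flift R N g (f \<oplus>\<^sub>(free_module R B) h) = flift R N g f \<oplus>\<^sub>N flift R N g h"
 if h: "h:cr (free_module R B)" for h
 proof -
 let ?A = "{b. f b ~= \<zero>} Un {b. h b ~= \<zero>}"
 have A: "finite ?A" "?A <= B" using supp[OF f] supp[OF h] by auto
 have "flift R N g (f \<oplus>\<^sub>(free_module R B) h)
 = finsum N (%b. (f b \<oplus> h b) \<odot>\<^sub>N g b) ?A"
 using flift_eq[OF N g F.M.a_closed[OF f h] A(1) _ A(2)]
 by (force simp: free_simps)
 also have "\<dots> = finsum N (%b. f b \<odot>\<^sub>N g b \<oplus>\<^sub>N h b \<odot>\<^sub>N g b) ?A"
 by (rule N.M.finsum_cong') (use A g supp[OF f] supp[OF h] in \<open>auto simp: N.smult_l_distr Pi_iff subset_iff\<close>)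
 also have "\<dots> = finsum N (%b. f b \<odot>\<^sub>N g b) ?A \<oplus>\<^sub>N finsum N (%b. h b \<odot>\<^sub>N g b) ?A"
 by (rule N.M.finsum_addf) (use A g supp[OF f] supp[OF h] in \<open>auto simp: subset_iff Pi_iff\<close>)
 finally show ?thesis
 using flift_eq[OF N g f A(1) _ A(2)] flift_eq[OF N g h A(1) _ A(2)] by simp
 qed
 show "flift R N g (r \<odot>\<^sub>(free_module R B) f) = r \<odot>\<^sub>N flift R N g f"
 if r: "r:cr R" for r
 proof -
 let ?A = "{b. f b ~= \<zero>}"
 have A: "finite ?A" "?A <= B" using supp[OF f] by auto
 have "flift R N g (r \<odot>\<^sub>(free_module R B) f) = finsum N (%b. (r \<otimes> f b) \<odot>\<^sub>N g b) ?A"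
 using flift_eq[OF N g F.smult_closed[OF r f] A(1) _ A(2)] r supp[OF f]
 by (force simp: free_simps)
 also have "\<dots> = finsum N (%b. r \<odot>\<^sub>N (f b \<odot>\<^sub>N g b)) ?A"
 by (rule N.M.finsum_cong') (use A g r supp[OF f] in \<open>auto simp: N.smult_assoc1 Pi_iff subset_iff\<close>)
 also have "\<dots> = r \<odot>\<^sub>N finsum N (%b. f b \<odot>\<^sub>N g b) ?A"
 by (rule N.finsum_smult_ldistr[symmetric]) (use A r g supp[OF f] in \<open>auto simp: Pi_iff subset_iff\<close>)
 finally show ?thesis by (simp add: flift_def)
 qed
qed

lemma flift_gen:
 assumes N: "module R N" and g: "g:B \<rightarrow> cr N" and b: "b:B"
 shows "flift R N g (free_gen R b) = g b"
proof -
 interpret N: module R N by (rule N)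
 have "flift R N g (free_gen R b) = finsum N (%c. free_gen R b c \<odot>\<^sub>N g c) {b}"
 by (rule flift_eq[OF N g free_gen_c[OF b]]) (use b in \<open>auto simp: free_gen_def\<close>)
 thus ?thesis
 using g b by (auto simp: free_gen_def Pi_iff)
qed

end

context module
begin

lemma a_r_coset_eq_iff:
 assumes K: "submodule K R M" and x: "x:cr M" and y: "y:cr M"
 shows "K +>\<^sub>M x = K +>\<^sub>M y \<longleftrightarrow> x \<ominus>\<^sub>M y:K"
proof -
 have sub: "subgroup K (add_monoid M)" using submodule.axioms(1)[OF K] .
 have KM: "K <= cr M" using submoduleE(1)[OF K] .
 show ?thesis
 proof
 assume "K +>\<^sub>M x = K +>\<^sub>M y"
 hence "K +>\<^sub>M (x \<oplus>\<^sub>M \<ominus>\<^sub>M y) = K" using M.a_coset_add_inv2 x y KM by simp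
 thus "x \<ominus>\<^sub>M y:K" using M.a_coset_join1[OF _ _ sub] x y by (simp add: a_minus_def)
 next
 assume "x \<ominus>\<^sub>M y:K"
 hence "K +>\<^sub>M (x \<oplus>\<^sub>M \<ominus>\<^sub>M y) = K"
 using M.a_coset_join2[OF _ sub] x y by (simp add: a_minus_def)
 thus "K +>\<^sub>M x = K +>\<^sub>M y" using M.a_coset_add_inv1 x y KM by simp
 qed
qed

lemma a_r_coset_mem_iff:
 assumes K: "submodule K R M" and x: "x:cr M"
 shows "y:K +>\<^sub>M x \<longleftrightarrow> y:cr M & K +>\<^sub>M y = K +>\<^sub>M x"
proof -
 interpret K: abelian_subgroup K M
 using submodule.axioms(1)[OF K] M.abelian_group_axioms
 by (auto intro: abelian_subgroupI3 additive_subgroupI)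
 have "K +>\<^sub>M x <= cr M"
 using M.a_r_coset_subset_G[OF submoduleE(1)[OF K] x] .
 thus ?thesis
 using M.a_repr_independence[OF _ x submodule.axioms(1)[OF K]] K.a_rcos_self by blast
qed

context
 fixes K assumes K: "submodule K R M"
begin

lemma cr_quot: "cr (quotient_module R M K) = (%x. K +>\<^sub>M x) ` cr M"
 by (auto simp: quotient_module_def A_RCOSETS_def')

lemma quot_zero: "\<zero>\<^sub>(quotient_module R M K) = K +>\<^sub>M \<zero>\<^sub>M"
 using submoduleE(1)[OF K] by (simp add: quotient_module_def)

lemma quot_add:
 assumes "x:cr M" "y:cr M"
 shows "(K +>\<^sub>M x) \<oplus>\<^sub>(quotient_module R M K) (K +>\<^sub>M y) = K +>\<^sub>M (x \<oplus>\<^sub>M y)"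
proof -
 interpret K: abelian_subgroup K M
 using submodule.axioms(1)[OF K] M.abelian_group_axioms
 by (auto intro: abelian_subgroupI3 additive_subgroupI)
 show ?thesis using assms by (simp add: quotient_module_def K.a_rcos_sum)
qed

text \<open>Scalar multiplication in the quotient is a union over all representatives; the union
  collapses because each of them yields the same coset.\<close>

lemma quot_smult:
 assumes r: "r:cr R" and x: "x:cr M"
 shows "r \<odot>\<^sub>(quotient_module R M K) (K +>\<^sub>M x) = K +>\<^sub>M (r \<odot>\<^sub>M x)"
proof -
 have "K +>\<^sub>M (r \<odot>\<^sub>M c) = K +>\<^sub>M (r \<odot>\<^sub>M x)" if "c:K +>\<^sub>M x" for c
 proof -
 have c: "c:cr M" "c \<ominus>\<^sub>M x:K"
 using that K x by (auto simp: a_r_coset_mem_iff a_r_coset_eq_iff)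
 have "r \<odot>\<^sub>M c \<ominus>\<^sub>M r \<odot>\<^sub>M x = r \<odot>\<^sub>M (c \<ominus>\<^sub>M x)"
 using r x c by (simp add: a_minus_def smult_r_distr smult_r_minus)
 thus ?thesis using c r x K by (simp add: a_r_coset_eq_iff submoduleE)
 qed
 moreover have "x:K +>\<^sub>M x" using x K by (simp add: a_r_coset_mem_iff)
 ultimately have "(\<Union>c\<in>K +>\<^sub>M x. K +>\<^sub>M (r \<odot>\<^sub>M c)) = K +>\<^sub>M (r \<odot>\<^sub>M x)"
 by (intro UN_constant_eq) blast+
 thus ?thesis
 by (simp add: quotient_module_def)
qed

lemma quot_is_mod: "module R (quotient_module R M K)"
proof (rule moduleI)
 show "abelian_group (quotient_module R M K)"
 proof (rule abelian_groupI)
 fix C assume "C:cr (quotient_module R M K)"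
 then obtain x where x: "x:cr M" "C = K +>\<^sub>M x" by (auto simp: cr_quot)
 thus "EX D:cr (quotient_module R M K).
 D \<oplus>\<^sub>(quotient_module R M K) C = \<zero>\<^sub>(quotient_module R M K)"
 by (intro bexI[of _ "K +>\<^sub>M (\<ominus>\<^sub>M x)"])
 (auto simp: cr_quot quot_add quot_zero M.l_neg)
 qed (auto simp: cr_quot quot_add quot_zero M.a_ac)
qed (auto simp: R.is_cring cr_quot quot_add quot_smult smult_l_distr smult_r_distr
 smult_assoc1)

lemma quot_map_hom: "(%x. K +>\<^sub>M x):lin R M (quotient_module R M K)"
 by (rule linI) (auto simp: cr_quot quot_add quot_smult)

end

end

lemma (in two_mods) quot_lift:
 assumes K: "submodule K R M" and f: "f:lin R M N" and "!!x. x:K ==> f x = \<zero>\<^sub>N"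
 shows "EX ph:lin R (quotient_module R M K) N. !x:cr M. ph (K +>\<^sub>M x) = f x"
proof -
 define ph where "ph C = f (SOME x. x:cr M & C = K +>\<^sub>M x)" for C
 have ph: "ph (K +>\<^sub>M x) = f x" if x: "x:cr M" for x
 proof -
 define y where "y = (SOME y. y:cr M & K +>\<^sub>M x = K +>\<^sub>M y)"
 have y: "y:cr M & K +>\<^sub>M x = K +>\<^sub>M y"
 unfolding y_def by (rule someI_ex) (use x in blast)
 hence "x \<ominus>\<^sub>M y:K" using M.a_r_coset_eq_iff[OF K x] by blast
 with y have "f x \<ominus>\<^sub>N f y = \<zero>\<^sub>N"
 using assms(3) lin_minus[OF f x] by fastforce
 moreover have "f x:cr N" "f y:cr N" using x y linD(1)[OF f] by auto
 ultimately show ?thesis unfolding ph_def y_def[symmetric] by (simp add: N.M.minus_eq_zero_iff)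
 qed
 show ?thesis
 by (intro bexI[of _ ph] linI)
 (auto simp: M.cr_quot[OF K] M.quot_add[OF K] M.quot_smult[OF K] ph linD[OF f])
qed

context cring
begin

context
 fixes B :: "'i set" and K :: "('i => 'a) set"
 assumes K: "K <= cr (free_module R B)"
begin

interpretation F: module R "free_module R B" by (rule free_module)

lemma pres_is_mod: "module R (presented_module R B K)"
 unfolding presented_module_def by (rule F.quot_is_mod[OF F.span_submod[OF K]])

lemma pres_class_hom:
 "presented_class R B K:lin R (free_module R B) (presented_module R B K)"
 using F.quot_map_hom[OF F.span_submod[OF K]]
 unfolding presented_module_def presented_class_def .

lemma cr_pres:
 "cr (presented_module R B K) = presented_class R B K ` cr (free_module R B)"
 unfolding presented_module_def presented_class_def
 by (rule F.cr_quot[OF F.span_submod[OF K]])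

lemma pres_span:
 "cr (presented_module R B K) =
 module_span R (presented_module R B K) ((%b. presented_class R B K (free_gen R b)) ` B)"
proof -
 interpret P: two_mods R "free_module R B" "presented_module R B K"
 using free_module pres_is_mod by (simp add: two_mods_def)
 have sub: "(%b. presented_class R B K (free_gen R b)) ` B <= cr (presented_module R B K)"
 by (auto intro!: linD(1)[OF pres_class_hom] free_gen_c)
 have gens: "free_gen R ` B <= cr (free_module R B)" by (auto intro: free_gen_c)
 show ?thesis (is "_ = ?S")
 proof
 show "?S <= cr (presented_module R B K)" by (rule P.N.span_sub[OF sub])
 show "cr (presented_module R B K) <= ?S"
 proof
 fix c assume "c:cr (presented_module R B K)"
 then obtain f where f: "c = presented_class R B K f"
 "f:module_span R (free_module R B) (free_gen R ` B)"
 unfolding cr_pres using free_span by blast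
 show "c:?S" unfolding f(1)
 by (rule P.lin_span[OF pres_class_hom P.N.span_submod[OF sub] gens _ f(2)])
 (auto intro!: P.N.span_base)
 qed
 qed
qed

lemma pres_class_eqI:
 assumes "f:cr (free_module R B)" "g:cr (free_module R B)"
 and "f \<ominus>\<^sub>(free_module R B) g:module_span R (free_module R B) K"
 shows "presented_class R B K f = presented_class R B K g"
 unfolding presented_class_def using F.a_r_coset_eq_iff[OF F.span_submod[OF K]] assms by blast

lemma pres_class_mem_iff:
 assumes "f:cr (free_module R B)"
 shows "g:presented_class R B K f \<longleftrightarrow>
 g:cr (free_module R B) & presented_class R B K g = presented_class R B K f"
 unfolding presented_class_def using F.a_r_coset_mem_iff[OF F.span_submod[OF K]] assms by blast

text \<open>Universal property of generators and relations. \<open>ph\<close> is described on all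
  classes and not only on generators, since restriction maps of presented presheaves are given by a
  formula on classes.\<close>

lemma pres_lift:
 assumes N: "module R N" and g: "g:B \<rightarrow> cr N"
 and rel: "!!k. k:K ==> flift R N g k = \<zero>\<^sub>N"
 shows "EX ph:lin R (presented_module R B K) N.
 !f:cr (free_module R B). ph (presented_class R B K f) = flift R N g f"
proof -
 interpret P: two_mods R "free_module R B" N
 using free_module N by (simp add: two_mods_def)
 have "flift R N g k = \<zero>\<^sub>N" if "k:module_span R (free_module R B) K" for k
 using P.lin_span[OF flift_hom[OF N g] P.N.zero_submod K _ that] rel by blast
 thus ?thesis
 using P.quot_lift[OF F.span_submod[OF K] flift_hom[OF N g]]
 unfolding presented_module_def presented_class_def by blast
qed

end

end

section \<open>Symmetric powers generate tensor powers\<close>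

lemma (in abelian_group) add_pow_nat:
 "[(0::nat)] \<cdot> x = \<zero>" "[Suc n] \<cdot> x = [n] \<cdot> x \<oplus> x"
 by (simp_all add: add_pow_def)

lemma (in abelian_group) add_pow_nat_c: "x:cr G ==> [(n::nat)] \<cdot> x:cr G"
 by (induction n) (simp_all add: add_pow_nat)

lemma (in abelian_group) finsum_const_nat:
 "finite A ==> x:cr G ==> (\<Oplus>i\<in>A. x) = [card A] \<cdot> x"
 by (induction A rule: finite_induct) (simp_all add: add_pow_nat add_pow_nat_c a_comm)

text \<open>Polynomial functions of degree at most \<open>d\<close> on the natural numbers,
  described by iterated differences: with values in an abelian group neither coefficients nor
  division are at hand.\<close>

primrec polyseq :: "('n, 'e) ring_scheme => nat => (nat => 'n) => bool" where
 "polyseq N 0 f \<longleftrightarrow> (!t. f t:cr N & f (Suc t) = f t)"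
| "polyseq N (Suc d) f \<longleftrightarrow>
 (!t. f t:cr N) & polyseq N d (%t. f (Suc t) \<ominus>\<^sub>N f t)"

context abelian_group
begin

lemma polyseq_c: "polyseq G d f ==> f t:cr G"
 by (cases d) auto

lemma polyseq_shift: "polyseq G d f ==> polyseq G d (%t. f (Suc t))"
 by (induction d arbitrary: f) auto

lemma add_minus_add:
 assumes "a:cr G" "b:cr G" "c:cr G" "d:cr G"
 shows "(a \<oplus> b) \<ominus> (c \<oplus> d) = (a \<ominus> c) \<oplus> (b \<ominus> d)"
 using assms by (simp add: a_minus_def minus_add a_ac)

lemma polyseq_add:
 "polyseq G d f ==> polyseq G d g ==> polyseq G d (%t. f t \<oplus> g t)"
proof (induction d arbitrary: f g)
 case (Suc d)
 hence "(f (Suc t) \<oplus> g (Suc t)) \<ominus> (f t \<oplus> g t) = (f (Suc t) \<ominus> f t) \<oplus> (g (Suc t) \<ominus> g t)" for t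
 by (simp add: add_minus_add)
 with Suc show ?case by simp
qed simp

lemma polyseq_Suc: "polyseq G d f ==> polyseq G (Suc d) f"
proof (induction d arbitrary: f)
 case 0
 thus ?case by (auto simp: a_minus_def r_neg)
next
 case (Suc d)
 thus ?case using polyseq.simps(2) by blast
qed

lemma polyseq_mono: "polyseq G d f ==> d <= e ==> polyseq G e f"
 by (induction e) (auto simp: le_Suc_eq polyseq_Suc simp del: polyseq.simps)

text \<open>Discrete product rule: the difference of \<open>t f(t)\<close> is \<open>t\<close> times
  the difference of \<open>f\<close>, plus \<open>f(t + 1)\<close>.\<close>

lemma polyseq_times:
 "polyseq G d f ==> polyseq G (Suc d) (%t. [t] \<cdot> f t)"
proof (induction d arbitrary: f)
 case 0
 hence "f t:cr G" for t by simp
 with 0 have "[Suc t] \<cdot> f (Suc t) \<ominus> [t] \<cdot> f t = f t" for t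
 by (simp add: add_pow_nat add_pow_nat_c a_minus_def a_ac r_neg r_neg1 add.inv_closed)
 with 0 show ?case by (simp add: add_pow_nat_c)
next
 case (Suc d)
 hence f: "f t:cr G" for t by simp
 have dist: "[t] \<cdot> (x \<ominus> y) = [t] \<cdot> x \<ominus> [t] \<cdot> y" if "x:cr G" "y:cr G" for t :: nat and x y
 using that
 proof (induction t)
 case 0
 thus ?case by (simp add: add_pow_nat a_minus_def r_neg)
 qed (simp add: add_pow_nat add_pow_nat_c a_minus_def minus_add a_ac)
 have "[Suc t] \<cdot> f (Suc t) \<ominus> [t] \<cdot> f t = [t] \<cdot> (f (Suc t) \<ominus> f t) \<oplus> f (Suc t)" for t
 using f by (simp add: dist[unfolded a_minus_def] add_pow_nat add_pow_nat_c a_minus_def a_ac)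
 moreover have "polyseq G (Suc d) (%t. [t] \<cdot> (f (Suc t) \<ominus> f t) \<oplus> f (Suc t))"
 using Suc.prems
 by (intro polyseq_add Suc.IH polyseq_shift[of "Suc d"]) auto
 ultimately show ?case
 using f by (subst polyseq.simps) (simp add: add_pow_nat_c del: polyseq.simps)
qed

end

text \<open>This replaces the inversion of a Vandermonde matrix. \<open>f 0\<close> equals
  \<open>f 1\<close> minus the first difference at 0, and the differences form a polynomial sequence
  of lower degree whose positive values lie in \<open>W\<close> again; so \<open>f 0\<close> is an
  integral combination of positive values of \<open>f\<close>.\<close>

lemma (in module) polyseq_at_zero:
 assumes W: "submodule W R M" and "polyseq M d f" and "!!t. f (Suc t):W"
 shows "f 0:W"
 using assms(2,3)
proof (induction d arbitrary: f)
 case 0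
 from 0(1) have "f (Suc 0) = f 0" by simp
 with 0(2)[of 0] show ?case by simp
next
 case (Suc d)
 have "f (Suc 0) \<ominus>\<^sub>M f 0:W"
 by (rule Suc.IH[of "%t. f (Suc t) \<ominus>\<^sub>M f t"])
 (use Suc.prems in \<open>auto intro!: submod_minus[OF W]\<close>)
 moreover have "f 0 = f (Suc 0) \<ominus>\<^sub>M (f (Suc 0) \<ominus>\<^sub>M f 0)"
 using polyseq_c[OF Suc.prems(1)] by (simp add: a_minus_def M.minus_add M.minus_minus M.r_neg2)
 ultimately show ?case
 using Suc.prems(2) submod_minus[OF W] by metis
qed

section \<open>Multilinear maps on words with many equal letters\<close>

definition fill :: "'m list => nat set => 'm => 'm list" where
 "fill xs C c = map (%i. if i:C then c else xs ! i) [0..<length xs]"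

lemma nth_list_update_if: "xs[i := x] ! j = (if i = j & j < length xs then x else xs ! j)"
 by (cases "i < length xs") (auto simp: nth_list_update list_update_beyond)

lemma length_fill [simp]: "length (fill xs C c) = length xs"
 by (simp add: fill_def)

lemma nth_fill: "i < length xs ==> fill xs C c ! i = (if i:C then c else xs ! i)"
 by (simp add: fill_def)

lemma fill_empty [simp]: "fill xs {} c = xs"
 by (rule nth_equalityI) (simp_all add: nth_fill)

lemma fill_insert: "y ~: C ==> fill xs (insert y C) c = (fill xs C c)[y := c]"
 by (rule nth_equalityI) (auto simp: nth_fill nth_list_update_if)

lemma fill_update: "y ~: C ==> fill (xs[y := d]) C c = (fill xs C c)[y := d]"
 by (rule nth_equalityI) (auto simp: nth_fill nth_list_update_if)

lemma fill_id: "(!!i. i:C ==> i < length xs ==> xs ! i = c) ==> fill xs C c = xs"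
 by (rule nth_equalityI) (auto simp: nth_fill)

lemma fill_w:
 assumes "xs:words n M" "c:cr M" shows "fill xs C c:words n M"
 using assms by (auto simp: words_def fill_def in_set_conv_nth subset_iff)

text \<open>Stated with sums on both sides, so that no truncated difference of multisets
  occurs.\<close>

lemma mset_fill:
 assumes "finite C" "C <= {..<length xs}" "!!i. i:C ==> xs ! i = v"
 shows "mset (fill xs C c) + replicate_mset (card C) v = mset xs + replicate_mset (card C) c"
 using assms
proof (induction C rule: finite_induct)
 case (insert y C)
 hence "mset ((fill xs C c)[y := c]) + {#v#} = mset (fill xs C c) + {#c#}"
 by (simp add: mset_update nth_fill)
 (metis insert_DiffM length_fill nth_fill nth_mem_mset)
 hence "mset ((fill xs C c)[y := c]) + replicate_mset (Suc (card C)) v =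
 mset (fill xs C c) + replicate_mset (card C) v + {#c#}"
 by (simp flip: union_mset_add_mset_left)
 with insert show ?case by (simp add: fill_insert)
qed simp

context two_mods
begin

text \<open>Expansion in powers of \<open>t\<close>: \<open>h 0\<close> is the derivative at
  \<open>t = 0\<close>, the sum over the slots of \<open>C\<close> in which a single
  \<open>v\<close> becomes \<open>u\<close>. Only this coefficient matters; the higher ones stay
  hidden in the polynomial sequence \<open>h\<close>.\<close>

lemma mlt_fill_expansion:
 assumes g: "mlt R n M N g" and "finite C" and v: "v:cr M" and u: "u:cr M"
 and "C <= {..<n}" "xs:words n M"
 shows "EX h d. polyseq N d h &
 h 0 = finsum N (%x. g ((fill xs C v)[x := u])) C &
 (!t. g (fill xs C (v \<oplus>\<^sub>M [t] \<cdot>\<^sub>M u)) = g (fill xs C v) \<oplus>\<^sub>N [t] \<cdot>\<^sub>N h t)"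
 using assms(2,5,6)
proof (induction C arbitrary: xs rule: finite_induct)
 case empty
 hence gx: "g xs:cr N" using mltD(1)[OF g] by simp
 have z: "[t] \<cdot>\<^sub>N \<zero>\<^sub>N = \<zero>\<^sub>N" for t :: nat
 by (induction t) (simp_all add: N.M.add_pow_nat)
 show ?case
 by (rule exI[of _ "%_. \<zero>\<^sub>N"], rule exI[of _ 0]) (simp add: gx z)
next
 case (insert y C)
 have y: "y < n" "C <= {..<n}" and n: "length xs = n" using insert.prems by (auto simp: words_def)
 have w: "xs[y := v]:words n M" "xs[y := u]:words n M"
 using insert.prems u v w_update by auto
 have tu: "[t] \<cdot>\<^sub>M u:cr M" for t :: nat using u by (rule M.M.add_pow_nat_c)
 obtain h d where h: "polyseq N d h"
 "h 0 = finsum N (%x. g ((fill (xs[y := v]) C v)[x := u])) C"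
 "!!t. g (fill (xs[y := v]) C (v \<oplus>\<^sub>M [t] \<cdot>\<^sub>M u)) =
 g (fill (xs[y := v]) C v) \<oplus>\<^sub>N [t] \<cdot>\<^sub>N h t"
 using insert.IH[OF y(2) w(1)] by blast
 obtain h' d' where h': "polyseq N d' h'"
 "!!t. g (fill (xs[y := u]) C (v \<oplus>\<^sub>M [t] \<cdot>\<^sub>M u)) =
 g (fill (xs[y := u]) C v) \<oplus>\<^sub>N [t] \<cdot>\<^sub>N h' t"
 using insert.IH[OF y(2) w(2)] by blast
 \<comment> \<open>The slot \<open>y\<close> holds \<open>v + t u\<close>. Its \<open>v\<close>-part
   is covered by the induction hypothesis, and its \<open>u\<close>-part already carries the factor
   \<open>t\<close>, so the whole polynomial \<open>q\<close> is added to \<open>h\<close>.\<close>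
 define q where "q t = g (fill (xs[y := u]) C (v \<oplus>\<^sub>M [t] \<cdot>\<^sub>M u))" for t :: nat
 have gc: "g (fill xs' C' c):cr N" if "xs':words n M" "c:cr M" for xs' C' c
 using fill_w[OF that] mltD(1)[OF g] by blast
 have "polyseq N (Suc d') (%t. g (fill (xs[y := u]) C v) \<oplus>\<^sub>N [t] \<cdot>\<^sub>N h' t)"
 by (intro N.M.polyseq_add N.M.polyseq_times h')
 (rule N.M.polyseq_mono[of 0]; simp add: gc w v)
 hence q: "polyseq N (Suc d') q" by (simp add: q_def[abs_def] h'(2))
 define H where "H t = h t \<oplus>\<^sub>N q t" for t
 have hc: "h t:cr N" and qc: "q t:cr N" for t
 by (rule N.M.polyseq_c[OF h(1)], rule N.M.polyseq_c[OF q])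
 have "polyseq N (max d (Suc d')) H"
 unfolding H_def
 by (intro N.M.polyseq_add N.M.polyseq_mono[OF h(1)] N.M.polyseq_mono[OF q]) auto
 moreover have "H 0 = finsum N (%x. g ((fill xs (insert y C) v)[x := u])) (insert y C)"
 proof -
 have 1: "(fill (xs[y := v]) C v)[x := u] = (fill xs (insert y C) v)[x := u]" for x
 using insert.hyps by (simp add: fill_insert fill_update)
 have 2: "q 0 = g ((fill xs (insert y C) v)[y := u])"
 using insert.hyps v by (simp add: q_def fill_insert fill_update M.M.add_pow_nat)
 have c: "g ((fill xs (insert y C) v)[x := u]):cr N" for x
 using mltD(1)[OF g w_update[OF fill_w[OF insert.prems(2) v] u]] .
 show ?thesis unfolding H_def 2 h(2) 1
 using insert.hyps c by (simp add: N.M.a_comm)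
 qed
 moreover have "g (fill xs (insert y C) (v \<oplus>\<^sub>M [t] \<cdot>\<^sub>M u)) =
 g (fill xs (insert y C) v) \<oplus>\<^sub>N [t] \<cdot>\<^sub>N H t" for t
 proof -
 let ?c = "v \<oplus>\<^sub>M [t] \<cdot>\<^sub>M u"
 have c: "?c:cr M" using v tu by simp
 have f: "fill xs C ?c:words n M" by (rule fill_w[OF insert.prems(2) c])
 note lin = linD(2)[OF mltD(2)[OF g f y(1)]]
 have nat: "g ((fill xs C ?c)[y := [s] \<cdot>\<^sub>M u]) = [s] \<cdot>\<^sub>N g ((fill xs C ?c)[y := u])" for s :: nat
 proof (induction s)
 case 0
 thus ?case
 using lin_zero[OF mltD(2)[OF g f y(1)]]
 by (simp add: M.M.add_pow_nat N.M.add_pow_nat)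
 next
 case (Suc s)
 thus ?case
 using lin[of "[s] \<cdot>\<^sub>M u" u] u M.M.add_pow_nat_c
 by (simp add: M.M.add_pow_nat N.M.add_pow_nat)
 qed
 have "g (fill xs (insert y C) ?c) = g ((fill xs C ?c)[y := v]) \<oplus>\<^sub>N [t] \<cdot>\<^sub>N g ((fill xs C ?c)[y := u])"
 using insert.hyps lin[OF v tu[of t]] nat by (simp add: fill_insert)
 also have "\<dots> = (g (fill (xs[y := v]) C v) \<oplus>\<^sub>N [t] \<cdot>\<^sub>N h t) \<oplus>\<^sub>N [t] \<cdot>\<^sub>N q t"
 using insert.hyps h(3) by (simp add: fill_update q_def)
 also have "\<dots> = g (fill (xs[y := v]) C v) \<oplus>\<^sub>N [t] \<cdot>\<^sub>N (h t \<oplus>\<^sub>N q t)"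
 proof -
 have "[s] \<cdot>\<^sub>N (h t \<oplus>\<^sub>N q t) = [s] \<cdot>\<^sub>N h t \<oplus>\<^sub>N [s] \<cdot>\<^sub>N q t" for s :: nat
 by (induction s) (simp_all add: N.M.add_pow_nat hc qc N.M.add_pow_nat_c N.M.a_ac)
 thus ?thesis
 by (simp add: N.M.a_assoc hc qc N.M.add_pow_nat_c gc w v)
 qed
 finally show ?thesis
 using insert.hyps by (simp add: H_def fill_insert fill_update)
 qed
 ultimately show ?case by blast
qed

text \<open>For \<open>t > 0\<close> the expansion puts \<open>t h(t)\<close> into \<open>W\<close>,
  the hypothesis \<open>tor\<close> divides by \<open>t\<close>, and a polynomial sequence with
  positive values in \<open>W\<close> has its value at 0 there too.\<close>

lemma mlt_fill_linear_part:
 assumes g: "mlt R n M N g" and W: "submodule W R N"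
 and tor: "!!m w. w:cr N ==> [Suc m] \<cdot>\<^sub>N w:W ==> w:W"
 and C: "C <= {..<n}" and v: "v:cr M" and u: "u:cr M" and xs: "xs:words n M"
 and fill: "!!c. c:cr M ==> g (fill xs C c):W"
 shows "finsum N (%x. g ((fill xs C v)[x := u])) C:W"
proof -
 obtain h d where h: "polyseq N d h" "h 0 = finsum N (%x. g ((fill xs C v)[x := u])) C"
 "!!t. g (fill xs C (v \<oplus>\<^sub>M [t] \<cdot>\<^sub>M u)) = g (fill xs C v) \<oplus>\<^sub>N [t] \<cdot>\<^sub>N h t"
 using mlt_fill_expansion[OF g _ v u C xs] finite_subset[OF C] by blast
 have hc: "h t:cr N" for t using N.M.polyseq_c[OF h(1)] .
 have "h (Suc t):W" for t
 proof -
 have "v \<oplus>\<^sub>M [Suc t] \<cdot>\<^sub>M u:cr M" using u v M.M.add_pow_nat_c by simp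
 hence "(g (fill xs C v) \<oplus>\<^sub>N [Suc t] \<cdot>\<^sub>N h (Suc t)) \<ominus>\<^sub>N g (fill xs C v):W"
 using N.submod_minus[OF W fill fill[OF v]] h(3) by metis
 moreover have "g (fill xs C v):cr N"
 using mltD(1)[OF g fill_w[OF xs v]] .
 moreover have "[Suc t] \<cdot>\<^sub>N h (Suc t):cr N"
 using hc N.M.add_pow_nat_c by blast
 ultimately have "[Suc t] \<cdot>\<^sub>N h (Suc t):W"
 by (simp add: a_minus_def N.M.a_ac N.M.r_neg2 del: N.M.add_pow_nat)
 thus ?thesis using tor hc by blast
 qed
 thus ?thesis using N.polyseq_at_zero[OF W h(1)] h(2) by metis
qed

text \<open>The heart of the matter: if \<open>j\<close> letters are left over after removing \<open>k\<close>-fold letters, one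
 of them, \<open>u\<close> at position \<open>p\<close>, is traded for the filler \<open>v\<close>. Replacing \<open>k\<close> fillers by \<open>v + t u\<close> and
 comparing coefficients of \<open>t\<close> shows that the sum of the words with \<open>u\<close> in one place of a
 \<open>k\<close>-element set is good, and exchanging single elements of that set shows that all
 these words are congruent.\<close>

lemma mlt_powers_filler:
 assumes g: "mlt R n M N g" and W: "submodule W R N" and k: "0 < k" "k dvd n"
 and tor: "!!m w. w:cr N ==> [Suc m] \<cdot>\<^sub>N w:W ==> w:W"
 and pow: "!!xs m. xs:words n M ==> mset xs = repeat_mset k m ==> g xs:W"
 and "xs:words n M" "mset xs = repeat_mset k m0 + replicate_mset f v + m1"
 and "k * size m1 <= f"
 shows "g xs:W"
 using assms(7-)
proof (induction "size m1" arbitrary: xs m0 f m1)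
 case 0
 hence ms: "mset xs = repeat_mset k m0 + replicate_mset f v" by simp
 \<comment> \<open>No letters are left over; as \<open>k\<close> divides the length
   \<open>n\<close>, the fillers form \<open>k\<close>-fold blocks as well.\<close>
 have "n = k * size m0 + f"
 using arg_cong[OF ms, of size] 0(2) by (simp add: words_def)
 hence "k dvd f" using k(2) by (simp add: dvd_add_right_iff)
 then obtain f' where "f = k * f'" ..
 hence "mset xs = repeat_mset k (m0 + replicate_mset f' v)"
 unfolding ms by (auto simp: multiset_eq_iff)
 thus ?case using pow 0 by blast
next
 case (Suc j)
 have len: "length xs = n" using Suc.prems(1) by (simp add: words_def)
 obtain u m2 where m1: "m1 = add_mset u m2" "size m2 = j"
 using Suc.hyps(2) by (metis size_eq_Suc_imp_eq_union size_add_mset Suc_inject)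
 have fk: "k * j + k <= f" using Suc.prems(3) m1 by simp
 have "u:set xs" "v:set xs"
 using Suc.prems(2) m1 fk k by (auto simp flip: set_mset_mset)
 then obtain p where p: "p < n" "xs ! p = u" by (auto simp: in_set_conv_nth len)
 have uv: "u:cr M" "v:cr M"
 using \<open>u:set xs\<close> \<open>v:set xs\<close> Suc.prems(1) by (auto simp: words_def)
 define Z where "Z = {i. i < n & xs ! i = v} - {p}"
 define ys where "ys = xs[p := v]"
 have ys: "ys:words n M" "length ys = n" using Suc.prems(1) uv len by (auto simp: ys_def w_update)
 \<comment> \<open>If \<open>u\<close> and \<open>v\<close> coincide, \<open>v\<close> occurs at
   least \<open>f + 1\<close> times, which makes up for the position \<open>p\<close> excluded from
   \<open>Z\<close>.\<close>
 have "f <= card Z"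
 proof -
 have "card {i. i < n & xs ! i = v} = count (mset xs) v"
 by (simp add: len[symmetric] count_mset count_list_eq_length_filter length_filter_conv_card eq_commute)
 also have "\<dots> >= f + (if u = v then 1 else 0)" using Suc.prems(2) m1 by simp
 finally show ?thesis
 using p by (auto simp: Z_def card_Diff_singleton_if split: if_splits)
 qed
 have ysv: "ys ! i = v" if "i:insert p Z" for i
 using that p len by (auto simp: ys_def Z_def nth_list_update)
 have good: "finsum N (%x. g (ys[x := u])) C:W" if C: "C <= insert p Z" "card C = k" for C
 proof -
 have Cn: "C <= {..<n}" using C(1) p(1) by (auto simp: Z_def)
 have fin: "finite C" using C(2) k(1) card_ge_0_finite by blast
 have "g (fill ys C c):W" if c: "c:cr M" for c
 proof -
 have "mset (fill ys C c) + replicate_mset k v = mset ys + replicate_mset k c"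
 using mset_fill[OF fin, of ys v c] Cn ys(2) C ysv by auto
 moreover have "mset ys + {#u#} = mset xs + {#v#}"
 using p len by (simp add: ys_def mset_update)
 (metis insert_DiffM nth_mem_mset)
 ultimately have "mset (fill ys C c) + replicate_mset k v + {#u#} =
 repeat_mset k m0 + replicate_mset f v + m1 + {#v#} + replicate_mset k c"
 using Suc.prems(2) by (simp add: ac_simps)
 hence cnt: "count (mset (fill ys C c) + replicate_mset k v + {#u#}) x =
 count (repeat_mset k m0 + replicate_mset f v + m1 + {#v#} + replicate_mset k c) x" for x
 by (rule arg_cong)
 \<comment> \<open>\<open>ys\<close> has one filler more and one leftover letter less than
   \<open>xs\<close>. Filling \<open>C\<close> turns \<open>k\<close> fillers into a block of
   \<open>k\<close> letters \<open>c\<close>, so the induction hypothesis for \<open>m2\<close>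
   applies.\<close>
 have eq: "mset (fill ys C c) = repeat_mset k (m0 + {#c#}) + replicate_mset (f + 1 - k) v + m2"
 proof (rule multiset_eqI)
 fix x
 show "count (mset (fill ys C c)) x =
 count (repeat_mset k (m0 + {#c#}) + replicate_mset (f + 1 - k) v + m2) x"
 using cnt[of x] fk unfolding m1(1) by (cases "x = v"; cases "x = u"; cases "x = c") simp_all
 qed
 have "k * size m2 <= f + 1 - k" using fk m1(2) by simp
 thus ?thesis
 by (rule Suc.hyps(1)[OF m1(2)[symmetric] fill_w[OF ys(1) c] eq])
 qed
 hence "finsum N (%x. g ((fill ys C v)[x := u])) C:W"
 by (intro mlt_fill_linear_part[OF g W tor Cn uv(2,1) ys(1)]) auto
 moreover have "fill ys C v = ys" using ysv C(1) by (intro fill_id) auto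
 ultimately show ?thesis by simp
 qed
 have Tc: "g (ys[x := u]):cr N" for x
 using mltD(1)[OF g w_update[OF ys(1) uv(1)]] .
 have finZ: "finite Z" by (simp add: Z_def)
 have kZ: "k <= card Z" using \<open>f <= card Z\<close> fk by linarith
 have pZ: "p ~: Z" by (simp add: Z_def)
 \<comment> \<open>Two \<open>k\<close>-element sets that differ in one element: the difference of
   their sums is the difference of the two exchanged words.\<close>
 have exch: "g (ys[p := u]) \<ominus>\<^sub>N g (ys[x := u]):W" if x: "x:Z" for x
 proof -
 have "k - 1 <= card (Z - {x})" using kZ x finZ by simp
 then obtain C where C: "C <= Z - {x}" "card C = k - 1" "finite C"
 by (rule obtain_subset_with_card_n)
 let ?s = "finsum N (%x. g (ys[x := u])) C"
 have sc: "?s:cr N" using Tc by (intro N.M.finsum_closed) auto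
 have "x ~: C" "p ~: C" using C(1) pZ by auto
 have "finsum N (%x. g (ys[x := u])) (insert p C):W"
 "finsum N (%x. g (ys[x := u])) (insert x C):W"
 using C x k(1) \<open>x ~: C\<close> \<open>p ~: C\<close> by (auto intro!: good)
 hence "(g (ys[p := u]) \<oplus>\<^sub>N ?s) \<ominus>\<^sub>N (g (ys[x := u]) \<oplus>\<^sub>N ?s):W"
 using N.submod_minus[OF W] C(3) Tc \<open>x ~: C\<close> \<open>p ~: C\<close> by simp
 moreover have "(g (ys[p := u]) \<oplus>\<^sub>N ?s) \<ominus>\<^sub>N (g (ys[x := u]) \<oplus>\<^sub>N ?s) =
 g (ys[p := u]) \<ominus>\<^sub>N g (ys[x := u])"
 using Tc sc N.M.add_minus_add[OF Tc sc Tc sc] by (simp add: a_minus_def N.M.r_neg)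
 ultimately show ?thesis by simp
 qed
 have "k - 1 <= card Z" using kZ by simp
 then obtain C0 where C0: "C0 <= Z" "card C0 = k - 1" "finite C0"
 by (rule obtain_subset_with_card_n)
 define C where "C = insert p C0"
 have C: "finite C" "card C = k" "C <= insert p Z"
 using C0 pZ k(1) by (auto simp: C_def card_insert_if subset_iff)
 have "g (ys[p := u]) \<ominus>\<^sub>N g (ys[x := u]):W" if "x:C" for x
 proof (cases "x = p")
 case True
 thus ?thesis using N.submod_zero[OF W] Tc by (simp add: a_minus_def N.M.r_neg)
 next
 case False
 thus ?thesis using exch that C(3) by auto
 qed
 hence "finsum N (%x. g (ys[p := u]) \<ominus>\<^sub>N g (ys[x := u])) C:W"
 by (rule N.submod_finsum[OF W C(1)])
 hence "finsum N (%x. g (ys[p := u]) \<ominus>\<^sub>N g (ys[x := u])) C \<oplus>\<^sub>N finsum N (%x. g (ys[x := u])) C:W"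
 using good[OF C(3,2)] N.submoduleE(5)[OF W] by blast
 also have "finsum N (%x. g (ys[p := u]) \<ominus>\<^sub>N g (ys[x := u])) C \<oplus>\<^sub>N finsum N (%x. g (ys[x := u])) C
 = finsum N (%x. (g (ys[p := u]) \<ominus>\<^sub>N g (ys[x := u])) \<oplus>\<^sub>N g (ys[x := u])) C"
 using Tc by (subst N.M.finsum_addf) (auto simp: a_minus_def)
 also have "\<dots> = finsum N (%x. g (ys[p := u])) C"
 using Tc by (intro N.M.finsum_cong') (auto simp: a_minus_def N.M.a_assoc N.M.l_neg)
 \<comment> \<open>Adding the differences, which lie in \<open>W\<close>, to the sum over
   \<open>C\<close> leaves \<open>k\<close> copies of the value at the word with \<open>u\<close> in
   place \<open>p\<close>, that is, at \<open>xs\<close>; \<open>tor\<close> then divides by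
   \<open>k\<close>.\<close>
 also have "\<dots> = [k] \<cdot>\<^sub>N g (ys[p := u])"
 using C Tc by (simp add: N.M.finsum_const_nat)
 finally have "g (ys[p := u]):W" using tor[OF Tc, of "k - 1"] k(1) by simp
 moreover have "ys[p := u] = xs" using p by (metis ys_def list_update_id list_update_overwrite)
 ultimately show ?case by simp
qed

end

section \<open>Pigeonhole arguments for words in finitely many letters\<close>

lemma multiset_pigeonhole:
 assumes "finite S" "set_mset m <= S" "card S * b < size m"
 shows "EX v:S. b < count m v"
proof (rule ccontr)
 assume "~ ?thesis"
 hence "sum (count m) S <= card S * b"
 by (intro sum_bounded_above[where K = b, simplified]) (auto simp: not_less)
 moreover have "size m = sum (count m) S"
 unfolding size_multiset_overloaded_eq
 by (rule sum.mono_neutral_left) (use assms in \<open>auto simp: not_in_iff\<close>)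
 ultimately show False using assms(3) by simp
qed

text \<open>No letterwise division with remainder is carried out: a block of \<open>k\<close> equal
  letters is split off as long as the pigeonhole principle finds a letter occurring more than
  \<open>k\<close> times, and this already bounds the rest.\<close>

lemma multiset_div_mod:
 assumes "finite S" "set_mset m <= S" "0 < k"
 shows "EX m0 m1. m = repeat_mset k m0 + m1 & size m1 <= card S * k"
 using assms(2)
proof (induction "size m" arbitrary: m rule: less_induct)
 case less
 show ?case
 proof (cases "card S * k < size m")
 case True
 then obtain v where v: "v:S" "k < count m v"
 using multiset_pigeonhole[OF assms(1) less.prems] by blast
 define m' where "m' = m - replicate_mset k v"
 have m: "m = m' + replicate_mset k v"
 using v(2) by (auto simp: m'_def multiset_eq_iff)
 hence "size m' < size m" "set_mset m' <= S" using \<open>0 < k\<close> less.prems by auto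
 then obtain m0 m1 where "m' = repeat_mset k m0 + m1" "size m1 <= card S * k"
 using less.hyps by blast
 hence "m = repeat_mset k (add_mset v m0) + m1 & size m1 <= card S * k"
 using m by simp
 thus ?thesis by blast
 next
 case False
 hence "m = repeat_mset k {#} + m & size m <= card S * k" by simp
 thus ?thesis by blast
 qed
qed

text \<open>Origin of the bound on \<open>a\<close>: grouping the other letters into
  \<open>k\<close>-fold blocks leaves at most \<open>card S * k\<close> of them over, and each needs
  \<open>k\<close> fillers. A word of length \<open>k * a\<close> over \<open>S\<close> has a letter
  occurring more than \<open>k * (card S * k)\<close> times as soon as
  \<open>card S * (card S * k) < a\<close>.\<close>

theorem (in two_mods) mlt_in_submod_if_powers:
 assumes g: "mlt R (k * a) M N g" and W: "submodule W R N" and k: "0 < k"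
 and tor: "!!m w. w:cr N ==> [Suc m] \<cdot>\<^sub>N w:W ==> w:W"
 and pow: "!!xs m. xs:words (k * a) M ==> mset xs = repeat_mset k m ==> g xs:W"
 and S: "finite S" "S <= cr M" "cr M = module_span R M S"
 and a: "card S * (card S * k) < a" and xs: "xs:words (k * a) M"
 shows "g xs:W"
proof (rule mlt_in_submod[OF S(2,3) g W _ xs])
 fix ss assume ss: "length ss = k * a" "set ss <= S"
 have "card S * (k * (card S * k)) < size (mset ss)"
 using a k by (simp add: ss(1) mult.left_commute)
 then obtain v where v: "v:S" "k * (card S * k) < count (mset ss) v"
 using multiset_pigeonhole[OF S(1), of "mset ss"] ss(2) by auto
 define f where "f = count (mset ss) v"
 have split: "mset ss = filter_mset (%x. x ~= v) (mset ss) + replicate_mset f v"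
 by (auto simp: multiset_eq_iff f_def)
 have "set_mset (filter_mset (%x. x ~= v) (mset ss)) <= S" using ss(2) by auto
 from multiset_div_mod[OF S(1) this k]
 obtain m0 m1 where m: "filter_mset (%x. x ~= v) (mset ss) = repeat_mset k m0 + m1"
 "size m1 <= card S * k" by blast
 have f: "k * size m1 <= f"
 unfolding f_def using mult_le_mono2[OF m(2), of k] v(2) by linarith
 have eq: "mset ss = repeat_mset k m0 + replicate_mset f v + m1"
 using split unfolding m(1) by (simp only: ac_simps)
 have w: "ss:words (k * a) M" using ss S(2) by (auto simp: words_def)
 show "g ss:W"
 by (rule mlt_powers_filler[OF g W k dvd_triv_left tor pow w eq f])
qed

text \<open>The ideal enters through its closure properties only. The surplus generators
  \<open>ws\<close> are removed one at a time: modulo the span of the others, \<open>w\<close>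
  equals \<open>\<mu> w\<close> with \<open>\<mu>\<close> in \<open>I\<close>, and
  \<open>1 - \<mu>\<close> is a unit.\<close>

lemma (in module) nakayama:
 assumes I: "I <= cr R" "!!\<mu> r. \<mu>:I ==> r:cr R ==> \<mu> \<otimes> r:I"
 "!!\<mu> \<nu>. \<mu>:I ==> \<nu>:I ==> \<mu> \<oplus> \<nu>:I" "\<zero>:I" "!!\<mu>. \<mu>:I ==> \<one> \<ominus> \<mu>:Units R"
 and N: "submodule N R M" and M: "cr M = module_span R M (N Un {\<mu> \<odot>\<^sub>M x | \<mu> x. \<mu>:I & x:cr M})"
 and "set ws <= cr M" "cr M = module_span R M (N Un set ws)"
 shows "N = cr M"
 using assms(8,9)
proof (induction ws)
 case Nil
 have "module_span R M N <= N" by (rule span_least[OF N]) simp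
 moreover have "cr M = module_span R M N" using Nil(2) by simp
 ultimately show ?case using submoduleE(1)[OF N] by blast
next
 case (Cons w ws)
 have NM: "N <= cr M" using submoduleE(1)[OF N] .
 define L where "L = module_span R M (N Un set ws)"
 have w: "w:cr M" and sub: "N Un set ws <= cr M" using Cons.prems(1) NM by simp_all
 have L: "submodule L R M" "N Un set ws <= L" "L <= cr M"
 unfolding L_def by (rule span_submod[OF sub] span_superset span_sub[OF sub])+
 \<comment> \<open>Used twice: with \<open>J\<close> the whole ring it writes every element as
   \<open>l + r w\<close>, and with \<open>J = I\<close> it writes \<open>w\<close> itself in this
   form.\<close>
 have Lw: "EX l r. l:L & r:J & x = l \<oplus>\<^sub>M r \<odot>\<^sub>M w"
 if J: "J <= cr R" "!!\<mu> \<nu>. \<mu>:J ==> \<nu>:J ==> \<mu> \<oplus> \<nu>:J" "\<zero>:J" "!!\<mu> r. \<mu>:J ==> r:cr R ==> \<mu> \<otimes> r:J"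
 and S: "!!x. x:S ==> EX l r. l:L & r:J & x = l \<oplus>\<^sub>M r \<odot>\<^sub>M w" and x: "x:module_span R M S" for J S x
 proof -
 have "submodule {x. EX l r. l:L & r:J & x = l \<oplus>\<^sub>M r \<odot>\<^sub>M w} R M" (is "submodule ?H R M")
 proof (rule submod_if_c)
 show "?H <= cr M" using L(3) J(1) w by auto
 show "\<zero>\<^sub>M:?H" using J(3) submod_zero[OF L(1)] w by force
 fix x y assume "x:?H" "y:?H"
 then obtain l r l' r' where lr: "l:L" "r:J" "x = l \<oplus>\<^sub>M r \<odot>\<^sub>M w"
 "l':L" "r':J" "y = l' \<oplus>\<^sub>M r' \<odot>\<^sub>M w" by auto
 hence "x \<oplus>\<^sub>M y = (l \<oplus>\<^sub>M l') \<oplus>\<^sub>M (r \<oplus> r') \<odot>\<^sub>M w"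
 using L(3) J(1) w by (simp add: smult_l_distr M.a_ac subset_iff)
 thus "x \<oplus>\<^sub>M y:?H" using lr J(2) submoduleE(5)[OF L(1)] by blast
 next
 fix c x assume c: "c:cr R" and "x:?H"
 then obtain l r where lr: "l:L" "r:J" "x = l \<oplus>\<^sub>M r \<odot>\<^sub>M w" by auto
 hence "c \<odot>\<^sub>M x = c \<odot>\<^sub>M l \<oplus>\<^sub>M (r \<otimes> c) \<odot>\<^sub>M w"
 using L(3) J(1) w c by (simp add: smult_r_distr smult_assoc1[symmetric] R.m_comm subset_iff)
 thus "c \<odot>\<^sub>M x:?H" using lr c J(4) submoduleE(4)[OF L(1)] by blast
 qed
 from span_least[OF this, of S] S x show ?thesis by blast
 qed
 have zw: "EX l r. l:L & r:J & x = l \<oplus>\<^sub>M r \<odot>\<^sub>M w" if "x:L" "\<zero>:J" for x J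
 using that w L(3) by (intro exI[of _ x] exI[of _ \<zero>]) auto
 have all: "EX l r. l:L & r:cr R & x = l \<oplus>\<^sub>M r \<odot>\<^sub>M w" if "x:cr M" for x
 proof (rule Lw[of "cr R" "N Un set (w # ws)"])
 show "x:module_span R M (N Un set (w # ws))" using that Cons.prems(2) by simp
 fix y assume "y:N Un set (w # ws)"
 then consider "y:L" | "y = w" using L(2) by auto
 thus "EX l r. l:L & r:cr R & y = l \<oplus>\<^sub>M r \<odot>\<^sub>M w"
 proof cases
 case 1
 thus ?thesis by (rule zw) simp
 next
 case 2
 thus ?thesis using w submod_zero[OF L(1)]
 by (intro exI[of _ "\<zero>\<^sub>M"] exI[of _ \<one>]) auto
 qed
 qed auto
 have "EX l r. l:L & r:I & w = l \<oplus>\<^sub>M r \<odot>\<^sub>M w"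
 proof (rule Lw[OF I(1) I(3) I(4) I(2)])
 show "w:module_span R M (N Un {\<mu> \<odot>\<^sub>M x | \<mu> x. \<mu>:I & x:cr M})"
 using w M by simp
 fix y assume "y:N Un {\<mu> \<odot>\<^sub>M x | \<mu> x. \<mu>:I & x:cr M}"
 then consider "y:N" | \<mu> x where "y = \<mu> \<odot>\<^sub>M x" "\<mu>:I" "x:cr M" by auto
 thus "EX l r. l:L & r:I & y = l \<oplus>\<^sub>M r \<odot>\<^sub>M w"
 proof cases
 case 1
 hence "y:L" using L(2) by auto
 thus ?thesis using I(4) by (rule zw)
 next
 case 2
 then obtain l r where lr: "l:L" "r:cr R" "x = l \<oplus>\<^sub>M r \<odot>\<^sub>M w" using all by blast
 have \<mu>: "\<mu>:cr R" using 2 I(1) by auto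
 have "y = \<mu> \<odot>\<^sub>M l \<oplus>\<^sub>M (\<mu> \<otimes> r) \<odot>\<^sub>M w"
 using lr 2 \<mu> L(3) w by (simp add: smult_r_distr smult_assoc1 subset_iff)
 thus ?thesis using lr 2 I(2) \<mu> submoduleE(4)[OF L(1)] by blast
 qed
 qed
 then obtain l \<mu> where l: "l:L" "\<mu>:I" "w = l \<oplus>\<^sub>M \<mu> \<odot>\<^sub>M w" by blast
 have \<mu>: "\<mu>:cr R" and lM: "l:cr M" using l I(1) L(3) by auto
 have "(\<one> \<ominus> \<mu>) \<odot>\<^sub>M w = w \<ominus>\<^sub>M \<mu> \<odot>\<^sub>M w"
 using \<mu> w by (simp add: R.minus_eq smult_l_distr smult_l_minus a_minus_def)
 also have "\<dots> = (l \<oplus>\<^sub>M \<mu> \<odot>\<^sub>M w) \<ominus>\<^sub>M \<mu> \<odot>\<^sub>M w" using l(3) by simp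
 also have "\<dots> = l" using lM \<mu> w by (simp add: a_minus_def M.a_assoc M.r_neg)
 finally have eq: "(\<one> \<ominus> \<mu>) \<odot>\<^sub>M w = l" .
 have "\<one> \<ominus> \<mu>:Units R" using I(5) l by blast
 hence "w = inv (\<one> \<ominus> \<mu>) \<odot>\<^sub>M l"
 unfolding eq[symmetric] using w
 by (metis R.Units_closed R.Units_inv_closed R.Units_l_inv smult_assoc1 smult_one)
 hence "w:L"
 using \<open>\<one> \<ominus> \<mu>:Units R\<close> l(1) submoduleE(4)[OF L(1)] R.Units_inv_closed by metis
 hence "N Un set (w # ws) <= L" using L(2) by auto
 hence "cr M = L" using Cons.prems(2) span_least[OF L(1)] L(3) by blast
 thus ?case using Cons.IH Cons.prems(1) unfolding L_def by simp
qed

section \<open>Germs and stalks\<close>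

locale set_psh =
 fixes T :: "'p topology" and F :: "'p set => 's set" and r :: "'p set => 'p set => 's => 's"
 assumes res_c: "openin T U ==> openin T V ==> V <= U ==> s:F U ==> r U V s:F V"
 and res_id: "openin T U ==> s:F U ==> r U U s = s"
 and res_res: "openin T U ==> openin T V ==> openin T W ==> W <= V ==> V <= U ==> s:F U ==>
 r V W (r U V s) = r U W s"
begin

lemma germ_eq_iff:
 assumes "openin T U" "x:U" "s:F U" "openin T V" "x:V" "t:F V"
 shows "germ T F r x U s = germ T F r x V t \<longleftrightarrow>
 (EX W. openin T W & x:W & W <= U Int V & r U W s = r V W t)" (is "?L \<longleftrightarrow> ?R")
proof
 assume ?L
 moreover have "(V, t):germ T F r x V t"
 using assms by (auto simp: germ_def)
 ultimately have "(V, t):germ T F r x U s" by simp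
 thus ?R by (auto simp: germ_def)
next
 have sub: "germ T F r x U s <= germ T F r x V t"
 if "openin T U" "s:F U" "openin T V" "t:F V"
 and W: "openin T W" "x:W" "W <= U Int V" "r U W s = r V W t" for U V W s t
 proof
 fix p assume "p:germ T F r x U s"
 then obtain V' t' W' where p: "p = (V', t')" "openin T V'" "x:V'" "t':F V'"
 "openin T W'" "x:W'" "W' <= U Int V'" "r U W' s = r V' W' t'"
 by (auto simp: germ_def)
 have o: "openin T (W Int W')" by (rule openin_Int[OF W(1) p(5)])
 have "r V (W Int W') t = r W (W Int W') (r V W t)"
 using res_res[OF that(3) W(1) o _ _ that(4)] W(3) by simp
 also have "\<dots> = r W' (W Int W') (r U W' s)"
 using res_res[OF that(1) W(1) o _ _ that(2)] res_res[OF that(1) p(5) o _ _ that(2)] W p by simp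
 also have "\<dots> = r V' (W Int W') t'"
 unfolding p(8) using res_res[OF p(2,5) o _ _ p(4)] p(7) by simp
 finally show "p:germ T F r x V t"
 using o p W by (auto simp: germ_def intro!: exI[of _ "W Int W'"])
 qed
 assume ?R
 then obtain W where W: "openin T W" "x:W" "W <= U Int V" "r U W s = r V W t" by blast
 show ?L
 using sub[OF assms(1,3,4,6) W] sub[OF assms(4,6,1,3) W(1,2) _ W(4)[symmetric]] W(3) by auto
qed

lemma germ_mem_iff:
 assumes "openin T U" "x:U" "s:F U"
 shows "(V, t):germ T F r x U s \<longleftrightarrow>
 openin T V & x:V & t:F V & germ T F r x V t = germ T F r x U s"
proof (cases "openin T V & x:V & t:F V")
 case True
 hence "(V, t):germ T F r x U s \<longleftrightarrow>
 (EX W. openin T W & x:W & W <= U Int V & r U W s = r V W t)"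
 by (simp add: germ_def)
 also have "\<dots> \<longleftrightarrow> germ T F r x U s = germ T F r x V t"
 using germ_eq_iff[OF assms, of V t] True by simp
 finally show ?thesis using True by auto
qed (auto simp: germ_def)

lemma germ_res:
 assumes "openin T U" "openin T V" "V <= U" "x:V" "s:F U"
 shows "germ T F r x V (r U V s) = germ T F r x U s"
 using assms res_c[OF assms(1,2,3,5)]
 by (subst germ_eq_iff) (auto simp: res_res intro!: exI[of _ V])

end

text \<open>The operations on germs are unions over all pairs of representatives. If an operation
  commutes with restriction, all members of the union agree, since representatives of one germ
  coincide on a smaller neighbourhood. Three different presheaves are allowed so that scalar
  multiplication is covered.\<close>

lemma germ_operation:
 assumes F: "set_psh T F f" and G: "set_psh T G g" and H: "set_psh T H h"
 and closed: "!!U s t. openin T U ==> s:F U ==> t:G U ==> q U s t:H U"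
 and natural: "!!U V s t. openin T U ==> openin T V ==> V <= U ==> s:F U ==> t:G U ==>
 h U V (q U s t) = q V (f U V s) (g U V t)"
 and U0: "openin T U0" "x:U0" "s0:F U0" "t0:G U0"
 shows "(\<Union>(U, s)\<in>germ T F f x U0 s0. \<Union>(V, t)\<in>germ T G g x U0 t0.
 germ T H h x (U Int V) (q (U Int V) (f U (U Int V) s) (g V (U Int V) t))) =
 germ T H h x U0 (q U0 s0 t0)"
proof -
 interpret F: set_psh T F f by (rule F)
 interpret G: set_psh T G g by (rule G)
 interpret H: set_psh T H h by (rule H)
 have "germ T H h x (U Int V) (q (U Int V) (f U (U Int V) s) (g V (U Int V) t)) = germ T H h x U0 (q U0 s0 t0)"
 if s: "(U, s):germ T F f x U0 s0" and t: "(V, t):germ T G g x U0 t0" for U s V t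
 proof -
 obtain W where W: "openin T U" "x:U" "s:F U" "openin T W" "x:W" "W <= U0 Int U"
 "f U0 W s0 = f U W s" using s by (auto simp: germ_def)
 obtain W' where W': "openin T V" "x:V" "t:G V" "openin T W'" "x:W'" "W' <= U0 Int V"
 "g U0 W' t0 = g V W' t" using t by (auto simp: germ_def)
 have o: "openin T (U Int V)" "openin T (W Int W')" using W W' by (auto intro: openin_Int)
 have c: "f U (U Int V) s:F (U Int V)" "g V (U Int V) t:G (U Int V)"
 using W W' o by (auto intro: F.res_c G.res_c)
 have "f U0 (W Int W') s0 = f W (W Int W') (f U W s)"
 using F.res_res[OF U0(1) W(4) o(2) _ _ U0(3)] W(6,7) by simp
 hence f: "f U0 (W Int W') s0 = f U (W Int W') s"
 using F.res_res[OF W(1,4) o(2) _ _ W(3)] W(6) by simp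
 have "g U0 (W Int W') t0 = g W' (W Int W') (g V W' t)"
 using G.res_res[OF U0(1) W'(4) o(2) _ _ U0(4)] W'(6,7) by simp
 hence g: "g U0 (W Int W') t0 = g V (W Int W') t"
 using G.res_res[OF W'(1,4) o(2) _ _ W'(3)] W'(6) by simp
 have "h (U Int V) (W Int W') (q (U Int V) (f U (U Int V) s) (g V (U Int V) t)) = q (W Int W') (f U (W Int W') s) (g V (W Int W') t)"
 using natural[OF o _ c] F.res_res[OF W(1) o _ _ W(3)] G.res_res[OF W'(1) o _ _ W'(3)] W(6) W'(6)
 by (simp add: le_infI1 le_infI2)
 also have "\<dots> = h U0 (W Int W') (q U0 s0 t0)"
 using natural[OF U0(1) o(2) _ U0(3,4)] W(6) f g by (simp add: le_infI1)
 finally show ?thesis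
 using o W W' U0 c closed[OF o(1) c] closed[OF U0(1,3,4)]
 by (subst H.germ_eq_iff) (auto intro!: exI[of _ "W Int W'"])
 qed
 hence inner: "(\<Union>(V, t)\<in>germ T G g x U0 t0.
 germ T H h x (U Int V) (q (U Int V) (f U (U Int V) s) (g V (U Int V) t))) = germ T H h x U0 (q U0 s0 t0)"
 if "(U, s):germ T F f x U0 s0" for U s
 using that U0 by (intro UN_constant_eq[of "(U0, t0)"]) (auto simp: G.germ_mem_iff)
 have "(U0, s0):germ T F f x U0 s0" using U0 by (simp add: F.germ_mem_iff)
 thus ?thesis
 proof (rule UN_constant_eq, intro ballI)
 fix p assume "p:germ T F f x U0 s0"
 thus "(case p of (U, s) => \<Union>(V, t)\<in>germ T G g x U0 t0.
 germ T H h x (U Int V) (q (U Int V) (f U (U Int V) s) (g V (U Int V) t))) = germ T H h x U0 (q U0 s0 t0)"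
 by (cases p) (simp only: prod.case inner)
 qed
qed

lemma sheaf_of_sets_imp_set_psh: "sheaf_of_sets T F r ==> set_psh T F r"
 by unfold_locales (simp_all add: sheaf_of_sets_def Pi_iff)

abbreviation "sec M U == cr (Msec M U)"
abbreviation "wsec n M U == words n (Msec M U)"

section \<open>The structure sheaf and its stalks\<close>

locale rspace =
 fixes X :: "('p, 'a) ringed"
 assumes ringed_space: "ringed_space X"
begin

abbreviation "opn == openin (Top X)"
abbreviation "pts == points X"
abbreviation "opb == opens_below X"
abbreviation "OS == Osec X"
abbreviation "osec U == cr (OS U)"
abbreviation "og == Ogerm X"
abbreviation "Ost == Ostalk X"
abbreviation "ostk x == cr (Ost x)"
abbreviation gm where "gm == Mgerm X"
abbreviation mg where "mg M x U == map (gm M x U)"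
abbreviation Mst where "Mst == Mstalk X"
abbreviation stk where "stk M x == cr (Mst M x)"
abbreviation wstk where "wstk n M x == words n (Mst M x)"
abbreviation spn where "spn M x == module_span (Ost x) (Mst M x)"
abbreviation shom where "shom x M N == lin (Ost x) (Mst M x) (Mst N x)"
abbreviation mlin where "mlin x n M N == mlt (Ost x) n (Mst M x) (Mst N x)"
abbreviation sfy where "sfy == sheafify X"

lemma OS_cring: "opn U ==> cring (OS U)"
 using ringed_space by (simp add: ringed_space_def)

lemma Ores_hom:
 "opn U ==> opn V ==> V <= U ==> Ores X U V:ring_hom (OS U) (OS V)"
 using ringed_space by (simp add: ringed_space_def)

lemma Osheaf: "sheaf_of_sets (Top X) (%U. osec U) (Ores X)"
 using ringed_space by (simp add: ringed_space_def)

sublocale O: set_psh "Top X" "%U. osec U" "Ores X"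
 by (rule sheaf_of_sets_imp_set_psh[OF Osheaf])

lemma Ores_zero:
 "opn U ==> opn V ==> V <= U ==> Ores X U V \<zero>\<^sub>(OS U) = \<zero>\<^sub>(OS V)"
 using ring_hom_zero[OF Ores_hom] OS_cring cring.axioms(1) by blast

lemma Ores_one:
 "opn U ==> opn V ==> V <= U ==> Ores X U V \<one>\<^sub>(OS U) = \<one>\<^sub>(OS V)"
 by (rule ring_hom_one[OF Ores_hom])

lemma og_eq_iff:
 assumes "opn U" "x:U" "s:osec U"
 "opn V" "x:V" "t:osec V"
 shows "og x U s = og x V t \<longleftrightarrow>
 (EX W. opn W & x:W & W <= U Int V & Ores X U W s = Ores X V W t)"
 unfolding Ogerm_def by (rule O.germ_eq_iff[OF assms])

lemma og_res:
 assumes "opn U" "opn V" "V <= U" "x:V" "s:osec U"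
 shows "og x V (Ores X U V s) = og x U s"
 unfolding Ogerm_def by (rule O.germ_res[OF assms])

lemma og_c:
 "opn U ==> x:U ==> s:osec U ==> og x U s:ostk x"
 by (auto simp: Ostalk_def)

lemma OstalkE:
 assumes "G:ostk x"
 obtains U s where "opn U" "x:U" "s:osec U" "G = og x U s"
 using assms by (auto simp: Ostalk_def)

lemma Ost_within:
 assumes "G:ostk x" "opn V" "x:V"
 obtains U s where "opn U" "x:U" "U <= V" "s:osec U" "G = og x U s"
proof -
 obtain U s where U: "opn U" "x:U" "s:osec U" "G = og x U s"
 using assms(1) by (rule OstalkE)
 have o: "opn (U Int V)" by (rule openin_Int[OF U(1) assms(2)])
 show thesis
 by (rule that[OF o _ _ O.res_c[OF U(1) o _ U(3)]])
 (use U assms in \<open>auto simp: og_res[OF U(1) o]\<close>)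
qed

lemma Ost_add:
 assumes "opn U" "x:U" "s:osec U" "t:osec U"
 shows "og x U s \<oplus>\<^sub>(Ost x) og x U t = og x U (s \<oplus>\<^sub>(OS U) t)"
 using germ_operation[OF O.set_psh_axioms O.set_psh_axioms O.set_psh_axioms,
 of "%U. add (OS U)", OF _ _ assms] OS_cring[THEN cring.axioms(1)]
 by (simp add: Ostalk_def Ogerm_def ring_hom_add[OF Ores_hom] ring.ring_simprules(1))

lemma Ost_mult:
 assumes "opn U" "x:U" "s:osec U" "t:osec U"
 shows "og x U s \<otimes>\<^sub>(Ost x) og x U t = og x U (s \<otimes>\<^sub>(OS U) t)"
 using germ_operation[OF O.set_psh_axioms O.set_psh_axioms O.set_psh_axioms,
 of "%U. mult (OS U)", OF _ _ assms] OS_cring[THEN cring.axioms(1)]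
 by (simp add: Ostalk_def Ogerm_def ring_hom_mult[OF Ores_hom] ring.ring_simprules(5))

lemma openin_points: "opn U ==> U <= pts"
 by (rule openin_subset)

lemma points_mem: "opn U ==> x:U ==> x:pts"
 using openin_points by blast

lemma Ost_zero:
 assumes "opn U" "x:U"
 shows "\<zero>\<^sub>(Ost x) = og x U \<zero>\<^sub>(OS U)"
proof -
 have "\<zero>\<^sub>(OS pts):osec pts"
 using OS_cring[OF openin_topspace] by (simp add: cring.cring_simprules)
 from og_res[OF openin_topspace assms(1) openin_points[OF assms(1)] assms(2) this]
 show ?thesis using Ores_zero[OF openin_topspace assms(1) openin_points[OF assms(1)]]
 by (simp add: Ostalk_def)
qed

lemma Ost_one:
 assumes "opn U" "x:U"
 shows "\<one>\<^sub>(Ost x) = og x U \<one>\<^sub>(OS U)"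
proof -
 have "\<one>\<^sub>(OS pts):osec pts"
 using OS_cring[OF openin_topspace] by (simp add: cring.cring_simprules)
 from og_res[OF openin_topspace assms(1) openin_points[OF assms(1)] assms(2) this]
 show ?thesis using Ores_one[OF openin_topspace assms(1) openin_points[OF assms(1)]]
 by (simp add: Ostalk_def)
qed

lemma Ost_common2:
 assumes "G:ostk x" "H:ostk x"
 obtains U s t where "opn U" "x:U" "s:osec U" "t:osec U"
 "G = og x U s" "H = og x U t"
proof -
 obtain V s where V: "opn V" "x:V" "s:osec V" "G = og x V s"
 using assms(1) by (rule OstalkE)
 obtain U t where U: "opn U" "x:U" "U <= V" "t:osec U" "H = og x U t"
 using assms(2) V(1,2) by (rule Ost_within)
 show thesis
 by (rule that[OF U(1,2) O.res_c[OF V(1) U(1,3) V(3)] U(4) _ U(5)])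
 (simp add: og_res[OF V(1) U(1,3,2) V(3)] V(4))
qed

lemma Ost_common3:
 assumes "G:ostk x" "H:ostk x" "K:ostk x"
 obtains U s t u where "opn U" "x:U"
 "s:osec U" "t:osec U" "u:osec U"
 "G = og x U s" "H = og x U t" "K = og x U u"
proof -
 obtain V s t where V: "opn V" "x:V" "s:osec V" "t:osec V"
 "G = og x V s" "H = og x V t"
 using assms(1,2) by (rule Ost_common2)
 obtain U u where U: "opn U" "x:U" "U <= V" "u:osec U" "K = og x U u"
 using assms(3) V(1,2) by (rule Ost_within)
 show thesis
 by (rule that[OF U(1,2) O.res_c[OF V(1) U(1,3) V(3)] O.res_c[OF V(1) U(1,3) V(4)] U(4) _ _ U(5)])
 (simp_all add: og_res[OF V(1) U(1,3,2)] V)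
qed

lemma Ost_cring:
 assumes x: "x:pts"
 shows "cring (Ost x)"
proof (rule cringI)
 note gs = Ost_add Ost_mult og_c
 show "abelian_group (Ost x)"
 proof (rule abelian_groupI)
 show "\<zero>\<^sub>(Ost x):ostk x"
 using Ost_zero[OF openin_topspace x] OS_cring[OF openin_topspace] x
 by (simp add: og_c cring.cring_simprules)
 next
 fix G H assume "G:ostk x" "H:ostk x"
 then obtain U s t where U: "opn U" "x:U" "s:osec U" "t:osec U"
 "G = og x U s" "H = og x U t" by (rule Ost_common2)
 interpret R: cring "OS U" by (rule OS_cring[OF U(1)])
 show "G \<oplus>\<^sub>(Ost x) H:ostk x" "G \<oplus>\<^sub>(Ost x) H = H \<oplus>\<^sub>(Ost x) G"
 using U by (simp_all add: gs R.a_comm)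
 next
 fix G H K assume "G:ostk x" "H:ostk x" "K:ostk x"
 then obtain U s t u where U: "opn U" "x:U"
 "s:osec U" "t:osec U" "u:osec U"
 "G = og x U s" "H = og x U t" "K = og x U u" by (rule Ost_common3)
 interpret R: cring "OS U" by (rule OS_cring[OF U(1)])
 show "G \<oplus>\<^sub>(Ost x) H \<oplus>\<^sub>(Ost x) K = G \<oplus>\<^sub>(Ost x) (H \<oplus>\<^sub>(Ost x) K)"
 using U by (simp add: gs R.a_assoc)
 next
 fix G assume "G:ostk x"
 then obtain U s where U: "opn U" "x:U" "s:osec U" "G = og x U s"
 by (rule OstalkE)
 interpret R: cring "OS U" by (rule OS_cring[OF U(1)])
 show "\<zero>\<^sub>(Ost x) \<oplus>\<^sub>(Ost x) G = G"
 using U by (simp add: gs Ost_zero[OF U(1,2)])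
 show "EX H:ostk x. H \<oplus>\<^sub>(Ost x) G = \<zero>\<^sub>(Ost x)"
 using U by (intro bexI[of _ "og x U (\<ominus>\<^sub>(OS U) s)"])
 (simp_all add: gs Ost_zero[OF U(1,2)] R.l_neg)
 qed
 show "Group.comm_monoid (Ost x)"
 proof (rule comm_monoidI)
 show "\<one>\<^sub>(Ost x):ostk x"
 using Ost_one[OF openin_topspace x] OS_cring[OF openin_topspace] x
 by (simp add: og_c cring.cring_simprules)
 next
 fix G H assume "G:ostk x" "H:ostk x"
 then obtain U s t where U: "opn U" "x:U" "s:osec U" "t:osec U"
 "G = og x U s" "H = og x U t" by (rule Ost_common2)
 interpret R: cring "OS U" by (rule OS_cring[OF U(1)])
 show "G \<otimes>\<^sub>(Ost x) H:ostk x" "G \<otimes>\<^sub>(Ost x) H = H \<otimes>\<^sub>(Ost x) G"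
 using U by (simp_all add: gs R.m_comm)
 next
 fix G H K assume "G:ostk x" "H:ostk x" "K:ostk x"
 then obtain U s t u where U: "opn U" "x:U"
 "s:osec U" "t:osec U" "u:osec U"
 "G = og x U s" "H = og x U t" "K = og x U u" by (rule Ost_common3)
 interpret R: cring "OS U" by (rule OS_cring[OF U(1)])
 show "G \<otimes>\<^sub>(Ost x) H \<otimes>\<^sub>(Ost x) K = G \<otimes>\<^sub>(Ost x) (H \<otimes>\<^sub>(Ost x) K)"
 using U by (simp add: gs R.m_assoc)
 next
 fix G assume "G:ostk x"
 then obtain U s where U: "opn U" "x:U" "s:osec U" "G = og x U s"
 by (rule OstalkE)
 interpret R: cring "OS U" by (rule OS_cring[OF U(1)])
 show "\<one>\<^sub>(Ost x) \<otimes>\<^sub>(Ost x) G = G"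
 using U by (simp add: gs Ost_one[OF U(1,2)])
 qed
 fix G H K assume "G:ostk x" "H:ostk x" "K:ostk x"
 then obtain U s t u where U: "opn U" "x:U"
 "s:osec U" "t:osec U" "u:osec U"
 "G = og x U s" "H = og x U t" "K = og x U u" by (rule Ost_common3)
 interpret R: cring "OS U" by (rule OS_cring[OF U(1)])
 show "(G \<oplus>\<^sub>(Ost x) H) \<otimes>\<^sub>(Ost x) K = G \<otimes>\<^sub>(Ost x) K \<oplus>\<^sub>(Ost x) H \<otimes>\<^sub>(Ost x) K"
 using U by (simp add: gs R.l_distr)
qed

lemma og_ring_hom:
 assumes "opn U" "x:U"
 shows "og x U:ring_hom (OS U) (Ost x)"
 by (rule ring_hom_memI)
 (use assms in \<open>simp_all add: og_c Ost_add Ost_mult Ost_one[OF assms]\<close>)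

end

text \<open>Only presheaf axioms: presented presheaves need not be sheaves, and all arguments take
  place in stalks. Where gluing is needed, it is demanded separately.\<close>

definition psheaf :: "('p, 'a) ringed => ('p, 'a, 'm) presheaf => bool" where
 "psheaf X M \<longleftrightarrow>
 set_psh (Top X) (%U. cr (Msec M U)) (Mres M) &
 (!U. openin (Top X) U --> module (Osec X U) (Msec M U)) &
 (!U V. openin (Top X) U & openin (Top X) V & V <= U -->
 (!s:cr (Msec M U). !t:cr (Msec M U).
 Mres M U V (s \<oplus>\<^sub>(Msec M U) t) = Mres M U V s \<oplus>\<^sub>(Msec M V) Mres M U V t) &
 (!r:cr (Osec X U). !s:cr (Msec M U).
 Mres M U V (r \<odot>\<^sub>(Msec M U) s) = Ores X U V r \<odot>\<^sub>(Msec M V) Mres M U V s))"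

lemma mod_sheaf_imp_psh: "module_sheaf X M ==> psheaf X M"
 unfolding module_sheaf_def psheaf_def
 by (elim conjE, intro conjI, erule sheaf_of_sets_imp_set_psh)

abbreviation (in rspace) "psh == psheaf X"

locale mpsh = rspace X for X :: "('p, 'a) ringed" +
 fixes M :: "('p, 'a, 'm) presheaf"
 assumes psheaf: "psheaf X M"
begin

sublocale M: set_psh "Top X" "%U. sec M U" "Mres M"
 using psheaf by (simp add: psheaf_def)

lemma Msec_mod: "opn U ==> module (OS U) (Msec M U)"
 using psheaf by (simp add: psheaf_def)

lemma Mres_add:
 "opn U ==> opn V ==> V <= U ==> s:sec M U ==> t:sec M U ==>
 Mres M U V (s \<oplus>\<^sub>(Msec M U) t) = Mres M U V s \<oplus>\<^sub>(Msec M V) Mres M U V t"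
 using psheaf by (simp add: psheaf_def)

lemma Mres_smult:
 "opn U ==> opn V ==> V <= U ==> r:osec U ==> s:sec M U ==>
 Mres M U V (r \<odot>\<^sub>(Msec M U) s) = Ores X U V r \<odot>\<^sub>(Msec M V) Mres M U V s"
 using psheaf by (simp add: psheaf_def)

lemma Mres_zero:
 assumes U: "opn U" and V: "opn V" "V <= U"
 shows "Mres M U V \<zero>\<^sub>(Msec M U) = \<zero>\<^sub>(Msec M V)"
proof -
 interpret U: module "OS U" "Msec M U" by (rule Msec_mod[OF U])
 interpret V: module "OS V" "Msec M V" by (rule Msec_mod[OF V(1)])
 have "Mres M U V (\<zero>\<^sub>(OS U) \<odot>\<^sub>(Msec M U) \<zero>\<^sub>(Msec M U)) = \<zero>\<^sub>(OS V) \<odot>\<^sub>(Msec M V) Mres M U V \<zero>\<^sub>(Msec M U)"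
 using Mres_smult[OF U V, of "\<zero>\<^sub>(OS U)" "\<zero>\<^sub>(Msec M U)"] Ores_zero[OF U V] by simp
 thus ?thesis using M.res_c[OF U V, of "\<zero>\<^sub>(Msec M U)"] by simp
qed

lemma gm_eq_iff:
 assumes "opn U" "x:U" "s:sec M U"
 "opn V" "x:V" "t:sec M V"
 shows "gm M x U s = gm M x V t \<longleftrightarrow>
 (EX W. opn W & x:W & W <= U Int V & Mres M U W s = Mres M V W t)"
 unfolding Mgerm_def by (rule M.germ_eq_iff[OF assms])

lemma gm_res:
 assumes "opn U" "opn V" "V <= U" "x:V" "s:sec M U"
 shows "gm M x V (Mres M U V s) = gm M x U s"
 unfolding Mgerm_def by (rule M.germ_res[OF assms])

lemma gm_c:
 "opn U ==> x:U ==> s:sec M U ==> gm M x U s:stk M x"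
 by (auto simp: Mstalk_def)

lemma MstalkE:
 assumes "G:stk M x"
 obtains U s where "opn U" "x:U" "s:sec M U" "G = gm M x U s"
 using assms by (auto simp: Mstalk_def)

lemma Mst_within:
 assumes "G:stk M x" "opn V" "x:V"
 obtains U s where "opn U" "x:U" "U <= V" "s:sec M U" "G = gm M x U s"
proof -
 obtain U s where U: "opn U" "x:U" "s:sec M U" "G = gm M x U s"
 using assms(1) by (rule MstalkE)
 have o: "opn (U Int V)" by (rule openin_Int[OF U(1) assms(2)])
 show thesis
 by (rule that[OF o _ _ M.res_c[OF U(1) o _ U(3)]])
 (use U assms in \<open>auto simp: gm_res[OF U(1) o]\<close>)
qed

lemma Mst_add:
 assumes "opn U" "x:U" "s:sec M U" "t:sec M U"
 shows "gm M x U s \<oplus>\<^sub>(Mst M x) gm M x U t = gm M x U (s \<oplus>\<^sub>(Msec M U) t)"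
 using germ_operation[OF M.set_psh_axioms M.set_psh_axioms M.set_psh_axioms,
 of "%U. add (Msec M U)", OF _ _ assms] Msec_mod[THEN module.axioms(2)]
 by (simp add: Mstalk_def Mgerm_def Mres_add abelian_groupE(1))

lemma Mst_smult:
 assumes "opn U" "x:U" "r:osec U" "t:sec M U"
 shows "og x U r \<odot>\<^sub>(Mst M x) gm M x U t = gm M x U (r \<odot>\<^sub>(Msec M U) t)"
 using germ_operation[OF O.set_psh_axioms M.set_psh_axioms M.set_psh_axioms,
 of "%U. smult (Msec M U)", OF _ _ assms] module.smult_closed[OF Msec_mod]
 by (simp add: Mstalk_def Mgerm_def Ogerm_def Mres_smult)

lemma Mst_zero:
 assumes "opn U" "x:U"
 shows "\<zero>\<^sub>(Mst M x) = gm M x U \<zero>\<^sub>(Msec M U)"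
proof -
 have "\<zero>\<^sub>(Msec M pts):sec M pts"
 using Msec_mod[OF openin_topspace, THEN module.axioms(2)] by (simp add: abelian_groupE)
 from gm_res[OF openin_topspace assms(1) openin_points[OF assms(1)] assms(2) this]
 show ?thesis using Mres_zero[OF openin_topspace assms(1) openin_points[OF assms(1)]]
 by (simp add: Mstalk_def)
qed

text \<open>Finitely many germs have representatives over one neighbourhood. Words also stand in for
  pairs and triples of germs when algebraic laws are verified.\<close>

lemma Mst_w_within:
 assumes "gs:wstk n M x" "opn V" "x:V"
 obtains U ss where "opn U" "x:U" "U <= V" "ss:wsec n M U"
 "gs = mg M x U ss"
 using assms
proof (induction n arbitrary: gs V thesis)
 case 0
 from 0(1)[OF 0(3,4) order.refl, of "[]"] 0(2) show ?case by (simp add: words_def)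
next
 case (Suc n)
 obtain h hs where h: "gs = h # hs" "h:stk M x" "hs:wstk n M x"
 using Suc.prems(2) by (rule w_SucE)
 obtain U s where U: "opn U" "x:U" "U <= V" "s:sec M U" "h = gm M x U s"
 using h(2) Suc.prems(3,4) by (rule Mst_within)
 obtain W ss where W: "opn W" "x:W" "W <= U" "ss:wsec n M W"
 "hs = mg M x W ss"
 using Suc.IH[OF _ h(3) U(1,2)] by blast
 show ?case
 proof (rule Suc.prems(1)[OF W(1,2)])
 show "W <= V" using U W by blast
 show "Mres M U W s # ss:wsec (Suc n) M W"
 using M.res_c[OF U(1) W(1,3) U(4)] W(4) by (simp add: w_Cons)
 show "gs = mg M x W (Mres M U W s # ss)"
 using h U W gm_res[OF U(1) W(1,3,2) U(4)] by simp
 qed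
qed

lemma words_res:
 "opn U ==> opn V ==> V <= U ==> ss:wsec n M U ==>
 map (Mres M U V) ss:wsec n M V"
 using M.res_c by (fastforce simp: words_def)

lemma w_germ:
 "opn U ==> x:U ==> ss:wsec n M U ==> mg M x U ss:wstk n M x"
 using gm_c by (fastforce simp: words_def)

lemma map_germ_res:
 assumes "opn U" "opn V" "V <= U" "x:V" "ss:wsec n M U"
 shows "mg M x V (map (Mres M U V) ss) = mg M x U ss"
 using assms gm_res by (auto simp: words_def)

lemma Mst_common:
 assumes "G:ostk x" "H:ostk x" "gs:wstk n M x" "x:pts"
 obtains U a b ss where "opn U" "x:U" "a:osec U" "b:osec U"
 "ss:wsec n M U" "G = og x U a" "H = og x U b" "gs = mg M x U ss"
proof -
 obtain V a b where V: "opn V" "x:V" "a:osec V" "b:osec V"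
 "G = og x V a" "H = og x V b"
 using assms(1,2) by (rule Ost_common2)
 obtain U ss where U: "opn U" "x:U" "U <= V" "ss:wsec n M U"
 "gs = mg M x U ss"
 using assms(3) V(1,2) by (rule Mst_w_within)
 show thesis
 by (rule that[OF U(1,2) O.res_c[OF V(1) U(1,3) V(3)] O.res_c[OF V(1) U(1,3) V(4)] U(4) _ _ U(5)])
 (simp_all add: og_res[OF V(1) U(1,3,2)] V)
qed

lemma Mst_mod:
 assumes x: "x:pts"
 shows "module (Ost x) (Mst M x)"
proof -
 note gs = Mst_add Mst_smult gm_c og_c Ost_add Ost_mult
 interpret Ox: cring "Ost x" by (rule Ost_cring[OF x])
 have one: "\<one>\<^sub>(Ost x):ostk x" by simp
 have c3: "EX U a b s t u. opn U & x:U & a:osec U & b:osec U &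
 s:sec M U & t:sec M U & u:sec M U &
 A = og x U a & B = og x U b &
 G = gm M x U s & H = gm M x U t & K = gm M x U u"
 if A: "A:ostk x" "B:ostk x" and G: "G:stk M x"
 "H:stk M x" "K:stk M x" for A B G H K
 proof -
 have "[G, H, K]:wstk 3 M x" using G by (simp add: words_def)
 then obtain U a b ss where U: "opn U" "x:U" "a:osec U" "b:osec U"
 "ss:wsec 3 M U" "A = og x U a" "B = og x U b"
 "[G, H, K] = mg M x U ss"
 using Mst_common[OF A _ x] by blast
 then obtain s t u where "ss = [s, t, u]" by auto
 with U have "s:sec M U & t:sec M U & u:sec M U &
 G = gm M x U s & H = gm M x U t & K = gm M x U u" by (simp add: words_def)
 with U show ?thesis by blast
 qed
 have z: "\<zero>\<^sub>(Mst M x):stk M x"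
 using Mst_zero[OF openin_topspace x] Msec_mod[OF openin_topspace, THEN module.axioms(2)] x
 by (simp add: gm_c abelian_groupE)
 have ab: "abelian_group (Mst M x)"
 proof (rule abelian_groupI)
 fix G H K assume G: "G:stk M x" "H:stk M x" "K:stk M x"
 obtain U s t u where U: "opn U" "x:U"
 "s:sec M U" "t:sec M U" "u:sec M U"
 "G = gm M x U s" "H = gm M x U t" "K = gm M x U u"
 using c3[OF one one G] by blast
 interpret U: module "OS U" "Msec M U" by (rule Msec_mod[OF U(1)])
 show "G \<oplus>\<^sub>(Mst M x) H \<oplus>\<^sub>(Mst M x) K = G \<oplus>\<^sub>(Mst M x) (H \<oplus>\<^sub>(Mst M x) K)"
 using U by (simp add: gs U.M.a_assoc)
 next
 fix G H assume G: "G:stk M x" "H:stk M x"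
 obtain U s t where U: "opn U" "x:U" "s:sec M U" "t:sec M U"
 "G = gm M x U s" "H = gm M x U t"
 using c3[OF one one G G(1)] by blast
 interpret U: module "OS U" "Msec M U" by (rule Msec_mod[OF U(1)])
 show "G \<oplus>\<^sub>(Mst M x) H:stk M x" "G \<oplus>\<^sub>(Mst M x) H = H \<oplus>\<^sub>(Mst M x) G"
 using U by (simp_all add: gs U.M.a_comm)
 next
 fix G assume G: "G:stk M x"
 obtain U s where U: "opn U" "x:U" "s:sec M U" "G = gm M x U s"
 using G by (rule MstalkE)
 interpret U: module "OS U" "Msec M U" by (rule Msec_mod[OF U(1)])
 show "\<zero>\<^sub>(Mst M x) \<oplus>\<^sub>(Mst M x) G = G"
 using U by (simp add: gs Mst_zero[OF U(1,2)])
 show "EX H:stk M x. H \<oplus>\<^sub>(Mst M x) G = \<zero>\<^sub>(Mst M x)"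
 using U by (intro bexI[of _ "gm M x U (\<ominus>\<^sub>(Msec M U) s)"])
 (simp_all add: gs Mst_zero[OF U(1,2)] U.M.l_neg)
 qed (rule z)
 have ax: "A \<odot>\<^sub>(Mst M x) G:stk M x"
 "(A \<oplus>\<^sub>(Ost x) B) \<odot>\<^sub>(Mst M x) G = A \<odot>\<^sub>(Mst M x) G \<oplus>\<^sub>(Mst M x) B \<odot>\<^sub>(Mst M x) G"
 "A \<odot>\<^sub>(Mst M x) (G \<oplus>\<^sub>(Mst M x) H) = A \<odot>\<^sub>(Mst M x) G \<oplus>\<^sub>(Mst M x) A \<odot>\<^sub>(Mst M x) H"
 "(A \<otimes>\<^sub>(Ost x) B) \<odot>\<^sub>(Mst M x) G = A \<odot>\<^sub>(Mst M x) (B \<odot>\<^sub>(Mst M x) G)"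
 "\<one>\<^sub>(Ost x) \<odot>\<^sub>(Mst M x) G = G"
 if A: "A:ostk x" "B:ostk x" and G: "G:stk M x"
 "H:stk M x" for A B G H
 proof -
 obtain U a b s t where U: "opn U" "x:U" "a:osec U" "b:osec U"
 "s:sec M U" "t:sec M U" "A = og x U a" "B = og x U b"
 "G = gm M x U s" "H = gm M x U t"
 using c3[OF A G G(1)] by blast
 interpret U: module "OS U" "Msec M U" by (rule Msec_mod[OF U(1)])
 show "A \<odot>\<^sub>(Mst M x) G:stk M x"
 "(A \<oplus>\<^sub>(Ost x) B) \<odot>\<^sub>(Mst M x) G = A \<odot>\<^sub>(Mst M x) G \<oplus>\<^sub>(Mst M x) B \<odot>\<^sub>(Mst M x) G"
 "A \<odot>\<^sub>(Mst M x) (G \<oplus>\<^sub>(Mst M x) H) = A \<odot>\<^sub>(Mst M x) G \<oplus>\<^sub>(Mst M x) A \<odot>\<^sub>(Mst M x) H"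
 "(A \<otimes>\<^sub>(Ost x) B) \<odot>\<^sub>(Mst M x) G = A \<odot>\<^sub>(Mst M x) (B \<odot>\<^sub>(Mst M x) G)"
 "\<one>\<^sub>(Ost x) \<odot>\<^sub>(Mst M x) G = G"
 using U by (simp_all add: gs Ost_one[OF U(1,2)] U.smult_l_distr U.smult_r_distr U.smult_assoc1)
 qed
 show ?thesis
 by (rule moduleI[OF Ox.is_cring ab]; rule ax; (assumption | rule one z))
qed

end

section \<open>Presheaves presented by generators and relations\<close>

lemma (in abelian_group) minus_zero_eq: "x:cr G ==> x \<ominus> \<zero> = x"
 using minus_equality[of \<zero> \<zero>] by (simp add: a_minus_def)

text \<open>Restriction of scalars along \<open>rho\<close>. It turns semilinear maps, such as
  restrictions and germ maps, into linear maps over the source ring, so that the universal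
  properties apply to them.\<close>

definition rsc ::
 "('a => 'b) => ('b, 'n, 'e) module_scheme => ('a, 'n) module" where
 "rsc rho N = \<lparr>carrier = cr N, mult = undefined, one = undefined,
 zero = \<zero>\<^sub>N, add = add N, smult = (%r n. rho r \<odot>\<^sub>N n)\<rparr>"

lemma rsc_simps [simp]:
 "cr (rsc rho N) = cr N" "\<zero>\<^sub>(rsc rho N) = \<zero>\<^sub>N"
 "x \<oplus>\<^sub>(rsc rho N) y = x \<oplus>\<^sub>N y" "r \<odot>\<^sub>(rsc rho N) x = rho r \<odot>\<^sub>N x"
 by (simp_all add: rsc_def)

lemma rsc_mod:
 assumes "cring R" "module S N" and rho: "rho:ring_hom R S"
 shows "module R (rsc rho N)"
proof -
 interpret N: module S N by (rule assms(2))
 have rhoc: "rho r:cr S" if "r:cr R" for r using ring_hom_closed[OF rho that] .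
 show ?thesis
 proof (rule moduleI[OF assms(1)])
 show "abelian_group (rsc rho N)"
 proof (rule abelian_groupI)
 show "EX y:cr (rsc rho N). y \<oplus>\<^sub>(rsc rho N) x = \<zero>\<^sub>(rsc rho N)"
 if "x:cr (rsc rho N)" for x
 using that by (intro bexI[of _ "\<ominus>\<^sub>N x"]) (simp_all add: N.M.l_neg)
 qed (simp_all add: N.M.a_assoc, simp add: N.M.a_comm)
 qed (simp_all add: rhoc ring_hom_add[OF rho] ring_hom_mult[OF rho] ring_hom_one[OF rho]
 N.smult_l_distr N.smult_r_distr N.smult_assoc1)
qed

lemma finsum_restricted_free:
 assumes "cring R" "cring S" and rho: "rho:ring_hom R S" and "finite A"
 and "!!a. a:A ==> f a:cr (free_module S B)"
 shows "finsum (rsc rho (free_module S B)) f A c = finsum S (%a. f a c) A"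
proof -
 interpret S: cring S by (rule assms(2))
 interpret F: module R "rsc rho (free_module S B)"
 by (rule rsc_mod[OF assms(1) S.free_module rho])
 show ?thesis
 using assms(4,5)
 proof (induction A rule: finite_induct)
 case empty
 thus ?case by (simp add: free_simps)
 next
 case (insert a A)
 have "f:A \<rightarrow> cr (rsc rho (free_module S B))"
 "f a:cr (rsc rho (free_module S B))" using insert.prems by auto
 hence "finsum (rsc rho (free_module S B)) f (insert a A) =
 f a \<oplus>\<^sub>(rsc rho (free_module S B)) finsum (rsc rho (free_module S B)) f A"
 by (rule F.M.finsum_insert[OF insert.hyps])
 moreover have "finsum S (%a. f a c) (insert a A) = f a c \<oplus>\<^sub>S finsum S (%a. f a c) A"
 using insert.prems by (intro S.finsum_insert insert.hyps) (auto simp: cr_free)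
 ultimately show ?case using insert by (simp add: free_simps)
 qed
qed

text \<open>The right-hand side is the formula inside \<open>presented_map\<close>. Recognised as
  the linear extension of a map of generators, it is well defined on classes once the relations are
  respected.\<close>

lemma flift_push_forward:
 assumes R: "cring R" and S: "cring S" and rho: "rho:ring_hom R S"
 and h: "h:B \<rightarrow> B'" and f: "f:cr (free_module R B)"
 shows "flift R (rsc rho (free_module S B')) (%b. free_gen S (h b)) f =
 (%c. finsum S (%b. rho (f b)) {b. f b ~= \<zero>\<^sub>R & h b = c})"
proof
 fix c
 interpret S: cring S by (rule S)
 have f': "finite {b. f b ~= \<zero>\<^sub>R}" "{b. f b ~= \<zero>\<^sub>R} <= B" "!!b. f b:cr R"
 using f by (auto simp: cr_free)
 have rhoc: "rho (f b):cr S" for b using ring_hom_closed[OF rho f'(3)] .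
 have gen: "free_gen S (h b):cr (free_module S B')" if "f b ~= \<zero>\<^sub>R" for b
 by (rule S.free_gen_c) (use h f'(2) that in auto)
 interpret F: module S "free_module S B'" by (rule S.free_module)
 have "flift R (rsc rho (free_module S B')) (%b. free_gen S (h b)) f c =
 finsum S (%b. (f b \<odot>\<^sub>(rsc rho (free_module S B')) free_gen S (h b)) c) {b. f b ~= \<zero>\<^sub>R}"
 unfolding flift_def
 by (rule finsum_restricted_free[OF R S rho f'(1)]) (simp add: gen rhoc F.smult_closed)
 also have "\<dots> = finsum S (%b. if h b = c then rho (f b) else \<zero>\<^sub>S) {b. f b ~= \<zero>\<^sub>R}"
 by (rule S.finsum_cong') (use rhoc in \<open>auto simp: free_simps free_gen_def\<close>)
 also have "\<dots> = finsum S (%b. rho (f b)) {b. f b ~= \<zero>\<^sub>R & h b = c}"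
 by (rule S.add.finprod_mono_neutral_cong_right) (use f'(1) rhoc in auto)
 finally show "flift R (rsc rho (free_module S B')) (%b. free_gen S (h b)) f c =
 finsum S (%b. rho (f b)) {b. f b ~= \<zero>\<^sub>R & h b = c}" .
qed

context mpsh
begin

lemma Mst_common2:
 assumes A: "A:ostk x" and G: "G:stk M x" "H:stk M x"
 and x: "x:pts"
 obtains U r s t where "opn U" "x:U" "r:osec U" "s:sec M U"
 "t:sec M U" "A = og x U r" "G = gm M x U s" "H = gm M x U t"
proof -
 have "[G, H]:wstk 2 M x" using G by (simp add: words_def)
 then obtain U r r' ss where U: "opn U" "x:U" "r:osec U"
 "r':osec U" "ss:wsec 2 M U" "A = og x U r" "A = og x U r'"
 "[G, H] = mg M x U ss"
 using Mst_common[OF A A _ x] by metis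
 then obtain s t where "ss = [s, t]" by auto
 with U have "s:sec M U" "t:sec M U" "G = gm M x U s"
 "H = gm M x U t" by (auto simp: words_def)
 with U that show thesis by metis
qed

text \<open>The stalk as a colimit: maps on sections that are compatible with restriction induce a
  map on germs.\<close>

lemma stalk_lift:
 assumes x: "x:pts" and N: "module (Ost x) N"
 and ps: "!!U. opn U ==> x:U ==>
 ps U:lin (OS U) (Msec M U) (rsc (og x U) N)"
 and res: "!!U V s. opn U ==> opn V ==> V <= U ==> x:V ==> s:sec M U ==>
 ps V (Mres M U V s) = ps U s"
 shows "EX ph:lin (Ost x) (Mst M x) N.
 !U s. opn U --> x:U --> s:sec M U --> ph (gm M x U s) = ps U s"
proof -
 define ph where "ph G = (SOME y. EX U s. opn U & x:U & s:sec M U &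
 G = gm M x U s & y = ps U s)" for G
 have ph: "ph (gm M x U s) = ps U s"
 if U: "opn U" "x:U" "s:sec M U" for U s
 proof -
 have "EX V t. opn V & x:V & t:sec M V &
 gm M x U s = gm M x V t & ph (gm M x U s) = ps V t"
 unfolding ph_def by (rule someI_ex) (use U in blast)
 then obtain V t where V: "opn V" "x:V" "t:sec M V"
 "gm M x U s = gm M x V t" "ph (gm M x U s) = ps V t" by blast
 obtain W where W: "opn W" "x:W" "W <= U Int V" "Mres M U W s = Mres M V W t"
 using V(4) gm_eq_iff[OF U V(1-3)] by blast
 have "ps U s = ps W (Mres M U W s)" using res[OF U(1) W(1) _ W(2) U(3)] W(3) by simp
 also have "\<dots> = ps V t" unfolding W(4) using res[OF V(1) W(1) _ W(2) V(3)] W(3) by simp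
 finally show ?thesis using V(5) by simp
 qed
 interpret Ox: cring "Ost x" by (rule Ost_cring[OF x])
 have "ph:lin (Ost x) (Mst M x) N"
 proof (rule linI)
 fix G assume "G:stk M x"
 then obtain U s where U: "opn U" "x:U" "s:sec M U" "G = gm M x U s"
 by (rule MstalkE)
 thus "ph G:cr N" using linD(1)[OF ps[OF U(1,2)] U(3)] by (simp add: ph)
 next
 fix G H assume "G:stk M x" "H:stk M x"
 from Ox.one_closed this x
 obtain U r s t where U: "opn U" "x:U" "r:osec U" "s:sec M U"
 "t:sec M U" "\<one>\<^sub>(Ost x) = og x U r" "G = gm M x U s" "H = gm M x U t"
 by (rule Mst_common2)
 interpret U: module "OS U" "Msec M U" by (rule Msec_mod[OF U(1)])
 show "ph (G \<oplus>\<^sub>(Mst M x) H) = ph G \<oplus>\<^sub>N ph H"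
 using U linD(2)[OF ps[OF U(1,2)] U(4,5)] by (simp add: Mst_add ph)
 next
 fix A G assume A: "A:ostk x" "G:stk M x"
 from A(1,2,2) x
 obtain U r s t where U: "opn U" "x:U" "r:osec U" "s:sec M U"
 "t:sec M U" "A = og x U r" "G = gm M x U s" "G = gm M x U t"
 by (rule Mst_common2)
 interpret U: module "OS U" "Msec M U" by (rule Msec_mod[OF U(1)])
 have "ph (A \<odot>\<^sub>(Mst M x) G) = ph (gm M x U (r \<odot>\<^sub>(Msec M U) s))"
 unfolding U(6,7) using U(1-4) by (simp only: Mst_smult)
 also have "\<dots> = A \<odot>\<^sub>N ph G"
 using U(1-4) linD(3)[OF ps[OF U(1,2)] U(3,4)] unfolding U(6,7) by (simp add: ph)
 finally show "ph (A \<odot>\<^sub>(Mst M x) G) = A \<odot>\<^sub>N ph G" .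
 qed
 with ph show ?thesis by blast
qed

end

text \<open>Relations have to restrict into the span of the relations, which is what well-defined
  restriction maps require.\<close>

locale pres_data = rspace X for X :: "('p, 'a) ringed" +
 fixes B :: "'p set => 'b set" and K :: "'p set => ('b => 'a) set" and h :: "'p set => 'p set => 'b => 'b"
 assumes gens: "set_psh (Top X) B h"
 and K_closed: "openin (Top X) U ==> K U <= cr (free_module (Osec X U) (B U))"
 and K_natural: "openin (Top X) U ==> openin (Top X) V ==> V <= U ==> k:K U ==>
 flift (Osec X U) (rsc (Ores X U V) (free_module (Osec X V) (B V)))
 (%b. free_gen (Osec X V) (h U V b)) k
 :module_span (Osec X V) (free_module (Osec X V) (B V)) (K V)"
begin

sublocale B: set_psh "Top X" B h by (rule gens)

abbreviation "pre == presented_presheaf X B K h"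

definition pgen :: "'p set => 'b => ('b => 'a) set" where
 "pgen U b = presented_class (OS U) (B U) (K U) (free_gen (OS U) b)"

lemma Msec_pre: "Msec pre U = presented_module (OS U) (B U) (K U)"
 by (simp add: presented_presheaf_def)

lemma pre_mod:
 assumes U: "opn U" shows "module (OS U) (Msec pre U)"
 unfolding Msec_pre by (rule cring.pres_is_mod[OF OS_cring[OF U] K_closed[OF U]])

lemma pgen_c:
 assumes U: "opn U" and b: "b:B U" shows "pgen U b:sec pre U"
 unfolding Msec_pre pgen_def
 by (rule linD(1)[OF cring.pres_class_hom[OF OS_cring[OF U] K_closed[OF U]]
 cring.free_gen_c[OF OS_cring[OF U] b]])

lemma pre_span:
 assumes U: "opn U"
 shows "sec pre U = module_span (OS U) (Msec pre U) (pgen U ` B U)"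
 unfolding Msec_pre pgen_def[abs_def]
 by (rule cring.pres_span[OF OS_cring[OF U] K_closed[OF U]])

lemma pre_hom_eqI:
 assumes U: "opn U" and N: "module (OS U) N"
 and "f:lin (OS U) (Msec pre U) N" "g:lin (OS U) (Msec pre U) N"
 and "!!b. b:B U ==> f (pgen U b) = g (pgen U b)" and s: "s:sec pre U"
 shows "f s = g s"
proof -
 interpret two_mods "OS U" "Msec pre U" N
 using pre_mod[OF U] N by (simp add: two_mods_def)
 show ?thesis
 using lin_eq_on_span[OF assms(3,4), of "pgen U ` B U" s] pgen_c[OF U] assms(5) s
 unfolding pre_span[OF U, symmetric] by auto
qed

lemma pre_lift:
 assumes U: "opn U" and N: "module (OS U) N" and g: "g:B U \<rightarrow> cr N"
 and "!!k. k:K U ==> flift (OS U) N g k = \<zero>\<^sub>N"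
 shows "EX ph:lin (OS U) (Msec pre U) N. (!b:B U. ph (pgen U b) = g b) &
 (!f:cr (free_module (OS U) (B U)).
 ph (presented_class (OS U) (B U) (K U) f) = flift (OS U) N g f)"
proof -
 interpret R: cring "OS U" by (rule OS_cring[OF U])
 obtain ph where ph: "ph:lin (OS U) (Msec pre U) N"
 "!f:cr (free_module (OS U) (B U)).
 ph (presented_class (OS U) (B U) (K U) f) = flift (OS U) N g f"
 using R.pres_lift[OF K_closed[OF U] N g assms(4)] unfolding Msec_pre by blast
 have "ph (pgen U b) = g b" if "b:B U" for b
 using ph(2) R.free_gen_c[OF that] R.flift_gen[OF N g that] by (simp add: pgen_def)
 with ph show ?thesis by blast
qed

text \<open>\<open>presented_map\<close> is a union over the representatives of a class.
  Push-forward followed by the class map kills the relations and hence induces a linear map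
  \<open>ph\<close>; every member of the union equals its value.\<close>

lemma Mres_pre:
 assumes U: "opn U" and V: "opn V" "V <= U"
 shows "Mres pre U V:lin (OS U) (Msec pre U) (rsc (Ores X U V) (Msec pre V))"
 and "!!b. b:B U ==> Mres pre U V (pgen U b) = pgen V (h U V b)"
proof -
 interpret RU: cring "OS U" by (rule OS_cring[OF U])
 interpret RV: cring "OS V" by (rule OS_cring[OF V(1)])
 let ?rho = "Ores X U V" and ?F = "free_module (OS V) (B V)"
 let ?N = "rsc ?rho (Msec pre V)" and ?G = "rsc ?rho ?F"
 note rho = Ores_hom[OF U V]
 interpret N: module "OS U" ?N
 by (rule rsc_mod[OF RU.is_cring pre_mod[OF V(1)] rho])
 interpret FU: two_mods "OS U" "free_module (OS U) (B U)" ?N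
 using RU.free_module N.module_axioms by (simp add: two_mods_def)
 have G: "module (OS U) ?G" by (rule rsc_mod[OF RU.is_cring RV.free_module rho])
 have hB: "h U V:B U \<rightarrow> B V" using B.res_c[OF U V] by auto
 define push where "push = flift (OS U) ?G (%b. free_gen (OS V) (h U V b))"
 have gc: "(%b. free_gen (OS V) (h U V b)):B U \<rightarrow> cr ?G"
 using hB by (auto intro: RV.free_gen_c)
 have push: "push:lin (OS U) (free_module (OS U) (B U)) ?G"
 unfolding push_def by (rule RU.flift_hom[OF G gc])
 let ?cl = "presented_class (OS V) (B V) (K V)"
 have cl: "?cl:lin (OS V) ?F (Msec pre V)"
 unfolding Msec_pre by (rule RV.pres_class_hom[OF K_closed[OF V(1)]])
 have rhoc: "?rho r:osec V" if "r:osec U" for r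
 using ring_hom_closed[OF rho that] .
 have comp: "(%f. ?cl (push f)):lin (OS U) (free_module (OS U) (B U)) ?N"
 using linD[OF push] linD[OF cl] rhoc by (intro linI) simp_all
 define g where "g b = pgen V (h U V b)" for b
 have g: "g:B U \<rightarrow> cr ?N" unfolding g_def using hB pgen_c[OF V(1)] by auto
 have lift: "?cl (push f) = flift (OS U) ?N g f"
 if f: "f:cr (free_module (OS U) (B U))" for f
 proof (rule FU.lin_eq_on_span[OF comp RU.flift_hom[OF N.module_axioms g],
 of "free_gen (OS U) ` B U"])
 show "f:module_span (OS U) (free_module (OS U) (B U)) (free_gen (OS U) ` B U)"
 using f RU.free_span by blast
 show "free_gen (OS U) ` B U <= cr (free_module (OS U) (B U))"
 by (auto intro: RU.free_gen_c)
 fix x assume "x:free_gen (OS U) ` B U"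
 then obtain b where b: "x = free_gen (OS U) b" "b:B U" by auto
 show "?cl (push x) = flift (OS U) ?N g x"
 unfolding b(1) RU.flift_gen[OF N.module_axioms g b(2)]
 unfolding push_def RU.flift_gen[OF G gc b(2)] by (simp add: g_def pgen_def)
 qed
 have "flift (OS U) ?N g k = \<zero>\<^sub>?N" if k: "k:K U" for k
 proof -
 interpret PV: module "OS V" ?F by (rule RV.free_module)
 have kc: "k:cr (free_module (OS U) (B U))" using K_closed[OF U] k by blast
 have "push k:module_span (OS V) ?F (K V)"
 unfolding push_def by (rule K_natural[OF U V k])
 moreover have "push k:cr ?F" using linD(1)[OF push kc] by simp
 ultimately have "?cl (push k) = ?cl \<zero>\<^sub>?F"
 by (intro RV.pres_class_eqI[OF K_closed[OF V(1)]])
 (simp_all add: PV.M.minus_zero_eq)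
 also have "\<dots> = \<zero>\<^sub>(Msec pre V)"
 proof -
 interpret two_mods "OS V" ?F "Msec pre V"
 using RV.free_module pre_mod[OF V(1)] by (simp add: two_mods_def)
 show ?thesis by (rule lin_zero[OF cl])
 qed
 finally show ?thesis using lift[OF kc] by simp
 qed
 from pre_lift[OF U N.module_axioms g this]
 obtain ph where ph: "ph:lin (OS U) (Msec pre U) ?N" "!b:B U. ph (pgen U b) = g b"
 "!f:cr (free_module (OS U) (B U)).
 ph (presented_class (OS U) (B U) (K U) f) = flift (OS U) ?N g f" by blast
 have eq: "Mres pre U V s = ph s" if s: "s:sec pre U" for s
 proof -
 obtain f where f: "f:cr (free_module (OS U) (B U))"
 "s = presented_class (OS U) (B U) (K U) f"
 using s RU.cr_pres[OF K_closed[OF U]] by (auto simp: Msec_pre)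
 have "?cl (%c. finsum (OS V) (%b. ?rho (f' b)) {b. f' b ~= \<zero>\<^sub>(OS U) & h U V b = c}) = ph s"
 if "f':s" for f'
 proof -
 have f': "f':cr (free_module (OS U) (B U))"
 "presented_class (OS U) (B U) (K U) f' = s"
 using that RU.pres_class_mem_iff[OF K_closed[OF U] f(1)] f(2) by auto
 have "(%c. finsum (OS V) (%b. ?rho (f' b)) {b. f' b ~= \<zero>\<^sub>(OS U) & h U V b = c}) = push f'"
 unfolding push_def
 by (rule flift_push_forward[OF RU.is_cring RV.is_cring rho hB f'(1), symmetric])
 thus ?thesis
 using lift[OF f'(1)] ph(3)[rule_format, OF f'(1)] f'(2) by simp
 qed
 moreover have "f:s" using RU.pres_class_mem_iff[OF K_closed[OF U] f(1)] f by simp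
 ultimately have "(\<Union>f\<in>s. ?cl (%c. finsum (OS V) (%b. ?rho (f b)) {b. f b ~= \<zero>\<^sub>(OS U) & h U V b = c})) = ph s"
 by (intro UN_constant_eq) auto
 thus ?thesis by (simp add: presented_presheaf_def presented_map_def)
 qed
 show "Mres pre U V:lin (OS U) (Msec pre U) ?N"
 proof -
 interpret PU: module "OS U" "Msec pre U" by (rule pre_mod[OF U])
 show ?thesis
 by (rule linI) (use linD[OF ph(1)] in \<open>simp_all add: eq\<close>)
 qed
 show "Mres pre U V (pgen U b) = pgen V (h U V b)" if "b:B U" for b
 using eq[OF pgen_c[OF U that]] ph(2) that by (simp add: g_def)
qed

lemma pre_psh: "psh pre"
 unfolding psheaf_def
proof (intro conjI allI impI)
 show "set_psh (Top X) (%U. sec pre U) (Mres pre)"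
 proof
 fix U V s assume U: "opn U" "opn V" "V <= U" "s:sec pre U"
 show "Mres pre U V s:sec pre V"
 using linD(1)[OF Mres_pre(1)[OF U(1-3)] U(4)] by simp
 next
 fix U s assume U: "opn U" "s:sec pre U"
 let ?N = "rsc (Ores X U U) (Msec pre U)"
 have N: "module (OS U) ?N"
 by (rule rsc_mod[OF OS_cring[OF U(1)] pre_mod[OF U(1)] Ores_hom[OF U(1,1) order.refl]])
 show "Mres pre U U s = s"
 by (rule pre_hom_eqI[OF U(1) N Mres_pre(1)[OF U(1,1) order.refl] _ _ U(2), where g = "%s. s"])
 (use U(1) in \<open>auto simp: Mres_pre(2) B.res_id O.res_id intro!: linI\<close>)
 next
 fix U V W s
 assume U: "opn U" "opn V" "opn W" "W <= V" "V <= U"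
 and s: "s:sec pre U"
 have WU: "W <= U" using U by blast
 let ?N = "rsc (Ores X U W) (Msec pre W)"
 have N: "module (OS U) ?N"
 by (rule rsc_mod[OF OS_cring[OF U(1)] pre_mod[OF U(3)] Ores_hom[OF U(1,3) WU]])
 have rhoc: "Ores X U V r:osec V" if "r:osec U" for r
 by (rule O.res_c[OF U(1,2,5) that])
 show "Mres pre V W (Mres pre U V s) = Mres pre U W s"
 proof (rule pre_hom_eqI[OF U(1) N _ Mres_pre(1)[OF U(1,3) WU] _ s,
 where f = "%s. Mres pre V W (Mres pre U V s)"])
 show "(%s. Mres pre V W (Mres pre U V s)):lin (OS U) (Msec pre U) ?N"
 using linD[OF Mres_pre(1)[OF U(1,2,5)]] linD[OF Mres_pre(1)[OF U(2,3,4)]] rhoc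
 by (intro linI) (simp_all add: O.res_res[OF U])
 show "Mres pre V W (Mres pre U V (pgen U b)) = Mres pre U W (pgen U b)" if "b:B U" for b
 using that U WU by (simp add: Mres_pre(2) B.res_c B.res_res)
 qed
 qed
 fix U assume U: "opn U"
 show "module (OS U) (Msec pre U)" by (rule pre_mod[OF U])
next
 fix U V assume UV: "opn U & opn V & V <= U"
 hence hom: "Mres pre U V:lin (OS U) (Msec pre U) (rsc (Ores X U V) (Msec pre V))"
 by (intro Mres_pre(1)) auto
 show "!s:sec pre U. !t:sec pre U.
 Mres pre U V (s \<oplus>\<^sub>(Msec pre U) t) = Mres pre U V s \<oplus>\<^sub>(Msec pre V) Mres pre U V t"
 "!r:osec U. !s:sec pre U.
 Mres pre U V (r \<odot>\<^sub>(Msec pre U) s) = Ores X U V r \<odot>\<^sub>(Msec pre V) Mres pre U V s"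
 using linD(2,3)[OF hom] by simp_all
qed

sublocale pre: mpsh X pre
 by unfold_locales (rule pre_psh)

lemma pre_stalk_lift:
 assumes x: "x:pts" and N: "module (Ost x) N"
 and g: "!!U b. opn U ==> x:U ==> b:B U ==> g U b:cr N"
 and res: "!!U V b. opn U ==> opn V ==> V <= U ==> x:V ==> b:B U ==>
 g V (h U V b) = g U b"
 and rel: "!!U k. opn U ==> x:U ==> k:K U ==>
 flift (OS U) (rsc (og x U) N) (g U) k = \<zero>\<^sub>N"
 shows "EX ph:lin (Ost x) (Mst pre x) N.
 !U b. opn U --> x:U --> b:B U --> ph (gm pre x U (pgen U b)) = g U b"
proof -
 have NU: "module (OS U) (rsc (og x U) N)" if "opn U" "x:U" for U
 by (rule rsc_mod[OF OS_cring[OF that(1)] N og_ring_hom[OF that]])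
 have "!U. EX ph. opn U & x:U -->
 ph:lin (OS U) (Msec pre U) (rsc (og x U) N) & (!b:B U. ph (pgen U b) = g U b)"
 proof (intro allI)
 fix U
 show "EX ph. opn U & x:U -->
 ph:lin (OS U) (Msec pre U) (rsc (og x U) N) & (!b:B U. ph (pgen U b) = g U b)"
 proof (cases "opn U & x:U")
 case True
 hence U: "opn U" "x:U" by auto
 have "g U:B U \<rightarrow> cr (rsc (og x U) N)" using g[OF U] by simp
 from pre_lift[OF U(1) NU[OF U] this] rel[OF U]
 obtain ph where "ph:lin (OS U) (Msec pre U) (rsc (og x U) N)"
 "!b:B U. ph (pgen U b) = g U b" by auto
 thus ?thesis by (intro exI[of _ ph]) simp
 qed auto
 qed
 from choice[OF this] obtain ps where ps': "!U. opn U & x:U -->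
 ps U:lin (OS U) (Msec pre U) (rsc (og x U) N) & (!b:B U. ps U (pgen U b) = g U b)" ..
 hence ps: "!!U. opn U ==> x:U ==>
 ps U:lin (OS U) (Msec pre U) (rsc (og x U) N)"
 "!!U b. opn U ==> x:U ==> b:B U ==> ps U (pgen U b) = g U b"
 by simp_all
 have psres: "ps V (Mres pre U V s) = ps U s"
 if U: "opn U" "opn V" "V <= U" "x:V" "s:sec pre U" for U V s
 proof (rule pre_hom_eqI[OF U(1) NU _ ps(1) _ U(5), where f = "%s. ps V (Mres pre U V s)"])
 show "(%s. ps V (Mres pre U V s)):lin (OS U) (Msec pre U) (rsc (og x U) N)"
 using linD[OF ps(1)[OF U(2,4)]] linD[OF Mres_pre(1)[OF U(1-3)]] O.res_c[OF U(1-3)]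
 by (intro linI) (simp_all add: og_res[OF U(1-4)])
 show "ps V (Mres pre U V (pgen U b)) = ps U (pgen U b)" if "b:B U" for b
 using U that by (simp add: Mres_pre(2) ps(2) B.res_c res subsetD[OF U(3,4)])
 qed (use U in auto)
 from pre.stalk_lift[OF x N ps(1) psres]
 obtain ph where ph: "ph:lin (Ost x) (Mst pre x) N"
 "!U s. opn U --> x:U --> s:sec pre U --> ph (gm pre x U s) = ps U s" ..
 thus ?thesis
 by (intro bexI[OF _ ph(1)]) (simp add: ps(2) pgen_c)
qed

end

section \<open>Sheafification\<close>

context mpsh
begin

definition sheafified :: "'p set => 'm => 'p => ('p set \<times> 'm) set" where
 "sheafified U t = (\<lambda>y\<in>U. gm M y U t)"

lemma sfy_cr:
 "s:sec (sfy M) U \<longleftrightarrow> s:(\<Pi>\<^sub>E x\<in>U. stk M x) &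
 (!x:U. EX V t. opn V & x:V & V <= U & t:sec M V &
 (!y:V. s y = gm M y V t))"
proof -
 have "(EX t:{%y. gm M y V t | t. t:sec M V}. !y:V. s y = t y) \<longleftrightarrow>
 (EX t. t:sec M V & (!y:V. s y = gm M y V t))" for V
 by auto
 thus ?thesis
 by (simp only: sheafify_def locally_in_def presheaf.simps module.simps partial_object.simps mem_Collect_eq ex_simps simp_thms)
qed

lemma sfy_simps:
 "\<zero>\<^sub>(Msec (sfy M) U) = (\<lambda>x\<in>U. \<zero>\<^sub>(Mst M x))"
 "s \<oplus>\<^sub>(Msec (sfy M) U) t = (\<lambda>x\<in>U. s x \<oplus>\<^sub>(Mst M x) t x)"
 "r \<odot>\<^sub>(Msec (sfy M) U) s = (\<lambda>x\<in>U. og x U r \<odot>\<^sub>(Mst M x) s x)"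
 "Mres (sfy M) U V s = restrict s V"
 by (simp_all add: sheafify_def)

lemma sfy_c:
 "s:sec (sfy M) U ==> x:U ==> s x:stk M x"
 by (auto simp: sfy_cr)

lemma sfy_ext:
 assumes "s:sec (sfy M) U" "t:sec (sfy M) U"
 and "!!x. x:U ==> s x = t x"
 shows "s = t"
 using assms by (auto simp: sfy_cr intro: PiE_ext)

lemma sheafifyE:
 assumes "s:sec (sfy M) U" "x:U" "opn W" "x:W"
 obtains V t where "opn V" "x:V" "V <= U" "V <= W" "t:sec M V"
 "!y:V. s y = gm M y V t"
proof -
 obtain V t where V: "opn V" "x:V" "V <= U" "t:sec M V"
 "!y:V. s y = gm M y V t"
 using assms(1,2) by (auto simp: sfy_cr)
 have o: "opn (V Int W)" by (rule openin_Int[OF V(1) assms(3)])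
 show thesis
 proof (rule that[OF o])
 show "Mres M V (V Int W) t:sec M (V Int W)" by (rule M.res_c[OF V(1) o _ V(4)]) simp
 show "!y:V Int W. s y = gm M y (V Int W) (Mres M V (V Int W) t)"
 using gm_res[OF V(1) o _ _ V(4)] V(5) by simp
 qed (use V assms in auto)
qed

lemma sfy_add_c:
 assumes U: "opn U" and s: "s:sec (sfy M) U"
 and t: "t:sec (sfy M) U"
 shows "(\<lambda>x\<in>U. s x \<oplus>\<^sub>(Mst M x) t x):sec (sfy M) U"
 unfolding sfy_cr
proof (intro conjI ballI)
 show "(\<lambda>x\<in>U. s x \<oplus>\<^sub>(Mst M x) t x):(\<Pi>\<^sub>E x\<in>U. stk M x)"
 proof (rule restrict_PiE_iff[THEN iffD2, rule_format])
 fix x assume x: "x:U"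
 interpret Sx: module "Ost x" "Mst M x" by (rule Mst_mod[OF points_mem[OF U x]])
 show "s x \<oplus>\<^sub>(Mst M x) t x:stk M x"
 using sfy_c[OF s x] sfy_c[OF t x] by simp
 qed
 fix x assume x: "x:U"
 obtain V a where V: "opn V" "x:V" "V <= U" "V <= U" "a:sec M V"
 "!y:V. s y = gm M y V a" using s x U x by (rule sheafifyE)
 obtain W b where W: "opn W" "x:W" "W <= U" "W <= V" "b:sec M W"
 "!y:W. t y = gm M y W b" using t x V(1,2) by (rule sheafifyE)
 let ?a = "Mres M V W a"
 interpret W: module "OS W" "Msec M W" by (rule Msec_mod[OF W(1)])
 have a: "?a:sec M W" by (rule M.res_c[OF V(1) W(1,4) V(5)])
 show "EX V' t'. opn V' & x:V' & V' <= U & t':sec M V' &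
 (!y:V'. (\<lambda>x\<in>U. s x \<oplus>\<^sub>(Mst M x) t x) y = gm M y V' t')"
 proof (intro exI[of _ W] exI[of _ "?a \<oplus>\<^sub>(Msec M W) b"] conjI ballI)
 fix y assume y: "y:W"
 hence "s y = gm M y W ?a"
 using V(6) W(4) gm_res[OF V(1) W(1,4) y V(5)] by auto
 with y show "(\<lambda>x\<in>U. s x \<oplus>\<^sub>(Mst M x) t x) y = gm M y W (?a \<oplus>\<^sub>(Msec M W) b)"
 using W(3,6) Mst_add[OF W(1) y a W(5)] by auto
 qed (use W a in auto)
qed

lemma sfy_smult_c:
 assumes U: "opn U" and r: "r:osec U" and s: "s:sec (sfy M) U"
 shows "(\<lambda>x\<in>U. og x U r \<odot>\<^sub>(Mst M x) s x):sec (sfy M) U"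
 unfolding sfy_cr
proof (intro conjI ballI)
 show "(\<lambda>x\<in>U. og x U r \<odot>\<^sub>(Mst M x) s x):(\<Pi>\<^sub>E x\<in>U. stk M x)"
 proof (rule restrict_PiE_iff[THEN iffD2, rule_format])
 fix x assume x: "x:U"
 interpret Sx: module "Ost x" "Mst M x" by (rule Mst_mod[OF points_mem[OF U x]])
 show "og x U r \<odot>\<^sub>(Mst M x) s x:stk M x"
 using sfy_c[OF s x] og_c[OF U x r] by simp
 qed
 fix x assume x: "x:U"
 obtain V a where V: "opn V" "x:V" "V <= U" "V <= U" "a:sec M V"
 "!y:V. s y = gm M y V a" using s x U x by (rule sheafifyE)
 let ?r = "Ores X U V r"
 interpret V: module "OS V" "Msec M V" by (rule Msec_mod[OF V(1)])
 have c: "?r:osec V" by (rule O.res_c[OF U V(1,3) r])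
 show "EX V' t'. opn V' & x:V' & V' <= U & t':sec M V' &
 (!y:V'. (\<lambda>x\<in>U. og x U r \<odot>\<^sub>(Mst M x) s x) y = gm M y V' t')"
 proof (intro exI[of _ V] exI[of _ "?r \<odot>\<^sub>(Msec M V) a"] conjI ballI)
 fix y assume y: "y:V"
 thus "(\<lambda>x\<in>U. og x U r \<odot>\<^sub>(Mst M x) s x) y = gm M y V (?r \<odot>\<^sub>(Msec M V) a)"
 using V(3,6) Mst_smult[OF V(1) y c V(5)] og_res[OF U V(1,3) y r] by auto
 qed (use V c in auto)
qed

lemma sfd_c:
 assumes U: "opn U" and t: "t:sec M U"
 shows "sheafified U t:sec (sfy M) U"
 using U t gm_c[OF U _ t] by (auto simp: sfy_cr sheafified_def)

lemma sfd_hom: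
 assumes U: "opn U"
 shows "sheafified U:lin (OS U) (Msec M U) (Msec (sfy M) U)"
 by (rule linI, rule sfd_c[OF U])
 (auto simp: sfy_simps sheafified_def restrict_def fun_eq_iff Mst_add[OF U] Mst_smult[OF U])

lemma sfd_zero:
 assumes U: "opn U"
 shows "sheafified U \<zero>\<^sub>(Msec M U) = \<zero>\<^sub>(Msec (sfy M) U)"
 using Mst_zero[OF U] by (auto simp: sheafified_def sfy_simps restrict_def fun_eq_iff)

lemma sfd_res:
 assumes U: "opn U" "opn V" "V <= U" and t: "t:sec M U"
 shows "Mres (sfy M) U V (sheafified U t) = sheafified V (Mres M U V t)"
 using U(3) gm_res[OF U _ t]
 by (auto simp: sheafified_def sfy_simps restrict_def fun_eq_iff)

lemma sfy_mod:
 assumes U: "opn U"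
 shows "module (OS U) (Msec (sfy M) U)"
proof -
 interpret R: cring "OS U" by (rule OS_cring[OF U])
 interpret M: module "OS U" "Msec M U" by (rule Msec_mod[OF U])
 note closed = sfy_add_c[OF U] sfy_smult_c[OF U]
 have zero: "(\<lambda>x\<in>U. \<zero>\<^sub>(Mst M x)):sec (sfy M) U"
 using sfd_c[OF U M.M.zero_closed] unfolding sfd_zero[OF U] sfy_simps .
 have Sx: "module (Ost x) (Mst M x)" if "x:U" for x
 by (rule Mst_mod[OF points_mem[OF U that]])
 note sc = sfy_c
 have hom: "og x U:ring_hom (OS U) (Ost x)" if "x:U" for x
 by (rule og_ring_hom[OF U that])
 show ?thesis
 proof (rule moduleI[OF R.is_cring])
 show "abelian_group (Msec (sfy M) U)"
 proof (rule abelian_groupI)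
 fix s t u assume s: "s:sec (sfy M) U"
 show "\<zero>\<^sub>(Msec (sfy M) U) \<oplus>\<^sub>(Msec (sfy M) U) s = s"
 proof (rule sfy_ext[OF _ s])
 show "\<zero>\<^sub>(Msec (sfy M) U) \<oplus>\<^sub>(Msec (sfy M) U) s:sec (sfy M) U"
 using closed(1)[OF zero s] by (simp add: sfy_simps)
 show "(\<zero>\<^sub>(Msec (sfy M) U) \<oplus>\<^sub>(Msec (sfy M) U) s) x = s x" if "x:U" for x
 using abelian_groupE(5)[OF module.axioms(2)[OF Sx[OF that]] sc[OF s that]] that
 by (simp add: sfy_simps)
 qed
 show "EX y:sec (sfy M) U. y \<oplus>\<^sub>(Msec (sfy M) U) s = \<zero>\<^sub>(Msec (sfy M) U)"
 proof (intro bexI)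
 let ?y = "\<lambda>x\<in>U. og x U (\<ominus>\<^sub>(OS U) \<one>\<^sub>(OS U)) \<odot>\<^sub>(Mst M x) s x"
 show y: "?y:sec (sfy M) U" by (rule closed(2)) (simp_all add: s)
 show "?y \<oplus>\<^sub>(Msec (sfy M) U) s = \<zero>\<^sub>(Msec (sfy M) U)"
 proof (rule sfy_ext)
 show "?y \<oplus>\<^sub>(Msec (sfy M) U) s:sec (sfy M) U"
 "\<zero>\<^sub>(Msec (sfy M) U):sec (sfy M) U"
 using closed(1)[OF y s] zero by (simp_all only: sfy_simps)
 fix x assume x: "x:U"
 interpret Sx: module "Ost x" "Mst M x" by (rule Sx[OF x])
 have "og x U (\<ominus>\<^sub>(OS U) \<one>\<^sub>(OS U)) = \<ominus>\<^sub>(Ost x) \<one>\<^sub>(Ost x)"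
 using Ost_add[OF U x, of "\<ominus>\<^sub>(OS U) \<one>\<^sub>(OS U)" "\<one>\<^sub>(OS U)"] og_c[OF U x]
 by (intro Sx.R.minus_equality[symmetric]) (simp_all add: Ost_one[OF U x] Ost_zero[OF U x] R.l_neg)
 thus "(?y \<oplus>\<^sub>(Msec (sfy M) U) s) x = \<zero>\<^sub>(Msec (sfy M) U) x"
 using x sc[OF s x] by (simp add: sfy_simps Sx.smult_l_minus Sx.M.l_neg)
 qed
 qed
 assume t: "t:sec (sfy M) U"
 show "s \<oplus>\<^sub>(Msec (sfy M) U) t:sec (sfy M) U"
 using closed(1)[OF s t] by (simp add: sfy_simps)
 show "s \<oplus>\<^sub>(Msec (sfy M) U) t = t \<oplus>\<^sub>(Msec (sfy M) U) s"
 using abelian_groupE(4)[OF module.axioms(2)[OF Sx] sc[OF s] sc[OF t]]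
 by (auto simp: sfy_simps restrict_def fun_eq_iff)
 assume u: "u:sec (sfy M) U"
 show "s \<oplus>\<^sub>(Msec (sfy M) U) t \<oplus>\<^sub>(Msec (sfy M) U) u =
 s \<oplus>\<^sub>(Msec (sfy M) U) (t \<oplus>\<^sub>(Msec (sfy M) U) u)"
 using abelian_groupE(3)[OF module.axioms(2)[OF Sx] sc[OF s] sc[OF t] sc[OF u]]
 by (auto simp: sfy_simps restrict_def fun_eq_iff)
 qed (simp only: sfy_simps zero)
 next
 fix a b s t assume a: "a:osec U" and s: "s:sec (sfy M) U"
 have ac: "og x U a:ostk x" if "x:U" for x
 by (rule og_c[OF U that a])
 show "a \<odot>\<^sub>(Msec (sfy M) U) s:sec (sfy M) U"
 using closed(2)[OF a s] by (simp add: sfy_simps)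
 {
 assume t: "t:sec (sfy M) U"
 show "a \<odot>\<^sub>(Msec (sfy M) U) (s \<oplus>\<^sub>(Msec (sfy M) U) t) =
 a \<odot>\<^sub>(Msec (sfy M) U) s \<oplus>\<^sub>(Msec (sfy M) U) a \<odot>\<^sub>(Msec (sfy M) U) t"
 using module.smult_r_distr[OF Sx ac sc[OF s] sc[OF t]]
 by (auto simp: sfy_simps restrict_def fun_eq_iff)
 }
 assume b: "b:osec U"
 have bc: "og x U b:ostk x" if "x:U" for x
 by (rule og_c[OF U that b])
 show "(a \<oplus>\<^sub>(OS U) b) \<odot>\<^sub>(Msec (sfy M) U) s =
 a \<odot>\<^sub>(Msec (sfy M) U) s \<oplus>\<^sub>(Msec (sfy M) U) b \<odot>\<^sub>(Msec (sfy M) U) s"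
 using module.smult_l_distr[OF Sx ac bc sc[OF s]] ring_hom_add[OF hom a b]
 by (auto simp: sfy_simps restrict_def fun_eq_iff)
 show "(a \<otimes>\<^sub>(OS U) b) \<odot>\<^sub>(Msec (sfy M) U) s =
 a \<odot>\<^sub>(Msec (sfy M) U) (b \<odot>\<^sub>(Msec (sfy M) U) s)"
 using module.smult_assoc1[OF Sx ac bc sc[OF s]] ring_hom_mult[OF hom a b]
 by (auto simp: sfy_simps restrict_def fun_eq_iff)
 next
 fix s assume s: "s:sec (sfy M) U"
 show "\<one>\<^sub>(OS U) \<odot>\<^sub>(Msec (sfy M) U) s = s"
 proof (rule sfy_ext[OF _ s])
 show "\<one>\<^sub>(OS U) \<odot>\<^sub>(Msec (sfy M) U) s:sec (sfy M) U"
 using closed(2)[OF R.one_closed s] by (simp add: sfy_simps)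
 show "(\<one>\<^sub>(OS U) \<odot>\<^sub>(Msec (sfy M) U) s) x = s x" if "x:U" for x
 using module.smult_one[OF Sx sc[OF s], OF that that] ring_hom_one[OF hom[OF that]] that
 by (simp add: sfy_simps)
 qed
 qed
qed

lemma sfy_psh: "psh (sfy M)"
 unfolding psheaf_def
proof (intro conjI allI impI)
 show "set_psh (Top X) (%U. sec (sfy M) U) (Mres (sfy M))"
 proof
 fix U V s assume U: "opn U" "opn V" "V <= U" "s:sec (sfy M) U"
 show "Mres (sfy M) U V s:sec (sfy M) V"
 unfolding sfy_simps sfy_cr
 proof (intro conjI ballI)
 show "restrict s V:(\<Pi>\<^sub>E x\<in>V. stk M x)"
 using sfy_c[OF U(4)] U(3) by auto
 fix x assume x: "x:V"
 obtain W t where W: "opn W" "x:W" "W <= U" "W <= V" "t:sec M W"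
 "!y:W. s y = gm M y W t"
 using U(4) subsetD[OF U(3) x] U(2) x by (rule sheafifyE)
 thus "EX W t. opn W & x:W & W <= V & t:sec M W &
 (!y:W. restrict s V y = gm M y W t)"
 by (intro exI[of _ W] exI[of _ t]) auto
 qed
 next
 fix U s assume "s:sec (sfy M) U"
 thus "Mres (sfy M) U U s = s"
 by (auto simp: sfy_simps sfy_cr PiE_restrict)
 next
 fix U V W :: "'p set" and s :: "'p => ('p set \<times> 'm) set" assume "W <= V"
 thus "Mres (sfy M) V W (Mres (sfy M) U V s) = Mres (sfy M) U W s"
 by (auto simp: sfy_simps restrict_def fun_eq_iff)
 qed
 show "module (OS U) (Msec (sfy M) U)" if "opn U" for U
 by (rule sfy_mod[OF that])
 fix U V assume UV: "opn U & opn V & V <= U"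
 hence U: "opn U" "opn V" and sub: "!!x. x:V ==> x:U" by auto
 show "!s:sec (sfy M) U. !t:sec (sfy M) U.
 Mres (sfy M) U V (s \<oplus>\<^sub>(Msec (sfy M) U) t) =
 Mres (sfy M) U V s \<oplus>\<^sub>(Msec (sfy M) V) Mres (sfy M) U V t"
 by (auto simp: sfy_simps restrict_def fun_eq_iff sub)
 show "!r:osec U. !s:sec (sfy M) U.
 Mres (sfy M) U V (r \<odot>\<^sub>(Msec (sfy M) U) s) =
 Ores X U V r \<odot>\<^sub>(Msec (sfy M) V) Mres (sfy M) U V s"
 using UV og_res[OF U] by (auto simp: sfy_simps restrict_def fun_eq_iff sub)
qed

text \<open>Sections of the sheafification are functions with values in the stalks of
  \<open>M\<close>. Evaluation at \<open>x\<close> therefore leads from the stalk of the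
  sheafification back to the stalk of \<open>M\<close>.\<close>

lemma sfy_stalk_value:
 assumes x: "x:pts"
 shows "EX ph:shom x (sfy M) M.
 !U s. opn U --> x:U --> s:sec (sfy M) U -->
 ph (gm (sfy M) x U s) = s x"
proof -
 interpret S: mpsh X "sfy M" by unfold_locales (rule sfy_psh)
 show ?thesis
 proof (rule S.stalk_lift[OF x Mst_mod[OF x], where ps = "%U s. s x"])
 show "(%s. s x):lin (OS U) (Msec (sfy M) U) (rsc (og x U) (Mst M x))"
 if "x:U" for U
 using that by (intro linI) (simp_all add: sfy_c sfy_simps)
 qed (simp add: sfy_simps)
qed

text \<open>One value determines the germ: near \<open>x\<close> the section \<open>s\<close> is the
  family of germs of some section \<open>a\<close> of \<open>M\<close>, and equality of two germs at
  \<open>x\<close> persists on a neighbourhood.\<close>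

lemma sfy_germ_eq:
 assumes U: "opn U" "x:U" "s:sec (sfy M) U"
 and V: "opn V" "x:V" "t:sec M V" "s x = gm M x V t"
 shows "gm (sfy M) x U s = gm (sfy M) x V (sheafified V t)"
proof -
 interpret S: mpsh X "sfy M" by unfold_locales (rule sfy_psh)
 obtain W a where W: "opn W" "x:W" "W <= U" "W <= V" "a:sec M W"
 "!y:W. s y = gm M y W a"
 using U(3,2) V(1,2) by (rule sheafifyE)
 have "gm M x W a = gm M x V t" using W(6)[rule_format, OF W(2)] V(4) by simp
 then obtain W' where W': "opn W'" "x:W'" "W' <= W Int V" "Mres M W W' a = Mres M V W' t"
 using gm_eq_iff[OF W(1,2,5) V(1-3)] by blast
 have "s y = sheafified V t y" if y: "y:W'" for y
 proof -
 have "s y = gm M y W' (Mres M W W' a)"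
 using W'(3) y W(6)[rule_format, of y] gm_res[OF W(1) W'(1) _ y W(5)] by auto
 also have "\<dots> = gm M y V t"
 unfolding W'(4) using W'(3) gm_res[OF V(1) W'(1) _ y V(3)] by simp
 finally show ?thesis using W'(3) y by (auto simp: sheafified_def)
 qed
 hence "Mres (sfy M) U W' s = Mres (sfy M) V W' (sheafified V t)"
 by (auto simp: sfy_simps restrict_def fun_eq_iff)
 moreover have "W' <= U Int V" using W' W by blast
 ultimately show ?thesis
 using S.gm_eq_iff[OF U V(1,2) sfd_c[OF V(1,3)]] W'(1,2) by blast
qed

lemma sfy_stalkE:
 assumes "G:stk (sfy M) x" "opn W" "x:W"
 obtains V t where "opn V" "x:V" "V <= W" "t:sec M V"
 "G = gm (sfy M) x V (sheafified V t)"
proof -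
 interpret S: mpsh X "sfy M" by unfold_locales (rule sfy_psh)
 obtain U s where U: "opn U" "x:U" "s:sec (sfy M) U"
 "G = gm (sfy M) x U s" using assms(1) by (rule S.MstalkE)
 obtain V a where V: "opn V" "x:V" "V <= U" "V <= W" "a:sec M V"
 "!y:V. s y = gm M y V a"
 using U(3,2) assms(2,3) by (rule sheafifyE)
 show thesis
 by (rule that[OF V(1,2,4,5)]) (simp add: U(4) sfy_germ_eq[OF U(1-3) V(1,2,5) bspec[OF V(6,2)]])
qed

text \<open>Gluing is phrased by families of germs instead of covers. The value of the glued section
  at a point is obtained by evaluating the prescribed germ there.\<close>

lemma sfy_glue:
 assumes U: "opn U"
 and loc: "!!x. x:U ==> EX V s. opn V & x:V & V <= U & s:sec (sfy M) V &
 (!y:V. f y = gm (sfy M) y V s)"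
 shows "EX s:sec (sfy M) U. !x:U. gm (sfy M) x U s = f x"
proof -
 interpret S: mpsh X "sfy M" by unfold_locales (rule sfy_psh)
 have "!x. EX ph. x:U --> (!V s. opn V --> x:V --> s:sec (sfy M) V -->
 ph (gm (sfy M) x V s) = s x)"
 using sfy_stalk_value points_mem[OF U] by metis
 from choice[OF this] obtain ph where ph: "!!x V s. x:U ==> opn V ==> x:V ==>
 s:sec (sfy M) V ==> ph x (gm (sfy M) x V s) = s x" by metis
 define s where "s = (\<lambda>x\<in>U. ph x (f x))"
 have res: "restrict s V = t"
 if V: "opn V" "V <= U" "t:sec (sfy M) V"
 "!y:V. f y = gm (sfy M) y V t" for V t
 proof
 fix y show "restrict s V y = t y"
 using V ph[OF subsetD[OF V(2)] V(1) _ V(3)]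
 by (cases "y:V") (auto simp: s_def sfy_cr PiE_def extensional_def)
 qed
 have s: "s:sec (sfy M) U"
 unfolding sfy_cr
 proof (intro conjI ballI)
 have "s x:stk M x" if x: "x:U" for x
 proof -
 obtain V t where V: "opn V" "x:V" "V <= U" "t:sec (sfy M) V"
 "!y:V. f y = gm (sfy M) y V t" using loc[OF x] by blast
 have "s x = t x" using res[OF V(1,3,4,5)] V(2) by (metis restrict_apply')
 thus ?thesis using sfy_c[OF V(4,2)] by simp
 qed
 thus "s:(\<Pi>\<^sub>E x\<in>U. stk M x)" by (auto simp: s_def)
 fix x assume x: "x:U"
 obtain V t where V: "opn V" "x:V" "V <= U" "t:sec (sfy M) V"
 "!y:V. f y = gm (sfy M) y V t" using loc[OF x] by blast
 obtain W a where W: "opn W" "x:W" "W <= V" "W <= V" "a:sec M W"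
 "!y:W. t y = gm M y W a"
 using V(4,2,1,2) by (rule sheafifyE)
 have "s y = t y" if "y:V" for y using res[OF V(1,3,4,5)] that by (metis restrict_apply')
 with W V(3) show "EX W t. opn W & x:W & W <= U & t:sec M W &
 (!y:W. s y = gm M y W t)"
 by (intro exI[of _ W] exI[of _ a]) auto
 qed
 moreover have "gm (sfy M) x U s = f x" if x: "x:U" for x
 proof -
 obtain V t where V: "opn V" "x:V" "V <= U" "t:sec (sfy M) V"
 "!y:V. f y = gm (sfy M) y V t" using loc[OF x] by blast
 have "Mres (sfy M) U V s = t" using res[OF V(1,3,4,5)] by (simp add: sfy_simps)
 thus ?thesis
 using S.gm_res[OF U V(1,3,2) s] V(2,5) by simp
 qed
 ultimately show ?thesis by blast
qed

end

context pres_data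
begin

abbreviation "shf == sfy pre"

definition gen_sec :: "'p set => 'b => 'p => ('p set \<times> ('b => 'a) set) set" where
 "gen_sec U b = pre.sheafified U (pgen U b)"

lemma shf_psh: "psh shf"
 by (rule pre.sfy_psh)

sublocale shf: mpsh X shf
 by unfold_locales (rule shf_psh)

lemma gen_sec_c: "opn U ==> b:B U ==> gen_sec U b:sec shf U"
 unfolding gen_sec_def by (rule pre.sfd_c) (auto intro: pgen_c)

lemma gen_sec_res:
 "opn U ==> opn V ==> V <= U ==> b:B U ==> Mres shf U V (gen_sec U b) = gen_sec V (h U V b)"
 unfolding gen_sec_def by (simp add: pre.sfd_res pgen_c Mres_pre(2))

text \<open>The generating sections extend to a linear map on the free module, so that each relation
  can be evaluated term by term.\<close>

lemma gen_sec_relations: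
 assumes U: "opn U"
 shows "EX ph:lin (OS U) (free_module (OS U) (B U)) (Msec shf U).
 (!b:B U. ph (free_gen (OS U) b) = gen_sec U b) & (!k:K U. ph k = \<zero>\<^sub>(Msec shf U))"
proof -
 interpret R: cring "OS U" by (rule OS_cring[OF U])
 let ?F = "free_module (OS U) (B U)" and ?cl = "presented_class (OS U) (B U) (K U)"
 interpret F: module "OS U" ?F by (rule R.free_module)
 interpret FP: two_mods "OS U" ?F "Msec pre U"
 using F.module_axioms pre_mod[OF U] by (simp add: two_mods_def)
 have cl: "?cl:lin (OS U) ?F (Msec pre U)"
 unfolding Msec_pre by (rule R.pres_class_hom[OF K_closed[OF U]])
 show ?thesis
 proof (intro bexI[of _ "%f. pre.sheafified U (?cl f)"] conjI ballI)
 show "(%f. pre.sheafified U (?cl f)):lin (OS U) ?F (Msec shf U)"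
 by (rule lin_compose[OF cl pre.sfd_hom[OF U]])
 show "pre.sheafified U (?cl (free_gen (OS U) b)) = gen_sec U b" for b
 by (simp add: gen_sec_def pgen_def)
 fix k assume k: "k:K U"
 hence kc: "k:cr ?F" using K_closed[OF U] by blast
 have "?cl k = ?cl \<zero>\<^sub>?F"
 by (rule R.pres_class_eqI[OF K_closed[OF U] kc F.M.zero_closed])
 (simp add: F.M.minus_zero_eq[OF kc] F.span_base[OF k])
 thus "pre.sheafified U (?cl k) = \<zero>\<^sub>(Msec shf U)"
 using FP.lin_zero[OF cl] pre.sfd_zero[OF U] by simp
 qed
qed

lemma shf_stalk_lift:
 assumes x: "x:pts" and N: "module (Ost x) N"
 and g: "!!U b. opn U ==> x:U ==> b:B U ==> g U b:cr N"
 and res: "!!U V b. opn U ==> opn V ==> V <= U ==> x:V ==> b:B U ==>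
 g V (h U V b) = g U b"
 and rel: "!!U k. opn U ==> x:U ==> k:K U ==>
 flift (OS U) (rsc (og x U) N) (g U) k = \<zero>\<^sub>N"
 shows "EX ph:lin (Ost x) (Mst shf x) N.
 !U b. opn U --> x:U --> b:B U --> ph (gm shf x U (gen_sec U b)) = g U b"
proof -
 obtain ph where ph: "ph:lin (Ost x) (Mst pre x) N"
 "!U b. opn U --> x:U --> b:B U --> ph (gm pre x U (pgen U b)) = g U b"
 using pre_stalk_lift[OF assms] by blast
 obtain v where v: "v:shom x shf pre"
 "!U s. opn U --> x:U --> s:sec shf U --> v (gm shf x U s) = s x"
 using pre.sfy_stalk_value[OF x] by blast
 have "ph (v (gm shf x U (gen_sec U b))) = g U b"
 if "opn U" "x:U" "b:B U" for U b
 using that v(2) ph(2) gen_sec_c by (simp add: gen_sec_def pre.sheafified_def)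
 thus ?thesis by (intro bexI[OF _ lin_compose[OF v(1) ph(1)]]) simp
qed

lemma shf_stalk_span:
 assumes x: "x:pts"
 shows "stk shf x = spn shf x
 {gm shf x U (gen_sec U b) | U b. opn U & x:U & b:B U}" (is "_ = module_span _ _ ?S")
proof -
 interpret Sx: module "Ost x" "Mst shf x" by (rule shf.Mst_mod[OF x])
 have sub: "?S <= stk shf x" by (auto intro: shf.gm_c gen_sec_c)
 have "G:spn shf x ?S" if G: "G:stk shf x" for G
 proof -
 obtain U t where U: "opn U" "x:U" "U <= pts" "t:sec pre U"
 "G = gm shf x U (pre.sheafified U t)"
 using G openin_topspace x by (rule pre.sfy_stalkE)
 interpret U: module "OS U" "Msec pre U" by (rule pre_mod[OF U(1)])
 note hom = linD[OF pre.sfd_hom[OF U(1)]]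
 have "t:module_span (OS U) (Msec pre U) (pgen U ` B U)"
 using U(4) pre_span[OF U(1)] by blast
 hence "gm shf x U (pre.sheafified U t):spn shf x ?S"
 proof (induction rule: U.span_induct)
 case (base s)
 thus ?case using U(1,2) pgen_c[OF U(1)] by (auto intro!: Sx.span_base simp: gen_sec_def)
 next
 case zero
 thus ?case
 using Sx.span_zero by (simp add: pre.sfd_zero[OF U(1)] shf.Mst_zero[OF U(1,2), symmetric])
 next
 case (add s t)
 thus ?case
 using Sx.span_add by (simp add: hom shf.Mst_add[OF U(1,2), symmetric])
 next
 case (smult r s)
 thus ?case
 using Sx.span_smult og_c U(1,2) by (simp add: hom shf.Mst_smult[OF U(1,2), symmetric])
 qed
 thus ?thesis by (simp add: U(5))
 qed
 thus ?thesis using Sx.span_sub[OF sub] by blast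
qed

end

section \<open>Stalks of tensor products, tensor powers and symmetric powers\<close>

lemma rsc_minus:
 "\<ominus>\<^sub>(rsc rho N) x = \<ominus>\<^sub>N x" "x \<ominus>\<^sub>(rsc rho N) y = x \<ominus>\<^sub>N y"
 by (simp_all add: a_inv_def m_inv_def a_minus_def)

text \<open>A common shape for the relations of tensor products, tensor powers and symmetric powers:
  \<open>A\<close> lists sums, \<open>S\<close> scalar multiples and \<open>E\<close> equalities
  between generators. Each construction then only supplies its index sets.\<close>

definition linear_rels ::
 "('a, 'c) ring_scheme => 'b set => ('b \<times> 'b \<times> 'b) set => ('a \<times> 'b \<times> 'b) set => ('b \<times> 'b) set =>
 ('b => 'a) set" where
 "linear_rels R B A S E = (let F = free_module R B; g = free_gen R in
 (%(a, b, c). g a \<ominus>\<^sub>F (g b \<oplus>\<^sub>F g c)) ` A Un (%(r, a, b). g a \<ominus>\<^sub>F r \<odot>\<^sub>F g b) ` S Un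
 (%(a, b). g a \<ominus>\<^sub>F g b) ` E)"

lemma linear_rels_cases:
 assumes "k:linear_rels R B A S E"
 obtains a b c where "(a, b, c):A"
 "k = free_gen R a \<ominus>\<^sub>(free_module R B) (free_gen R b \<oplus>\<^sub>(free_module R B) free_gen R c)"
 | r a b where "(r, a, b):S"
 "k = free_gen R a \<ominus>\<^sub>(free_module R B) r \<odot>\<^sub>(free_module R B) free_gen R b"
 | a b where "(a, b):E" "k = free_gen R a \<ominus>\<^sub>(free_module R B) free_gen R b"
 using assms unfolding linear_rels_def Let_def by auto

lemma linear_rels_intros:
 "(a, b, c):A ==>
 free_gen R a \<ominus>\<^sub>(free_module R B) (free_gen R b \<oplus>\<^sub>(free_module R B) free_gen R c):linear_rels R B A S E"
 "(r, a, b):S ==>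
 free_gen R a \<ominus>\<^sub>(free_module R B) r \<odot>\<^sub>(free_module R B) free_gen R b:linear_rels R B A S E"
 "(a, b):E ==> free_gen R a \<ominus>\<^sub>(free_module R B) free_gen R b:linear_rels R B A S E"
 unfolding linear_rels_def Let_def by (intro UnI1, force) (intro UnI1 UnI2, force, intro UnI2, force)

lemma image_Collect_ex:
 "f ` {t x y | x y. P2 x y} = {f (t x y) | x y. P2 x y}"
 "f ` {t' x y z | x y z. P3 x y z} = {f (t' x y z) | x y z. P3 x y z}"
 "f ` {t'' w x y z | w x y z. P4 w x y z} = {f (t'' w x y z) | w x y z. P4 w x y z}"
 by blast+

locale rels_data = rspace X for X :: "('p, 'a) ringed" +
 fixes B :: "'p set => 'b set" and h :: "'p set => 'p set => 'b => 'b"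
 and A :: "'p set => ('b \<times> 'b \<times> 'b) set" and S :: "'p set => ('a \<times> 'b \<times> 'b) set"
 and E :: "'p set => ('b \<times> 'b) set"
 assumes gens: "set_psh (Top X) B h"
 and A_sub: "openin (Top X) U ==> A U <= B U \<times> B U \<times> B U"
 and S_sub: "openin (Top X) U ==> S U <= cr (Osec X U) \<times> B U \<times> B U"
 and E_sub: "openin (Top X) U ==> E U <= B U \<times> B U"
 and A_res: "openin (Top X) U ==> openin (Top X) V ==> V <= U ==> (a, b, c):A U ==>
 (h U V a, h U V b, h U V c):A V"
 and S_res: "openin (Top X) U ==> openin (Top X) V ==> V <= U ==> (r, a, b):S U ==>
 (Ores X U V r, h U V a, h U V b):S V"
 and E_res: "openin (Top X) U ==> openin (Top X) V ==> V <= U ==> (a, b):E U ==> (h U V a, h U V b):E V"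
begin

lemma hom_on_rels:
 assumes U: "opn U" and N: "module (OS U) N"
 and f: "f:lin (OS U) (free_module (OS U) (B U)) N"
 shows "(a, b, c):A U ==> f (free_gen (OS U) a \<ominus>\<^sub>(free_module (OS U) (B U))
 (free_gen (OS U) b \<oplus>\<^sub>(free_module (OS U) (B U)) free_gen (OS U) c)) =
 f (free_gen (OS U) a) \<ominus>\<^sub>N (f (free_gen (OS U) b) \<oplus>\<^sub>N f (free_gen (OS U) c))"
 and "(r, a, b):S U ==> f (free_gen (OS U) a \<ominus>\<^sub>(free_module (OS U) (B U))
 r \<odot>\<^sub>(free_module (OS U) (B U)) free_gen (OS U) b) =
 f (free_gen (OS U) a) \<ominus>\<^sub>N r \<odot>\<^sub>N f (free_gen (OS U) b)"
 and "(a, b):E U ==> f (free_gen (OS U) a \<ominus>\<^sub>(free_module (OS U) (B U)) free_gen (OS U) b) =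
 f (free_gen (OS U) a) \<ominus>\<^sub>N f (free_gen (OS U) b)"
proof -
 interpret R: cring "OS U" by (rule OS_cring[OF U])
 interpret two_mods "OS U" "free_module (OS U) (B U)" N
 using R.free_module N by (simp add: two_mods_def)
 note gc = R.free_gen_c
 show "f (free_gen (OS U) a \<ominus>\<^sub>(free_module (OS U) (B U))
 (free_gen (OS U) b \<oplus>\<^sub>(free_module (OS U) (B U)) free_gen (OS U) c)) =
 f (free_gen (OS U) a) \<ominus>\<^sub>N (f (free_gen (OS U) b) \<oplus>\<^sub>N f (free_gen (OS U) c))"
 if "(a, b, c):A U"
 using that A_sub[OF U] by (simp add: gc lin_minus[OF f] linD(2)[OF f] subset_iff)
 show "f (free_gen (OS U) a \<ominus>\<^sub>(free_module (OS U) (B U))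
 r \<odot>\<^sub>(free_module (OS U) (B U)) free_gen (OS U) b) =
 f (free_gen (OS U) a) \<ominus>\<^sub>N r \<odot>\<^sub>N f (free_gen (OS U) b)"
 if "(r, a, b):S U"
 using that S_sub[OF U] by (simp add: gc lin_minus[OF f] linD(3)[OF f] subset_iff)
 show "f (free_gen (OS U) a \<ominus>\<^sub>(free_module (OS U) (B U)) free_gen (OS U) b) =
 f (free_gen (OS U) a) \<ominus>\<^sub>N f (free_gen (OS U) b)"
 if "(a, b):E U"
 using that E_sub[OF U] by (simp add: gc lin_minus[OF f] subset_iff)
qed

abbreviation "K U == linear_rels (OS U) (B U) (A U) (S U) (E U)"

lemma presented: "pres_data X B K h"
proof (intro pres_data.intro pres_data_axioms.intro)
 show "rspace X" by (rule rspace_axioms)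
 show "set_psh (Top X) B h" by (rule gens)
 interpret B: set_psh "Top X" B h by (rule gens)
 fix U assume U: "opn U"
 interpret R: cring "OS U" by (rule OS_cring[OF U])
 interpret F: module "OS U" "free_module (OS U) (B U)" by (rule R.free_module)
 show "K U <= cr (free_module (OS U) (B U))"
 proof
 fix k assume "k:K U"
 thus "k:cr (free_module (OS U) (B U))"
 using A_sub[OF U] S_sub[OF U] E_sub[OF U]
 by (cases rule: linear_rels_cases) (auto intro!: R.free_gen_c F.M.minus_closed F.M.a_closed F.smult_closed)
 qed
 fix V k assume V: "opn V" "V <= U" and k: "k:K U"
 interpret RV: cring "OS V" by (rule OS_cring[OF V(1)])
 interpret FV: module "OS V" "free_module (OS V) (B V)" by (rule RV.free_module)
 let ?N = "rsc (Ores X U V) (free_module (OS V) (B V))"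
 let ?g = "%b. free_gen (OS V) (h U V b)"
 have N: "module (OS U) ?N"
 by (rule rsc_mod[OF R.is_cring RV.free_module Ores_hom[OF U V]])
 have g: "?g:B U \<rightarrow> cr ?N"
 using B.res_c[OF U V] by (auto intro!: RV.free_gen_c)
 note f = R.flift_hom[OF N g]
 note rels = hom_on_rels[OF U N f]
 note gen = R.flift_gen[OF N g]
 from k have "flift (OS U) ?N ?g k:K V"
 proof (cases rule: linear_rels_cases)
 case (1 a b c)
 hence "flift (OS U) ?N ?g k = ?g a \<ominus>\<^sub>(free_module (OS V) (B V)) (?g b \<oplus>\<^sub>(free_module (OS V) (B V)) ?g c)"
 using A_sub[OF U] by (auto simp: rels gen rsc_minus)
 thus ?thesis using linear_rels_intros(1)[OF A_res[OF U V 1(1)]] by simp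
 next
 case (2 r a b)
 hence "flift (OS U) ?N ?g k = ?g a \<ominus>\<^sub>(free_module (OS V) (B V)) Ores X U V r \<odot>\<^sub>(free_module (OS V) (B V)) ?g b"
 using S_sub[OF U] by (auto simp: rels gen rsc_minus)
 thus ?thesis using linear_rels_intros(2)[OF S_res[OF U V 2(1)]] by simp
 next
 case (3 a b)
 hence "flift (OS U) ?N ?g k = ?g a \<ominus>\<^sub>(free_module (OS V) (B V)) ?g b"
 using E_sub[OF U] by (auto simp: rels gen rsc_minus)
 thus ?thesis using linear_rels_intros(3)[OF E_res[OF U V 3(1)]] by simp
 qed
 thus "flift (OS U) ?N ?g k:module_span (OS V) (free_module (OS V) (B V)) (K V)"
 by (rule FV.span_base)
qed

sublocale pres_data X B K h
 by (rule presented)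

lemma gen_sec_rels:
 assumes U: "opn U"
 shows "(a, b, c):A U ==> gen_sec U a = gen_sec U b \<oplus>\<^sub>(Msec shf U) gen_sec U c"
 and "(r, a, b):S U ==> gen_sec U a = r \<odot>\<^sub>(Msec shf U) gen_sec U b"
 and "(a, b):E U ==> gen_sec U a = gen_sec U b"
proof -
 interpret N: module "OS U" "Msec shf U" by (rule shf.Msec_mod[OF U])
 obtain ph where ph: "ph:lin (OS U) (free_module (OS U) (B U)) (Msec shf U)"
 "!b:B U. ph (free_gen (OS U) b) = gen_sec U b" "!k:K U. ph k = \<zero>\<^sub>(Msec shf U)"
 using gen_sec_relations[OF U] by blast
 note rels = hom_on_rels[OF U N.module_axioms ph(1)]
 note c = gen_sec_c[OF U]
 show "gen_sec U a = gen_sec U b \<oplus>\<^sub>(Msec shf U) gen_sec U c" if abc: "(a, b, c):A U"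
 proof -
 have B: "a:B U" "b:B U" "c:B U" using A_sub[OF U] abc by auto
 have "free_gen (OS U) a \<ominus>\<^sub>(free_module (OS U) (B U))
 (free_gen (OS U) b \<oplus>\<^sub>(free_module (OS U) (B U)) free_gen (OS U) c):K U"
 using abc by (rule linear_rels_intros(1))
 hence "gen_sec U a \<ominus>\<^sub>(Msec shf U) (gen_sec U b \<oplus>\<^sub>(Msec shf U) gen_sec U c) = \<zero>\<^sub>(Msec shf U)"
 using rels(1)[OF abc] ph(2,3) B by simp
 thus ?thesis using N.M.minus_eq_zero_iff c B by simp
 qed
 show "gen_sec U a = r \<odot>\<^sub>(Msec shf U) gen_sec U b" if rab: "(r, a, b):S U"
 proof -
 have B: "r:osec U" "a:B U" "b:B U" using S_sub[OF U] rab by auto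
 have "free_gen (OS U) a \<ominus>\<^sub>(free_module (OS U) (B U))
 r \<odot>\<^sub>(free_module (OS U) (B U)) free_gen (OS U) b:K U"
 using rab by (rule linear_rels_intros(2))
 hence "gen_sec U a \<ominus>\<^sub>(Msec shf U) r \<odot>\<^sub>(Msec shf U) gen_sec U b = \<zero>\<^sub>(Msec shf U)"
 using rels(2)[OF rab] ph(2,3) B by simp
 thus ?thesis using N.M.minus_eq_zero_iff c B by simp
 qed
 show "gen_sec U a = gen_sec U b" if ab: "(a, b):E U"
 proof -
 have B: "a:B U" "b:B U" using E_sub[OF U] ab by auto
 have "free_gen (OS U) a \<ominus>\<^sub>(free_module (OS U) (B U)) free_gen (OS U) b:K U"
 using ab by (rule linear_rels_intros(3))
 hence "gen_sec U a \<ominus>\<^sub>(Msec shf U) gen_sec U b = \<zero>\<^sub>(Msec shf U)"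
 using rels(3)[OF ab] ph(2,3) B by simp
 thus ?thesis using N.M.minus_eq_zero_iff c B by simp
 qed
qed

text \<open>Universal property of the stalk of a presented sheaf: the prescription on germs of
  generators has to be independent of the neighbourhood and to respect the three kinds of
  relations.\<close>

lemma shf_stalk_lift_rels:
 assumes x: "x:pts" and N: "module (Ost x) N"
 and g: "!!U b. opn U ==> x:U ==> b:B U ==> g U b:cr N"
 and res: "!!U V b. opn U ==> opn V ==> V <= U ==> x:V ==> b:B U ==>
 g V (h U V b) = g U b"
 and A: "!!U a b c. opn U ==> x:U ==> (a, b, c):A U ==> g U a = g U b \<oplus>\<^sub>N g U c"
 and S: "!!U r a b. opn U ==> x:U ==> (r, a, b):S U ==> g U a = og x U r \<odot>\<^sub>N g U b"
 and E: "!!U a b. opn U ==> x:U ==> (a, b):E U ==> g U a = g U b"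
 shows "EX ph:lin (Ost x) (Mst shf x) N.
 !U b. opn U --> x:U --> b:B U --> ph (gm shf x U (gen_sec U b)) = g U b"
proof (rule shf_stalk_lift[OF x N g res])
 fix U k assume U: "opn U" "x:U" and k: "k:K U"
 interpret N: module "Ost x" N by (rule N)
 interpret R: cring "OS U" by (rule OS_cring[OF U(1)])
 let ?N = "rsc (og x U) N"
 have N': "module (OS U) ?N"
 by (rule rsc_mod[OF R.is_cring N og_ring_hom[OF U]])
 have g': "g U:B U \<rightarrow> cr ?N" using g[OF U] by auto
 note rels = hom_on_rels[OF U(1) N' R.flift_hom[OF N' g']]
 note gen = R.flift_gen[OF N' g']
 from k show "flift (OS U) ?N (g U) k = \<zero>\<^sub>N"
 proof (cases rule: linear_rels_cases)
 case (1 a b c)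
 thus ?thesis
 using A_sub[OF U(1)] A[OF U 1(1)] g[OF U] N.M.a_closed
 by (auto simp: rels gen rsc_minus N.M.minus_eq_zero_iff)
 next
 case (2 r a b)
 thus ?thesis
 using S_sub[OF U(1)] S[OF U 2(1)] g[OF U] N.smult_closed og_c[OF U]
 by (auto simp: rels gen rsc_minus N.M.minus_eq_zero_iff)
 next
 case (3 a b)
 thus ?thesis
 using E_sub[OF U(1)] E[OF U 3(1)] g[OF U]
 by (auto simp: rels gen rsc_minus N.M.minus_eq_zero_iff)
 qed
qed

end

subsection \<open>Tensor products\<close>

definition bilinear ::
 "('a, 'c) ring_scheme => ('a, 'l, 'f) module_scheme => ('a, 'm, 'd) module_scheme =>
 ('a, 'n, 'e) module_scheme => ('l => 'm => 'n) => bool"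
 where "bilinear R L M N g \<longleftrightarrow>
 (!x:cr L. g x:lin R M N) & (!y:cr M. (%x. g x y):lin R L N)"

abbreviation tns_gens where
 "tns_gens M N == (%U. cr (Msec M U) \<times> cr (Msec N U))"

abbreviation tns_res where
 "tns_res M N == (%U V. map_prod (Mres M U V) (Mres N U V))"

definition tsec where
 "tsec X M N U s t = pres_data.gen_sec X (tns_gens M N)
 (%U. bilinear_rels (Osec X U) (Msec M U) (Msec N U)) (tns_res M N) U (s, t)"

text \<open>The pure tensor of two germs, by a choice of representatives over a common
  neighbourhood; \<open>stn_gm\<close> shows that the choice does not matter.\<close>

definition stalk_tensor where
 "stalk_tensor X M N x G H = (SOME T. EX U s t. openin (Top X) U & x:U &
 s:cr (Msec M U) & t:cr (Msec N U) & G = Mgerm X M x U s & H = Mgerm X N x U t &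
 T = Mgerm X (tensor_sheaf X M N) x U (tsec X M N U s t))"

abbreviation (in rspace) "tns == tensor_sheaf X"
abbreviation (in rspace) "stn == stalk_tensor X"
abbreviation (in rspace) bilin where "bilin x M N L == bilinear (Ost x) (Mst M x) (Mst N x) (Mst L x)"

abbreviation tns_add where
 "tns_add M N == (%U. {((x \<oplus>\<^sub>(Msec M U) x', y), (x, y), (x', y)) | x x' y.
 x:cr (Msec M U) & x':cr (Msec M U) & y:cr (Msec N U)} Un
 {((x, y \<oplus>\<^sub>(Msec N U) y'), (x, y), (x, y')) | x y y'.
 x:cr (Msec M U) & y:cr (Msec N U) & y':cr (Msec N U)})"

abbreviation tns_smult where
 "tns_smult X M N == (%U. {(r, (r \<odot>\<^sub>(Msec M U) x, y), (x, y)) | r x y.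
 r:cr (Osec X U) & x:cr (Msec M U) & y:cr (Msec N U)} Un
 {(r, (x, r \<odot>\<^sub>(Msec N U) y), (x, y)) | r x y.
 r:cr (Osec X U) & x:cr (Msec M U) & y:cr (Msec N U)})"

lemma bil_rels_eq:
 "bilinear_rels (Osec X U) (Msec M U) (Msec N U) =
 linear_rels (Osec X U) (tns_gens M N U) (tns_add M N U) (tns_smult X M N U) {}"
 by (simp only: bilinear_rels_def linear_rels_def Let_def image_Un image_Collect_ex prod.case
 image_empty Un_empty_right Un_assoc)

context rspace
begin

lemma tns_rels:
 assumes M: "psh M" and N: "psh N"
 shows "rels_data X (tns_gens M N) (tns_res M N) (tns_add M N) (tns_smult X M N) (%U. {})"
proof -
 interpret M: mpsh X M by unfold_locales (rule M)
 interpret N: mpsh X N by unfold_locales (rule N)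
 show ?thesis
 proof (intro rels_data.intro rels_data_axioms.intro)
 show "rspace X" by (rule rspace_axioms)
 show "set_psh (Top X) (tns_gens M N) (tns_res M N)"
 by unfold_locales (auto simp: M.M.res_c N.M.res_c M.M.res_id N.M.res_id M.M.res_res N.M.res_res)
 next
 fix U assume U: "opn U"
 interpret MU: module "OS U" "Msec M U" by (rule M.Msec_mod[OF U])
 interpret NU: module "OS U" "Msec N U" by (rule N.Msec_mod[OF U])
 show "tns_add M N U <= tns_gens M N U \<times> tns_gens M N U \<times> tns_gens M N U" by auto
 show "tns_smult X M N U <= osec U \<times> tns_gens M N U \<times> tns_gens M N U" by auto
 next
 fix U V a b c assume U: "opn U" "opn V" "V <= U" and "(a, b, c):tns_add M N U"
 thus "(tns_res M N U V a, tns_res M N U V b, tns_res M N U V c):tns_add M N V"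
 using M.M.res_c[OF U] N.M.res_c[OF U] by (auto simp: M.Mres_add[OF U] N.Mres_add[OF U])
 next
 fix U V r a b assume U: "opn U" "opn V" "V <= U" and "(r, a, b):tns_smult X M N U"
 thus "(Ores X U V r, tns_res M N U V a, tns_res M N U V b):tns_smult X M N V"
 using M.M.res_c[OF U] N.M.res_c[OF U] O.res_c[OF U]
 by (auto simp: M.Mres_smult[OF U] N.Mres_smult[OF U])
 qed auto
qed

context
 fixes M :: "('p, 'a, 'm) presheaf" and N :: "('p, 'a, 'n) presheaf"
 assumes M: "psh M" and N: "psh N"
begin

interpretation M: mpsh X M by unfold_locales (rule M)
interpretation N: mpsh X N by unfold_locales (rule N)
interpretation T: rels_data X "tns_gens M N" "tns_res M N" "tns_add M N" "tns_smult X M N" "%U. {}"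
 by (rule tns_rels[OF M N])

lemma tns_sheaf_eq: "tns M N = T.shf"
 by (simp add: tensor_sheaf_def bil_rels_eq)

lemma tsec_eq: "tsec X M N U s t = T.gen_sec U (s, t)"
 by (simp add: tsec_def bil_rels_eq)

lemma tns_psh: "psh (tns M N)"
 unfolding tns_sheaf_eq by (rule T.shf_psh)

interpretation MN: mpsh X "tns M N" by unfold_locales (rule tns_psh)

lemma tsec_c:
 "opn U ==> s:sec M U ==> t:sec N U ==>
 tsec X M N U s t:sec (tns M N) U"
 unfolding tsec_eq tns_sheaf_eq by (rule T.gen_sec_c) auto

lemma stn_gm:
 assumes U: "opn U" "x:U" "s:sec M U" "t:sec N U"
 shows "stn M N x (gm M x U s) (gm N x U t) =
 gm (tns M N) x U (tsec X M N U s t)"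
proof -
 let ?P = "%T. EX V s' t'. opn V & x:V &
 s':sec M V & t':sec N V & gm M x U s = gm M x V s' &
 gm N x U t = gm N x V t' &
 T = gm (tns M N) x V (tsec X M N V s' t')"
 have "?P (stn M N x (gm M x U s) (gm N x U t))"
 unfolding stalk_tensor_def by (rule someI_ex) (use U in blast)
 then obtain V s' t' where V: "opn V" "x:V" "s':sec M V" "t':sec N V"
 "gm M x U s = gm M x V s'" "gm N x U t = gm N x V t'"
 and eq: "stn M N x (gm M x U s) (gm N x U t) =
 gm (tns M N) x V (tsec X M N V s' t')"
 by (elim exE conjE)
 obtain W where W: "opn W" "x:W" "W <= U Int V" "Mres M U W s = Mres M V W s'"
 using V(5) M.gm_eq_iff[OF U(1-3) V(1-3)] by blast
 obtain W' where W': "opn W'" "x:W'" "W' <= U Int V" "Mres N U W' t = Mres N V W' t'"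
 using V(6) N.gm_eq_iff[OF U(1,2,4) V(1,2,4)] by blast
 let ?Y = "W Int W'"
 have Y: "opn ?Y" "x:?Y" "?Y <= U" "?Y <= V" "?Y <= W" "?Y <= W'"
 using W W' by (auto intro: openin_Int)
 have "Mres M U ?Y s = Mres M W ?Y (Mres M U W s)"
 using M.M.res_res[OF U(1) W(1) Y(1,5) _ U(3)] W(3) by simp
 hence s: "Mres M U ?Y s = Mres M V ?Y s'"
 unfolding W(4) using M.M.res_res[OF V(1) W(1) Y(1,5) _ V(3)] W(3) by simp
 have "Mres N U ?Y t = Mres N W' ?Y (Mres N U W' t)"
 using N.M.res_res[OF U(1) W'(1) Y(1,6) _ U(4)] W'(3) by simp
 hence t: "Mres N U ?Y t = Mres N V ?Y t'"
 unfolding W'(4) using N.M.res_res[OF V(1) W'(1) Y(1,6) _ V(4)] W'(3) by simp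
 have res: "Mres (tns M N) U ?Y (tsec X M N U s t) =
 tsec X M N ?Y (Mres M U ?Y s) (Mres N U ?Y t)"
 if "opn U" "?Y <= U" "s:sec M U" "t:sec N U" for U s t
 using T.gen_sec_res[OF that(1) Y(1) that(2), of "(s, t)"] that
 by (simp add: tsec_eq tns_sheaf_eq)
 show ?thesis
 unfolding eq
 using res[OF U(1) Y(3) U(3,4)] res[OF V(1) Y(4) V(3,4)] s t
 MN.gm_res[OF U(1) Y(1,3,2) tsec_c[OF U(1,3,4)]]
 MN.gm_res[OF V(1) Y(1,4,2) tsec_c[OF V(1,3,4)]]
 by simp
qed

lemma stalks_common:
 assumes "G:stk M x" "H:stk N x"
 obtains U s t where "opn U" "x:U" "s:sec M U" "t:sec N U"
 "G = gm M x U s" "H = gm N x U t"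
proof -
 obtain V s where V: "opn V" "x:V" "s:sec M V" "G = gm M x V s"
 using assms(1) by (rule M.MstalkE)
 obtain U t where U: "opn U" "x:U" "U <= V" "t:sec N U" "H = gm N x U t"
 using assms(2) V(1,2) by (rule N.Mst_within)
 show thesis
 by (rule that[OF U(1,2) M.M.res_c[OF V(1) U(1,3) V(3)] U(4) _ U(5)])
 (simp add: M.gm_res[OF V(1) U(1,3,2) V(3)] V(4))
qed

context
 fixes x assumes x: "x:pts"
begin

lemma stn_bil:
 "bilin x M N (tns M N) (stn M N x)"
 unfolding bilinear_def
proof (intro conjI ballI linI)
 fix G H assume "G:stk M x" "H:stk N x"
 then obtain U s t where U: "opn U" "x:U" "s:sec M U" "t:sec N U"
 "G = gm M x U s" "H = gm N x U t" by (rule stalks_common)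
 show "stn M N x G H:stk (tns M N) x"
 unfolding U(5,6) stn_gm[OF U(1-4)]
 by (rule MN.gm_c[OF U(1,2) tsec_c[OF U(1,3,4)]])
 thus "stn M N x G H:stk (tns M N) x" .
next
 fix G H H' assume G: "G:stk M x" and H: "H:stk N x" "H':stk N x"
 obtain V s t where V: "opn V" "x:V" "s:sec M V" "t:sec N V"
 "G = gm M x V s" "H = gm N x V t" using G H(1) by (rule stalks_common)
 obtain U t' where U: "opn U" "x:U" "U <= V" "t':sec N U" "H' = gm N x U t'"
 using H(2) V(1,2) by (rule N.Mst_within)
 define s1 t1 where "s1 = Mres M V U s" and "t1 = Mres N V U t"
 have s1: "s1:sec M U" "G = gm M x U s1"
 unfolding s1_def using M.M.res_c[OF V(1) U(1,3) V(3)] M.gm_res[OF V(1) U(1,3,2) V(3)] V(5) by auto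
 have t1: "t1:sec N U" "H = gm N x U t1"
 unfolding t1_def using N.M.res_c[OF V(1) U(1,3) V(4)] N.gm_res[OF V(1) U(1,3,2) V(4)] V(6) by auto
 interpret NU: module "OS U" "Msec N U" by (rule N.Msec_mod[OF U(1)])
 have add: "tsec X M N U s1 (t1 \<oplus>\<^sub>(Msec N U) t') =
 tsec X M N U s1 t1 \<oplus>\<^sub>(Msec (tns M N) U) tsec X M N U s1 t'"
 unfolding tsec_eq tns_sheaf_eq by (rule T.gen_sec_rels(1)[OF U(1)]) (use s1 t1 U in auto)
 show "stn M N x G (H \<oplus>\<^sub>(Mst N x) H') =
 stn M N x G H \<oplus>\<^sub>(Mst (tns M N) x) stn M N x G H'"
 unfolding s1(2) t1(2) U(5) N.Mst_add[OF U(1,2) t1(1) U(4)]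
 by (simp add: stn_gm U s1 t1 add MN.Mst_add tsec_c)
next
 fix G G' H assume G: "G:stk M x" "G':stk M x" and H: "H:stk N x"
 obtain V s t where V: "opn V" "x:V" "s:sec M V" "t:sec N V"
 "G = gm M x V s" "H = gm N x V t" using G(1) H by (rule stalks_common)
 obtain U s' where U: "opn U" "x:U" "U <= V" "s':sec M U" "G' = gm M x U s'"
 using G(2) V(1,2) by (rule M.Mst_within)
 define s1 t1 where "s1 = Mres M V U s" and "t1 = Mres N V U t"
 have s1: "s1:sec M U" "G = gm M x U s1"
 unfolding s1_def using M.M.res_c[OF V(1) U(1,3) V(3)] M.gm_res[OF V(1) U(1,3,2) V(3)] V(5) by auto
 have t1: "t1:sec N U" "H = gm N x U t1"
 unfolding t1_def using N.M.res_c[OF V(1) U(1,3) V(4)] N.gm_res[OF V(1) U(1,3,2) V(4)] V(6) by auto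
 interpret MU: module "OS U" "Msec M U" by (rule M.Msec_mod[OF U(1)])
 have add: "tsec X M N U (s1 \<oplus>\<^sub>(Msec M U) s') t1 =
 tsec X M N U s1 t1 \<oplus>\<^sub>(Msec (tns M N) U) tsec X M N U s' t1"
 unfolding tsec_eq tns_sheaf_eq by (rule T.gen_sec_rels(1)[OF U(1)]) (use s1 t1 U in auto)
 show "stn M N x (G \<oplus>\<^sub>(Mst M x) G') H =
 stn M N x G H \<oplus>\<^sub>(Mst (tns M N) x) stn M N x G' H"
 unfolding s1(2) t1(2) U(5) M.Mst_add[OF U(1,2) s1(1) U(4)]
 by (simp add: stn_gm U s1 t1 add MN.Mst_add tsec_c)
next
 fix G H r assume G: "G:stk M x" and H: "H:stk N x" and r: "r:ostk x"
 obtain V s t where V: "opn V" "x:V" "s:sec M V" "t:sec N V"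
 "G = gm M x V s" "H = gm N x V t" using G H by (rule stalks_common)
 obtain U a where U: "opn U" "x:U" "U <= V" "a:osec U" "r = og x U a"
 using r V(1,2) by (rule Ost_within)
 define s1 t1 where "s1 = Mres M V U s" and "t1 = Mres N V U t"
 have s1: "s1:sec M U" "G = gm M x U s1"
 unfolding s1_def using M.M.res_c[OF V(1) U(1,3) V(3)] M.gm_res[OF V(1) U(1,3,2) V(3)] V(5) by auto
 have t1: "t1:sec N U" "H = gm N x U t1"
 unfolding t1_def using N.M.res_c[OF V(1) U(1,3) V(4)] N.gm_res[OF V(1) U(1,3,2) V(4)] V(6) by auto
 interpret MU: module "OS U" "Msec M U" by (rule M.Msec_mod[OF U(1)])
 interpret NU: module "OS U" "Msec N U" by (rule N.Msec_mod[OF U(1)])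
 have sm: "tsec X M N U (a \<odot>\<^sub>(Msec M U) s1) t1 =
 a \<odot>\<^sub>(Msec (tns M N) U) tsec X M N U s1 t1"
 "tsec X M N U s1 (a \<odot>\<^sub>(Msec N U) t1) =
 a \<odot>\<^sub>(Msec (tns M N) U) tsec X M N U s1 t1"
 unfolding tsec_eq tns_sheaf_eq by (rule T.gen_sec_rels(2)[OF U(1)]; use s1 t1 U in auto)+
 show "stn M N x (r \<odot>\<^sub>(Mst M x) G) H =
 r \<odot>\<^sub>(Mst (tns M N) x) stn M N x G H"
 unfolding s1(2) t1(2) U(5) M.Mst_smult[OF U(1,2,4) s1(1)]
 by (simp add: stn_gm U s1 t1 sm MN.Mst_smult tsec_c)
 show "stn M N x G (r \<odot>\<^sub>(Mst N x) H) =
 r \<odot>\<^sub>(Mst (tns M N) x) stn M N x G H"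
 unfolding s1(2) t1(2) U(5) N.Mst_smult[OF U(1,2,4) t1(1)]
 by (simp add: stn_gm U s1 t1 sm MN.Mst_smult tsec_c)
qed

lemma stn_span:
 "stk (tns M N) x = spn (tns M N) x
 {stn M N x G H | G H. G:stk M x & H:stk N x}"
 (is "_ = module_span _ _ ?S")
proof -
 interpret Tx: module "Ost x" "Mst (tns M N) x" by (rule MN.Mst_mod[OF x])
 have "?S <= stk (tns M N) x"
 using stn_bil by (auto simp: bilinear_def intro: linD(1))
 moreover have "{gm T.shf x U (T.gen_sec U b) | U b. opn U & x:U & b:tns_gens M N U} <= ?S"
 proof clarify
 fix U s t assume U: "opn U" "x:U" "s:sec M U" "t:sec N U"
 have "gm T.shf x U (T.gen_sec U (s, t)) = stn M N x (gm M x U s) (gm N x U t)"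
 using stn_gm[OF U] by (simp add: tsec_eq tns_sheaf_eq)
 thus "EX G H. gm T.shf x U (T.gen_sec U (s, t)) = stn M N x G H &
 G:stk M x & H:stk N x"
 using M.gm_c[OF U(1,2,3)] N.gm_c[OF U(1,2,4)] by blast
 qed
 ultimately show ?thesis
 using T.shf_stalk_span[OF x, folded tns_sheaf_eq] Tx.span_mono[of _ ?S] Tx.span_sub[of ?S]
 by (simp add: tns_sheaf_eq subset_antisym)
qed

text \<open>Together with bilinearity and \<open>stn_span\<close> this identifies the stalk of a
  tensor product with the tensor product of the stalks. No isomorphism is constructed; the universal
  property does its work.\<close>

lemma stn_lift:
 assumes L: "module (Ost x) L" and g: "bilinear (Ost x) (Mst M x) (Mst N x) L g"
 shows "EX ph:lin (Ost x) (Mst (tns M N) x) L.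
 !G:stk M x. !H:stk N x. ph (stn M N x G H) = g G H"
proof -
 have g1: "g G:lin (Ost x) (Mst N x) L" if "G:stk M x" for G
 using g that by (simp add: bilinear_def)
 have g2: "(%G. g G H):lin (Ost x) (Mst M x) L" if "H:stk N x" for H
 using g that by (simp add: bilinear_def)
 have "EX ph:lin (Ost x) (Mst T.shf x) L. !U b. opn U --> x:U -->
 b:tns_gens M N U --> ph (gm T.shf x U (T.gen_sec U b)) =
 (case b of (s, t) => g (gm M x U s) (gm N x U t))"
 proof (rule T.shf_stalk_lift_rels[OF x L])
 fix U b assume U: "opn U" "x:U" "b:tns_gens M N U"
 thus "(case b of (s, t) => g (gm M x U s) (gm N x U t)):cr L"
 using linD(1)[OF g1[OF M.gm_c[OF U(1,2)]] N.gm_c[OF U(1,2)]] by auto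
 next
 fix U V b assume "opn U" "opn V" "V <= U" "x:V" "b:tns_gens M N U"
 thus "(case tns_res M N U V b of (s, t) => g (gm M x V s) (gm N x V t)) =
 (case b of (s, t) => g (gm M x U s) (gm N x U t))"
 by (auto simp: M.gm_res N.gm_res)
 next
 fix U a b c assume U: "opn U" "x:U" and "(a, b, c):tns_add M N U"
 thus "(case a of (s, t) => g (gm M x U s) (gm N x U t)) =
 (case b of (s, t) => g (gm M x U s) (gm N x U t)) \<oplus>\<^sub>L
 (case c of (s, t) => g (gm M x U s) (gm N x U t))"
 by (auto simp: M.Mst_add[OF U, symmetric] N.Mst_add[OF U, symmetric] M.gm_c N.gm_c
 linD(2)[OF g1] linD(2)[OF g2])
 next
 fix U r a b assume U: "opn U" "x:U" and "(r, a, b):tns_smult X M N U"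
 thus "(case a of (s, t) => g (gm M x U s) (gm N x U t)) =
 og x U r \<odot>\<^sub>L (case b of (s, t) => g (gm M x U s) (gm N x U t))"
 by (auto simp: M.Mst_smult[OF U, symmetric] N.Mst_smult[OF U, symmetric] M.gm_c N.gm_c
 og_c linD(3)[OF g1] linD(3)[OF g2])
 qed simp
 then obtain ph where ph: "ph:lin (Ost x) (Mst T.shf x) L"
 "!U b. opn U --> x:U --> b:tns_gens M N U -->
 ph (gm T.shf x U (T.gen_sec U b)) = (case b of (s, t) => g (gm M x U s) (gm N x U t))" by blast
 have "ph (stn M N x G H) = g G H"
 if GH: "G:stk M x" "H:stk N x" for G H
 proof -
 obtain U s t where U: "opn U" "x:U" "s:sec M U" "t:sec N U"
 "G = gm M x U s" "H = gm N x U t" using GH by (rule stalks_common)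
 show ?thesis unfolding U(5,6) stn_gm[OF U(1-4)]
 using ph(2) U(1-4) by (simp add: tsec_eq tns_sheaf_eq)
 qed
 with ph(1) show ?thesis unfolding tns_sheaf_eq by blast
qed

end

end

end

subsection \<open>Tensor powers and symmetric powers\<close>

abbreviation word_gens where
 "word_gens n M == (%U. words n (Msec M U))"

abbreviation word_res where
 "word_res M == (%U V. map (Mres M U V))"

abbreviation word_add where
 "word_add n M == (%U. {(xs[i := x \<oplus>\<^sub>(Msec M U) y], xs[i := x], xs[i := y]) | xs i x y.
 xs:words n (Msec M U) & i < n & x:cr (Msec M U) & y:cr (Msec M U)})"

abbreviation word_smult where
 "word_smult X n M == (%U. {(r, xs[i := r \<odot>\<^sub>(Msec M U) x], xs[i := x]) | xs i r x.
 xs:words n (Msec M U) & i < n & r:cr (Osec X U) & x:cr (Msec M U)})"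

abbreviation word_sym where
 "word_sym sy n M == (%U. if sy then {(xs, ys) | xs ys.
 xs:words n (Msec M U) & ys:words n (Msec M U) & mset xs = mset ys} else {})"

text \<open>The symmetric power for \<open>sy = True\<close> and the tensor power for \<open>sy = False\<close>.\<close>

definition wpow where
 "wpow X sy n M = sheafify X (presented_presheaf X (word_gens n M)
 (%U. linear_rels (Osec X U) (words n (Msec M U)) (word_add n M U) (word_smult X n M U) (word_sym sy n M U))
 (word_res M))"

definition wsct where
 "wsct X sy n M = pres_data.gen_sec X (word_gens n M)
 (%U. linear_rels (Osec X U) (words n (Msec M U)) (word_add n M U) (word_smult X n M U) (word_sym sy n M U))
 (word_res M)"

definition stalk_word where
 "stalk_word X sy n M x gs = (SOME T. EX U ss. openin (Top X) U & x:U & ss:words n (Msec M U) &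
 gs = map (Mgerm X M x U) ss & T = Mgerm X (wpow X sy n M) x U (wsct X sy n M U ss))"

abbreviation (in rspace) "wpw == wpow X"
abbreviation (in rspace) "tpw == wpow X False"
abbreviation (in rspace) "spw == wpow X True"
abbreviation (in rspace) "stw == stalk_word X"
abbreviation (in rspace) "tw == stalk_word X False"
abbreviation (in rspace) "sw == stalk_word X True"

lemma tns_power_eq: "tensor_power X n M = wpow X False n M"
 unfolding tensor_power_def wpow_def multilinear_rels_def linear_rels_def Let_def if_False
 by (simp only: image_Un image_Collect_ex prod.case image_empty Un_empty_right)

lemma sym_power_eq: "sym_power X n M = wpow X True n M"
 unfolding sym_power_def wpow_def multilinear_rels_def symmetry_rels_def linear_rels_def Let_def if_True
 by (simp only: image_Un image_Collect_ex prod.case)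

context rspace
begin

lemma word_rels:
 assumes M: "psh M"
 shows "rels_data X (word_gens n M) (word_res M) (word_add n M) (word_smult X n M) (word_sym sy n M)"
proof -
 interpret M: mpsh X M by unfold_locales (rule M)
 show ?thesis
 proof (intro rels_data.intro rels_data_axioms.intro)
 show "rspace X" by (rule rspace_axioms)
 show "set_psh (Top X) (word_gens n M) (word_res M)"
 proof
 fix U ss assume "opn U" "ss:wsec n M U"
 thus "map (Mres M U U) ss = ss"
 by (auto simp: words_def M.M.res_id intro!: map_idI)
 next
 fix U V W ss assume U: "opn U" "opn V" "opn W" "W <= V" "V <= U"
 and "ss:wsec n M U"
 thus "map (Mres M V W) (map (Mres M U V) ss) = map (Mres M U W) ss"
 using M.M.res_res[OF U] by (auto simp: words_def)
 qed (rule M.words_res)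
 next
 fix U assume U: "opn U"
 interpret MU: module "OS U" "Msec M U" by (rule M.Msec_mod[OF U])
 show "word_add n M U <= wsec n M U \<times> wsec n M U \<times> wsec n M U"
 by (auto simp: w_update)
 show "word_smult X n M U <= osec U \<times> wsec n M U \<times> wsec n M U"
 by (auto simp: w_update)
 show "word_sym sy n M U <= wsec n M U \<times> wsec n M U" by auto
 next
 fix U V a b c assume U: "opn U" "opn V" "V <= U" and "(a, b, c):word_add n M U"
 then obtain xs i x y where "a = xs[i := x \<oplus>\<^sub>(Msec M U) y]" "b = xs[i := x]" "c = xs[i := y]"
 "xs:wsec n M U" "i < n" "x:sec M U" "y:sec M U" by auto
 note abc = this
 have eq: "word_res M U V a = (word_res M U V xs)[i := Mres M U V x \<oplus>\<^sub>(Msec M V) Mres M U V y]"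
 "word_res M U V b = (word_res M U V xs)[i := Mres M U V x]"
 "word_res M U V c = (word_res M U V xs)[i := Mres M U V y]"
 using abc by (simp_all add: map_update M.Mres_add[OF U])
 show "(word_res M U V a, word_res M U V b, word_res M U V c):word_add n M V"
 unfolding eq using abc(5) M.words_res[OF U abc(4)] M.M.res_c[OF U abc(6)] M.M.res_c[OF U abc(7)]
 by blast
 next
 fix U V r a b assume U: "opn U" "opn V" "V <= U" and "(r, a, b):word_smult X n M U"
 then obtain xs i x where "a = xs[i := r \<odot>\<^sub>(Msec M U) x]" "b = xs[i := x]"
 "xs:wsec n M U" "i < n" "r:osec U" "x:sec M U" by auto
 note ab = this
 have eq: "word_res M U V a = (word_res M U V xs)[i := Ores X U V r \<odot>\<^sub>(Msec M V) Mres M U V x]"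
 "word_res M U V b = (word_res M U V xs)[i := Mres M U V x]"
 using ab by (simp_all add: map_update M.Mres_smult[OF U])
 show "(Ores X U V r, word_res M U V a, word_res M U V b):word_smult X n M V"
 unfolding eq using ab(4) M.words_res[OF U ab(3)] O.res_c[OF U ab(5)] M.M.res_c[OF U ab(6)]
 by blast
 next
 fix U V a b assume U: "opn U" "opn V" "V <= U" and "(a, b):word_sym sy n M U"
 thus "(word_res M U V a, word_res M U V b):word_sym sy n M V"
 using M.words_res[OF U] by (auto split: if_splits)
 qed
qed

context
 fixes M :: "('p, 'a, 'm) presheaf" and n :: nat and sy :: bool
 assumes M: "psh M"
begin

interpretation M: mpsh X M by unfold_locales (rule M)
interpretation T: rels_data X "word_gens n M" "word_res M" "word_add n M" "word_smult X n M" "word_sym sy n M"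
 by (rule word_rels[OF M])

lemma wpow_psh: "psh (wpw sy n M)"
 unfolding wpow_def by (rule T.shf_psh)

interpretation W: mpsh X "wpw sy n M" by unfold_locales (rule wpow_psh)

lemma wsct_c:
 "opn U ==> ss:wsec n M U ==>
 wsct X sy n M U ss:sec (wpw sy n M) U"
 unfolding wsct_def wpow_def by (rule T.gen_sec_c)

text \<open>Equality of words of germs is equality of finitely many germs; the neighbourhood is
  shrunk one letter at a time.\<close>

lemma stw_gm:
 assumes U: "opn U" "x:U" "ss:wsec n M U"
 shows "stw sy n M x (mg M x U ss) =
 gm (wpw sy n M) x U (wsct X sy n M U ss)"
proof -
 let ?P = "%T. EX V ss'. opn V & x:V & ss':wsec n M V &
 mg M x U ss = mg M x V ss' &
 T = gm (wpw sy n M) x V (wsct X sy n M V ss')"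
 have "?P (stw sy n M x (mg M x U ss))"
 unfolding stalk_word_def by (rule someI_ex) (use U in blast)
 then obtain V ss' where V: "opn V" "x:V" "ss':wsec n M V"
 "mg M x U ss = mg M x V ss'"
 and eq: "stw sy n M x (mg M x U ss) =
 gm (wpw sy n M) x V (wsct X sy n M V ss')"
 by (elim exE conjE)
 have len: "length ss = n" "length ss' = n" using U(3) V(3) by (auto simp: words_def)
 have "EX W. opn W & x:W & W <= U Int V & (!i<j. Mres M U W (ss ! i) = Mres M V W (ss' ! i))"
 if "j <= n" for j
 using that
 proof (induction j)
 case 0
 thus ?case using U V by (intro exI[of _ "U Int V"]) (auto intro: openin_Int)
 next
 case (Suc j)
 then obtain W where W: "opn W" "x:W" "W <= U Int V"
 "!i<j. Mres M U W (ss ! i) = Mres M V W (ss' ! i)" by auto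
 have c: "ss ! i:sec M U" "ss' ! i:sec M V" if "i < Suc j" for i
 using words_nth[OF U(3)] words_nth[OF V(3)] that Suc.prems by auto
 have "gm M x U (ss ! j) = gm M x V (ss' ! j)"
 using arg_cong[OF V(4), of "%xs. xs ! j"] len Suc.prems by simp
 then obtain W' where W': "opn W'" "x:W'" "W' <= U Int V" "Mres M U W' (ss ! j) = Mres M V W' (ss' ! j)"
 using M.gm_eq_iff[OF U(1,2) c(1)[OF lessI] V(1,2) c(2)[OF lessI]] by blast
 have o: "opn (W Int W')" by (rule openin_Int[OF W(1) W'(1)])
 have "Mres M U (W Int W') (ss ! i) = Mres M V (W Int W') (ss' ! i)" if i: "i < Suc j" for i
 proof (cases "i = j")
 case True
 have "Mres M U (W Int W') (ss ! i) = Mres M W' (W Int W') (Mres M U W' (ss ! i))"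
 using M.M.res_res[OF U(1) W'(1) o _ _ c(1)[OF i]] W'(3) by simp
 also have "\<dots> = Mres M V (W Int W') (ss' ! i)"
 unfolding True W'(4) using M.M.res_res[OF V(1) W'(1) o _ _ c(2)[OF lessI]] W'(3) by simp
 finally show ?thesis .
 next
 case False
 hence eq: "Mres M U W (ss ! i) = Mres M V W (ss' ! i)" using W(4) i by simp
 have "Mres M U (W Int W') (ss ! i) = Mres M W (W Int W') (Mres M U W (ss ! i))"
 using M.M.res_res[OF U(1) W(1) o _ _ c(1)[OF i]] W(3) by simp
 also have "\<dots> = Mres M V (W Int W') (ss' ! i)"
 unfolding eq using M.M.res_res[OF V(1) W(1) o _ _ c(2)[OF i]] W(3) by simp
 finally show ?thesis .
 qed
 thus ?case using o W W' by (intro exI[of _ "W Int W'"]) auto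
 qed
 from this[OF order.refl] obtain W where W: "opn W" "x:W" "W <= U" "W <= V"
 "!i<n. Mres M U W (ss ! i) = Mres M V W (ss' ! i)" by auto
 have m: "map (Mres M U W) ss = map (Mres M V W) ss'"
 using W(5) len by (intro nth_equalityI) auto
 have res: "Mres (wpw sy n M) U W (wsct X sy n M U ss) =
 wsct X sy n M W (map (Mres M U W) ss)"
 if "opn U" "W <= U" "ss:wsec n M U" for U ss
 using T.gen_sec_res[OF that(1) W(1) that(2,3)] by (simp add: wsct_def wpow_def)
 show ?thesis
 unfolding eq
 using res[OF U(1) W(3) U(3)] res[OF V(1) W(4) V(3)] m
 W.gm_res[OF U(1) W(1,3,2) wsct_c[OF U(1,3)]]
 W.gm_res[OF V(1) W(1,4,2) wsct_c[OF V(1,3)]]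
 by simp
qed

context
 fixes x assumes x: "x:pts"
begin

lemma stw_mlt:
 "mlin x n M (wpw sy n M) (stw sy n M x)"
proof -
 have closed: "stw sy n M x gs:stk (wpw sy n M) x"
 if gs: "gs:wstk n M x" for gs
 proof -
 obtain U ss where U: "opn U" "x:U" "U <= pts" "ss:wsec n M U"
 "gs = mg M x U ss"
 using gs openin_topspace x by (rule M.Mst_w_within)
 show ?thesis
 unfolding U(5) stw_gm[OF U(1,2,4)]
 by (rule W.gm_c[OF U(1,2) wsct_c[OF U(1,4)]])
 qed
 show ?thesis
 unfolding mlt_def
 proof (intro conjI ballI allI impI linI)
 show "stw sy n M x:wstk n M x \<rightarrow> stk (wpw sy n M) x"
 using closed by auto
 fix gs i assume gs: "gs:wstk n M x" and i: "i < n"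
 {
 fix G assume "G:stk M x"
 thus "stw sy n M x (gs[i := G]):stk (wpw sy n M) x"
 using closed w_update[OF gs] by blast
 }
 {
 fix G H assume "G:stk M x" "H:stk M x"
 hence "G # H # gs:wstk (Suc (Suc n)) M x" using gs by (simp add: w_Cons)
 then obtain U us where U: "opn U" "x:U" "U <= pts"
 "us:wsec (Suc (Suc n)) M U" "G # H # gs = mg M x U us"
 using openin_topspace x by (rule M.Mst_w_within)
 obtain s t ss where "us = s # t # ss" using U(5) by auto
 with U have s: "s:sec M U" "t:sec M U" "ss:wsec n M U"
 "G = gm M x U s" "H = gm M x U t" "gs = mg M x U ss"
 by (auto simp: w_Cons)
 interpret MU: module "OS U" "Msec M U" by (rule M.Msec_mod[OF U(1)])
 note wc = w_update[OF s(3)]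
 have add: "wsct X sy n M U (ss[i := s \<oplus>\<^sub>(Msec M U) t]) =
 wsct X sy n M U (ss[i := s]) \<oplus>\<^sub>(Msec (wpw sy n M) U) wsct X sy n M U (ss[i := t])"
 unfolding wsct_def wpow_def
 by (rule T.gen_sec_rels(1)[OF U(1)]) (use s i in blast)
 show "stw sy n M x (gs[i := G \<oplus>\<^sub>(Mst M x) H]) =
 stw sy n M x (gs[i := G]) \<oplus>\<^sub>(Mst (wpw sy n M) x) stw sy n M x (gs[i := H])"
 unfolding s(4,5,6) M.Mst_add[OF U(1,2) s(1,2)] map_update[symmetric]
 using wc s(1,2)
 by (simp add: stw_gm[OF U(1,2)] add W.Mst_add[OF U(1,2)] wsct_c[OF U(1)])
 }
 fix r G assume r: "r:ostk x" and G: "G:stk M x"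
 have "G # gs:wstk (Suc n) M x" using gs G by (simp add: w_Cons)
 from r r this x obtain U a b us where U: "opn U" "x:U" "a:osec U"
 "b:osec U" "us:wsec (Suc n) M U" "r = og x U a" "r = og x U b"
 "G # gs = mg M x U us"
 by (rule M.Mst_common)
 obtain s ss where "us = s # ss" using U(8) by auto
 with U have s: "s:sec M U" "ss:wsec n M U"
 "G = gm M x U s" "gs = mg M x U ss"
 by (auto simp: w_Cons)
 interpret MU: module "OS U" "Msec M U" by (rule M.Msec_mod[OF U(1)])
 note wc = w_update[OF s(2)]
 have sm: "wsct X sy n M U (ss[i := a \<odot>\<^sub>(Msec M U) s]) =
 a \<odot>\<^sub>(Msec (wpw sy n M) U) wsct X sy n M U (ss[i := s])"
 unfolding wsct_def wpow_def
 by (rule T.gen_sec_rels(2)[OF U(1)]) (use s i U(3) in blast)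
 show "stw sy n M x (gs[i := r \<odot>\<^sub>(Mst M x) G]) =
 r \<odot>\<^sub>(Mst (wpw sy n M) x) stw sy n M x (gs[i := G])"
 unfolding s(3,4) U(6) M.Mst_smult[OF U(1,2,3) s(1)] map_update[symmetric]
 using wc s(1) U(3)
 by (simp add: stw_gm[OF U(1,2)] sm W.Mst_smult[OF U(1,2)] wsct_c[OF U(1)])
 qed
qed

lemma stw_span:
 "stk (wpw sy n M) x = spn (wpw sy n M) x
 (stw sy n M x ` wstk n M x)" (is "_ = module_span _ _ ?S")
proof -
 interpret Tx: module "Ost x" "Mst (wpw sy n M) x" by (rule W.Mst_mod[OF x])
 have "?S <= stk (wpw sy n M) x"
 using mltD(1)[OF stw_mlt] by auto
 moreover have "{gm T.shf x U (T.gen_sec U b) | U b. opn U & x:U & b:word_gens n M U} <= ?S"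
 proof clarify
 fix U ss assume U: "opn U" "x:U" "ss:wsec n M U"
 have "gm T.shf x U (T.gen_sec U ss) = stw sy n M x (mg M x U ss)"
 using stw_gm[OF U] by (simp add: wsct_def wpow_def)
 thus "gm T.shf x U (T.gen_sec U ss):?S"
 using M.w_germ[OF U] by blast
 qed
 ultimately show ?thesis
 using T.shf_stalk_span[OF x, folded wpow_def] Tx.span_mono[of _ ?S] Tx.span_sub[of ?S]
 by (simp add: wpow_def subset_antisym)
qed

text \<open>Universal property of both kinds of powers at once: symmetry of \<open>g\<close> is
  demanded when \<open>sy\<close> holds, that is, for symmetric powers.\<close>

lemma stw_lift:
 assumes L: "module (Ost x) L" and g: "mlt (Ost x) n (Mst M x) L g"
 and s: "!!gs hs. sy ==> gs:wstk n M x ==> hs:wstk n M x ==>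
 mset gs = mset hs ==> g gs = g hs"
 shows "EX ph:lin (Ost x) (Mst (wpw sy n M) x) L.
 !gs:wstk n M x. ph (stw sy n M x gs) = g gs"
proof -
 have "EX ph:lin (Ost x) (Mst T.shf x) L. !U b. opn U --> x:U -->
 b:word_gens n M U --> ph (gm T.shf x U (T.gen_sec U b)) = g (mg M x U b)"
 proof (rule T.shf_stalk_lift_rels[OF x L])
 fix U b assume U: "opn U" "x:U" "b:word_gens n M U"
 thus "g (mg M x U b):cr L"
 using mltD(1)[OF g M.w_germ] by simp
 next
 fix U V b assume U: "opn U" "opn V" "V <= U" "x:V" "b:word_gens n M U"
 show "g (mg M x V (map (Mres M U V) b)) = g (mg M x U b)"
 unfolding M.map_germ_res[OF U] ..
 next
 fix U a b c assume U: "opn U" "x:U" and "(a, b, c):word_add n M U"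
 then obtain xs i s t where abc: "a = xs[i := s \<oplus>\<^sub>(Msec M U) t]" "b = xs[i := s]" "c = xs[i := t]"
 "xs:wsec n M U" "i < n" "s:sec M U" "t:sec M U" by auto
 show "g (mg M x U a) = g (mg M x U b) \<oplus>\<^sub>L g (mg M x U c)"
 unfolding abc(1-3) map_update M.Mst_add[OF U abc(6,7), symmetric]
 by (rule linD(2)[OF mltD(2)[OF g M.w_germ[OF U abc(4)] abc(5)]
 M.gm_c[OF U abc(6)] M.gm_c[OF U abc(7)]])
 next
 fix U r a b assume U: "opn U" "x:U" and "(r, a, b):word_smult X n M U"
 then obtain xs i s where ab: "a = xs[i := r \<odot>\<^sub>(Msec M U) s]" "b = xs[i := s]"
 "xs:wsec n M U" "i < n" "r:osec U" "s:sec M U" by auto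
 show "g (mg M x U a) = og x U r \<odot>\<^sub>L g (mg M x U b)"
 unfolding ab(1,2) map_update M.Mst_smult[OF U ab(5,6), symmetric]
 by (rule linD(3)[OF mltD(2)[OF g M.w_germ[OF U ab(3)] ab(4)]
 og_c[OF U ab(5)] M.gm_c[OF U ab(6)]])
 next
 fix U a b assume U: "opn U" "x:U" and "(a, b):word_sym sy n M U"
 hence ab: "sy" "a:wsec n M U" "b:wsec n M U" "mset a = mset b"
 by (auto split: if_splits)
 show "g (mg M x U a) = g (mg M x U b)"
 by (rule s[OF ab(1) M.w_germ[OF U ab(2)] M.w_germ[OF U ab(3)]]) (simp add: ab(4))
 qed
 then obtain ph where ph: "ph:lin (Ost x) (Mst T.shf x) L"
 "!U b. opn U --> x:U --> b:word_gens n M U -->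
 ph (gm T.shf x U (T.gen_sec U b)) = g (mg M x U b)" by blast
 have "ph (stw sy n M x gs) = g gs" if gs: "gs:wstk n M x" for gs
 proof -
 obtain U ss where U: "opn U" "x:U" "U <= pts" "ss:wsec n M U"
 "gs = mg M x U ss"
 using gs openin_topspace x by (rule M.Mst_w_within)
 show ?thesis unfolding U(5) stw_gm[OF U(1,2,4)]
 using ph(2) U(1,2,4) by (simp add: wsct_def wpow_def)
 qed
 with ph(1) show ?thesis unfolding wpow_def by blast
qed

end

end

end

section \<open>Global generation at a point\<close>

definition glob_span where
 "glob_span X M x = module_span (Ostalk X x) (Mstalk X M x)
 (Mgerm X M x (points X) ` cr (Msec M (points X)))"

definition gen_at where
 "gen_at X M x \<longleftrightarrow> glob_span X M x = cr (Mstalk X M x)"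

text \<open>The existence half of the sheaf axiom in terms of germs: a family of germs that is
  locally given by sections comes from a global section. In this form stalkwise maps can produce
  sections.\<close>

definition gluing where
 "gluing X M \<longleftrightarrow> (!f. (!x:points X. EX V s. openin (Top X) V & x:V & s:cr (Msec M V) &
 (!y:V. f y = Mgerm X M y V s)) -->
 (EX s:cr (Msec M (points X)). !x:points X. Mgerm X M x (points X) s = f x))"

abbreviation (in rspace) "gsp == glob_span X"
abbreviation (in rspace) "ggen == gen_at X"

lemma (in mpsh) sfy_gluing: "gluing X (sfy M)"
 unfolding gluing_def
proof (intro allI impI)
 fix f assume *: "!x:pts. EX V s. opn V & x:V & s:sec (sfy M) V &
 (!y:V. f y = gm (sfy M) y V s)"
 show "EX s:sec (sfy M) pts. !x:pts. gm (sfy M) x pts s = f x"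
 proof (rule sfy_glue[OF openin_topspace])
 fix x assume x: "x:pts"
 from bspec[OF * x] obtain V s where V: "opn V" "x:V" "s:sec (sfy M) V"
 "!y:V. f y = gm (sfy M) y V s" by (elim exE conjE)
 show "EX V s. opn V & x:V & V <= pts & s:sec (sfy M) V &
 (!y:V. f y = gm (sfy M) y V s)"
 by (intro exI conjI; (rule V | rule openin_points[OF V(1)]))
 qed
qed

context rspace
begin

lemma tns_gluing:
 assumes M: "psh M" and N: "psh N"
 shows "gluing X (tns M N)"
proof -
 interpret T: rels_data X "tns_gens M N" "tns_res M N" "tns_add M N" "tns_smult X M N" "%U. {}"
 by (rule tns_rels[OF M N])
 show ?thesis unfolding tns_sheaf_eq[OF M N] by (rule T.pre.sfy_gluing)
qed

end

context mpsh
begin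

lemma glob_germs_c:
 assumes x: "x:pts"
 shows "gm M x pts ` sec M pts <= stk M x"
 using gm_c[OF openin_topspace x] by auto

lemma gsp_sub:
 assumes x: "x:pts"
 shows "submodule (gsp M x) (Ost x) (Mst M x)"
proof -
 interpret Sx: module "Ost x" "Mst M x" by (rule Mst_mod[OF x])
 show ?thesis unfolding glob_span_def by (rule Sx.span_submod[OF glob_germs_c[OF x]])
qed

lemma gsp_base:
 assumes x: "x:pts" and s: "s:sec M pts"
 shows "gm M x pts s:gsp M x"
proof -
 interpret Sx: module "Ost x" "Mst M x" by (rule Mst_mod[OF x])
 show ?thesis unfolding glob_span_def by (rule Sx.span_base[OF imageI[OF s]])
qed

lemma gen_atI:
 assumes x: "x:pts" and "stk M x = spn M x S"
 and S: "!!s. s:S ==> s:gsp M x"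
 shows "ggen M x"
proof -
 interpret Sx: module "Ost x" "Mst M x" by (rule Mst_mod[OF x])
 have "spn M x S <= gsp M x"
 by (rule Sx.span_least[OF gsp_sub[OF x]]) (use S in auto)
 moreover have "gsp M x <= stk M x"
 by (rule Sx.submoduleE(1)[OF gsp_sub[OF x]])
 ultimately show ?thesis unfolding gen_at_def using assms(2) by auto
qed

end

subsection \<open>Locality of maps between stalks\<close>

text \<open>\<open>L\<close> is any family of linear maps of stalks. That it behaves like a morphism
  of sheaves is not assumed but tested germ by germ, by \<open>local_at\<close>.\<close>

locale psh_map = rspace X + D: mpsh X D + N: mpsh X N
 for X :: "('p, 'a) ringed" and D :: "('p, 'a, 'm) presheaf" and N :: "('p, 'a, 'n) presheaf" +
 fixes L
 assumes glue: "gluing X N"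
 and hom: "x:points X ==> L x:lin (Ostalk X x) (Mstalk X D x) (Mstalk X N x)"
begin

definition local_at where
 "local_at x G \<longleftrightarrow> (EX U s t. opn U & x:U & s:sec D U & t:sec N U &
 G = gm D x U s & (!z:U. L z (gm D z U s) = gm N z U t))"

lemma local_atE:
 assumes "local_at x G" "opn W" "x:W"
 obtains U s t where "opn U" "x:U" "U <= W" "s:sec D U" "t:sec N U"
 "G = gm D x U s" "!z:U. L z (gm D z U s) = gm N z U t"
proof -
 obtain U s t where U: "opn U" "x:U" "s:sec D U" "t:sec N U"
 "G = gm D x U s" "!z:U. L z (gm D z U s) = gm N z U t"
 using assms(1) unfolding local_at_def by blast
 let ?V = "U Int W"
 have V: "opn ?V" "?V <= U" "x:?V" using U assms by (auto intro: openin_Int)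
 show thesis
 proof (rule that[OF V(1,3) _ D.M.res_c[OF U(1) V(1,2) U(3)] N.M.res_c[OF U(1) V(1,2) U(4)]])
 show "G = gm D x ?V (Mres D U ?V s)"
 using D.gm_res[OF U(1) V U(3)] U(5) by simp
 show "!z:?V. L z (gm D z ?V (Mres D U ?V s)) = gm N z ?V (Mres N U ?V t)"
 using D.gm_res[OF U(1) V(1,2) _ U(3)] N.gm_res[OF U(1) V(1,2) _ U(4)] U(6) by simp
 qed auto
qed

lemma local_at_sct:
 assumes G: "local_at x G" and W: "opn W" "x:W" "s:sec D W" "G = gm D x W s"
 shows "EX V t. opn V & x:V & V <= W & t:sec N V &
 (!z:V. L z (gm D z W s) = gm N z V t)"
proof -
 obtain U s' t where U: "opn U" "x:U" "U <= W" "s':sec D U" "t:sec N U"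
 "G = gm D x U s'" "!z:U. L z (gm D z U s') = gm N z U t"
 using G W(1,2) by (rule local_atE)
 have "gm D x W s = gm D x U s'" using W(4) U(6) by simp
 then obtain V where V: "opn V" "x:V" "V <= W Int U" "Mres D W V s = Mres D U V s'"
 using D.gm_eq_iff[OF W(1-3) U(1,2,4)] by blast
 have VU: "V <= U" "V <= W" using V(3) by auto
 have "L z (gm D z W s) = gm N z V (Mres N U V t)" if z: "z:V" for z
 proof -
 have "gm D z W s = gm D z U s'"
 using D.gm_res[OF W(1) V(1) VU(2) z W(3)] D.gm_res[OF U(1) V(1) VU(1) z U(4)] V(4) by simp
 thus ?thesis using U(7) z VU(1) N.gm_res[OF U(1) V(1) VU(1) z U(5)] by auto
 qed
 thus ?thesis using V VU N.M.res_c[OF U(1) V(1) VU(1) U(5)] by blast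
qed

text \<open>Because of this, locality of \<open>L\<close> has to be checked on generators of the
  stalks only.\<close>

lemma local_at_submod:
 assumes x: "x:pts"
 shows "submodule {G:stk D x. local_at x G} (Ost x) (Mst D x)"
proof -
 interpret Dx: module "Ost x" "Mst D x" by (rule D.Mst_mod[OF x])
 have two: "two_mods (Ost z) (Mst D z) (Mst N z)" if "z:pts" for z
 using D.Mst_mod[OF that] N.Mst_mod[OF that] by (simp add: two_mods_def)
 note pm = points_mem
 show ?thesis
 proof (rule Dx.submod_if_c)
 interpret DX: module "OS pts" "Msec D pts" by (rule D.Msec_mod[OF openin_topspace])
 interpret NX: module "OS pts" "Msec N pts" by (rule N.Msec_mod[OF openin_topspace])
 have "local_at x \<zero>\<^sub>(Mst D x)"
 unfolding local_at_def
 proof (intro exI conjI ballI)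
 show "\<zero>\<^sub>(Mst D x) = gm D x pts \<zero>\<^sub>(Msec D pts)"
 by (rule D.Mst_zero[OF openin_topspace x])
 show "L z (gm D z pts \<zero>\<^sub>(Msec D pts)) = gm N z pts \<zero>\<^sub>(Msec N pts)"
 if z: "z:pts" for z
 unfolding D.Mst_zero[OF openin_topspace z, symmetric] N.Mst_zero[OF openin_topspace z, symmetric]
 by (rule two_mods.lin_zero[OF two[OF z] hom[OF z]])
 qed (use x in auto)
 thus "\<zero>\<^sub>(Mst D x):{G:stk D x. local_at x G}" by simp
 next
 fix G H assume "G:{G:stk D x. local_at x G}" "H:{G:stk D x. local_at x G}"
 hence G: "G:stk D x" "H:stk D x" "local_at x G" "local_at x H" by auto
 obtain W s1 t1 where W: "opn W" "x:W" "W <= pts" "s1:sec D W" "t1:sec N W"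
 "G = gm D x W s1" "!z:W. L z (gm D z W s1) = gm N z W t1"
 using G(3) openin_topspace x by (rule local_atE)
 obtain U s t where U: "opn U" "x:U" "U <= W" "s:sec D U" "t:sec N U"
 "H = gm D x U s" "!z:U. L z (gm D z U s) = gm N z U t"
 using G(4) W(1,2) by (rule local_atE)
 define s2 t2 where "s2 = Mres D W U s1" and "t2 = Mres N W U t1"
 have s2: "s2:sec D U" "t2:sec N U"
 unfolding s2_def t2_def by (rule D.M.res_c[OF W(1) U(1,3) W(4)] N.M.res_c[OF W(1) U(1,3) W(5)])+
 have g2: "gm D z U s2 = gm D z W s1" "gm N z U t2 = gm N z W t1" if "z:U" for z
 unfolding s2_def t2_def
 by (rule D.gm_res[OF W(1) U(1,3) that W(4)] N.gm_res[OF W(1) U(1,3) that W(5)])+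
 interpret DU: module "OS U" "Msec D U" by (rule D.Msec_mod[OF U(1)])
 interpret NU: module "OS U" "Msec N U" by (rule N.Msec_mod[OF U(1)])
 have "local_at x (G \<oplus>\<^sub>(Mst D x) H)"
 unfolding local_at_def
 proof (intro exI conjI ballI)
 show "G \<oplus>\<^sub>(Mst D x) H = gm D x U (s2 \<oplus>\<^sub>(Msec D U) s)"
 using D.Mst_add[OF U(1,2) s2(1) U(4)] g2(1)[OF U(2)] W(6) U(6) by simp
 show "L z (gm D z U (s2 \<oplus>\<^sub>(Msec D U) s)) = gm N z U (t2 \<oplus>\<^sub>(Msec N U) t)" if z: "z:U" for z
 unfolding D.Mst_add[OF U(1) z s2(1) U(4), symmetric] N.Mst_add[OF U(1) z s2(2) U(5), symmetric]
 linD(2)[OF hom[OF pm[OF U(1) z]] D.gm_c[OF U(1) z s2(1)] D.gm_c[OF U(1) z U(4)]]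
 using U(7) W(7) z U(3) g2[OF z] by auto
 qed (use U s2 in auto)
 thus "G \<oplus>\<^sub>(Mst D x) H:{G:stk D x. local_at x G}" using G by simp
 next
 fix r G assume r: "r:ostk x" and "G:{G:stk D x. local_at x G}"
 hence G: "G:stk D x" "local_at x G" by auto
 obtain W a where W: "opn W" "x:W" "a:osec W" "r = og x W a"
 using r by (rule OstalkE)
 obtain U s t where U: "opn U" "x:U" "U <= W" "s:sec D U" "t:sec N U"
 "G = gm D x U s" "!z:U. L z (gm D z U s) = gm N z U t"
 using G(2) W(1,2) by (rule local_atE)
 define b where "b = Ores X W U a"
 have b: "b:osec U" "r = og x U b"
 unfolding b_def W(4) using O.res_c[OF W(1) U(1,3) W(3)] og_res[OF W(1) U(1,3,2) W(3)] by auto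
 interpret DU: module "OS U" "Msec D U" by (rule D.Msec_mod[OF U(1)])
 interpret NU: module "OS U" "Msec N U" by (rule N.Msec_mod[OF U(1)])
 have "local_at x (r \<odot>\<^sub>(Mst D x) G)"
 unfolding local_at_def
 proof (intro exI conjI ballI)
 show "r \<odot>\<^sub>(Mst D x) G = gm D x U (b \<odot>\<^sub>(Msec D U) s)"
 using D.Mst_smult[OF U(1,2) b(1) U(4)] U(6) b(2) by simp
 show "L z (gm D z U (b \<odot>\<^sub>(Msec D U) s)) = gm N z U (b \<odot>\<^sub>(Msec N U) t)" if z: "z:U" for z
 unfolding D.Mst_smult[OF U(1) z b(1) U(4), symmetric] N.Mst_smult[OF U(1) z b(1) U(5), symmetric]
 linD(3)[OF hom[OF pm[OF U(1) z]] og_c[OF U(1) z b(1)] D.gm_c[OF U(1) z U(4)]]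
 using U(7) z by simp
 qed (use U b in auto)
 thus "r \<odot>\<^sub>(Mst D x) G:{G:stk D x. local_at x G}" using G r by simp
 qed auto
qed

text \<open>The images of the germs of a global section are locally given by sections, hence glue to
  a global section of \<open>N\<close>. The hypotheses concern all points although the claim is
  about \<open>x\<close>, since gluing takes place on the whole space.\<close>

lemma map_glob_span:
 assumes span: "!!x. x:pts ==> stk D x = spn D x (P x)"
 and P: "!!x. x:pts ==> P x <= stk D x"
 and loc: "!!x G. x:pts ==> G:P x ==> local_at x G"
 and x: "x:pts" and G: "G:gsp D x"
 shows "L x G:gsp N x"
proof -
 have all: "local_at x G" if x: "x:pts" and G: "G:stk D x" for x G
 proof -
 interpret Dx: module "Ost x" "Mst D x" by (rule D.Mst_mod[OF x])
 have "spn D x (P x) <= {G:stk D x. local_at x G}"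
 by (rule Dx.span_least[OF local_at_submod[OF x]]) (use P[OF x] loc[OF x] in auto)
 thus ?thesis using G span[OF x] by auto
 qed
 have base: "L x (gm D x pts s):gsp N x" if s: "s:sec D pts" for s
 proof -
 have "EX t:sec N pts. !x:pts. gm N x pts t = L x (gm D x pts s)"
 proof (rule glue[unfolded gluing_def, rule_format])
 fix y assume y: "y:pts"
 show "EX V t. opn V & y:V & t:sec N V &
 (!z:V. L z (gm D z pts s) = gm N z V t)"
 using local_at_sct[OF all[OF y D.gm_c[OF openin_topspace y s]] openin_topspace y s refl]
 by blast
 qed
 then obtain t where "t:sec N pts"
 "gm N x pts t = L x (gm D x pts s)" using x by blast
 thus ?thesis using N.gsp_base[OF x] by metis
 qed
 interpret two_mods "Ost x" "Mst D x" "Mst N x"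
 using D.Mst_mod[OF x] N.Mst_mod[OF x] by (simp add: two_mods_def)
 show ?thesis
 by (rule lin_span[OF hom[OF x] N.gsp_sub[OF x] D.glob_germs_c[OF x] _
 G[unfolded glob_span_def]]) (use base in auto)
qed

end

section \<open>Twisted tensor powers\<close>

lemma mlt_compose:
 assumes "mlt R n M N g" "ph:lin R N L"
 shows "mlt R n M L (%xs. ph (g xs))"
 unfolding mlt_def
proof (intro conjI ballI allI impI)
 show "(%xs. ph (g xs)):words n M \<rightarrow> cr L"
 using mltD(1)[OF assms(1)] linD(1)[OF assms(2)] by auto
 show "(%x. ph (g (xs[i := x]))):lin R M L" if "xs:words n M" "i < n" for xs i
 by (rule lin_compose[OF mltD(2)[OF assms(1) that] assms(2)])
qed

lemma bilinearD:
 assumes "bilinear R L M N b"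
 shows "x:cr L ==> b x:lin R M N"
 and "y:cr M ==> (%x. b x y):lin R L N"
 and "x:cr L ==> y:cr M ==> b x y:cr N"
 using assms linD(1) unfolding bilinear_def by fastforce+

lemma bil_span_subset:
 assumes L: "module R L" and M: "module R M" and N: "module R N" and b: "bilinear R L M N b"
 and S: "S <= cr L" "cr L = module_span R L S"
 and T: "T <= cr M" "cr M = module_span R M T"
 and H: "submodule H R N" and base: "!!x y. x:S ==> y:T ==> b x y:H"
 and x: "x:cr L" and y: "y:cr M"
 shows "b x y:H"
proof -
 interpret LN: two_mods R L N using L N by (simp add: two_mods_def)
 interpret MN: two_mods R M N using M N by (simp add: two_mods_def)
 have y': "y:module_span R M T" using y T(2) by simp
 have x': "x:module_span R L S" using x S(2) by simp
 show ?thesis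
 proof (rule LN.lin_span[OF bilinearD(2)[OF b y] H S(1) _ x'])
 fix s assume s: "s:S"
 hence "s:cr L" using S(1) by blast
 from bilinearD(1)[OF b this] H T(1) show "b s y:H"
 by (rule MN.lin_span[OF _ _ _ _ y']) (rule base[OF s])
 qed
qed

lemma mlt_finsum:
 assumes "module R M" "module R N" "finite A" and f: "!!i. i:A ==> mlt R n M N (f i)"
 shows "mlt R n M N (%xs. finsum N (%i. f i xs) A)"
proof -
 interpret two_mods R M N using assms(1,2) by (simp add: two_mods_def)
 show ?thesis
 unfolding mlt_def
 proof (intro conjI ballI allI impI)
 show "(%xs. finsum N (%i. f i xs) A):words n M \<rightarrow> cr N"
 using mltD(1)[OF f] by (auto intro!: N.M.finsum_closed)
 show "(%x. finsum N (%i. f i (xs[j := x])) A):lin R M N" if "xs:words n M" "j < n" for xs j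
 by (rule lin_finsum[OF assms(3)]) (rule mltD(2)[OF f that])
 qed
qed

section \<open>Permuting and splitting the arguments of multilinear maps\<close>

lemma perm_w:
 assumes "si permutes {..<n}" "xs:words n M" shows "permute_list si xs:words n M"
 using assms by (auto simp: words_def)

lemma perm_list_update:
 assumes si: "si permutes {..<length xs}" and i: "i < length xs"
 shows "permute_list si (xs[i := x]) = (permute_list si xs)[inv_into UNIV si i := x]"
proof (rule nth_equalityI)
 fix j assume "j < length (permute_list si (xs[i := x]))"
 hence j: "j < length xs" by simp
 have sij: "si j < length xs" using permutes_in_image[OF si, of j] j by simp
 have "si j = i \<longleftrightarrow> j = inv_into UNIV si i" using permutes_inverses[OF si] by metis
 thus "permute_list si (xs[i := x]) ! j = (permute_list si xs)[inv_into UNIV si i := x] ! j"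
 using si sij i j by (auto simp: permute_list_nth nth_list_update_if)
qed simp

lemma mlt_perm:
 assumes g: "mlt R n M N g" and si: "si permutes {..<n}"
 shows "mlt R n M N (%xs. g (permute_list si xs))"
 unfolding mlt_def
proof (intro conjI ballI allI impI)
 show "(%xs. g (permute_list si xs)):words n M \<rightarrow> cr N"
 using mltD(1)[OF g perm_w[OF si]] by auto
 fix xs i assume xs: "xs:words n M" and i: "i < n"
 have len: "length xs = n" using xs by (simp add: words_def)
 have "inv_into UNIV si i < n" using permutes_in_image[OF permutes_inv[OF si], of i] i by simp
 from mltD(2)[OF g perm_w[OF si xs] this]
 show "(%x. g (permute_list si (xs[i := x]))):lin R M N"
 using perm_list_update[of si xs i] si i len by simp
qed

lemma mlt_append1:
 assumes g: "mlt R (m + n) M N g" and ys: "ys:words n M"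
 shows "mlt R m M N (%xs. g (xs @ ys))"
 unfolding mlt_def
proof (intro conjI ballI allI impI)
 show "(%xs. g (xs @ ys)):words m M \<rightarrow> cr N"
 using mltD(1)[OF g w_append[OF _ ys]] by auto
 fix xs i assume xs: "xs:words m M" and i: "i < m"
 hence "length xs = m" by (simp add: words_def)
 with mltD(2)[OF g w_append[OF xs ys], of i] i
 show "(%x. g (xs[i := x] @ ys)):lin R M N" by (simp add: list_update_append)
qed

lemma mlt_append2:
 assumes g: "mlt R (m + n) M N g" and xs: "xs:words m M"
 shows "mlt R n M N (%ys. g (xs @ ys))"
 unfolding mlt_def
proof (intro conjI ballI allI impI)
 show "(%ys. g (xs @ ys)):words n M \<rightarrow> cr N"
 using mltD(1)[OF g w_append[OF xs]] by auto
 fix ys i assume ys: "ys:words n M" and i: "i < n"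
 have "length xs = m" using xs by (simp add: words_def)
 with mltD(2)[OF g w_append[OF xs ys], of "m + i"] i
 show "(%x. g (xs @ ys[i := x])):lin R M N" by (simp add: list_update_append)
qed

lemma words_0 [simp]: "words 0 M = {[]}"
 by (auto simp: words_def)

lemma mlt_0: "g []:cr N ==> mlt R 0 M N g"
 by (simp add: mlt_def)

subsection \<open>Systems of local generators\<close>

abbreviation (in rspace) loc where
 "loc M U f == EX s:sec M U. !z:U. f z = gm M z U s"

text \<open>\<open>I z\<close> indexes generators \<open>\<gamma> z\<close> of the stalk at \<open>z\<close>, and \<open>J U\<close> consists of the families of indices
 over \<open>U\<close> for which the corresponding generators are the germs of a section.\<close>

locale generators = mpsh X D for X :: "('p, 'a) ringed" and D :: "('p, 'a, 'm) presheaf" +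
 fixes I :: "'p => 'i set" and J :: "'p set => ('p => 'i) set" and ga :: "'p => 'i => ('p set \<times> 'm) set"
 assumes closed: "z:pts ==> ga z ` I z <= stk D z"
 and span: "z:pts ==> stk D z = spn D z (ga z ` I z)"
 and index: "opn W ==> z:W ==> i:I z ==> EX U j. opn U & z:U & U <= W & j:J U & i = j z"
 and index_c: "opn U ==> j:J U ==> z:U ==> j z:I z"
 and local: "opn U ==> j:J U ==> loc D U (%z. ga z (j z))"
 and index_res: "opn U ==> opn V ==> V <= U ==> j:J U ==> j:J V"

context rspace
begin

text \<open>The workhorse: a prescription \<open>h\<close> on indexed generators that extends
  linearly to each stalk of \<open>D\<close> and sends local families to local families carries
  spans of global germs into such spans. The extensions at different points are picked
  independently.\<close>

theorem transfer_glob: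
 assumes D: "generators X D I J ga" and N: "psh N" "gluing X N"
 and lift: "!!z. z:pts ==> EX L:shom z D N. !i:I z. L (ga z i) = h z i"
 and h: "!!U j. opn U ==> j:J U ==> loc N U (%z. h z (j z))"
 and x: "x:pts" and i: "i:I x" and G: "ga x i:gsp D x"
 shows "h x i:gsp N x"
proof -
 have "!z. EX L. z:pts --> L:shom z D N & (!i:I z. L (ga z i) = h z i)" using lift by blast
 from choice[OF this] obtain L where L: "!z. z:pts --> L z:shom z D N & (!i:I z. L z (ga z i) = h z i)" ..
 interpret D: generators X D I J ga by (rule D)
 interpret N: mpsh X N by unfold_locales (rule N(1))
 interpret L: psh_map X D N L by unfold_locales (use L N in auto)
 have "L x (ga x i):gsp N x"
 proof (rule L.map_glob_span[OF D.span D.closed _ x G])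
 fix z H assume z: "z:pts" and "H:ga z ` I z"
 then obtain k where k: "k:I z" "H = ga z k" by blast
 from D.index[OF openin_topspace z k(1)] obtain U j where U: "opn U" "z:U" "j:J U" "k = j z" by blast
 obtain s where s: "s:sec D U" "!z:U. ga z (j z) = gm D z U s" using D.local[OF U(1,3)] by blast
 obtain t where t: "t:sec N U" "!z:U. h z (j z) = gm N z U t" using h[OF U(1,3)] by blast
 have "L y (gm D y U s) = gm N y U t" if y: "y:U" for y
 using L points_mem[OF U(1) y] D.index_c[OF U(1,3) y] s(2)[rule_format, OF y, symmetric] t(2)[rule_format, OF y] by simp
 thus "L.local_at z H" unfolding L.local_at_def using U s t k(2) by blast
 qed
 thus ?thesis using L x i by simp
qed

text \<open>The tensor product of two global sections is a global section; the spans follow by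
  linearity in each factor.\<close>

lemma glob_tns:
 assumes M: "psh M" and N: "psh N" and x: "x:pts" and p: "p:gsp M x" and q: "q:gsp N x"
 shows "stn M N x p q:gsp (tns M N) x"
proof -
 interpret M: mpsh X M by unfold_locales (rule M)
 interpret N: mpsh X N by unfold_locales (rule N)
 interpret T: mpsh X "tns M N" by unfold_locales (rule tns_psh[OF M N])
 note bil = stn_bil[OF M N x]
 note MT = two_mods.intro[OF M.Mst_mod[OF x] T.Mst_mod[OF x]]
 note NT = two_mods.intro[OF N.Mst_mod[OF x] T.Mst_mod[OF x]]
 have b: "stn M N x (gm M x pts s) (gm N x pts t):gsp (tns M N) x" if "s:sec M pts" "t:sec N pts" for s t
 unfolding stn_gm[OF M N openin_topspace x that]
 by (rule T.gsp_base[OF x tsec_c[OF M N openin_topspace that]])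
 note sub = T.gsp_sub[OF x] and germs = M.glob_germs_c[OF x]
 have q': "q:stk N x" using module.submoduleE(1)[OF N.Mst_mod[OF x] N.gsp_sub[OF x]] q by blast
 have "stn M N x G q:gsp (tns M N) x" if G: "G:gm M x pts ` sec M pts" for G
 using bilinearD(1)[OF bil subsetD[OF germs G]] sub N.glob_germs_c[OF x] _ q[unfolded glob_span_def]
 by (rule two_mods.lin_span[OF NT]) (use b G in auto)
 thus ?thesis
 by (rule two_mods.lin_span[OF MT bilinearD(2)[OF bil q'] sub germs _ p[unfolded glob_span_def]])
qed

lemma tns_generators_lift:
 assumes D: "generators X D I J ga" and E: "generators X E K L de" and z: "z:pts" and N: "module (Ost z) N"
 and h1: "!!k. k:K z ==> EX ph:lin (Ost z) (Mst D z) N. !i:I z. ph (ga z i) = h i k"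
 and h2: "!!i. i:I z ==> EX ph:lin (Ost z) (Mst E z) N. !k:K z. ph (de z k) = h i k"
 shows "EX ph:lin (Ost z) (Mst (tns D E) z) N. !i:I z. !k:K z. ph (stn D E z (ga z i) (de z k)) = h i k"
proof -
 interpret D: generators X D I J ga by (rule D)
 interpret E: generators X E K L de by (rule E)
 note c = D.closed[OF z] E.closed[OF z]
 obtain G where G: "bilinear (Ost z) (Mst D z) (Mst E z) N G" "!i:I z. !k:K z. G (ga z i) (de z k) = h i k"
 using bil_extension[OF D.Mst_mod[OF z] E.Mst_mod[OF z] N D.span[OF z] c(1) E.span[OF z] c(2) h1 h2]
 unfolding bilinear_def by blast
 from stn_lift[OF D.psheaf E.psheaf z N G(1)] obtain ph
 where ph: "ph:lin (Ost z) (Mst (tns D E) z) N" "!F:stk D z. !H:stk E z. ph (stn D E z F H) = G F H" by blast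
 show ?thesis by (intro bexI[OF _ ph(1)] ballI) (use ph(2) G(2) c in \<open>simp add: image_subset_iff\<close>)
qed

lemma gens_tns:
 assumes D: "generators X D I J ga" and E: "generators X E K L de"
 shows "generators X (tns D E) (%z. I z \<times> K z) (%U. {p. fst \<circ> p:J U & snd \<circ> p:L U})
 (%z (i, k). stn D E z (ga z i) (de z k))" (is "generators X ?T _ ?J ?g")
proof -
 interpret D: generators X D I J ga by (rule D)
 interpret E: generators X E K L de by (rule E)
 note psh = D.psheaf E.psheaf
 interpret T: mpsh X ?T by unfold_locales (rule tns_psh[OF psh])
 show ?thesis
 proof
 fix z assume z: "z:pts"
 note bil = stn_bil[OF psh z]
 note c = D.closed[OF z] E.closed[OF z]
 interpret Tz: module "Ost z" "Mst ?T z" by (rule T.Mst_mod[OF z])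
 let ?S = "?g z ` (I z \<times> K z)"
 show sub: "?S <= stk ?T z" using c bilinearD(3)[OF bil] by auto
 have "stn D E z F H:spn ?T z ?S" if "F:stk D z" "H:stk E z" for F H
 by (rule bil_span_subset[OF D.Mst_mod[OF z] E.Mst_mod[OF z] Tz.module_axioms bil
 c(1) D.span[OF z] c(2) E.span[OF z] Tz.span_submod[OF sub] _ that])
 (auto intro!: Tz.span_base)
 hence "{stn D E z F H | F H. F:stk D z & H:stk E z} <= spn ?T z ?S" by blast
 from Tz.span_least[OF Tz.span_submod[OF sub] this]
 show "stk ?T z = spn ?T z ?S"
 unfolding stn_span[OF psh z, symmetric] using Tz.span_sub[OF sub] by (rule subset_antisym)
next
 fix U j assume U: "opn U" and "j:?J U"
 hence j: "fst \<circ> j:J U" "snd \<circ> j:L U" by auto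
 show "j z:I z \<times> K z" if "z:U" for z
 using D.index_c[OF U j(1) that] E.index_c[OF U j(2) that] by (simp add: mem_Times_iff)
 obtain s t where "s:sec D U" "!z:U. ga z (fst (j z)) = gm D z U s" "t:sec E U" "!z:U. de z (snd (j z)) = gm E z U t"
 using D.local[OF U j(1)] E.local[OF U j(2)] by auto
 note st = this
 show "loc ?T U (%z. ?g z (j z))"
 by (intro bexI[OF _ tsec_c[OF psh U st(1,3)]] ballI)
 (use st stn_gm[OF psh U _ st(1,3)] in \<open>simp add: case_prod_beta\<close>)
next
 fix W z p assume W: "opn W" "z:W" and p: "p:I z \<times> K z"
 then obtain i k where ik: "p = (i, k)" "i:I z" "k:K z" by auto
 obtain V j where V: "opn V" "z:V" "V <= W" "j:J V" "i = j z" using D.index[OF W ik(2)] by blast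
 obtain U l where U: "opn U" "z:U" "U <= V" "l:L U" "k = l z" using E.index[OF V(1,2) ik(3)] by blast
 show "EX U j. opn U & z:U & U <= W & j:?J U & p = j z"
 by (rule exI[of _ U], rule exI[of _ "%z. (j z, l z)"])
 (use U V D.index_res[OF V(1) U(1,3) V(4)] ik(1) in \<open>simp add: comp_def\<close>)
next
 fix U V j assume "opn U" "opn V" "V <= U" "j:?J U"
 thus "j:?J V" using D.index_res E.index_res by blast
qed
qed

lemma gens_word:
 assumes M: "psh M"
 shows "generators X (wpw sy n M) (wstk n M) (%U. {j. EX ss:wsec n M U. !z:U. j z = mg M z U ss}) (stw sy n M)"
 (is "generators X ?T ?I ?J ?g")
proof -
 interpret M: mpsh X M by unfold_locales (rule M)
 interpret T: mpsh X ?T by unfold_locales (rule wpow_psh[OF M])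
 show ?thesis
 proof
 show "?g z ` ?I z <= stk ?T z" "stk ?T z = spn ?T z (?g z ` ?I z)" if z: "z:pts" for z
 using mltD(1)[OF stw_mlt[OF M z]] stw_span[OF M z] by blast+
 show "EX U j. opn U & z:U & U <= W & j:?J U & i = j z" if W: "opn W" "z:W" and i: "i:?I z" for W z i
 proof -
 obtain U ss where U: "opn U" "z:U" "U <= W" "ss:wsec n M U" "i = mg M z U ss"
 using i W by (rule M.Mst_w_within)
 show ?thesis by (rule exI[of _ U], rule exI[of _ "%z. mg M z U ss"]) (use U in auto)
 qed
 fix U j assume U: "opn U" and "j:?J U"
 then obtain ss where ss: "ss:wsec n M U" "!z:U. j z = mg M z U ss" by blast
 show "j z:?I z" if "z:U" for z using ss(2) that M.w_germ[OF U that ss(1)] by simp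
 show "loc ?T U (%z. ?g z (j z))"
 by (rule bexI[OF _ wsct_c[OF M U ss(1)]]) (use ss stw_gm[OF M U _ ss(1)] in simp)
 fix V assume V: "opn V" "V <= U"
 show "j:?J V"
 by (rule CollectI, rule bexI[OF _ M.words_res[OF U V ss(1)]]) (use V ss M.map_germ_res[OF U V _ ss(1)] in auto)
qed
qed

end

text \<open>The bundle \<open>T^N V\<close> twisted by \<open>T^n C\<close>. Tensor powers are used
  in place of symmetric ones so that words can be concatenated, permuted and paired off freely;
  \<open>C\<close> will be the ample bundle or its dual.\<close>

abbreviation twisted where
 "twisted X N V n C == tensor_sheaf X (wpow X False N V) (wpow X False n C)"

definition pure_tensor where
 "pure_tensor X N V n C x es cs = stalk_tensor X (wpow X False N V) (wpow X False n C) x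
 (stalk_word X False N V x es) (stalk_word X False n C x cs)"

abbreviation (in rspace) twd where "twd N V n C == twisted X N V n C"
abbreviation (in rspace) "ptn == pure_tensor X"

context rspace
begin

context
 fixes V :: "('p, 'a, 'v) presheaf" and C :: "('p, 'a, 'c) presheaf" and N n :: nat
 assumes V: "psh V" and C: "psh C"
begin

interpretation V: mpsh X V by unfold_locales (rule V)
interpretation C: mpsh X C by unfold_locales (rule C)

lemma twisted_psh: "psh (twd N V n C)"
 by (rule tns_psh[OF wpow_psh[OF V] wpow_psh[OF C]])

lemma twisted_gluing: "gluing X (twd N V n C)"
 by (rule tns_gluing[OF wpow_psh[OF V] wpow_psh[OF C]])

interpretation T: mpsh X "twd N V n C" by unfold_locales (rule twisted_psh)

definition psec where
 "psec U es cs = tsec X (tpw N V) (tpw n C) U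
 (wsct X False N V U es) (wsct X False n C U cs)"

lemma psec_c:
 "opn U ==> es:wsec N V U ==> cs:wsec n C U ==>
 psec U es cs:sec (twd N V n C) U"
 unfolding psec_def
 by (rule tsec_c[OF wpow_psh[OF V] wpow_psh[OF C] _
 wsct_c[OF V] wsct_c[OF C]])

lemma ptn_germ:
 assumes U: "opn U" "x:U" "es:wsec N V U" "cs:wsec n C U"
 shows "ptn N V n C x (mg V x U es) (mg C x U cs) =
 gm (twd N V n C) x U (psec U es cs)"
 unfolding pure_tensor_def psec_def stw_gm[OF V U(1,2,3)] stw_gm[OF C U(1,2,4)]
 by (rule stn_gm[OF wpow_psh[OF V] wpow_psh[OF C] U(1,2)
 wsct_c[OF V U(1,3)] wsct_c[OF C U(1,4)]])

context
 fixes x assumes x: "x:pts"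
begin

lemma ptn_mlt:
 shows "cs:wstk n C x ==>
 mlin x N V (twd N V n C) (%es. ptn N V n C x es cs)"
 and "es:wstk N V x ==>
 mlin x n C (twd N V n C) (ptn N V n C x es)"
proof -
 note bil = stn_bil[OF wpow_psh[OF V] wpow_psh[OF C] x, of False N False n]
 note mV = stw_mlt[OF V x, of N False]
 note mC = stw_mlt[OF C x, of n False]
 show "mlin x N V (twd N V n C) (%es. ptn N V n C x es cs)"
 if "cs:wstk n C x"
 unfolding pure_tensor_def
 by (rule mlt_compose[OF mV bilinearD(2)[OF bil mltD(1)[OF mC that]]])
 show "mlin x n C (twd N V n C) (ptn N V n C x es)"
 if "es:wstk N V x"
 unfolding pure_tensor_def[abs_def]
 by (rule mlt_compose[OF mC bilinearD(1)[OF bil mltD(1)[OF mV that]]])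
qed

lemma ptn_c:
 "es:wstk N V x ==> cs:wstk n C x ==>
 ptn N V n C x es cs:stk (twd N V n C) x"
 using mltD(1)[OF ptn_mlt(2)] .

end

end

subsection \<open>Products of global sections\<close>

lemma gens_twisted:
 assumes V: "psh V" and C: "psh C"
 shows "generators X (twd N V n C) (%z. wstk N V z \<times> wstk n C z)
 (%U. {p. (EX ss:wsec N V U. !z:U. fst (p z) = mg V z U ss) & (EX ss:wsec n C U. !z:U. snd (p z) = mg C z U ss)})
 (%z (es, cs). ptn N V n C z es cs)"
 using gens_tns[OF gens_word[OF V] gens_word[OF C], of False N False n] by (simp add: pure_tensor_def)

text \<open>Two pure tensors that are combinations of global sections may be fed into any operation
  \<open>g\<close> that is linear in each letter of the four words and takes sections to sections.
  Concatenation, permutation, contraction and the product of \<open>E\<close> with \<open>F\<close>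
  are all instances.\<close>

theorem twisted_product:
 assumes V: "psh V" and C: "psh C"
 and V': "psh V'" and C': "psh C'"
 and T: "psh T" and glue: "gluing X T"
 and g1: "!!z cs fs ds. z:pts ==> cs:wstk n C z ==> fs:wstk N' V' z ==>
 ds:wstk n' C' z ==> mlin z N V T (%es. g z es cs fs ds)"
 and g2: "!!z es fs ds. z:pts ==> es:wstk N V z ==> fs:wstk N' V' z ==>
 ds:wstk n' C' z ==> mlin z n C T (%cs. g z es cs fs ds)"
 and g3: "!!z es cs ds. z:pts ==> es:wstk N V z ==> cs:wstk n C z ==>
 ds:wstk n' C' z ==> mlin z N' V' T (%fs. g z es cs fs ds)"
 and g4: "!!z es cs fs. z:pts ==> es:wstk N V z ==> cs:wstk n C z ==>
 fs:wstk N' V' z ==> mlin z n' C' T (%ds. g z es cs fs ds)"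
 and loc: "!!U es cs fs ds. opn U ==> es:wsec N V U ==> cs:wsec n C U ==>
 fs:wsec N' V' U ==> ds:wsec n' C' U ==>
 EX t:sec T U. !z:U. g z (mg V z U es) (mg C z U cs)
 (mg V' z U fs) (mg C' z U ds) = gm T z U t"
 and x: "x:pts"
 and es: "es:wstk N V x" and cs: "cs:wstk n C x"
 and fs: "fs:wstk N' V' x" and ds: "ds:wstk n' C' x"
 and p: "ptn N V n C x es cs:gsp (twd N V n C) x"
 and q: "ptn N' V' n' C' x fs ds:gsp (twd N' V' n' C') x"
 shows "g x es cs fs ds:gsp T x"
proof -
 let ?D = "twd N V n C" and ?E = "twd N' V' n' C'"
 note D = gens_twisted[OF V C, of N n] and E = gens_twisted[OF V' C', of N' n']
 interpret T: mpsh X T by unfold_locales (rule T)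
 let ?h = "%z ((es, cs), (fs, ds)). g z es cs fs ds"
 have "?h x ((es, cs), (fs, ds)):gsp T x"
 proof (rule transfer_glob[OF gens_tns[OF D E] T glue _ _ x])
 show "((es, cs), (fs, ds)):(wstk N V x \<times> wstk n C x) \<times> (wstk N' V' x \<times> wstk n' C' x)"
 using es cs fs ds by simp
 show "(%(i, k). stn ?D ?E x ((%(es, cs). ptn N V n C x es cs) i) ((%(es, cs). ptn N' V' n' C' x es cs) k))
 ((es, cs), (fs, ds)):gsp (tns ?D ?E) x"
 using glob_tns[OF twisted_psh[OF V C] twisted_psh[OF V' C'] x p q] by simp
 next
 fix z assume z: "z:pts"
 note Tz = T.Mst_mod[OF z]
 have "EX ph:shom z (tns ?D ?E) T. !i:wstk N V z \<times> wstk n C z. !k:wstk N' V' z \<times> wstk n' C' z.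
 ph (stn ?D ?E z ((%(es, cs). ptn N V n C z es cs) i) ((%(es, cs). ptn N' V' n' C' z es cs) k)) = ?h z (i, k)"
 proof (rule tns_generators_lift[OF D E z Tz])
 fix k assume "k:wstk N' V' z \<times> wstk n' C' z"
 then obtain fs ds where k: "k = (fs, ds)" "fs:wstk N' V' z" "ds:wstk n' C' z" by auto
 have "EX ph:shom z ?D T. !es:wstk N V z. !cs:wstk n C z. ph (ptn N V n C z es cs) = g z es cs fs ds"
 unfolding pure_tensor_def
 by (rule tns_generators_lift[OF gens_word[OF V] gens_word[OF C] z Tz]; rule stw_lift[OF _ z Tz])
 (simp_all add: V C g1[OF z _ k(2,3)] g2[OF z _ k(2,3)])
 thus "EX ph:shom z ?D T. !i:wstk N V z \<times> wstk n C z. ph ((%(es, cs). ptn N V n C z es cs) i) = ?h z (i, k)"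
 by (auto simp: k(1) elim!: bexI[rotated])
 next
 fix i assume "i:wstk N V z \<times> wstk n C z"
 then obtain es cs where i: "i = (es, cs)" "es:wstk N V z" "cs:wstk n C z" by auto
 have "EX ph:shom z ?E T. !fs:wstk N' V' z. !ds:wstk n' C' z. ph (ptn N' V' n' C' z fs ds) = g z es cs fs ds"
 unfolding pure_tensor_def
 by (rule tns_generators_lift[OF gens_word[OF V'] gens_word[OF C'] z Tz]; rule stw_lift[OF _ z Tz])
 (simp_all add: V' C' g3[OF z i(2,3)] g4[OF z i(2,3)])
 thus "EX ph:shom z ?E T. !k:wstk N' V' z \<times> wstk n' C' z. ph ((%(es, cs). ptn N' V' n' C' z es cs) k) = ?h z (i, k)"
 by (auto simp: i(1) elim!: bexI[rotated])
 qed
 thus "EX L:shom z (tns ?D ?E) T. !i:(wstk N V z \<times> wstk n C z) \<times> (wstk N' V' z \<times> wstk n' C' z).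
 L ((%(i, k). stn ?D ?E z ((%(es, cs). ptn N V n C z es cs) i) ((%(es, cs). ptn N' V' n' C' z es cs) k)) i) = ?h z i"
 by (auto elim!: bexI[rotated])
 next
 fix U p assume U: "opn U" and "p:{p. fst \<circ> p:{p. (EX ss:wsec N V U. !z:U. fst (p z) = mg V z U ss) &
 (EX ss:wsec n C U. !z:U. snd (p z) = mg C z U ss)} & snd \<circ> p:{p. (EX ss:wsec N' V' U. !z:U. fst (p z) = mg V' z U ss) &
 (EX ss:wsec n' C' U. !z:U. snd (p z) = mg C' z U ss)}}"
 then obtain as bs cs ds where w: "as:wsec N V U" "bs:wsec n C U" "cs:wsec N' V' U" "ds:wsec n' C' U"
 and e: "!z:U. fst (fst (p z)) = mg V z U as" "!z:U. snd (fst (p z)) = mg C z U bs"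
 "!z:U. fst (snd (p z)) = mg V' z U cs" "!z:U. snd (snd (p z)) = mg C' z U ds" by auto
 show "loc T U (%z. ?h z (p z))" using loc[OF U w] e by (simp add: case_prod_beta)
 qed
 thus ?thesis by simp
qed

lemma ptn_append:
 assumes V: "psh V" and C: "psh C" and x: "x:pts"
 and es: "es:wstk N V x" and cs: "cs:wstk n C x"
 and fs: "fs:wstk N' V x" and ds: "ds:wstk n' C x"
 and p: "ptn N V n C x es cs:gsp (twd N V n C) x"
 and q: "ptn N' V n' C x fs ds:gsp (twd N' V n' C) x"
 shows "ptn (N + N') V (n + n') C x (es @ fs) (cs @ ds):gsp (twd (N + N') V (n + n') C) x"
proof (rule twisted_product[OF V C V C twisted_psh[OF V C] twisted_gluing[OF V C] _ _ _ _ _ x es cs fs ds p q,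
 where g = "%z es cs fs ds. ptn (N + N') V (n + n') C z (es @ fs) (cs @ ds)"])
 fix z es cs fs ds assume z: "z:pts"
 show "mlin z N V (twd (N + N') V (n + n') C)
 (%es. ptn (N + N') V (n + n') C z (es @ fs) (cs @ ds))"
 if "cs:wstk n C z" "fs:wstk N' V z" "ds:wstk n' C z"
 by (rule mlt_append1[OF ptn_mlt(1)[OF V C z w_append[OF that(1,3)]] that(2)])
 show "mlin z N' V (twd (N + N') V (n + n') C)
 (%fs. ptn (N + N') V (n + n') C z (es @ fs) (cs @ ds))"
 if "es:wstk N V z" "cs:wstk n C z" "ds:wstk n' C z"
 by (rule mlt_append2[OF ptn_mlt(1)[OF V C z w_append[OF that(2,3)]] that(1)])
 show "mlin z n C (twd (N + N') V (n + n') C)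
 (%cs. ptn (N + N') V (n + n') C z (es @ fs) (cs @ ds))"
 if "es:wstk N V z" "fs:wstk N' V z" "ds:wstk n' C z"
 by (rule mlt_append1[OF ptn_mlt(2)[OF V C z w_append[OF that(1,2)]] that(3)])
 show "mlin z n' C (twd (N + N') V (n + n') C)
 (%ds. ptn (N + N') V (n + n') C z (es @ fs) (cs @ ds))"
 if "es:wstk N V z" "cs:wstk n C z" "fs:wstk N' V z"
 by (rule mlt_append2[OF ptn_mlt(2)[OF V C z w_append[OF that(1,3)]] that(2)])
next
 fix U es cs fs ds assume U: "opn U" and w: "es:wsec N V U" "cs:wsec n C U"
 "fs:wsec N' V U" "ds:wsec n' C U"
 note a = w_append[OF w(1,3)] w_append[OF w(2,4)]
 show "EX t:sec (twd (N + N') V (n + n') C) U. !z:U.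
 ptn (N + N') V (n + n') C z (mg V z U es @ mg V z U fs)
 (mg C z U cs @ mg C z U ds) = gm (twd (N + N') V (n + n') C) z U t"
 using ptn_germ[OF V C U _ a]
 by (intro bexI[OF _ psec_c[OF V C U a]] ballI) simp
qed

text \<open>The unit of the tensor algebra. It serves as a dummy second factor when an operation on
  a single pure tensor is wanted, and starts the inductions on products.\<close>

lemma ptn_empty_glob:
 assumes V: "psh V" and C: "psh C" and x: "x:pts"
 shows "ptn 0 V 0 C x [] []:gsp (twd 0 V 0 C) x"
proof -
 interpret T: mpsh X "twd 0 V 0 C" by unfold_locales (rule twisted_psh[OF V C])
 have "psec V C 0 0 pts [] []:sec (twd 0 V 0 C) pts"
 by (rule psec_c[OF V C openin_topspace]) auto
 thus ?thesis
 using ptn_germ[OF V C openin_topspace x, of "[]" 0 "[]" 0] T.gsp_base[OF x] by simp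
qed

lemma ptn_perm:
 assumes V: "psh V" and C: "psh C" and x: "x:pts"
 and es: "es:wstk N V x" and cs: "cs:wstk n C x"
 and p: "ptn N V n C x es cs:gsp (twd N V n C) x"
 and si: "si permutes {..<N}"
 shows "ptn N V n C x (permute_list si es) cs:gsp (twd N V n C) x"
proof (rule twisted_product[OF V C V C twisted_psh[OF V C] twisted_gluing[OF V C] _ _ _ _ _ x es cs _ _ p
 ptn_empty_glob[OF V C x], where g = "%z es cs fs ds. ptn N V n C z (permute_list si es) cs"])
 fix z es cs assume z: "z:pts"
 {
 assume cs: "cs:wstk n C z"
 show "mlin z N V (twd N V n C)
 (%es. ptn N V n C z (permute_list si es) cs)"
 by (rule mlt_perm[OF ptn_mlt(1)[OF V C z cs] si])
 }
 assume es: "es:wstk N V z"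
 show "mlin z n C (twd N V n C)
 (%cs. ptn N V n C z (permute_list si es) cs)"
 by (rule ptn_mlt(2)[OF V C z perm_w[OF si es]])
 assume cs: "cs:wstk n C z"
 show "mlin z 0 V (twd N V n C)
 (%fs. ptn N V n C z (permute_list si es) cs)"
 "mlin z 0 C (twd N V n C)
 (%fs. ptn N V n C z (permute_list si es) cs)"
 using ptn_c[OF V C z perm_w[OF si es] cs] by (rule mlt_0)+
next
 fix U es cs assume U: "opn U" and w: "es:wsec N V U" "cs:wsec n C U"
 note p = perm_w[OF si w(1)]
 have "si permutes {..<length es}" using si w(1) by (simp add: words_def)
 note perm = permute_list_map[OF this]
 show "EX t:sec (twd N V n C) U. !z:U.
 ptn N V n C z (permute_list si (mg V z U es)) (mg C z U cs) =
 gm (twd N V n C) z U t"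
 unfolding perm using ptn_germ[OF V C U _ p w(2)]
 by (intro bexI[OF _ psec_c[OF V C U p w(2)]] ballI) simp
qed auto

end

section \<open>Iterated symmetric powers\<close>

definition nwords where
 "nwords m q M = {vss. length vss = m & set vss <= words q M}"

lemma nst_w_update:
 "vss:nwords m q M ==> vs:words q M ==> vss[i := vs]:nwords m q M"
 using set_update_subset_insert by (fastforce simp: nwords_def)

lemma w_concat: "vss:nwords m q M ==> concat vss:words (m * q) M"
proof (induction vss arbitrary: m)
 case (Cons vs vss)
 then obtain m' where "m = Suc m'" by (cases m) (auto simp: nwords_def)
 with Cons show ?case by (auto simp: nwords_def intro!: w_append)
qed (auto simp: nwords_def words_def)

lemma nst_w_map:
 assumes "vss:nwords m q M" "!!vs. vs:words q M ==> map f vs:words q N"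
 shows "map (map f) vss:nwords m q N"
 using assms by (auto simp: nwords_def)

lemma mlt_concat:
 assumes g: "mlt R (m * q) M N g" and vss: "vss:nwords m q M" and i: "i < m"
 shows "mlt R q M N (%vs. g (concat (vss[i := vs])))"
proof -
 have len: "length vss = m" using vss by (simp add: nwords_def)
 have vss_in: "set vss <= words q M" using vss by (simp add: nwords_def)
 have t: "concat (take i vss):words (i * q) M"
 using vss_in set_take_subset[of i vss] len i by (intro w_concat) (auto simp: nwords_def)
 have d: "concat (drop (Suc i) vss):words ((m - Suc i) * q) M"
 using vss_in set_drop_subset[of "Suc i" vss] len i by (intro w_concat) (auto simp: nwords_def)
 have "m = i + (1 + (m - Suc i))" using i by simp
 hence "m * q = i * q + (q + (m - Suc i) * q)" by (metis add_mult_distrib mult_1)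
 with g have "mlt R (i * q + (q + (m - Suc i) * q)) M N g" by simp
 from mlt_append1[OF mlt_append2[OF this t] d]
 show ?thesis using i len by (simp add: upd_conv_take_nth_drop)
qed

text \<open>Inverse to \<open>concat\<close> on \<open>m\<close> words of length \<open>q\<close>:
  it reads the blocks of \<open>S^m S^q\<close> off a flat word.\<close>

primrec chunks :: "nat => nat => 'v list => 'v list list" where
 "chunks 0 q xs = []"
| "chunks (Suc m) q xs = take q xs # chunks m q (drop q xs)"

lemma chunks_map: "chunks m q (map f xs) = map (map f) (chunks m q xs)"
 by (induction m arbitrary: xs) (simp_all add: take_map drop_map)

lemma chunks_concat: "vss:nwords m q M ==> chunks m q (concat vss) = vss"
proof (induction m arbitrary: vss)
 case (Suc m)
 then obtain vs vss' where "vss = vs # vss'" by (cases vss) (auto simp: nwords_def)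
 with Suc show ?case by (simp add: nwords_def words_def)
qed (simp add: nwords_def)

lemma chunks_nst_w: "xs:words (m * q) M ==> chunks m q xs:nwords m q M"
proof (induction m arbitrary: xs)
 case (Suc m)
 have "take q xs:words q M" "drop q xs:words (m * q) M"
 using Suc.prems set_take_subset[of q xs] set_drop_subset[of q xs] by (auto simp: words_def)
 with Suc.IH[of "drop q xs"] show ?case by (simp add: nwords_def)
qed (simp add: nwords_def)

lemma mlt_chunks:
 assumes ga: "mlt R q M L ga" and G: "mlt R m L N G"
 shows "mlt R (m * q) M N (%xs. G (map ga (chunks m q xs)))"
 using G
proof (induction m arbitrary: G)
 case 0
 thus ?case using mltD(1)[OF 0] by (simp add: mlt_def)
next
 case (Suc m)
 have split: "take q xs:words q M" "drop q xs:words (m * q) M" if "xs:words (Suc m * q) M" for xs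
 using that set_take_subset[of q xs] set_drop_subset[of q xs] by (auto simp: words_def)
 have gaw: "map ga (chunks m q ys):words m L" if "ys:words (m * q) M" for ys
 using chunks_nst_w[OF that] mltD(1)[OF ga] by (auto simp: nwords_def words_def[of m])
 show ?case
 unfolding mlt_def
 proof (intro conjI ballI allI impI funcsetI)
 show "G (map ga (chunks (Suc m) q xs)):cr N" if "xs:words (Suc m * q) M" for xs
 using mltD(1)[OF Suc.prems] mltD(1)[OF ga split(1)[OF that]] gaw[OF split(2)[OF that]]
 by (simp add: w_Cons)
 fix xs i assume xs: "xs:words (Suc m * q) M" and i: "i < Suc m * q"
 note s = split[OF xs]
 have h: "ga (take q xs):cr L" by (rule mltD(1)[OF ga s(1)])
 show "(%x. G (map ga (chunks (Suc m) q (xs[i := x])))):lin R M N"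
 proof (cases "i < q")
 case True
 have w: "ga (take q xs) # map ga (chunks m q (drop q xs)):words (Suc m) L"
 using h gaw[OF s(2)] by (simp add: w_Cons)
 have "(%x. G (ga ((take q xs)[i := x]) # map ga (chunks m q (drop q xs)))):lin R M N"
 using lin_compose[OF mltD(2)[OF ga s(1) True] mltD(2)[OF Suc.prems w, of 0]] by simp
 thus ?thesis using True by (simp add: take_update_swap)
 next
 case False
 hence i': "i - q < m * q" using i by simp
 show ?thesis
 using mltD(2)[OF Suc.IH[OF mlt_Cons[OF Suc.prems h]] s(2) i'] False
 by (simp add: drop_update_swap)
 qed
 qed
qed

lemma concat_rep_rep: "concat (replicate m (replicate q v)) = replicate (m * q) v"
 by (induction m) (simp_all add: replicate_add)

definition nst_word where
 "nst_word X m q V x vss =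
 stalk_word X True m (wpow X True q V) x (map (stalk_word X True q V x) vss)"

definition nst_sct where
 "nst_sct X m q V U vss =
 wsct X True m (wpow X True q V) U (map (wsct X True q V U) vss)"

lemma list_in_map_image: "set ss <= f ` D ==> EX ds. set ds <= D & ss = map f ds"
proof (induction ss)
 case (Cons s ss)
 then obtain d ds where "d:D" "s = f d" "set ds <= D" "ss = map f ds" by auto
 thus ?case by (intro exI[of _ "d # ds"]) simp
qed simp

context rspace
begin

context
 fixes V :: "('p, 'a, 'v) presheaf"
 assumes V: "psh V"
begin

interpretation V: mpsh X V by unfold_locales (rule V)

lemma nst_psh: "psh (spw m (spw q V))"
 by (rule wpow_psh[OF wpow_psh[OF V]])

lemma nst_sct_c:
 assumes "opn U" "vss:nwords m q (Msec V U)"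
 shows "nst_sct X m q V U vss:sec (spw m (spw q V)) U"
 unfolding nst_sct_def
 by (rule wsct_c[OF wpow_psh[OF V] assms(1)])
 (use assms(2) wsct_c[OF V assms(1)] in \<open>auto simp: nwords_def words_def[of m]\<close>)

lemma nst_word_germ:
 assumes U: "opn U" "x:U" "vss:nwords m q (Msec V U)"
 shows "nst_word X m q V x (map (mg V x U) vss) =
 gm (spw m (spw q V)) x U (nst_sct X m q V U vss)"
proof -
 have w: "map (wsct X True q V U) vss:wsec m (spw q V) U"
 using U(3) wsct_c[OF V U(1)] by (auto simp: nwords_def words_def[of m])
 have eq: "map (sw q V x) (map (mg V x U) vss) =
 mg (spw q V) x U (map (wsct X True q V U) vss)"
 unfolding map_map by (rule map_cong[OF refl])
 (use U(3) stw_gm[OF V U(1,2)] in \<open>auto simp: nwords_def\<close>)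
 show ?thesis
 unfolding nst_word_def nst_sct_def eq by (rule stw_gm[OF wpow_psh[OF V] U(1,2) w])
qed

context
 fixes x assumes x: "x:pts"
begin

interpretation Q: mpsh X "spw q V" for q by unfold_locales (rule wpow_psh[OF V])
interpretation N: mpsh X "spw m (spw q V)" for m q
 by unfold_locales (rule nst_psh)

lemma stw_gens_c:
 "sw q V x ` wstk q V x <= stk (spw q V) x"
 using mltD(1)[OF stw_mlt[OF V x]] by auto

lemma nst_word_args:
 assumes "vss:nwords m q (Mst V x)"
 shows "map (sw q V x) vss:wstk m (spw q V) x"
 using assms stw_gens_c by (auto simp: nwords_def words_def[of m])

lemma nst_word_c:
 assumes "vss:nwords m q (Mst V x)"
 shows "nst_word X m q V x vss:stk (spw m (spw q V)) x"
 unfolding nst_word_def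
 using mltD(1)[OF stw_mlt[OF wpow_psh[OF V] x] nst_word_args[OF assms]] .

lemma nst_word_span:
 "stk (spw m (spw q V)) x =
 spn (spw m (spw q V)) x
 (nst_word X m q V x ` nwords m q (Mst V x))"
 (is "cr ?M = module_span _ _ ?S")
proof -
 interpret Mx: module "Ost x" ?M by (rule N.Mst_mod[OF x])
 interpret QM: two_mods "Ost x" "Mst (spw q V) x" ?M
 using Q.Mst_mod[OF x] Mx.module_axioms by (simp add: two_mods_def)
 have sub: "?S <= cr ?M" using nst_word_c by auto
 note span = stw_span[OF V x, where sy = True and n = q]
 have "sw m (spw q V) x ` wstk m (spw q V) x <=
 module_span (Ost x) ?M ?S"
 proof (intro image_subsetI)
 fix gs assume gs: "gs:wstk m (spw q V) x"
 show "sw m (spw q V) x gs:module_span (Ost x) ?M ?S"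
 proof (rule QM.mlt_in_submod[OF stw_gens_c span
 stw_mlt[OF wpow_psh[OF V] x] Mx.span_submod[OF sub] _ gs])
 fix ss assume ss: "length ss = m" "set ss <= sw q V x ` wstk q V x"
 obtain vss where vss: "set vss <= wstk q V x" "ss = map (sw q V x) vss"
 using list_in_map_image[OF ss(2)] by blast
 hence "vss:nwords m q (Mst V x)" using ss(1) by (simp add: nwords_def)
 thus "sw m (spw q V) x ss:module_span (Ost x) ?M ?S"
 using Mx.span_base[of "nst_word X m q V x vss" ?S] by (simp add: nst_word_def vss(2))
 qed
 qed
 from Mx.span_least[OF Mx.span_submod[OF sub] this]
 show ?thesis
 unfolding stw_span[OF wpow_psh[OF V] x, where sy = True and n = m, symmetric]
 using Mx.span_sub[OF sub] by (rule subset_antisym)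
qed

text \<open>A fully symmetric multilinear function of \<open>m q\<close> letters factors through
  \<open>S^m S^q\<close>: with the other blocks fixed it extends over each inner symmetric power,
  and permuting the blocks permutes the flat word.\<close>

lemma nst_word_lift:
 assumes L: "module (Ost x) L" and g: "mlt (Ost x) (m * q) (Mst V x) L g"
 and s: "!!gs hs. gs:wstk (m * q) V x ==> hs:wstk (m * q) V x ==>
 mset gs = mset hs ==> g gs = g hs"
 shows "EX ph:lin (Ost x) (Mst (spw m (spw q V)) x) L.
 !vss:nwords m q (Mst V x). ph (nst_word X m q V x vss) = g (concat vss)"
proof -
 interpret QL: two_mods "Ost x" "Mst (spw q V) x" L
 using Q.Mst_mod[OF x] L by (simp add: two_mods_def)
 let ?D = "wstk q V x" and ?ga = "sw q V x"
 note span = stw_span[OF V x, where sy = True and n = q]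
 have nw: "ds:nwords m q (Mst V x)" if "length ds = m" "set ds <= ?D" for ds
 using that by (simp add: nwords_def)
 have "EX G. mlt (Ost x) m (Mst (spw q V) x) L G &
 (!ds. length ds = m --> set ds <= ?D --> G (map ?ga ds) = g (concat ds))"
 proof (rule QL.mlt_extension[OF span stw_gens_c])
 fix ds assume ds: "length ds = m" "set ds <= ?D"
 show "g (concat ds):cr L" by (rule mltD(1)[OF g w_concat[OF nw[OF ds]]])
 fix i assume i: "i < m"
 show "EX ph:lin (Ost x) (Mst (spw q V) x) L.
 !d:?D. ph (?ga d) = g (concat (ds[i := d]))"
 proof (rule stw_lift[OF V x L mlt_concat[OF g nw[OF ds] i]])
 fix gs hs assume gs: "gs:?D" "hs:?D" "mset gs = mset hs"
 have "mset (concat (ds[i := gs])) = mset (concat (ds[i := hs]))"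
 using gs(3) i ds(1) by (simp add: upd_conv_take_nth_drop)
 thus "g (concat (ds[i := gs])) = g (concat (ds[i := hs]))"
 by (intro s w_concat nst_w_update nw ds gs)
 qed
 qed
 then obtain G where G: "mlt (Ost x) m (Mst (spw q V) x) L G"
 "!!ds. length ds = m ==> set ds <= ?D ==> G (map ?ga ds) = g (concat ds)" by blast
 have sym: "G gs = G hs" if gs: "gs:wstk m (spw q V) x" "mset gs = mset hs" for gs hs
 proof -
 obtain p where p: "p permutes {..<length gs}" "permute_list p gs = hs"
 using mset_eq_permutation[OF gs(2)[symmetric]] by blast
 hence p': "p permutes {..<m}" using gs(1) by (simp add: words_def)
 \<comment> \<open>Symmetry in the blocks is an equality of multilinear maps, so it may be tested on
   products of letters, where \<open>G\<close> is \<open>g\<close> of the flat word.\<close>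
 have "G gs = G (permute_list p gs)"
 proof (rule QL.mlt_eqI[OF stw_gens_c span G(1) mlt_perm[OF G(1) p'] _ gs(1)])
 fix ss assume ss: "length ss = m" "set ss <= ?ga ` ?D"
 obtain ds where ds: "set ds <= ?D" "ss = map ?ga ds" using list_in_map_image[OF ss(2)] by blast
 have len: "length ds = m" using ss(1) ds(2) by simp
 have pd: "p permutes {..<length ds}" using p' len by simp
 have ds': "set (permute_list p ds) <= ?D" "length (permute_list p ds) = m" using ds(1) pd len by simp_all
 have "mset (map mset (permute_list p ds)) = mset (map mset ds)" using pd by simp
 hence "mset (concat (permute_list p ds)) = mset (concat ds)"
 unfolding mset_concat by (metis sum_mset_sum_list)
 hence "g (concat (permute_list p ds)) = g (concat ds)"
 by (intro s w_concat nw ds' ds len)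
 thus "G ss = G (permute_list p ss)"
 unfolding ds(2) permute_list_map[OF pd] G(2)[OF len ds(1)] G(2)[OF ds'(2,1)] by simp
 qed
 thus ?thesis using p(2) by simp
 qed
 from stw_lift[OF wpow_psh[OF V] x L G(1), of True] sym
 obtain ph where ph: "ph:lin (Ost x) (Mst (spw m (spw q V)) x) L"
 "!gs:wstk m (spw q V) x. ph (sw m (spw q V) x gs) = G gs"
 by blast
 show ?thesis
 proof (intro bexI[OF _ ph(1)] ballI)
 fix vss assume vss: "vss:nwords m q (Mst V x)"
 hence "length vss = m" "set vss <= ?D" by (simp_all add: nwords_def)
 thus "ph (nst_word X m q V x vss) = g (concat vss)"
 unfolding nst_word_def ph(2)[rule_format, OF nst_word_args[OF vss]] by (rule G(2))
 qed
qed

end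

end

lemma gens_nst:
 assumes V: "psh V"
 shows "generators X (spw m (spw q V)) (%z. nwords m q (Mst V z))
 (%U. {j. EX vss:nwords m q (Msec V U). !z:U. j z = map (mg V z U) vss}) (nst_word X m q V)"
 (is "generators X ?T ?I ?J ?g")
proof -
 interpret V: mpsh X V by unfold_locales (rule V)
 interpret T: mpsh X ?T by unfold_locales (rule nst_psh[OF V])
 show ?thesis
 proof
 show "?g z ` ?I z <= stk ?T z" "stk ?T z = spn ?T z (?g z ` ?I z)" if z: "z:pts" for z
 using nst_word_c[OF V z] nst_word_span[OF V z] by blast+
 show "EX U j. opn U & z:U & U <= W & j:?J U & vss = j z" if W: "opn W" "z:W" and vss: "vss:?I z" for W z vss
 proof -
 obtain U es where U: "opn U" "z:U" "U <= W" "es:wsec (m * q) V U" "concat vss = mg V z U es"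
 using w_concat[OF vss] W by (rule V.Mst_w_within)
 \<comment> \<open>The nested word was flattened to find one neighbourhood for all letters; cutting
   restores the nesting.\<close>
 have "vss = map (mg V z U) (chunks m q es)"
 using chunks_concat[OF vss] unfolding U(5) chunks_map by simp
 thus ?thesis
 using chunks_nst_w[OF U(4)] U(1-3)
 by (intro exI[of _ U] exI[of _ "%z. map (mg V z U) (chunks m q es)"]) auto
 qed
 fix U j assume U: "opn U" and "j:?J U"
 then obtain vss where vss: "vss:nwords m q (Msec V U)" "!z:U. j z = map (mg V z U) vss" by blast
 show "j z:?I z" if "z:U" for z
 using vss(2) that nst_w_map[OF vss(1) V.w_germ[OF U that]] by simp
 show "loc ?T U (%z. ?g z (j z))"
 by (rule bexI[OF _ nst_sct_c[OF V U vss(1)]]) (use vss nst_word_germ[OF V U _ vss(1)] in simp)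
 fix W assume W: "opn W" "W <= U"
 have "map (map (Mres V U W)) vss:nwords m q (Msec V W)"
 by (rule nst_w_map[OF vss(1) V.words_res[OF U W]])
 moreover have "j z = map (mg V z W) (map (map (Mres V U W)) vss)" if "z:W" for z
 using vss W that V.map_germ_res[OF U W that] by (auto simp: nwords_def subset_iff)
 ultimately show "j:?J W" by blast
 qed
qed

end

subsection \<open>Symmetrisation\<close>

lemma (in mpsh) gm_finsum:
 assumes U: "opn U" "x:U" and "finite A" "!!i. i:A ==> f i:sec M U"
 shows "gm M x U (finsum (Msec M U) f A) = finsum (Mst M x) (%i. gm M x U (f i)) A"
 using assms(3,4)
proof (induction rule: finite_induct)
 interpret MU: module "OS U" "Msec M U" by (rule Msec_mod[OF U(1)])
 interpret Mx: module "Ost x" "Mst M x" by (rule Mst_mod[OF points_mem[OF U]])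
 case empty
 show ?case using Mst_zero[OF U] by simp
next
 interpret MU: module "OS U" "Msec M U" by (rule Msec_mod[OF U(1)])
 interpret Mx: module "Ost x" "Mst M x" by (rule Mst_mod[OF points_mem[OF U]])
 case (insert i A)
 have f: "f:A \<rightarrow> sec M U" "f i:sec M U" using insert.prems by auto
 have g: "(%i. gm M x U (f i)):A \<rightarrow> stk M x" "gm M x U (f i):stk M x"
 using f gm_c[OF U] by auto
 have "gm M x U (finsum (Msec M U) f (insert i A)) =
 gm M x U (f i) \<oplus>\<^sub>(Mst M x) gm M x U (finsum (Msec M U) f A)"
 using MU.finsum_insert[OF insert.hyps f] Mst_add[OF U f(2) MU.finsum_closed[OF f(1)]] by simp
 also have "gm M x U (finsum (Msec M U) f A) = finsum (Mst M x) (%i. gm M x U (f i)) A"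
 by (rule insert.IH) (rule insert.prems, simp)
 finally show ?case using Mx.finsum_insert[OF insert.hyps g] by simp
qed

text \<open>An integer multiple is multiplication by an element of the ring, here a unit.\<close>

lemma (in module) submod_divide:
 assumes K: "submodule K R M" and u: "[Suc n] \<cdot>\<^sub>R \<one>\<^sub>R:Units R" and w: "w:cr M" "[Suc n] \<cdot>\<^sub>M w:K"
 shows "w:K"
proof -
 have one: "\<one>:cr R" by simp
 have c: "[n] \<cdot>\<^sub>R \<one>:cr R" for n :: nat by (rule R.add_pow_nat_c[OF one])
 have smult: "[n] \<cdot>\<^sub>M w = ([n] \<cdot>\<^sub>R \<one>) \<odot>\<^sub>M w" for n :: nat
 by (induction n) (simp_all add: M.add_pow_nat R.add_pow_nat c w(1) smult_l_distr)
 have i: "inv ([Suc n] \<cdot>\<^sub>R \<one>):cr R" using u by (rule R.Units_inv_closed)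
 have "inv ([Suc n] \<cdot>\<^sub>R \<one>) \<odot>\<^sub>M ([Suc n] \<cdot>\<^sub>M w) = (inv ([Suc n] \<cdot>\<^sub>R \<one>) \<otimes> [Suc n] \<cdot>\<^sub>R \<one>) \<odot>\<^sub>M w"
 unfolding smult by (rule smult_assoc1[OF i c w(1), symmetric])
 also have "\<dots> = w" using u w(1) by (simp add: R.Units_l_inv)
 finally show ?thesis using submoduleE(4)[OF K i w(2)] by simp
qed

text \<open>The two words differ by a permutation \<open>p\<close>, and composition with
  \<open>p\<close> permutes the summands.\<close>

lemma symmetrised_symmetric:
 assumes "abelian_group N" and g: "g:words n M \<rightarrow> cr N"
 and gs: "gs:words n M" and eq: "mset gs = mset hs"
 shows "finsum N (%si. g (permute_list si gs)) {si. si permutes {..<n}} =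
 finsum N (%si. g (permute_list si hs)) {si. si permutes {..<n}}"
proof -
 interpret N: abelian_group N by fact
 let ?P = "{si. si permutes {..<n}}"
 have len: "length gs = n" using gs by (simp add: words_def)
 obtain p where p: "p permutes {..<n}" "permute_list p gs = hs"
 using mset_eq_permutation[OF eq[symmetric]] len by blast
 have inj: "inj_on ((\<circ>) p) ?P"
 by (rule inj_onI) (metis fun.inj_map_strong permutes_inj[OF p(1)] inj_eq comp_apply ext)
 have im: "(\<circ>) p ` ?P = ?P"
 proof (intro subset_antisym subsetI)
 fix si assume "si:?P"
 hence "inv_into UNIV p \<circ> si:?P" "si = p \<circ> (inv_into UNIV p \<circ> si)"
 using permutes_compose[OF _ permutes_inv[OF p(1)]] permutes_inverses(1)[OF p(1)] by (auto simp: fun_eq_iff)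
 thus "si:(\<circ>) p ` ?P" by blast
 next
 fix si assume "si:(\<circ>) p ` ?P"
 thus "si:?P" using permutes_compose p(1) by auto
 qed
 have "finsum N (%si. g (permute_list si gs)) ((\<circ>) p ` ?P) = finsum N (%si. g (permute_list (p \<circ> si) gs)) ?P"
 by (rule N.add.finprod_reindex[OF _ inj, simplified])
 (use g perm_w[OF _ gs] im in auto)
 also have "\<dots> = finsum N (%si. g (permute_list si hs)) ?P"
 proof (rule N.finsum_cong'[OF refl])
 show "(%si. g (permute_list si hs)):?P \<rightarrow> cr N"
 using g perm_w[OF _ perm_w[OF p(1) gs]] p(2) by auto
 show "g (permute_list (p \<circ> si) gs) = g (permute_list si hs)" if "si:?P" for si
 using permute_list_compose[of si gs p] that len p(2) by simp
 qed
 finally show ?thesis unfolding im .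
qed

context rspace
begin

text \<open>The symmetrisation map from \<open>S^m S^q V\<close> to \<open>T^(mq) V\<close> sums
  over all permutations without dividing. On equal letters it yields \<open>(mq)!\<close> times the
  pure power, and the factorial is invertible in the stalk.\<close>

theorem pure_power_glob:
 assumes V: "psh V" and C: "psh C" and x: "x:pts"
 and tor: "!!n. [Suc n] \<cdot>\<^sub>(Ost x) \<one>\<^sub>(Ost x):Units (Ost x)"
 and gen: "ggen (tns (spw m (spw q V)) (tpw m C)) x"
 and v: "v:stk V x" and cs: "cs:wstk m C x"
 shows "ptn (m * q) V m C x (replicate (m * q) v) cs:gsp (twd (m * q) V m C) x"
proof -
 let ?S = "spw m (spw q V)" and ?C = "tpw m C"
 let ?D = "tns ?S ?C" and ?T = "twd (m * q) V m C"
 let ?P = "{si. si permutes {..<m * q}}"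
 have finP: "finite ?P" by (rule finite_permutations) simp
 interpret V: mpsh X V by unfold_locales (rule V)
 interpret C: mpsh X C by unfold_locales (rule C)
 note preS = nst_psh[OF V, of m q] and preC = wpow_psh[OF C, of False m]
 interpret T: mpsh X ?T by unfold_locales (rule twisted_psh[OF V C])
 define f where "f z es cs = finsum (Mst ?T z) (%si. ptn (m * q) V m C z (permute_list si es) cs) ?P"
 for z es cs
 have f1: "mlin z (m * q) V ?T (%es. f z es cs)"
 if z: "z:pts" and cs: "cs:wstk m C z" for z cs
 unfolding f_def
 by (rule mlt_finsum[OF V.Mst_mod[OF z] T.Mst_mod[OF z] finP])
 (rule mlt_perm[OF ptn_mlt(1)[OF V C z cs]], simp)
 have f2: "mlin z m C ?T (f z es)"
 if z: "z:pts" and es: "es:wstk (m * q) V z" for z es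
 unfolding f_def[abs_def]
 by (rule mlt_finsum[OF C.Mst_mod[OF z] T.Mst_mod[OF z] finP])
 (rule ptn_mlt(2)[OF V C z perm_w[OF _ es]], simp)
 note gn = gens_nst[OF V, of m q] gens_word[OF C, of False m]
 have lift: "EX L:shom z ?D ?T. !vss:nwords m q (Mst V z). !cs:wstk m C z.
 L (stn ?S ?C z (nst_word X m q V z vss) (tw m C z cs)) = f z (concat vss) cs" if z: "z:pts" for z
 proof (rule tns_generators_lift[OF gn z T.Mst_mod[OF z]])
 fix cs assume cs: "cs:wstk m C z"
 interpret Tz: module "Ost z" "Mst ?T z" by (rule T.Mst_mod[OF z])
 show "EX ph:shom z ?S ?T. !vss:nwords m q (Mst V z). ph (nst_word X m q V z vss) = f z (concat vss) cs"
 proof (rule nst_word_lift[OF V z T.Mst_mod[OF z] f1[OF z cs]])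
 fix gs hs assume gs: "gs:wstk (m * q) V z" "mset gs = mset hs"
 show "f z gs cs = f z hs cs"
 unfolding f_def
 by (rule symmetrised_symmetric[OF Tz.M.abelian_group_axioms _ gs])
 (use ptn_c[OF V C z _ cs] in auto)
 qed
 next
 fix vss assume "vss:nwords m q (Mst V z)"
 from f2[OF z w_concat[OF this]]
 show "EX ph:shom z ?C ?T. !cs:wstk m C z. ph (tw m C z cs) = f z (concat vss) cs"
 by (rule stw_lift[OF C z T.Mst_mod[OF z]]) simp
 qed
 have f_loc: "loc ?T U (%z. f z (mg V z U es) (mg C z U cs))"
 if U: "opn U" and w: "es:wsec (m * q) V U" "cs:wsec m C U" for U es cs
 proof -
 interpret TU: module "OS U" "Msec ?T U" by (rule T.Msec_mod[OF U])
 let ?f = "%si. psec V C (m * q) m U (permute_list si es) cs"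
 have ps: "permute_list si es:wsec (m * q) V U" if "si:?P" for si
 using perm_w[OF _ w(1)] that by simp
 note f = psec_c[OF V C U ps w(2)]
 have "f z (mg V z U es) (mg C z U cs) = gm ?T z U (finsum (Msec ?T U) ?f ?P)" if z: "z:U" for z
 proof -
 interpret Tz: module "Ost z" "Mst ?T z" by (rule T.Mst_mod[OF points_mem[OF U z]])
 have "f z (mg V z U es) (mg C z U cs) = finsum (Mst ?T z) (%si. gm ?T z U (?f si)) ?P"
 unfolding f_def
 proof (rule Tz.M.finsum_cong'[OF refl])
 show "(%si. gm ?T z U (?f si)):?P \<rightarrow> stk ?T z"
 using T.gm_c[OF U z f] by blast
 show "ptn (m * q) V m C z (permute_list si (mg V z U es)) (mg C z U cs) = gm ?T z U (?f si)"
 if si: "si:?P" for si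
 proof -
 have "si permutes {..<length es}" using si w(1) by (simp add: words_def)
 note perm = permute_list_map[OF this]
 show ?thesis unfolding perm by (rule ptn_germ[OF V C U z ps[OF si] w(2)])
 qed
 qed
 also have "\<dots> = gm ?T z U (finsum (Msec ?T U) ?f ?P)" by (rule T.gm_finsum[OF U z finP f, symmetric])
 finally show ?thesis .
 qed
 moreover have "finsum (Msec ?T U) ?f ?P:sec ?T U" by (rule TU.M.finsum_closed) (use f in blast)
 ultimately show ?thesis by blast
 qed
 let ?vss = "replicate m (replicate q v)"
 have vss: "?vss:nwords m q (Mst V x)" "concat ?vss = replicate (m * q) v"
 using v by (auto simp: nwords_def words_def concat_rep_rep)
 interpret Tx: module "Ost x" "Mst ?T x" by (rule T.Mst_mod[OF x])
 let ?p = "ptn (m * q) V m C x (replicate (m * q) v) cs"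
 have p: "?p:stk ?T x"
 using v by (intro ptn_c[OF V C x _ cs]) (auto simp: words_def)
 have "f x (replicate (m * q) v) cs = finsum (Mst ?T x) (%si. ?p) ?P"
 unfolding f_def
 proof (rule Tx.M.finsum_cong'[OF refl])
 show "ptn (m * q) V m C x (permute_list si (replicate (m * q) v)) cs = ?p" if "si:?P" for si
 proof -
 have "permute_list si (replicate (m * q) v) = replicate (m * q) v"
 using permutes_in_image[of si "{..<m * q}"] that by (intro nth_equalityI) (auto simp: permute_list_nth)
 thus ?thesis by simp
 qed
 qed (use p in auto)
 also have "\<dots> = [(fact (m * q) :: nat)] \<cdot>\<^sub>(Mst ?T x) ?p"
 using Tx.M.finsum_const_nat[OF finP p] card_permutations[of "{..<m * q}" "m * q"] by simp
 finally have f: "f x (replicate (m * q) v) cs = [(fact (m * q) :: nat)] \<cdot>\<^sub>(Mst ?T x) ?p" .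
 have "stn ?S ?C x (nst_word X m q V x ?vss) (tw m C x cs):gsp ?D x"
 using gen bilinearD(3)[OF stn_bil[OF preS preC x] nst_word_c[OF V x vss(1)]
 mltD(1)[OF stw_mlt[OF C x] cs]] unfolding gen_at_def by simp
 hence g: "(%(vss, cs). stn ?S ?C x (nst_word X m q V x vss) (tw m C x cs)) (?vss, cs):gsp ?D x" by simp
 have "(%(vss, cs). f x (concat vss) cs) (?vss, cs):gsp ?T x"
 proof (rule transfer_glob[where h = "%z (vss, cs). f z (concat vss) cs",
 OF gens_tns[OF gn] twisted_psh[OF V C] twisted_gluing[OF V C] _ _ x _ g])
 show "EX L:shom z ?D ?T. !i:nwords m q (Mst V z) \<times> wstk m C z.
 L ((%(vss, cs). stn ?S ?C z (nst_word X m q V z vss) (tw m C z cs)) i) = (%(vss, cs). f z (concat vss) cs) i"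
 if "z:pts" for z using lift[OF that] by (auto elim!: bexI[rotated])
 show "(?vss, cs):nwords m q (Mst V x) \<times> wstk m C x" using vss(1) cs by simp
 fix U j assume U: "opn U" and "j:{p. fst \<circ> p:{j. EX vss:nwords m q (Msec V U). !z:U. j z = map (mg V z U) vss} &
 snd \<circ> p:{j. EX ss:wsec m C U. !z:U. j z = mg C z U ss}}"
 then obtain ws cs where w: "ws:nwords m q (Msec V U)" "cs:wsec m C U"
 "!z:U. fst (j z) = map (mg V z U) ws" "!z:U. snd (j z) = mg C z U cs" by auto
 show "loc ?T U (%z. (%(vss, cs). f z (concat vss) cs) (j z))"
 using f_loc[OF U w_concat[OF w(1)] w(2)] w(3,4) by (simp add: case_prod_beta map_concat)
 qed
 hence "[(fact (m * q) :: nat)] \<cdot>\<^sub>(Mst ?T x) ?p:gsp ?T x" using f vss(2) by simp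
 moreover obtain n where "fact (m * q) = Suc n" using fact_gt_zero[of "m * q"] gr0_implies_Suc by metis
 ultimately show ?thesis
 using Tx.submod_divide[OF T.gsp_sub[OF x] tor p] by simp
qed

end

section \<open>Generation of tensor products\<close>

lemma mlt_map2:
 assumes b: "bilinear R L M T b" and g: "mlt R n T N g"
 shows "fs:words n M ==> mlt R n L N (%es. g (map2 b es fs))"
 and "es:words n L ==> mlt R n M N (%fs. g (map2 b es fs))"
proof -
 have w: "map2 b es fs:words n T" if "es:words n L" "fs:words n M" for es fs
 using that bilinearD(3)[OF b] by (fastforce simp: words_def dest: set_zip_leftD set_zip_rightD)
 have upd: "map2 b (es[i := e]) fs = (map2 b es fs)[i := b e (fs ! i)]"
 "map2 b es (fs[i := f]) = (map2 b es fs)[i := b (es ! i) f]"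
 if "length es = n" "length fs = n" "i < n" for es fs i e f
 using that by (auto intro!: nth_equalityI simp: nth_list_update_if)
 show "mlt R n L N (%es. g (map2 b es fs))" if fs: "fs:words n M"
 unfolding mlt_def
 proof (intro conjI ballI allI impI funcsetI)
 show "g (map2 b es fs):cr N" if "es:words n L" for es
 by (rule mltD(1)[OF g w[OF that fs]])
 fix es i assume es: "es:words n L" and i: "i < n"
 have eq: "map2 b (es[i := e]) fs = (map2 b es fs)[i := b e (fs ! i)]" for e
 by (rule upd(1)[OF _ _ i]) (use es fs in \<open>simp_all add: words_def\<close>)
 show "(%e. g (map2 b (es[i := e]) fs)):lin R L N"
 unfolding eq
 by (rule lin_compose[OF bilinearD(2)[OF b words_nth[OF fs i]] mltD(2)[OF g w[OF es fs] i]])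
 qed
 show "mlt R n M N (%fs. g (map2 b es fs))" if es: "es:words n L"
 unfolding mlt_def
 proof (intro conjI ballI allI impI funcsetI)
 show "g (map2 b es fs):cr N" if "fs:words n M" for fs
 by (rule mltD(1)[OF g w[OF es that]])
 fix fs i assume fs: "fs:words n M" and i: "i < n"
 have eq: "map2 b es (fs[i := e]) = (map2 b es fs)[i := b (es ! i) e]" for e
 by (rule upd(2)[OF _ _ i]) (use es fs in \<open>simp_all add: words_def\<close>)
 show "(%e. g (map2 b es (fs[i := e]))):lin R M N"
 unfolding eq
 by (rule lin_compose[OF bilinearD(1)[OF b words_nth[OF es i]] mltD(2)[OF g w[OF es fs] i]])
 qed
qed

lemma list_in_map2_image:
 assumes "set ss <= {f a b | a b. a:A & b:B}"
 shows "EX as bs. length as = length ss & length bs = length ss & set as <= A & set bs <= B & ss = map2 f as bs"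
 using assms
proof (induction ss)
 case Nil
 show ?case by (intro exI[of _ "[]"]) simp
next
 case (Cons s ss)
 from Cons.prems have "s:{f a b | a b. a:A & b:B}" "set ss <= {f a b | a b. a:A & b:B}" by simp_all
 from Cons.IH[OF this(2)] obtain as bs where 1: "length as = length ss" "length bs = length ss" "set as <= A"
 "set bs <= B" "ss = map2 f as bs" by (elim exE conjE) (rule that)
 from \<open>s:_\<close> obtain a b where 2: "a:A" "b:B" "s = f a b" by auto
 show ?case using 1(1-4) 2(1,2) by (intro exI[of _ "a # as"] exI[of _ "b # bs"]) (simp add: 2(3) flip: 1(5))
qed

lemma mset_concat_rep: "mset (concat (map (replicate k) vs)) = repeat_mset k (mset vs)"
 by (induction vs) simp_all

context rspace
begin

text \<open>Concatenation of \<open>a\<close> pure powers of possibly different letters; the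
  twisting word is cut into pieces of length \<open>m\<close>.\<close>

lemma pure_powers_glob:
 assumes V: "psh V" and C: "psh C" and x: "x:pts"
 and pow: "!!v cs. v:stk V x ==> cs:wstk m C x ==>
 ptn k V m C x (replicate k v) cs:gsp (twd k V m C) x"
 and "vs:wstk a V x" "cs:wstk (a * m) C x"
 shows "ptn (a * k) V (a * m) C x (concat (map (replicate k) vs)) cs :
 gsp (twd (a * k) V (a * m) C) x"
 using assms(5,6)
proof (induction a arbitrary: vs cs)
 case 0
 thus ?case using ptn_empty_glob[OF V C x] by simp
next
 case (Suc a)
 obtain v ws where v: "vs = v # ws" "v:stk V x" "ws:wstk a V x"
 using Suc.prems(1) by (rule w_SucE)
 have cs: "take m cs:wstk m C x" "drop m cs:wstk (a * m) C x"
 using Suc.prems(2) set_take_subset[of m cs] set_drop_subset[of m cs] by (auto simp: words_def)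
 have "map (replicate k) ws:nwords a k (Mst V x)"
 using v(3) by (auto simp: nwords_def words_def)
 hence ws: "concat (map (replicate k) ws):wstk (a * k) V x" by (rule w_concat)
 have "replicate k v:wstk k V x" using v(2) by (auto simp: words_def)
 from ptn_append[OF V C x this cs(1) ws cs(2) pow[OF v(2) cs(1)] Suc.IH[OF v(3) cs(2)]]
 show ?case by (simp add: v(1))
qed

text \<open>The combinatorial criterion is applied to the span of the global germs. A word in which
  every multiplicity is a multiple of \<open>m q\<close> is a permutation of a concatenation of pure
  powers, and tensor powers allow the permutation.\<close>

theorem pure_tensors_glob:
 assumes V: "psh V" and C: "psh C" and x: "x:pts"
 and tor: "!!n. [Suc n] \<cdot>\<^sub>(Ost x) \<one>\<^sub>(Ost x):Units (Ost x)"
 and gen: "ggen (tns (spw m (spw q V)) (tpw m C)) x"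
 and pos: "0 < m" "0 < q"
 and S: "finite S" "S <= stk V x" "stk V x = spn V x S"
 and a: "card S * (card S * (m * q)) < a"
 and es: "es:wstk (a * (m * q)) V x" and cs: "cs:wstk (a * m) C x"
 shows "ptn (a * (m * q)) V (a * m) C x es cs:gsp (twd (a * (m * q)) V (a * m) C) x"
proof -
 let ?N = "a * (m * q)" and ?T = "twd (a * (m * q)) V (a * m) C"
 interpret V: mpsh X V by unfold_locales (rule V)
 interpret T: mpsh X ?T by unfold_locales (rule twisted_psh[OF V C])
 interpret Tx: module "Ost x" "Mst ?T x" by (rule T.Mst_mod[OF x])
 interpret VT: two_mods "Ost x" "Mst V x" "Mst ?T x"
 using V.Mst_mod[OF x] Tx.module_axioms by (simp add: two_mods_def)
 have N: "?N = m * q * a" by simp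
 have g: "mlin x (m * q * a) V ?T (%es. ptn ?N V (a * m) C x es cs)"
 using ptn_mlt(1)[OF V C x cs, of ?N] unfolding N .
 show ?thesis
 proof (rule VT.mlt_in_submod_if_powers[OF g T.gsp_sub[OF x] _ _ _ S a])
 show "0 < m * q" using pos by simp
 show "w:gsp ?T x"
 if "w:stk ?T x" "[Suc n] \<cdot>\<^sub>(Mst ?T x) w:gsp ?T x" for n w
 by (rule Tx.submod_divide[OF T.gsp_sub[OF x] tor that])
 show "es:wstk (m * q * a) V x" using es unfolding N .
 fix xs M assume xs: "xs:wstk (m * q * a) V x" and eq: "mset xs = repeat_mset (m * q) M"
 obtain vs where vs: "mset vs = M" using ex_mset by blast
 have len: "length vs = a"
 proof -
 have "length xs = size (repeat_mset (m * q) (mset vs))" unfolding vs eq[symmetric] by (rule size_mset[symmetric])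
 hence "m * q * a = m * q * length vs" using xs by (simp only: words_def mem_Collect_eq size_repeat_mset size_mset)
 thus ?thesis using pos by simp
 qed
 have "set vs <= set xs"
 proof
 fix v assume "v:set vs"
 hence "0 < count (repeat_mset (m * q) M) v" unfolding vs[symmetric] count_repeat_mset using pos by simp
 thus "v:set xs" unfolding eq[symmetric] by simp
 qed
 hence vsw: "vs:wstk a V x" using len xs unfolding words_def by blast
 have "mset xs = mset (concat (map (replicate (m * q)) vs))"
 unfolding eq mset_concat_rep vs ..
 then obtain p where p: "p permutes {..<length (concat (map (replicate (m * q)) vs))}"
 "permute_list p (concat (map (replicate (m * q)) vs)) = xs" by (rule mset_eq_permutation)
 have w: "concat (map (replicate (m * q)) vs):wstk ?N V x"
 using vsw by (intro w_concat) (auto simp: nwords_def words_def)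
 have p': "p permutes {..<?N}" using p(1) w by (simp add: words_def)
 have "ptn ?N V (a * m) C x (concat (map (replicate (m * q)) vs)) cs:gsp ?T x"
 by (rule pure_powers_glob[OF V C x _ vsw cs]) (rule pure_power_glob[OF V C x tor gen])
 from ptn_perm[OF V C x w cs this p']
 show "ptn ?N V (a * m) C x xs cs:gsp ?T x" unfolding p(2) .
 qed
qed

text \<open>The twists of the two factors are combined by an arbitrary multilinear operation
  \<open>ka\<close> with values in \<open>T^M B\<close>, required to generate that stalk at
  \<open>x\<close>. Contraction and concatenation are the two instances.\<close>

theorem tns_gen:
 assumes E: "psh E" and F: "psh F" and C: "psh C"
 and D: "psh D" and B: "psh B"
 and ka1: "!!z ds. z:pts ==> ds:wstk n' D z ==>
 mlin z n C (tpw M B) (%cs. ka z cs ds)"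
 and ka2: "!!z cs. z:pts ==> cs:wstk n C z ==>
 mlin z n' D (tpw M B) (ka z cs)"
 and ka_local: "!!U cs ds. opn U ==> cs:wsec n C U ==> ds:wsec n' D U ==>
 EX t:sec (tpw M B) U. !z:U.
 ka z (mg C z U cs) (mg D z U ds) = gm (tpw M B) z U t"
 and x: "x:pts"
 and ka_span: "stk (tpw M B) x =
 spn (tpw M B) x
 {ka x cs ds | cs ds. cs:wstk n C x & ds:wstk n' D x}"
 and pE: "!!es cs. es:wstk (M * Q) E x ==> cs:wstk n C x ==>
 ptn (M * Q) E n C x es cs:gsp (twd (M * Q) E n C) x"
 and pF: "!!fs ds. fs:wstk (M * Q) F x ==> ds:wstk n' D x ==>
 ptn (M * Q) F n' D x fs ds:gsp (twd (M * Q) F n' D) x"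
 shows "ggen (tns (spw M (spw Q (tns E F)))
 (tpw M B)) x"
proof -
 let ?EF = "tns E F"
 let ?S = "spw M (spw Q ?EF)" and ?B = "tpw M B"
 let ?W = "tns ?S ?B"
 note EF = tns_psh[OF E F]
 note preS = nst_psh[OF EF, of M Q] and preB = wpow_psh[OF B, of False M]
 note preW = tns_psh[OF preS preB]
 interpret EF: mpsh X ?EF by unfold_locales (rule EF)
 interpret E: mpsh X E by unfold_locales (rule E)
 interpret F: mpsh X F by unfold_locales (rule F)
 interpret S: mpsh X ?S by unfold_locales (rule preS)
 interpret B: mpsh X ?B by unfold_locales (rule preB)
 interpret W: mpsh X ?W by unfold_locales (rule preW)
 have nest: "mlin z (M * Q) ?EF ?S
 (%xs. nst_word X M Q ?EF z (chunks M Q xs))" if z: "z:pts" for z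
 unfolding nst_word_def
 by (rule mlt_chunks[OF stw_mlt[OF EF z] stw_mlt[OF wpow_psh[OF EF] z]])
 have nestW: "mlin z (M * Q) ?EF ?W
 (%xs. stn ?S ?B z (nst_word X M Q ?EF z (chunks M Q xs)) b)"
 if z: "z:pts" and b: "b:stk ?B z" for z b
 by (rule mlt_compose[OF nest[OF z] bilinearD(2)[OF stn_bil[OF preS preB z] b]])
 \<comment> \<open>Letters of \<open>E\<close> and \<open>F\<close> are paired off into letters of
   the tensor product, and the resulting word of length \<open>M Q\<close> is read as a nested
   word.\<close>
 define g where "g z es cs fs ds =
 stn ?S ?B z (nst_word X M Q ?EF z (chunks M Q (map2 (stn E F z) es fs))) (ka z cs ds)"
 for z es cs fs ds
 have taw: "map2 (stn E F z) es fs:wstk (M * Q) ?EF z"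
 if "z:pts" "es:wstk (M * Q) E z" "fs:wstk (M * Q) F z" for z es fs
 using that bilinearD(3)[OF stn_bil[OF E F that(1)]]
 by (fastforce simp: words_def dest: set_zip_leftD set_zip_rightD)
 have kac: "ka z cs ds:stk ?B z"
 if "z:pts" "cs:wstk n C z" "ds:wstk n' D z" for z cs ds
 by (rule mltD(1)[OF ka2[OF that(1,2)] that(3)])
 have g_global: "g x es cs fs ds:gsp ?W x"
 if es: "es:wstk (M * Q) E x" and cs: "cs:wstk n C x"
 and fs: "fs:wstk (M * Q) F x" and ds: "ds:wstk n' D x" for es cs fs ds
 proof (rule twisted_product[OF E C F D preW tns_gluing[OF preS preB] _ _ _ _ _ x es cs fs ds pE[OF es cs] pF[OF fs ds]])
 fix z es cs fs ds assume z: "z:pts"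
 note bil = stn_bil[OF E F z]
 show "mlin z (M * Q) E ?W (%es. g z es cs fs ds)"
 if "cs:wstk n C z" "fs:wstk (M * Q) F z" "ds:wstk n' D z"
 unfolding g_def by (rule mlt_map2(1)[OF bil nestW[OF z kac[OF z that(1,3)]] that(2)])
 show "mlin z (M * Q) F ?W (%fs. g z es cs fs ds)"
 if "es:wstk (M * Q) E z" "cs:wstk n C z" "ds:wstk n' D z"
 unfolding g_def by (rule mlt_map2(2)[OF bil nestW[OF z kac[OF z that(2,3)]] that(1)])
 show "mlin z n C ?W (%cs. g z es cs fs ds)"
 if "es:wstk (M * Q) E z" "fs:wstk (M * Q) F z" "ds:wstk n' D z"
 unfolding g_def
 by (rule mlt_compose[OF ka1[OF z that(3)] bilinearD(1)[OF stn_bil[OF preS preB z]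
 mltD(1)[OF nest[OF z] taw[OF z that(1,2)]]]])
 show "mlin z n' D ?W (%ds. g z es cs fs ds)"
 if "es:wstk (M * Q) E z" "cs:wstk n C z" "fs:wstk (M * Q) F z"
 unfolding g_def
 by (rule mlt_compose[OF ka2[OF z that(2)] bilinearD(1)[OF stn_bil[OF preS preB z]
 mltD(1)[OF nest[OF z] taw[OF z that(1,3)]]]])
 next
 fix U es cs fs ds assume U: "opn U" and w: "es:wsec (M * Q) E U" "cs:wsec n C U"
 "fs:wsec (M * Q) F U" "ds:wsec n' D U"
 obtain t where t: "t:sec ?B U"
 "!z:U. ka z (mg C z U cs) (mg D z U ds) = gm ?B z U t"
 using ka_local[OF U w(2,4)] by blast
 let ?ts = "map2 (tsec X E F U) es fs"
 have tsec: "tsec X E F U e f:sec ?EF U" if "(e, f):set (zip es fs)" for e f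
 using w(1,3) set_zip_leftD[OF that] set_zip_rightD[OF that]
 by (intro tsec_c[OF E F U]) (auto simp: words_def)
 have ts: "?ts:wsec (M * Q) ?EF U" using w(1,3) tsec by (auto simp: words_def)
 note vss = chunks_nst_w[OF ts] and nsc = nst_sct_c[OF EF U chunks_nst_w[OF ts]]
 show "EX t:sec ?W U. !z:U. g z (mg E z U es) (mg C z U cs)
 (mg F z U fs) (mg D z U ds) = gm ?W z U t"
 proof (intro bexI[OF _ tsec_c[OF preS preB U nsc t(1)]] ballI)
 fix z assume z: "z:U"
 have eq: "map2 (stn E F z) (mg E z U es) (mg F z U fs) =
 mg ?EF z U ?ts"
 unfolding zip_map_map map_map
 proof (rule map_cong[OF refl])
 fix p assume p: "p:set (zip es fs)"
 obtain e f where ef: "p = (e, f)" by fastforce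
 have "e:sec E U" "f:sec F U"
 using w(1,3) p set_zip_leftD[of e f] set_zip_rightD[of e f] unfolding ef words_def by blast+
 thus "((%(x, y). stn E F z x y) \<circ> (%(x, y). (gm E z U x, gm F z U y))) p =
 (gm ?EF z U \<circ> (%(x, y). tsec X E F U x y)) p"
 unfolding ef by (simp add: stn_gm[OF E F U z])
 qed
 show "g z (mg E z U es) (mg C z U cs)
 (mg F z U fs) (mg D z U ds) =
 gm ?W z U (tsec X ?S ?B U (nst_sct X M Q ?EF U (chunks M Q ?ts)) t)"
 unfolding g_def t(2)[rule_format, OF z] eq chunks_map[where f = "gm ?EF z U"] nst_word_germ[OF EF U z vss]
 by (rule stn_gm[OF preS preB U z nsc t(1)])
 qed
 qed
 note bil = stn_bil[OF preS preB x]
 interpret EFW: two_mods "Ost x" "Mst ?EF x" "Mst ?W x"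
 using EF.Mst_mod[OF x] W.Mst_mod[OF x] by (simp add: two_mods_def)
 have "stn ?S ?B x G H:gsp ?W x"
 if "G:stk ?S x" "H:stk ?B x" for G H
 proof (rule bil_span_subset[OF S.Mst_mod[OF x] B.Mst_mod[OF x] W.Mst_mod[OF x] bil
 _ nst_word_span[OF EF x] _ ka_span W.gsp_sub[OF x] _ that])
 show "nst_word X M Q ?EF x ` nwords M Q (Mst ?EF x) <= stk ?S x"
 using nst_word_c[OF EF x] by blast
 show "{ka x cs ds | cs ds. cs:wstk n C x & ds:wstk n' D x} <= stk ?B x"
 using kac[OF x] by blast
 fix G H assume "G:nst_word X M Q ?EF x ` nwords M Q (Mst ?EF x)"
 "H:{ka x cs ds | cs ds. cs:wstk n C x & ds:wstk n' D x}"
 then obtain vss cs ds where G: "G = nst_word X M Q ?EF x vss" "vss:nwords M Q (Mst ?EF x)"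
 and H: "H = ka x cs ds" "cs:wstk n C x" "ds:wstk n' D x" by blast
 \<comment> \<open>By multilinearity the letters of the tensor product may be taken to be pure
   tensors; for such words the claim is \<open>g_global\<close>.\<close>
 let ?ta = "{stn E F x G H | G H. G:stk E x & H:stk F x}"
 have "?ta <= stk ?EF x" using bilinearD(3)[OF stn_bil[OF E F x]] by blast
 hence "stn ?S ?B x (nst_word X M Q ?EF x (chunks M Q (concat vss))) (ka x cs ds):gsp ?W x"
 proof (rule EFW.mlt_in_submod[OF _ stn_span[OF E F x] nestW[OF x kac[OF x H(2,3)]]
 W.gsp_sub[OF x] _ w_concat[OF G(2)]])
 fix ss assume ss: "length ss = M * Q" "set ss <= ?ta"
 note ex = list_in_map2_image[OF ss(2)]
 obtain es where ex': "EX fs. length es = length ss & length fs = length ss & set es <= stk E x &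
 set fs <= stk F x & ss = map2 (stn E F x) es fs"
 using ex by (rule exE)
 obtain fs where fs: "length es = length ss & length fs = length ss & set es <= stk E x &
 set fs <= stk F x & ss = map2 (stn E F x) es fs"
 using ex' by (rule exE)
 hence eq: "ss = map2 (stn E F x) es fs" by (elim conjE)
 have "es:wstk (M * Q) E x" "fs:wstk (M * Q) F x"
 using fs ss(1) unfolding words_def by (elim conjE; intro CollectI conjI; simp only:)+
 from g_global[OF this(1) H(2) this(2) H(3)]
 show "stn ?S ?B x (nst_word X M Q ?EF x (chunks M Q ss)) (ka x cs ds):gsp ?W x"
 unfolding g_def eq .
 qed
 thus "stn ?S ?B x G H:gsp ?W x"
 unfolding chunks_concat[OF G(2)] G(1)[symmetric] H(1)[symmetric] .
 qed
 thus ?thesis by (intro W.gen_atI[OF x stn_span[OF preS preB x]]) blast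
qed

end

section \<open>Contraction against a dual\<close>

definition regular :: "('a, 'c) ring_scheme => ('a, 'a) module" where
 "regular R = \<lparr>carrier = cr R, mult = undefined, one = undefined, zero = \<zero>\<^sub>R, add = add R, smult = mult R\<rparr>"

lemma regular_simps [simp]:
 "cr (regular R) = cr R" "\<zero>\<^sub>(regular R) = \<zero>\<^sub>R"
 "x \<oplus>\<^sub>(regular R) y = x \<oplus>\<^sub>R y" "x \<odot>\<^sub>(regular R) y = x \<otimes>\<^sub>R y"
 by (simp_all add: regular_def)

lemma (in cring) regular_mod: "module R (regular R)"
proof (rule moduleI)
 show "abelian_group (regular R)"
 proof (rule abelian_groupI)
 show "EX y:cr (regular R). y \<oplus>\<^sub>(regular R) x = \<zero>\<^sub>(regular R)" if "x:cr (regular R)" for x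
 using that by (intro bexI[of _ "\<ominus> x"]) (simp_all add: l_neg)
 qed (simp_all add: a_ac)
qed (simp_all add: is_cring l_distr r_distr m_ac)

text \<open>Contraction of a word of functionals with a word of vectors: the values of the pairing
  act successively as scalars on \<open>m\<close>.\<close>

definition contr where
 "contr pr N als bes m = foldr (%(al, be) m. pr al be \<odot>\<^sub>N m) (zip als bes) m"

lemma contr_swap: "contr pr N als bes m = contr (%be al. pr al be) N bes als m"
proof (induction als arbitrary: bes)
 case (Cons al als)
 thus ?case by (cases bes) (simp_all add: contr_def)
qed (simp add: contr_def)

lemma contr_simps [simp]:
 "contr pr N [] [] m = m"
 "contr pr N (al # als) (be # bes) m = pr al be \<odot>\<^sub>N contr pr N als bes m"
 by (simp_all add: contr_def)

lemma bil_swap: "bilinear R L M N b ==> bilinear R M L N (%y x. b x y)"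
 by (simp add: bilinear_def)

context
 fixes R :: "('r, 'c) ring_scheme" and D :: "('r, 'd, 'e) module_scheme" and A :: "('r, 'a, 'f) module_scheme"
 and N :: "('r, 'n, 'g) module_scheme"
 assumes N: "module R N"
begin

interpretation N: module R N by (rule N)
interpretation NN: two_mods R N N using N by (simp add: two_mods_def)

lemma smult_lin: "f:lin R D N ==> r:cr R ==> (%x. r \<odot>\<^sub>N f x):lin R D N"
 by (rule linI) (simp_all add: linD[of f R D N] N.smult_r_distr N.smult_assoc1[symmetric] N.R.m_comm)

lemma contr_hom:
 assumes pr: "bilinear R D A (regular R) pr" and "als:words n D" "bes:words n A"
 shows "contr pr N als bes:lin R N N"
 using assms(2,3)
proof (induction n arbitrary: als bes)
 case 0
 thus ?case by (auto intro: linI)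
next
 case (Suc n)
 obtain al als' where al: "als = al # als'" "al:cr D" "als':words n D" using Suc.prems(1) by (rule w_SucE)
 obtain be bes' where be: "bes = be # bes'" "be:cr A" "bes':words n A" using Suc.prems(2) by (rule w_SucE)
 have "pr al be:cr R" using bilinearD(3)[OF pr al(2) be(2)] by simp
 from NN.lin_smult[OF Suc.IH[OF al(3) be(3)] this]
 show ?case by (simp add: al(1) be(1))
qed

lemma contr_mlt1:
 assumes pr: "bilinear R D A (regular R) pr" and m: "m:cr N" and "bes:words n A"
 shows "mlt R n D N (%als. contr pr N als bes m)"
 using assms(3)
proof (induction n arbitrary: bes)
 case 0
 thus ?case using m by (auto intro: mlt_0)
next
 case (Suc n)
 obtain be bes' where be: "bes = be # bes'" "be:cr A" "bes':words n A" using Suc.prems by (rule w_SucE)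
 note IH = Suc.IH[OF be(3)]
 show ?case
 unfolding mlt_def
 proof (intro conjI ballI allI impI funcsetI)
 show "contr pr N als bes m:cr N" if "als:words (Suc n) D" for als
 by (rule linD(1)[OF contr_hom[OF pr that Suc.prems] m])
 fix als i assume als: "als:words (Suc n) D" and i: "i < Suc n"
 obtain al als' where al: "als = al # als'" "al:cr D" "als':words n D" using als by (rule w_SucE)
 have c: "contr pr N als' bes' m:cr N" by (rule mltD(1)[OF IH al(3)])
 show "(%x. contr pr N (als[i := x]) bes m):lin R D N"
 proof (cases i)
 case 0
 have p: "(%x. pr x be):lin R D (regular R)" by (rule bilinearD(2)[OF pr be(2)])
 have pc: "pr x be:cr R" if "x:cr D" for x using linD(1)[OF p that] by simp
 have "(%x. pr x be \<odot>\<^sub>N contr pr N als' bes' m):lin R D N"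
 proof (rule linI)
 show "pr x be \<odot>\<^sub>N contr pr N als' bes' m:cr N" if "x:cr D" for x
 by (rule N.smult_closed[OF pc[OF that] c])
 show "pr (x \<oplus>\<^sub>D y) be \<odot>\<^sub>N contr pr N als' bes' m =
 pr x be \<odot>\<^sub>N contr pr N als' bes' m \<oplus>\<^sub>N pr y be \<odot>\<^sub>N contr pr N als' bes' m"
 if "x:cr D" "y:cr D" for x y
 using linD(2)[OF p that] N.smult_l_distr[OF pc[OF that(1)] pc[OF that(2)] c] by simp
 show "pr (r \<odot>\<^sub>D x) be \<odot>\<^sub>N contr pr N als' bes' m = r \<odot>\<^sub>N (pr x be \<odot>\<^sub>N contr pr N als' bes' m)"
 if "r:cr R" "x:cr D" for r x
 using linD(3)[OF p that] N.smult_assoc1[OF that(1) pc[OF that(2)] c] by simp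
 qed
 thus ?thesis by (simp add: 0 al(1) be(1))
 next
 case (Suc j)
 have "pr al be:cr R" using bilinearD(3)[OF pr al(2) be(2)] by simp
 from smult_lin[OF mltD(2)[OF IH al(3)] this, of j]
 show ?thesis using i by (simp add: Suc al(1) be(1))
 qed
 qed
qed

end

lemma contr_mlt2:
 assumes "module R N" "bilinear R D A (regular R) pr" "m:cr N" "als:words n D"
 shows "mlt R n A N (%bes. contr pr N als bes m)"
 unfolding contr_swap[of pr]
 by (rule contr_mlt1[OF assms(1) bil_swap[OF assms(2)] assms(3,4)])

text \<open>Where the pairing takes the value one, contraction with repeated letters is the
  identity. This is how contractions are seen to be onto.\<close>

lemma (in module) contr_rep:
 assumes "pr al be = \<one>\<^sub>R" "m:cr M"
 shows "contr pr M (replicate n al) (replicate n be) m = m"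
 by (induction n) (simp_all add: assms)

subsection \<open>The dual sheaf\<close>

lemma structure_mod_eq: "Msec (structure_module X) V = regular (Osec X V)" "Mres (structure_module X) = Ores X"
 by (simp_all add: structure_module_def regular_def)

context mpsh
begin

abbreviation "dual == dual_sheaf X M"

lemma opbD: "V:opb U ==> opn V" "V:opb U ==> V <= U"
 by (simp_all add: opens_below_def)

lemma dual_sct_iff:
 "ph:sec dual U \<longleftrightarrow> ph:extensional (opb U) &
 (!V:opb U. ph V:extensional (sec M V) &
 ph V:lin (OS V) (Msec M V) (regular (OS V))) &
 (!V:opb U. !W:opb V. !s:sec M V. ph W (Mres M V W s) = Ores X V W (ph V s))"
 by (auto simp: dual_sheaf_def sheaf_homs_def linear_maps_def structure_mod_eq PiE_def Pi_def lin_def)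

lemma dual_sct_hom:
 "ph:sec dual U ==> V:opb U ==> ph V:lin (OS V) (Msec M V) (regular (OS V))"
 by (simp add: dual_sct_iff)

lemma dsec_c:
 assumes "ph:sec dual U" "V:opb U" "s:sec M V"
 shows "ph V s:osec V"
 using linD(1)[OF dual_sct_hom[OF assms(1,2)] assms(3)] by simp

lemma dual_sct_res:
 "ph:sec dual U ==> V:opb U ==> W:opb V ==> s:sec M V ==>
 ph W (Mres M V W s) = Ores X V W (ph V s)"
 by (simp add: dual_sct_iff)

lemma dual_sct_eqI:
 assumes "ph:sec dual U" "ps:sec dual U"
 and "!!V s. V:opb U ==> s:sec M V ==> ph V s = ps V s"
 shows "ph = ps"
proof (rule extensionalityI)
 show "ph:extensional (opb U)" "ps:extensional (opb U)"
 using assms by (simp_all add: dual_sct_iff)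
 fix V assume V: "V:opb U"
 show "ph V = ps V"
 by (rule extensionalityI[where A = "sec M V"])
 (use assms V in \<open>simp_all add: dual_sct_iff\<close>)
qed

lemma dual_sctI:
 assumes hom: "!!V. V:opb U ==> h V:lin (OS V) (Msec M V) (regular (OS V))"
 and nat: "!!V W s. V:opb U ==> W:opb V ==> s:sec M V ==>
 h W (Mres M V W s) = Ores X V W (h V s)"
 shows "(\<lambda>V\<in>opb U. \<lambda>s\<in>sec M V. h V s):sec dual U"
 unfolding dual_sct_iff
proof (intro conjI ballI)
 fix V assume V: "V:opb U"
 interpret MV: module "OS V" "Msec M V" by (rule Msec_mod[OF opbD(1)[OF V]])
 show "(\<lambda>V\<in>opb U. \<lambda>s\<in>sec M V. h V s) V:lin (OS V) (Msec M V) (regular (OS V))"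
 using V hom[OF V] by (auto simp: lin_def)
 fix W s assume W: "W:opb V" and s: "s:sec M V"
 have "W:opb U" using V W by (auto simp: opens_below_def)
 thus "(\<lambda>V\<in>opb U. \<lambda>s\<in>sec M V. h V s) W (Mres M V W s) =
 Ores X V W ((\<lambda>V\<in>opb U. \<lambda>s\<in>sec M V. h V s) V s)"
 using V s nat[OF V W s] M.res_c[OF opbD(1)[OF V] opbD[OF W] s] by simp
qed (auto simp: restrict_extensional)

lemma dual_simps:
 "\<zero>\<^sub>(Msec dual U) = (\<lambda>V\<in>opb U. \<lambda>s\<in>sec M V. \<zero>\<^sub>(OS V))"
 "ph \<oplus>\<^sub>(Msec dual U) ps = (\<lambda>V\<in>opb U. \<lambda>s\<in>sec M V. ph V s \<oplus>\<^sub>(OS V) ps V s)"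
 "r \<odot>\<^sub>(Msec dual U) ph = (\<lambda>V\<in>opb U. \<lambda>s\<in>sec M V. Ores X U V r \<otimes>\<^sub>(OS V) ph V s)"
 "Mres dual U V ph = restrict ph (opb V)"
 by (simp_all add: dual_sheaf_def)

lemma dual_ops_c:
 assumes U: "opn U"
 shows "\<zero>\<^sub>(Msec dual U):sec dual U"
 and "ph:sec dual U ==> ps:sec dual U ==> ph \<oplus>\<^sub>(Msec dual U) ps:sec dual U"
 and "r:osec U ==> ph:sec dual U ==> r \<odot>\<^sub>(Msec dual U) ph:sec dual U"
proof -
 have two: "two_mods (OS V) (Msec M V) (regular (OS V))" if "opn V" for V
 using Msec_mod[OF that] cring.regular_mod[OF OS_cring[OF that]] by (simp add: two_mods_def)
 have rh: "Ores X V W:ring_hom (OS V) (OS W)" if "V:opb U" "W:opb V" for V W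
 using Ores_hom[OF opbD(1)[OF that(1)] opbD[OF that(2)]] .
 show "\<zero>\<^sub>(Msec dual U):sec dual U"
 unfolding dual_simps
 proof (rule dual_sctI)
 show "(%s. \<zero>\<^sub>(OS V)):lin (OS V) (Msec M V) (regular (OS V))" if "V:opb U" for V
 using two_mods.lin_const_zero[OF two[OF opbD(1)[OF that]]] by simp
 show "\<zero>\<^sub>(OS W) = Ores X V W \<zero>\<^sub>(OS V)" if "V:opb U" "W:opb V" for V W
 using Ores_zero[OF opbD(1)[OF that(1)] opbD[OF that(2)]] ..
 qed
 show "ph \<oplus>\<^sub>(Msec dual U) ps:sec dual U"
 if ph: "ph:sec dual U" and ps: "ps:sec dual U" for ph ps
 unfolding dual_simps
 proof (rule dual_sctI)
 show "(%s. ph V s \<oplus>\<^sub>(OS V) ps V s):lin (OS V) (Msec M V) (regular (OS V))"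
 if V: "V:opb U" for V
 using two_mods.lin_add[OF two[OF opbD(1)[OF V]] dual_sct_hom[OF ph V] dual_sct_hom[OF ps V]]
 by simp
 show "ph W (Mres M V W s) \<oplus>\<^sub>(OS W) ps W (Mres M V W s) = Ores X V W (ph V s \<oplus>\<^sub>(OS V) ps V s)"
 if V: "V:opb U" "W:opb V" "s:sec M V" for V W s
 using ring_hom_add[OF rh[OF V(1,2)] dsec_c[OF ph V(1,3)] dsec_c[OF ps V(1,3)]]
 dual_sct_res[OF ph V] dual_sct_res[OF ps V] by simp
 qed
 show "r \<odot>\<^sub>(Msec dual U) ph:sec dual U"
 if r: "r:osec U" and ph: "ph:sec dual U" for r ph
 unfolding dual_simps
 proof (rule dual_sctI)
 have rV: "Ores X U V r:osec V" if "V:opb U" for V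
 by (rule O.res_c[OF U opbD[OF that] r])
 show "(%s. Ores X U V r \<otimes>\<^sub>(OS V) ph V s):lin (OS V) (Msec M V) (regular (OS V))"
 if V: "V:opb U" for V
 using two_mods.lin_smult[OF two[OF opbD(1)[OF V]] dual_sct_hom[OF ph V] rV[OF V]] by simp
 show "Ores X U W r \<otimes>\<^sub>(OS W) ph W (Mres M V W s) = Ores X V W (Ores X U V r \<otimes>\<^sub>(OS V) ph V s)"
 if V: "V:opb U" "W:opb V" "s:sec M V" for V W s
 using ring_hom_mult[OF rh[OF V(1,2)] rV[OF V(1)] dsec_c[OF ph V(1,3)]]
 dual_sct_res[OF ph V] O.res_res[OF U opbD(1)[OF V(1)] opbD[OF V(2)] opbD(2)[OF V(1)] r]
 by simp
 qed
qed

lemma dual_mod: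
 assumes U: "opn U"
 shows "module (OS U) (Msec dual U)"
proof (rule moduleI[OF OS_cring[OF U]])
 note c = dual_ops_c[OF U]
 have R: "cring (OS V)" if "V:opb U" for V by (rule OS_cring[OF opbD(1)[OF that]])
 have rh: "Ores X U V:ring_hom (OS U) (OS V)" if "V:opb U" for V
 using Ores_hom[OF U opbD[OF that]] .
 note rs = ring_hom_closed[OF rh] dsec_c dual_simps ring_hom_add[OF rh] ring_hom_mult[OF rh]
 ring_hom_one[OF rh] cring.cring_simprules[OF R] cring.cring_simprules(8)[OF R]
 show "abelian_group (Msec dual U)"
 proof (rule abelian_groupI[OF c(2,1)])
 show "ph \<oplus>\<^sub>(Msec dual U) ps \<oplus>\<^sub>(Msec dual U) ch = ph \<oplus>\<^sub>(Msec dual U) (ps \<oplus>\<^sub>(Msec dual U) ch)"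
 if "ph:sec dual U" "ps:sec dual U" "ch:sec dual U" for ph ps ch
 by (rule dual_sct_eqI[OF c(2)[OF c(2)[OF that(1,2)] that(3)] c(2)[OF that(1) c(2)[OF that(2,3)]]])
 (use that in \<open>simp add: rs\<close>)
 show "ph \<oplus>\<^sub>(Msec dual U) ps = ps \<oplus>\<^sub>(Msec dual U) ph"
 if "ph:sec dual U" "ps:sec dual U" for ph ps
 by (rule dual_sct_eqI[OF c(2)[OF that] c(2)[OF that(2,1)]]) (use that in \<open>simp add: rs\<close>)
 show "\<zero>\<^sub>(Msec dual U) \<oplus>\<^sub>(Msec dual U) ph = ph" if "ph:sec dual U" for ph
 by (rule dual_sct_eqI[OF c(2)[OF c(1) that] that]) (use that in \<open>simp add: rs\<close>)
 show "EX ps:sec dual U. ps \<oplus>\<^sub>(Msec dual U) ph = \<zero>\<^sub>(Msec dual U)" if ph: "ph:sec dual U" for ph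
 proof
 interpret RU: cring "OS U" by (rule OS_cring[OF U])
 have m: "\<ominus>\<^sub>(OS U) \<one>\<^sub>(OS U):osec U" by simp
 show n: "(\<ominus>\<^sub>(OS U) \<one>\<^sub>(OS U)) \<odot>\<^sub>(Msec dual U) ph:sec dual U" by (rule c(3)[OF m ph])
 show "(\<ominus>\<^sub>(OS U) \<one>\<^sub>(OS U)) \<odot>\<^sub>(Msec dual U) ph \<oplus>\<^sub>(Msec dual U) ph = \<zero>\<^sub>(Msec dual U)"
 proof (rule dual_sct_eqI[OF c(2)[OF n ph] c(1)])
 fix V s assume V: "V:opb U" and s: "s:sec M V"
 interpret RV: cring "OS V" by (rule R[OF V])
 have p: "ph V s:osec V" by (rule dsec_c[OF ph V s])
 have "Ores X U V (\<ominus>\<^sub>(OS U) \<one>\<^sub>(OS U)) = \<ominus>\<^sub>(OS V) \<one>\<^sub>(OS V)"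
 using ring_hom_cring.hom_a_inv[of "OS U" "OS V" "Ores X U V" "\<one>\<^sub>(OS U)"] rh[OF V]
 ring_hom_one[OF rh[OF V]]
 by (simp add: ring_hom_cring_def ring_hom_cring_axioms_def RU.is_cring RV.is_cring)
 thus "((\<ominus>\<^sub>(OS U) \<one>\<^sub>(OS U)) \<odot>\<^sub>(Msec dual U) ph \<oplus>\<^sub>(Msec dual U) ph) V s = \<zero>\<^sub>(Msec dual U) V s"
 using V s p by (simp add: dual_simps RV.l_minus RV.l_neg)
 qed
 qed
 qed
 show "r \<odot>\<^sub>(Msec dual U) ph:sec dual U"
 if "r:osec U" "ph:sec dual U" for r ph by (rule c(3)[OF that])
 interpret RU: cring "OS U" by (rule OS_cring[OF U])
 show "(r \<oplus>\<^sub>(OS U) r') \<odot>\<^sub>(Msec dual U) ph = r \<odot>\<^sub>(Msec dual U) ph \<oplus>\<^sub>(Msec dual U) r' \<odot>\<^sub>(Msec dual U) ph"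
 if "r:osec U" "r':osec U" "ph:sec dual U" for r r' ph
 by (rule dual_sct_eqI[OF c(3)[OF RU.a_closed[OF that(1,2)] that(3)] c(2)[OF c(3)[OF that(1,3)] c(3)[OF that(2,3)]]])
 (use that in \<open>simp add: rs\<close>)
 show "r \<odot>\<^sub>(Msec dual U) (ph \<oplus>\<^sub>(Msec dual U) ps) = r \<odot>\<^sub>(Msec dual U) ph \<oplus>\<^sub>(Msec dual U) r \<odot>\<^sub>(Msec dual U) ps"
 if "r:osec U" "ph:sec dual U" "ps:sec dual U" for r ph ps
 proof (rule dual_sct_eqI[OF c(3)[OF that(1) c(2)[OF that(2,3)]] c(2)[OF c(3)[OF that(1,2)] c(3)[OF that(1,3)]]])
 fix V s assume V: "V:opb U" and s: "s:sec M V"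
 interpret RV: cring "OS V" by (rule R[OF V])
 show "(r \<odot>\<^sub>(Msec dual U) (ph \<oplus>\<^sub>(Msec dual U) ps)) V s = (r \<odot>\<^sub>(Msec dual U) ph \<oplus>\<^sub>(Msec dual U) r \<odot>\<^sub>(Msec dual U) ps) V s"
 using V s that ring_hom_closed[OF rh[OF V] that(1)] dsec_c[OF _ V s]
 by (simp add: dual_simps RV.r_distr)
 qed
 show "(r \<otimes>\<^sub>(OS U) r') \<odot>\<^sub>(Msec dual U) ph = r \<odot>\<^sub>(Msec dual U) (r' \<odot>\<^sub>(Msec dual U) ph)"
 if "r:osec U" "r':osec U" "ph:sec dual U" for r r' ph
 by (rule dual_sct_eqI[OF c(3)[OF RU.m_closed[OF that(1,2)] that(3)] c(3)[OF that(1) c(3)[OF that(2,3)]]])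
 (use that in \<open>simp add: rs\<close>)
 show "\<one>\<^sub>(OS U) \<odot>\<^sub>(Msec dual U) ph = ph" if ph: "ph:sec dual U" for ph
 proof (rule dual_sct_eqI[OF c(3)[OF RU.one_closed ph] ph])
 fix V s assume V: "V:opb U" and s: "s:sec M V"
 interpret RV: cring "OS V" by (rule R[OF V])
 show "(\<one>\<^sub>(OS U) \<odot>\<^sub>(Msec dual U) ph) V s = ph V s"
 using V s dsec_c[OF ph V s] ring_hom_one[OF rh[OF V]] by (simp add: dual_simps)
 qed
qed

lemma dual_psh: "psh dual"
 unfolding psheaf_def
proof (intro conjI allI impI ballI; (elim conjE)?)
 have sub: "opb V <= opb U" if "V <= U" for U V using that by (auto simp: opens_below_def)
 show "set_psh (Top X) (%U. sec dual U) (Mres dual)"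
 proof
 fix U V ph assume "opn U" "opn V" "V <= U" and ph: "ph:sec dual U"
 note VU = sub[OF \<open>V <= U\<close>]
 show "Mres dual U V ph:sec dual V"
 using ph VU sub[OF opbD(2)] unfolding dual_sct_iff dual_simps
 by (simp add: restrict_extensional subset_iff)
 next
 fix U ph assume "ph:sec dual U"
 thus "Mres dual U U ph = ph" by (simp add: dual_simps dual_sct_iff extensional_restrict)
 next
 fix U V W :: "'p set" and ph assume "W <= V"
 thus "Mres dual V W (Mres dual U V ph) = Mres dual U W ph"
 using sub[of W V] by (simp add: dual_simps Int_absorb1)
 qed
 show "module (OS U) (Msec dual U)" if "opn U" for U by (rule dual_mod[OF that])
 fix U V assume U: "opn U" "opn V" "V <= U"
 note VU = sub[OF U(3)]
 show "Mres dual U V (ph \<oplus>\<^sub>(Msec dual U) ps) = Mres dual U V ph \<oplus>\<^sub>(Msec dual V) Mres dual U V ps" for ph ps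
 using VU by (auto simp: dual_simps fun_eq_iff restrict_def)
 show "Mres dual U V (r \<odot>\<^sub>(Msec dual U) ph) = Ores X U V r \<odot>\<^sub>(Msec dual V) Mres dual U V ph"
 if r: "r:osec U" for r ph
 proof -
 have "Ores X V W (Ores X U V r) = Ores X U W r" if "W:opb V" for W
 by (rule O.res_res[OF U(1,2) opbD[OF that] U(3) r])
 thus ?thesis using VU by (auto simp: dual_simps fun_eq_iff restrict_def)
 qed
qed

definition spair where
 "spair x al be = (SOME r. EX U ph s. opn U & x:U & ph:sec dual U &
 s:sec M U & al = gm dual x U ph & be = gm M x U s & r = og x U (ph U s))"

interpretation D: mpsh X dual by unfold_locales (rule dual_psh)

lemma opb_refl: "opn U ==> U:opb U"
 by (simp add: opens_below_def)

lemma evaluation_germ: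
 assumes U: "opn U" "opn W" "W <= U" "x:W"
 and ph: "ph:sec dual U" and s: "s:sec M U"
 shows "og x U (ph U s) = og x W (Mres dual U W ph W (Mres M U W s))"
proof -
 have W: "W:opb U" using U by (simp add: opens_below_def)
 have "Mres dual U W ph W (Mres M U W s) = ph W (Mres M U W s)"
 using opb_refl[OF U(2)] by (simp add: dual_simps)
 also have "\<dots> = Ores X U W (ph U s)" by (rule dual_sct_res[OF ph opb_refl[OF U(1)] W s])
 finally show ?thesis
 using og_res[OF U dsec_c[OF ph opb_refl[OF U(1)] s]] by simp
qed

lemma spair_germ:
 assumes U: "opn U" "x:U" and ph: "ph:sec dual U" and s: "s:sec M U"
 shows "spair x (gm dual x U ph) (gm M x U s) = og x U (ph U s)"
proof -
 let ?P = "%r. EX V ps t. opn V & x:V & ps:sec dual V & t:sec M V &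
 gm dual x U ph = gm dual x V ps & gm M x U s = gm M x V t & r = og x V (ps V t)"
 have "?P (spair x (gm dual x U ph) (gm M x U s))"
 unfolding spair_def by (rule someI_ex) (use U ph s in blast)
 then obtain V ps t where V: "opn V" "x:V" "ps:sec dual V" "t:sec M V"
 "gm dual x U ph = gm dual x V ps" "gm M x U s = gm M x V t"
 and eq: "spair x (gm dual x U ph) (gm M x U s) = og x V (ps V t)" by blast
 obtain W where W: "opn W" "x:W" "W <= U Int V" "Mres dual U W ph = Mres dual V W ps"
 using V(5) D.gm_eq_iff[OF U ph V(1,2,3)] by blast
 obtain Y where Y: "opn Y" "x:Y" "Y <= U Int V" "Mres M U Y s = Mres M V Y t"
 using V(6) gm_eq_iff[OF U s V(1,2,4)] by blast
 let ?Z = "W Int Y"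
 have Z: "opn ?Z" "x:?Z" "?Z <= U" "?Z <= V" "?Z <= W" "?Z <= Y"
 using W Y by (auto intro: openin_Int)
 have WU: "W <= U" "W <= V" "Y <= U" "Y <= V" using W(3) Y(3) by auto
 have "Mres dual U ?Z ph = Mres dual V ?Z ps"
 using D.M.res_res[OF U(1) W(1) Z(1,5) WU(1) ph] D.M.res_res[OF V(1) W(1) Z(1,5) WU(2) V(3)] W(4) by simp
 moreover have "Mres M U ?Z s = Mres M V ?Z t"
 using M.res_res[OF U(1) Y(1) Z(1,6) WU(3) s] M.res_res[OF V(1) Y(1) Z(1,6) WU(4) V(4)] Y(4) by simp
 ultimately show ?thesis
 unfolding eq evaluation_germ[OF U(1) Z(1,3,2) ph s] evaluation_germ[OF V(1) Z(1,4,2) V(3,4)] by simp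
qed

lemma spair_bil:
 assumes x: "x:pts"
 shows "bilinear (Ost x) (Mst dual x) (Mst M x) (regular (Ost x)) (spair x)"
proof -
 \<comment> \<open>Two germs are packed into a word of length two, to reuse the common neighbourhood
   of a word.\<close>
 have w2: "[al, al']:words 2 N" if "al:cr N" "al':cr N"
 for al al' :: 'z and N :: "('r, 'z) module"
 using that by (simp_all add: words_def)
 have nu2: "EX s t. ss = [s, t] & s:cr N & t:cr N" if "ss:words 2 N" for ss and N :: "('r, 'z) module"
 using that by (cases ss; cases "tl ss") (auto simp: words_def)
 show ?thesis
 unfolding bilinear_def
 proof (intro conjI ballI linI; simp only: regular_simps)
 fix al be assume albe: "al:stk dual x" "be:stk M x"
 obtain V ph where V: "opn V" "x:V" "ph:sec dual V" "al = gm dual x V ph"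
 using albe(1) by (rule D.MstalkE)
 obtain U s where U: "opn U" "x:U" "U <= V" "s:sec M U" "be = gm M x U s"
 using albe(2) V(1,2) by (rule Mst_within)
 define ps where "ps = Mres dual V U ph"
 have ps: "ps:sec dual U" "al = gm dual x U ps"
 unfolding ps_def V(4) using D.M.res_c[OF V(1) U(1,3) V(3)] D.gm_res[OF V(1) U(1,3,2) V(3)] by simp_all
 show "spair x al be:ostk x"
 unfolding ps(2) U(5) spair_germ[OF U(1,2) ps(1) U(4)]
 by (rule og_c[OF U(1,2) dsec_c[OF ps(1) opb_refl[OF U(1)] U(4)]])
 thus "spair x al be:ostk x" .
 fix r assume r: "r:ostk x"
 obtain W a where W: "opn W" "x:W" "W <= U" "a:osec W" "r = og x W a"
 using r U(1,2) by (rule Ost_within)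
 define ch t where "ch = Mres dual U W ps" and "t = Mres M U W s"
 have ch: "ch:sec dual W" "al = gm dual x W ch" and t: "t:sec M W" "be = gm M x W t"
 unfolding ch_def t_def ps(2) U(5)
 using D.M.res_c[OF U(1) W(1,3) ps(1)] D.gm_res[OF U(1) W(1,3,2) ps(1)]
 M.res_c[OF U(1) W(1,3) U(4)] gm_res[OF U(1) W(1,3,2) U(4)] by simp_all
 note c = dsec_c[OF ch(1) opb_refl[OF W(1)] t(1)]
 interpret DW: module "OS W" "Msec dual W" by (rule D.Msec_mod[OF W(1)])
 interpret MW: module "OS W" "Msec M W" by (rule Msec_mod[OF W(1)])
 show "spair x (r \<odot>\<^sub>(Mst dual x) al) be = r \<otimes>\<^sub>(Ost x) spair x al be"
 unfolding ch(2) t(2) W(5) D.Mst_smult[OF W(1,2,4) ch(1)]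
 spair_germ[OF W(1,2) ch(1) t(1)] spair_germ[OF W(1,2) DW.smult_closed[OF W(4) ch(1)] t(1)]
 Ost_mult[OF W(1,2,4) c]
 using opb_refl[OF W(1)] t(1) O.res_id[OF W(1,4)] by (simp add: dual_simps)
 show "spair x al (r \<odot>\<^sub>(Mst M x) be) = r \<otimes>\<^sub>(Ost x) spair x al be"
 unfolding ch(2) t(2) W(5) Mst_smult[OF W(1,2,4) t(1)]
 spair_germ[OF W(1,2) ch(1) t(1)] spair_germ[OF W(1,2) ch(1) MW.smult_closed[OF W(4) t(1)]]
 Ost_mult[OF W(1,2,4) c]
 using linD(3)[OF dual_sct_hom[OF ch(1) opb_refl[OF W(1)]] W(4) t(1)] by simp
 next
 fix al al' be assume albe: "be:stk M x" "al:stk dual x" "al':stk dual x"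
 obtain V phs where V: "opn V" "x:V" "V <= pts" "phs:wsec 2 dual V"
 "[al, al'] = mg dual x V phs"
 using w2[OF albe(2,3)] openin_topspace x by (rule D.Mst_w_within)
 obtain ph ph' where phs: "phs = [ph, ph']" "ph:sec dual V" "ph':sec dual V"
 using nu2[OF V(4)] by blast
 obtain U s where U: "opn U" "x:U" "U <= V" "s:sec M U" "be = gm M x U s"
 using albe(1) V(1,2) by (rule Mst_within)
 define ps ps' where "ps = Mres dual V U ph" and "ps' = Mres dual V U ph'"
 have ps: "ps:sec dual U" "al = gm dual x U ps" "ps':sec dual U" "al' = gm dual x U ps'"
 unfolding ps_def ps'_def
 using D.M.res_c[OF V(1) U(1,3)] D.gm_res[OF V(1) U(1,3,2)] V(5) phs by simp_all
 note U' = opb_refl[OF U(1)]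
 interpret DU: module "OS U" "Msec dual U" by (rule D.Msec_mod[OF U(1)])
 show "spair x (al \<oplus>\<^sub>(Mst dual x) al') be = spair x al be \<oplus>\<^sub>(Ost x) spair x al' be"
 unfolding ps(2,4) U(5) D.Mst_add[OF U(1,2) ps(1,3)]
 spair_germ[OF U(1,2) ps(1) U(4)] spair_germ[OF U(1,2) ps(3) U(4)]
 spair_germ[OF U(1,2) DU.a_closed[OF ps(1,3)] U(4)]
 Ost_add[OF U(1,2) dsec_c[OF ps(1) U' U(4)] dsec_c[OF ps(3) U' U(4)]]
 using U' U(4) by (simp add: dual_simps)
 next
 fix al be be' assume albe: "al:stk dual x" "be:stk M x" "be':stk M x"
 obtain V ss where V: "opn V" "x:V" "V <= pts" "ss:wsec 2 M V"
 "[be, be'] = mg M x V ss"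
 using w2[OF albe(2,3)] openin_topspace x by (rule Mst_w_within)
 obtain s s' where ss: "ss = [s, s']" "s:sec M V" "s':sec M V"
 using nu2[OF V(4)] by blast
 obtain U ph where U: "opn U" "x:U" "U <= V" "ph:sec dual U" "al = gm dual x U ph"
 using albe(1) V(1,2) by (rule D.Mst_within)
 define t t' where "t = Mres M V U s" and "t' = Mres M V U s'"
 have t: "t:sec M U" "be = gm M x U t" "t':sec M U" "be' = gm M x U t'"
 unfolding t_def t'_def
 using M.res_c[OF V(1) U(1,3)] gm_res[OF V(1) U(1,3,2)] V(5) ss by simp_all
 note U' = opb_refl[OF U(1)]
 interpret MU: module "OS U" "Msec M U" by (rule Msec_mod[OF U(1)])
 show "spair x al (be \<oplus>\<^sub>(Mst M x) be') = spair x al be \<oplus>\<^sub>(Ost x) spair x al be'"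
 unfolding t(2,4) U(5) Mst_add[OF U(1,2) t(1,3)]
 spair_germ[OF U(1,2,4) t(1)] spair_germ[OF U(1,2,4) t(3)]
 spair_germ[OF U(1,2,4) MU.a_closed[OF t(1,3)]]
 Ost_add[OF U(1,2) dsec_c[OF U(4) U' t(1)] dsec_c[OF U(4) U' t(3)]]
 using linD(2)[OF dual_sct_hom[OF U(4) U'] t(1,3)] by simp
 qed
qed

end

subsection \<open>Cancelling twists\<close>

lemma mlt_take_drop:
 assumes "!!ys. ys:words n M ==> mlt R m M N (%xs. h xs ys)"
 and "!!xs. xs:words m M ==> mlt R n M N (h xs)"
 shows "mlt R (m + n) M N (%zs. h (take m zs) (drop m zs))"
proof -
 have w: "take m zs:words m M" "drop m zs:words n M" if "zs:words (m + n) M" for zs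
 using that set_take_subset[of m zs] set_drop_subset[of m zs] by (auto simp: words_def)
 show ?thesis
 unfolding mlt_def
 proof (intro conjI ballI allI impI funcsetI)
 show "h (take m zs) (drop m zs):cr N" if "zs:words (m + n) M" for zs
 by (rule mltD(1)[OF assms(2)[OF w(1)[OF that]] w(2)[OF that]])
 fix zs i assume zs: "zs:words (m + n) M" and i: "i < m + n"
 show "(%z. h (take m (zs[i := z])) (drop m (zs[i := z]))):lin R M N"
 proof (cases "i < m")
 case True
 thus ?thesis
 using mltD(2)[OF assms(1)[OF w(2)[OF zs]] w(1)[OF zs] True] by (simp add: take_update_swap)
 next
 case False
 hence "i - m < n" using i by simp
 from mltD(2)[OF assms(2)[OF w(1)[OF zs]] w(2)[OF zs] this] False
 show ?thesis by (simp add: drop_update_swap)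
 qed
 qed
qed

lemma w_take_drop:
 "zs:words (m + n) M ==> take m zs:words m M" "zs:words (m + n) M ==> drop m zs:words n M"
 using set_take_subset[of m zs] set_drop_subset[of m zs] by (auto simp: words_def)

lemma w_rep: "x:cr M ==> replicate n x:words n M"
 by (auto simp: words_def)

context mpsh
begin

interpretation D: mpsh X dual by unfold_locales (rule dual_psh)

text \<open>Contraction of germs is the germ of the contraction of sections; this is the locality
  needed for transferring global sections.\<close>

lemma contr_germ:
 assumes N: "psh N" and U: "opn U" "z:U"
 and w: "als:wsec n dual U" "bes:wsec n M U" and t: "t:sec N U"
 shows "contr (%ph s. ph U s) (Msec N U) als bes t:sec N U"
 and "contr (spair z) (Mst N z) (mg dual z U als) (mg M z U bes) (gm N z U t) =
 gm N z U (contr (%ph s. ph U s) (Msec N U) als bes t)"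
proof -
 interpret N: mpsh X N by unfold_locales (rule N)
 interpret NU: module "OS U" "Msec N U" by (rule N.Msec_mod[OF U(1)])
 note ev = dsec_c[OF _ opb_refl[OF U(1)]]
 have "contr (%ph s. ph U s) (Msec N U) als bes t:sec N U &
 contr (spair z) (Mst N z) (mg dual z U als) (mg M z U bes) (gm N z U t) =
 gm N z U (contr (%ph s. ph U s) (Msec N U) als bes t)"
 using w
 proof (induction n arbitrary: als bes)
 case 0
 thus ?case using t by simp
 next
 case (Suc n)
 obtain al als' where al: "als = al # als'" "al:sec dual U" "als':wsec n dual U"
 using Suc.prems(1) by (rule w_SucE)
 obtain be bes' where be: "bes = be # bes'" "be:sec M U" "bes':wsec n M U"
 using Suc.prems(2) by (rule w_SucE)
 note IH = Suc.IH[OF al(3) be(3)] and e = ev[OF al(2) be(2)]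
 show ?case
 using IH NU.smult_closed[OF e conjunct1[OF IH]] spair_germ[OF U al(2) be(2)]
 N.Mst_smult[OF U e conjunct1[OF IH]] by (simp add: al(1) be(1))
 qed
 thus "contr (%ph s. ph U s) (Msec N U) als bes t:sec N U"
 and "contr (spair z) (Mst N z) (mg dual z U als) (mg M z U bes) (gm N z U t) =
 gm N z U (contr (%ph s. ph U s) (Msec N U) als bes t)" by blast+
qed

text \<open>\<open>E\<close> carries \<open>m + n\<close> dual letters and \<open>F\<close> carries
  \<open>n\<close> letters of \<open>M\<close>. Contracting these against the last \<open>n\<close>
  dual letters leaves \<open>m\<close> of them, the twist that belongs to
  \<open>S^m\<close>.\<close>

theorem tns_gen_negative:
 assumes E: "psh E" and F: "psh F" and x: "x:pts"
 and albe: "al:stk dual x" "be:stk M x" "spair x al be = \<one>\<^sub>(Ost x)"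
 and pE: "!!es cs. es:wstk (m * q) E x ==> cs:wstk (m + n) dual x ==>
 ptn (m * q) E (m + n) dual x es cs:gsp (twd (m * q) E (m + n) dual) x"
 and pF: "!!fs ds. fs:wstk (m * q) F x ==> ds:wstk n M x ==>
 ptn (m * q) F n M x fs ds:gsp (twd (m * q) F n M) x"
 shows "ggen (tns (spw m (spw q (tns E F)))
 (tpw m dual)) x"
proof -
 note M = psheaf and D = dual_psh
 let ?B = "tpw m dual"
 note B = wpow_psh[OF D, of False m]
 interpret B: mpsh X ?B by unfold_locales (rule B)
 define ka where "ka z cs ds = contr (spair z) (Mst ?B z) (drop m cs) ds (tw m dual z (take m cs))"
 for z cs ds
 have ka1: "mlin z (m + n) dual ?B (%cs. ka z cs ds)"
 if z: "z:pts" and ds: "ds:wstk n M z" for z ds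
 unfolding ka_def
 proof (rule mlt_take_drop[where h = "%xs ys. contr (spair z) (Mst ?B z) ys ds (tw m dual z xs)"])
 note sw = stw_mlt[OF D z, of m False]
 show "mlin z m dual ?B
 (%xs. contr (spair z) (Mst ?B z) ys ds (tw m dual z xs))"
 if ys: "ys:wstk n dual z" for ys
 by (rule mlt_compose[OF sw contr_hom[OF B.Mst_mod[OF z] spair_bil[OF z] ys ds]])
 show "mlin z n dual ?B
 (%ys. contr (spair z) (Mst ?B z) ys ds (tw m dual z xs))"
 if xs: "xs:wstk m dual z" for xs
 by (rule contr_mlt1[OF B.Mst_mod[OF z] spair_bil[OF z] mltD(1)[OF sw xs] ds])
 qed
 have ka2: "mlin z n M ?B (ka z cs)"
 if z: "z:pts" and cs: "cs:wstk (m + n) dual z" for z cs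
 unfolding ka_def[abs_def]
 by (rule contr_mlt2[OF B.Mst_mod[OF z] spair_bil[OF z]
 mltD(1)[OF stw_mlt[OF D z] w_take_drop(1)[OF cs]] w_take_drop(2)[OF cs]])
 show ?thesis
 proof (rule tns_gen[OF E F D M D ka1 ka2 _ x _ pE pF])
 fix U cs ds assume U: "opn U" and w: "cs:wsec (m + n) dual U" "ds:wsec n M U"
 note cs = w_take_drop[OF w(1)]
 note s = wsct_c[OF D U cs(1), of False]
 show "EX t:sec ?B U. !z:U. ka z (mg dual z U cs) (mg M z U ds) = gm ?B z U t"
 \<comment> \<open>\<open>contr_germ\<close> speaks of a point of \<open>U\<close>; over the empty
   set any section will do.\<close>
 proof (cases "U = {}")
 case True
 thus ?thesis using s by blast
 next
 case False
 then obtain z0 where "z0:U" by blast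
 note c = contr_germ(1)[OF B U this cs(2) w(2) s]
 show ?thesis
 proof (intro bexI[OF _ c] ballI)
 fix z assume z: "z:U"
 show "ka z (mg dual z U cs) (mg M z U ds) =
 gm ?B z U (contr (%ph s. ph U s) (Msec ?B U) (drop m cs) ds (wsct X False m dual U (take m cs)))"
 unfolding ka_def take_map drop_map stw_gm[OF D U z cs(1)]
 by (rule contr_germ(2)[OF B U z cs(2) w(2) s])
 qed
 qed
 next
 interpret Bx: module "Ost x" "Mst ?B x" by (rule B.Mst_mod[OF x])
 note sw = stw_mlt[OF D x, of m False]
 let ?K = "{ka x cs ds | cs ds. cs:wstk (m + n) dual x & ds:wstk n M x}"
 have K: "?K <= stk ?B x" using mltD(1)[OF ka2[OF x]] by blast
 have "tw m dual x ` wstk m dual x <= ?K"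
 proof (rule image_subsetI)
 fix cs assume cs: "cs:wstk m dual x"
 \<comment> \<open>Every generator is hit: \<open>n\<close> copies of \<open>al\<close> are appended
   and contracted with \<open>n\<close> copies of \<open>be\<close>.\<close>
 have "ka x (cs @ replicate n al) (replicate n be) = tw m dual x cs"
 unfolding ka_def using cs Bx.contr_rep[of "spair x", OF albe(3) mltD(1)[OF sw cs]] by (simp add: words_def)
 thus "tw m dual x cs:?K"
 using w_append[OF cs w_rep[OF albe(1)]] w_rep[OF albe(2)] by force
 qed
 from Bx.span_mono[OF this]
 have "stk ?B x <= spn ?B x ?K"
 unfolding stw_span[OF D x, where sy = False and n = m, symmetric] .
 thus "stk ?B x = spn ?B x ?K"
 using Bx.span_sub[OF K] by (rule subset_antisym)
 qed
qed

text \<open>Positive twists add up by concatenation; tensor degree \<open>(m + n) q\<close> and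
  twist \<open>m + n\<close> fit \<open>S^(m+n) S^q\<close>.\<close>

theorem tns_gen_positive:
 assumes E: "psh E" and F: "psh F" and x: "x:pts"
 and pE: "!!es cs. es:wstk ((m + n) * q) E x ==> cs:wstk m M x ==>
 ptn ((m + n) * q) E m M x es cs:gsp (twd ((m + n) * q) E m M) x"
 and pF: "!!fs ds. fs:wstk ((m + n) * q) F x ==> ds:wstk n M x ==>
 ptn ((m + n) * q) F n M x fs ds:gsp (twd ((m + n) * q) F n M) x"
 shows "ggen (tns (spw (m + n) (spw q (tns E F)))
 (tpw (m + n) M)) x"
proof -
 note M = psheaf
 let ?B = "tpw (m + n) M" and ?ka = "%z cs ds. tw (m + n) M z (cs @ ds)"
 note B = wpow_psh[OF M, of False "m + n"]
 interpret B: mpsh X ?B by unfold_locales (rule B)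
 have ka1: "mlin z m M ?B (%cs. ?ka z cs ds)"
 if "z:pts" "ds:wstk n M z" for z ds
 by (rule mlt_append1[OF stw_mlt[OF M that(1)] that(2)])
 have ka2: "mlin z n M ?B (?ka z cs)"
 if "z:pts" "cs:wstk m M z" for z cs
 by (rule mlt_append2[OF stw_mlt[OF M that(1)] that(2)])
 show ?thesis
 proof (rule tns_gen[OF E F M M M ka1 ka2 _ x _ pE pF])
 fix U cs ds assume U: "opn U" and w: "cs:wsec m M U" "ds:wsec n M U"
 show "EX t:sec ?B U. !z:U. ?ka z (mg M z U cs) (mg M z U ds) = gm ?B z U t"
 using stw_gm[OF M U _ w_append[OF w]]
 by (intro bexI[OF _ wsct_c[OF M U w_append[OF w]]] ballI) simp
 next
 have "tw (m + n) M x ` wstk (m + n) M x =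
 {?ka x cs ds | cs ds. cs:wstk m M x & ds:wstk n M x}" (is "?L = ?R")
 proof (intro subset_antisym image_subsetI)
 fix zs assume zs: "zs:wstk (m + n) M x"
 show "tw (m + n) M x zs:?R"
 by (rule CollectI, rule exI[of _ "take m zs"], rule exI[of _ "drop m zs"])
 (use w_take_drop[OF zs] in simp)
 qed (use w_append in blast)
 thus "stk ?B x = spn ?B x
 {?ka x cs ds | cs ds. cs:wstk m M x & ds:wstk n M x}"
 using stw_span[OF M x, where sy = False and n = "m + n"] by simp
 qed
qed

text \<open>If words of \<open>n\<close> letters of \<open>M\<close> are combinations of global
  sections, a dual twist of length \<open>n\<close> can be removed by contraction. This is how
  powers of the ample bundle itself enter for two V-big bundles.\<close>

theorem untwist_glob:
 assumes F: "psh F" and x: "x:pts"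
 and albe: "al:stk dual x" "be:stk M x" "spair x al be = \<one>\<^sub>(Ost x)"
 and fs: "fs:wstk N F x"
 and pF: "!!cs. cs:wstk n dual x ==>
 ptn N F n dual x fs cs:gsp (twd N F n dual) x"
 and pM: "!!ds. ds:wstk n M x ==>
 ptn 0 F n M x [] ds:gsp (twd 0 F n M) x"
 shows "ptn N F 0 M x fs []:gsp (twd N F 0 M) x"
proof -
 note M = psheaf and D = dual_psh
 let ?T = "twd N F 0 M"
 note T = twisted_psh[OF F M, of N 0]
 interpret T: mpsh X ?T by unfold_locales (rule T)
 interpret Tx: module "Ost x" "Mst ?T x" by (rule T.Mst_mod[OF x])
 let ?g = "%z fs cs (gs :: ('p set \<times> 'b) set list) ds. contr (spair z) (Mst ?T z) cs ds (ptn N F 0 M z fs [])"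
 have nil: "[]:words 0 L" for L :: "('r, 'w) module" by simp
 have pc: "ptn N F 0 M z fs []:stk ?T z"
 if "z:pts" "fs:wstk N F z" for z fs
 by (rule ptn_c[OF F M that]) simp
 have gc: "?g z fs cs gs ds:stk ?T z"
 if "z:pts" "fs:wstk N F z" "cs:wstk n dual z" "ds:wstk n M z"
 for z fs cs gs ds
 by (rule linD(1)[OF contr_hom[OF T.Mst_mod[OF that(1)] spair_bil[OF that(1)] that(3,4)]
 pc[OF that(1,2)]])
 have "?g x fs (replicate n al) [] (replicate n be):gsp ?T x"
 proof (rule twisted_product[OF F D F M T twisted_gluing[OF F M], where g = ?g and N' = 0])
 fix z fs cs gs ds assume z: "z:pts"
 show "mlin z N F ?T (%fs. ?g z fs cs gs ds)"
 if "cs:wstk n dual z" "ds:wstk n M z"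
 by (rule mlt_compose[OF ptn_mlt(1)[OF F M z]
 contr_hom[OF T.Mst_mod[OF z] spair_bil[OF z] that]]) simp
 show "mlin z n dual ?T (%cs. ?g z fs cs gs ds)"
 if "fs:wstk N F z" "ds:wstk n M z"
 by (rule contr_mlt1[OF T.Mst_mod[OF z] spair_bil[OF z] pc[OF z that(1)] that(2)])
 show "mlin z 0 F ?T (%gs. ?g z fs cs gs ds)"
 if "fs:wstk N F z" "cs:wstk n dual z" "ds:wstk n M z"
 by (rule mlt_0) (rule gc[OF z that])
 show "mlin z n M ?T (%ds. ?g z fs cs gs ds)"
 if "fs:wstk N F z" "cs:wstk n dual z"
 by (rule contr_mlt2[OF T.Mst_mod[OF z] spair_bil[OF z] pc[OF z that(1)] that(2)])
 next
 fix U fs cs gs ds assume U: "opn U" and w: "fs:wsec N F U" "cs:wsec n dual U"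
 "ds:wsec n M U"
 have p: "psec F M N 0 U fs []:sec ?T U" by (rule psec_c[OF F M U w(1)]) simp
 have pg: "ptn N F 0 M z (mg F z U fs) [] = gm ?T z U (psec F M N 0 U fs [])"
 if "z:U" for z using ptn_germ[OF F M U that w(1), of "[]" 0] by simp
 show "EX t:sec ?T U. !z:U. ?g z (mg F z U fs) (mg dual z U cs)
 (mg F z U gs) (mg M z U ds) = gm ?T z U t"
 proof (cases "U = {}")
 case True
 thus ?thesis using p by blast
 next
 case False
 then obtain z0 where "z0:U" by blast
 note c = contr_germ(1)[OF T U this w(2,3) p]
 show ?thesis
 by (intro bexI[OF _ c] ballI) (simp only: pg contr_germ(2)[OF T U _ w(2,3) p])
 qed
 next
 show "ptn 0 F n M x [] (replicate n be):gsp (twd 0 F n M) x"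
 by (rule pM[OF w_rep[OF albe(2)]])
 show "ptn N F n dual x fs (replicate n al):gsp (twd N F n dual) x"
 by (rule pF[OF w_rep[OF albe(1)]])
 qed (use x fs w_rep[OF albe(1)] w_rep[OF albe(2)] in auto)
 thus ?thesis using Tx.contr_rep[of "spair x", OF albe(3) pc[OF x fs]] by simp
qed

lemma power_glob:
 assumes F: "psh F" and x: "x:pts" and gen: "ggen (tpw k M) x"
 and ds: "ds:wstk k M x"
 shows "ptn 0 F k M x [] ds:gsp (twd 0 F k M) x"
proof -
 note M = psheaf
 let ?T = "twd 0 F k M"
 note T = twisted_psh[OF F M, of 0 k]
 interpret T: mpsh X ?T by unfold_locales (rule T)
 show ?thesis
 proof (rule transfer_glob[OF gens_word[OF M] T twisted_gluing[OF F M] _ _ x ds])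
 fix z assume z: "z:pts"
 have "mlin z k M ?T (ptn 0 F k M z [])"
 by (rule ptn_mlt(2)[OF F M z]) simp
 from stw_lift[OF M z T.Mst_mod[OF z] this, of False]
 show "EX L:shom z (tpw k M) ?T. !ds:wstk k M z. L (tw k M z ds) = ptn 0 F k M z [] ds" by simp
 next
 fix U j assume U: "opn U" and "j:{j. EX ss:wsec k M U. !z:U. j z = mg M z U ss}"
 then obtain ss where ss: "ss:wsec k M U" "!z:U. j z = mg M z U ss" by blast
 have nil: "[]:wsec 0 F U" by simp
 show "loc ?T U (%z. ptn 0 F k M z [] (j z))"
 by (rule bexI[OF _ psec_c[OF F M U nil ss(1)]])
 (use ss(2) ptn_germ[OF F M U _ nil ss(1)] in simp)
 next
 show "tw k M x ds:gsp (tpw k M) x"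
 using gen mltD(1)[OF stw_mlt[OF M x] ds] unfolding gen_at_def by simp
 qed
qed

lemma powers_glob:
 assumes F: "psh F" and x: "x:pts" and gen: "ggen (tpw k M) x"
 and "ds:wstk (b * k) M x"
 shows "ptn 0 F (b * k) M x [] ds:gsp (twd 0 F (b * k) M) x"
 using assms(4)
proof (induction b arbitrary: ds)
 case 0
 thus ?case using ptn_empty_glob[OF F psheaf x] by simp
next
 case (Suc b)
 have ds: "ds:wstk (k + b * k) M x" using Suc.prems by simp
 note w = w_take_drop[OF ds]
 have nil: "[]:wstk 0 F x" by simp
 from ptn_append[OF F psheaf x nil w(1) nil w(2) power_glob[OF F x gen w(1)] Suc.IH[OF w(2)]]
 show ?case by simp
qed

end

section \<open>Base loci and global generation\<close>

lemma bil_rels_linear: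
 "bilinear_rels R M N = linear_rels R (cr M \<times> cr N)
 ({((x \<oplus>\<^sub>M x', y), (x, y), (x', y)) | x x' y. x:cr M & x':cr M & y:cr N} Un
 {((x, y \<oplus>\<^sub>N y'), (x, y), (x, y')) | x y y'. x:cr M & y:cr N & y':cr N})
 ({(r, (r \<odot>\<^sub>M x, y), (x, y)) | r x y. r:cr R & x:cr M & y:cr N} Un
 {(r, (x, r \<odot>\<^sub>N y), (x, y)) | r x y. r:cr R & x:cr M & y:cr N}) {}"
 by (simp only: bilinear_rels_def linear_rels_def Let_def image_Un image_Collect_ex prod.case
 image_empty Un_empty_right Un_assoc)

context two_mods
begin

abbreviation "free_pairs == free_module R (cr M \<times> cr N)"

interpretation F: module R free_pairs by (rule M.R.free_module)

lemma bil_rels_c: "bilinear_rels R M N <= cr free_pairs"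
proof
 fix k assume "k:bilinear_rels R M N"
 thus "k:cr free_pairs"
 unfolding bil_rels_linear
 by (cases rule: linear_rels_cases)
 (auto intro!: M.R.free_gen_c F.M.minus_closed F.M.a_closed F.smult_closed)
qed

lemma tns_mod_is_mod: "module R (tensor_module R M N)"
 unfolding tensor_module_def by (rule M.R.pres_is_mod[OF bil_rels_c])

lemma tns_elem_c:
 "x:cr M ==> y:cr N ==> tensor_elem R M N x y:cr (tensor_module R M N)"
 unfolding tensor_module_def tensor_elem_def
 by (rule linD(1)[OF M.R.pres_class_hom[OF bil_rels_c] M.R.free_gen_c]) simp

lemma tns_mod_span:
 "cr (tensor_module R M N) = module_span R (tensor_module R M N)
 {tensor_elem R M N x y | x y. x:cr M & y:cr N}"
proof -
 have "(%b. presented_class R (cr M \<times> cr N) (bilinear_rels R M N) (free_gen R b)) ` (cr M \<times> cr N) =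
 {tensor_elem R M N x y | x y. x:cr M & y:cr N}"
 by (auto simp: tensor_elem_def)
 thus ?thesis
 unfolding tensor_module_def using M.R.pres_span[OF bil_rels_c] by simp
qed

lemma tns_elem_eqI:
 assumes "free_gen R p \<ominus>\<^sub>free_pairs f:bilinear_rels R M N" "p:cr M \<times> cr N" "f:cr free_pairs"
 shows "presented_class R (cr M \<times> cr N) (bilinear_rels R M N) (free_gen R p) =
 presented_class R (cr M \<times> cr N) (bilinear_rels R M N) f"
 by (rule M.R.pres_class_eqI[OF bil_rels_c M.R.free_gen_c[OF assms(2)] assms(3)
 F.span_base[OF assms(1)]])

lemma tns_elem_bil: "bilinear R M N (tensor_module R M N) (tensor_elem R M N)"
proof -
 note h = M.R.pres_class_hom[OF bil_rels_c]
 note g = M.R.free_gen_c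
 show ?thesis
 unfolding bilinear_def
 proof (intro conjI ballI linI)
 fix x y assume xy: "x:cr M" "y:cr N"
 thus "tensor_elem R M N x y:cr (tensor_module R M N)" by (rule tns_elem_c)
 thus "tensor_elem R M N x y:cr (tensor_module R M N)" .
 have p: "free_gen R (x, y):cr free_pairs" using xy by (intro g) simp
 fix r assume r: "r:cr R"
 show "tensor_elem R M N (r \<odot>\<^sub>M x) y = r \<odot>\<^sub>(tensor_module R M N) tensor_elem R M N x y"
 unfolding tensor_elem_def tensor_module_def linD(3)[OF h r p, symmetric]
 by (rule tns_elem_eqI) (use xy r p in \<open>auto intro: linear_rels_intros simp: bil_rels_linear\<close>)
 show "tensor_elem R M N x (r \<odot>\<^sub>N y) = r \<odot>\<^sub>(tensor_module R M N) tensor_elem R M N x y"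
 unfolding tensor_elem_def tensor_module_def linD(3)[OF h r p, symmetric]
 by (rule tns_elem_eqI) (use xy r p in \<open>auto intro: linear_rels_intros simp: bil_rels_linear\<close>)
 next
 fix x x' y assume xy: "x:cr M" "x':cr M" "y:cr N"
 have p: "free_gen R (x, y):cr free_pairs" "free_gen R (x', y):cr free_pairs"
 using xy by (auto intro: g)
 show "tensor_elem R M N (x \<oplus>\<^sub>M x') y =
 tensor_elem R M N x y \<oplus>\<^sub>(tensor_module R M N) tensor_elem R M N x' y"
 unfolding tensor_elem_def tensor_module_def linD(2)[OF h p, symmetric]
 by (rule tns_elem_eqI) (use xy p in \<open>auto intro!: linear_rels_intros simp: bil_rels_linear\<close>)
 next
 fix x y y' assume xy: "x:cr M" "y:cr N" "y':cr N"
 have p: "free_gen R (x, y):cr free_pairs" "free_gen R (x, y'):cr free_pairs"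
 using xy by (auto intro: g)
 show "tensor_elem R M N x (y \<oplus>\<^sub>N y') =
 tensor_elem R M N x y \<oplus>\<^sub>(tensor_module R M N) tensor_elem R M N x y'"
 unfolding tensor_elem_def tensor_module_def linD(2)[OF h p, symmetric]
 by (rule tns_elem_eqI) (use xy p in \<open>auto intro!: linear_rels_intros simp: bil_rels_linear\<close>)
 qed
qed

lemma tns_mod_lift:
 assumes L: "module R L" and b: "bilinear R M N L b"
 shows "EX ph:lin R (tensor_module R M N) L.
 !x:cr M. !y:cr N. ph (tensor_elem R M N x y) = b x y"
proof -
 interpret L: module R L by (rule L)
 interpret FL: two_mods R free_pairs L using F.module_axioms L by (simp add: two_mods_def)
 let ?g = "%(x, y). b x y"
 have g: "?g:cr M \<times> cr N \<rightarrow> cr L" using bilinearD(3)[OF b] by auto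
 note lift = M.R.flift_hom[OF L g] and gen = M.R.flift_gen[OF L g] and fc = M.R.free_gen_c
 have bc: "b x y:cr L" if "x:cr M" "y:cr N" for x y by (rule bilinearD(3)[OF b that])
 have "flift R L ?g k = \<zero>\<^sub>L" if k: "k:bilinear_rels R M N" for k
 using k unfolding bil_rels_linear
 proof (cases rule: linear_rels_cases)
 case (1 p q r)
 hence c: "p:cr M \<times> cr N" "q:cr M \<times> cr N" "r:cr M \<times> cr N" by auto
 have eq: "?g p = ?g q \<oplus>\<^sub>L ?g r"
 using 1(1) linD(2)[OF bilinearD(1)[OF b]] linD(2)[OF bilinearD(2)[OF b]] by auto
 have "flift R L ?g k = ?g p \<ominus>\<^sub>L (?g q \<oplus>\<^sub>L ?g r)"
 unfolding 1(2) FL.lin_minus[OF lift fc[OF c(1)] F.M.a_closed[OF fc[OF c(2)] fc[OF c(3)]]]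
 linD(2)[OF lift fc[OF c(2)] fc[OF c(3)]] gen[OF c(1)] gen[OF c(2)] gen[OF c(3)] ..
 moreover have "?g q \<oplus>\<^sub>L ?g r:cr L" using c bc by auto
 ultimately show ?thesis unfolding eq by (simp add: L.M.minus_eq_zero_iff)
 next
 case (2 r p q)
 hence c: "r:cr R" "p:cr M \<times> cr N" "q:cr M \<times> cr N" by auto
 have eq: "?g p = r \<odot>\<^sub>L ?g q"
 using 2(1) linD(3)[OF bilinearD(1)[OF b]] linD(3)[OF bilinearD(2)[OF b]] by auto
 have "flift R L ?g k = ?g p \<ominus>\<^sub>L r \<odot>\<^sub>L ?g q"
 unfolding 2(2) FL.lin_minus[OF lift fc[OF c(2)] F.smult_closed[OF c(1) fc[OF c(3)]]]
 linD(3)[OF lift c(1) fc[OF c(3)]] gen[OF c(2)] gen[OF c(3)] ..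
 moreover have "r \<odot>\<^sub>L ?g q:cr L" using c bc by auto
 ultimately show ?thesis unfolding eq by (simp add: L.M.minus_eq_zero_iff)
 qed simp
 from M.R.pres_lift[OF bil_rels_c L g this]
 obtain ph where ph: "ph:lin R (tensor_module R M N) L"
 "!f:cr free_pairs. ph (presented_class R (cr M \<times> cr N) (bilinear_rels R M N) f) = flift R L ?g f"
 unfolding tensor_module_def by blast
 show ?thesis
 proof (intro bexI[OF _ ph(1)] ballI)
 fix x y assume "x:cr M" "y:cr N"
 hence "(x, y):cr M \<times> cr N" by simp
 from bspec[OF ph(2) fc[OF this]] gen[OF this]
 show "ph (tensor_elem R M N x y) = b x y" unfolding tensor_elem_def by simp
 qed
qed

end

subsection \<open>Local rings and their residue fields\<close>

text \<open>The elementwise form of having a single maximal ideal; it can be read off fractions on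
  an affine chart.\<close>

definition local_ring where
 "local_ring R \<longleftrightarrow> cring R & \<one>\<^sub>R ~= \<zero>\<^sub>R & (!r:cr R. r:Units R | \<one>\<^sub>R \<ominus>\<^sub>R r:Units R)"

text \<open>The construction of \<open>residue_field\<close> for an arbitrary ring and ideal: the
  quotient, with scalars acting through it.\<close>

definition residue_mod where
 "residue_mod R I = ring.extend (R Quot I) (module.fields (%r c. (I +>\<^sub>R r) \<otimes>\<^sub>(R Quot I) c))"

lemma residue_mod_simps [simp]:
 "cr (residue_mod R I) = cr (R Quot I)" "\<zero>\<^sub>(residue_mod R I) = \<zero>\<^sub>(R Quot I)"
 "\<one>\<^sub>(residue_mod R I) = \<one>\<^sub>(R Quot I)"
 "c \<oplus>\<^sub>(residue_mod R I) d = c \<oplus>\<^sub>(R Quot I) d" "r \<odot>\<^sub>(residue_mod R I) c = (I +>\<^sub>R r) \<otimes>\<^sub>(R Quot I) c"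
 by (simp_all add: residue_mod_def ring.defs module.defs)

lemma (in cring) residue_mod:
 assumes I: "ideal I R"
 shows "module R (residue_mod R I)"
proof -
 interpret I: ideal I R by (rule I)
 interpret Q: cring "R Quot I" by (rule I.quotient_is_cring[OF is_cring])
 note h = I.rcos_ring_hom
 show ?thesis
 proof (rule moduleI)
 show "abelian_group (residue_mod R I)"
 proof (rule abelian_groupI)
 show "EX d:cr (residue_mod R I). d \<oplus>\<^sub>(residue_mod R I) c = \<zero>\<^sub>(residue_mod R I)"
 if "c:cr (residue_mod R I)" for c
 using that by (intro bexI[of _ "\<ominus>\<^sub>(R Quot I) c"]) (simp_all add: Q.l_neg)
 qed (simp_all add: Q.a_ac)
 qed (simp_all add: is_cring ring_hom_closed[OF h] ring_hom_add[OF h] ring_hom_mult[OF h] ring_hom_one[OF h]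
 Q.l_distr Q.r_distr Q.m_assoc)
qed

context cring
begin

lemma Units_factor:
 assumes "a:cr R" "b:cr R" "a \<otimes> b:Units R"
 shows "a:Units R"
proof -
 have i: "inv (a \<otimes> b):cr R" by (rule Units_inv_closed[OF assms(3)])
 have "a \<otimes> (b \<otimes> inv (a \<otimes> b)) = \<one>" using assms i by (simp add: m_assoc[symmetric])
 thus ?thesis using assms(1,2) i by (auto simp: Units_def m_comm intro!: bexI[of _ "b \<otimes> inv (a \<otimes> b)"])
qed

text \<open>If \<open>a + b\<close> is a unit, scaling by its inverse gives two elements with sum
  one, so one of them is a unit.\<close>

lemma local_ring_nonunits:
 assumes "local_ring R"
 shows "ideal (cr R - Units R) R"
proof -
 have loc: "r:Units R | \<one> \<ominus> r:Units R" if "r:cr R" for r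
 using assms that unfolding local_ring_def by blast
 have zero: "\<zero> ~: Units R"
 proof
 assume z: "\<zero>:Units R"
 have "\<one> = \<zero> \<otimes> inv \<zero>" by (rule Units_r_inv[OF z, symmetric])
 also have "\<dots> = \<zero>" by (rule l_null[OF Units_inv_closed[OF z]])
 finally show False using assms unfolding local_ring_def by blast
 qed
 have mult: "a \<otimes> x:cr R - Units R" if "a:cr R - Units R" "x:cr R" for a x
 using that Units_factor[of a x] by auto
 show ?thesis
 proof (rule idealI[OF ring_axioms])
 show "subgroup (cr R - Units R) (add_monoid R)"
 proof (rule add.subgroupI)
 show "cr R - Units R ~= {}" using zero by blast
 show "\<ominus> a:cr R - Units R" if "a:cr R - Units R" for a
 using mult[OF that, of "\<ominus> \<one>"] that by (simp add: r_minus)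
 show "a \<oplus> b:cr R - Units R" if a: "a:cr R - Units R" and b: "b:cr R - Units R" for a b
 proof -
 have "a \<oplus> b ~: Units R"
 proof
 assume u: "a \<oplus> b:Units R"
 let ?i = "inv (a \<oplus> b)"
 have i: "?i:cr R" by (rule Units_inv_closed[OF u])
 have c: "a:cr R" "b:cr R" using a b by auto
 have "(a \<oplus> b) \<otimes> ?i = \<one>" by (rule Units_r_inv[OF u])
 hence "a \<otimes> ?i \<oplus> b \<otimes> ?i = \<one>" using c i by (simp add: l_distr)
 moreover have p: "a \<otimes> ?i:cr R" "b \<otimes> ?i:cr R" using c i by simp_all
 moreover have "(a \<otimes> ?i \<oplus> b \<otimes> ?i) \<ominus> a \<otimes> ?i = b \<otimes> ?i"
 using p by (simp only: a_minus_def a_comm[OF p] a_assoc a_inv_closed r_neg r_zero)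
 ultimately have "\<one> \<ominus> a \<otimes> ?i = b \<otimes> ?i" by simp
 moreover note p(1)
 ultimately have "a \<otimes> ?i:Units R | b \<otimes> ?i:Units R" using loc by metis
 thus False using a b i Units_factor[of _ ?i] by blast
 qed
 thus ?thesis using a b by simp
 qed
 qed auto
 show "x \<otimes> a:cr R - Units R" if "a:cr R - Units R" "x:cr R" for a x
 using mult[OF that] that by (simp add: m_comm)
 qed (rule mult)
qed

end

text \<open>Nakayama in the shape needed for base loci. With \<open>N\<close> the span of
  \<open>G\<close> and \<open>I\<close> the nonunits, generation of the fibre gives
  \<open>M = N + I M\<close>: a map from the fibre to \<open>M / (N + I M)\<close> kills the
  generators, hence everything.\<close>

lemma (in module) tns_residue_gen_iff:
 assumes loc: "local_ring R" and G: "G <= cr M"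
 and fg: "set ws <= cr M" "cr M = module_span R M (set ws)"
 defines "ka == residue_mod R (cr R - Units R)"
 shows "module_span R (tensor_module R M ka) ((%m. tensor_elem R M ka m \<one>\<^sub>ka) ` G) = cr (tensor_module R M ka) \<longleftrightarrow>
 module_span R M G = cr M" (is "module_span R ?T ?S = _ \<longleftrightarrow> _")
proof -
 let ?I = "cr R - Units R"
 note Id = R.local_ring_nonunits[OF loc]
 interpret I: ideal ?I R by (rule Id)
 interpret Q: cring "R Quot ?I" by (rule I.quotient_is_cring[OF R.is_cring])
 have mk: "module R ka" unfolding ka_def by (rule R.residue_mod[OF Id])
 interpret T: two_mods R M ka using module_axioms mk by (simp add: two_mods_def)
 interpret Tm: module R ?T by (rule T.tns_mod_is_mod)
 interpret MT: two_mods R M ?T using module_axioms Tm.module_axioms by (simp add: two_mods_def)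
 note bil = T.tns_elem_bil
 have ka: "cr ka = cr (R Quot ?I)" "\<one>\<^sub>ka = ?I +>\<^sub>R \<one>" "\<one>\<^sub>ka:cr ka"
 using Q.one_closed by (simp_all add: ka_def FactRing_def)
 have cosets: "EX r:cr R. c = ?I +>\<^sub>R r" if "c:cr ka" for c
 using that by (auto simp: ka(1) FactRing_def A_RCOSETS_def')
 have coset_smult: "r \<odot>\<^sub>ka (?I +>\<^sub>R s) = ?I +>\<^sub>R (r \<otimes> s)" if "r:cr R" "s:cr R" for r s
 using ring_hom_mult[OF I.rcos_ring_hom that] by (simp add: ka_def)
 have coset_add: "(?I +>\<^sub>R r) \<oplus>\<^sub>ka (?I +>\<^sub>R s) = ?I +>\<^sub>R (r \<oplus> s)" if "r:cr R" "s:cr R" for r s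
 using ring_hom_add[OF I.rcos_ring_hom that] by (simp add: ka_def)
 have coset_in: "?I +>\<^sub>R r:cr ka" if "r:cr R" for r
 using ring_hom_closed[OF I.rcos_ring_hom that] by (simp add: ka(1))
 have S: "?S <= cr ?T" using G T.tns_elem_c[OF _ ka(3)] by auto
 show ?thesis
 proof
 assume gen: "module_span R M G = cr M"
 let ?H = "module_span R ?T ?S"
 note sub = Tm.span_submod[OF S]
 have one: "tensor_elem R M ka m \<one>\<^sub>ka:?H" if m: "m:cr M" for m
 by (rule MT.lin_span[OF bilinearD(2)[OF bil ka(3)] sub G])
 (use m gen in \<open>auto intro!: Tm.span_base\<close>)
 have "tensor_elem R M ka m c:?H" if m: "m:cr M" and c: "c:cr ka" for m c
 proof -
 obtain r where r: "r:cr R" "c = ?I +>\<^sub>R r" using cosets[OF c] by blast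
 have "c = r \<odot>\<^sub>ka \<one>\<^sub>ka" unfolding ka(2) using coset_smult[OF r(1) R.one_closed] r by simp
 hence "tensor_elem R M ka m c = r \<odot>\<^sub>?T tensor_elem R M ka m \<one>\<^sub>ka"
 using linD(3)[OF bilinearD(1)[OF bil m] r(1) ka(3)] by simp
 thus ?thesis using Tm.submoduleE(4)[OF sub r(1) one[OF m]] by simp
 qed
 hence "module_span R ?T {tensor_elem R M ka x y | x y. x:cr M & y:cr ka} <= ?H"
 by (intro Tm.span_least[OF sub]) blast
 thus "?H = cr ?T"
 unfolding T.tns_mod_span[symmetric] using Tm.span_sub[OF S] by (intro subset_antisym)
 next
 assume gen: "module_span R ?T ?S = cr ?T"
 let ?N = "module_span R M G" and ?IM = "{\<mu> \<odot>\<^sub>M x | \<mu> x. \<mu>:?I & x:cr M}"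
 note N = span_submod[OF G] and NM = span_sub[OF G]
 have IM: "?IM <= cr M" by auto
 have NIM: "?N Un ?IM <= cr M" using NM IM by blast
 let ?J = "module_span R M (?N Un ?IM)"
 note J = span_submod[OF NIM]
 let ?Q = "quotient_module R M ?J"
 note q = quot_map_hom[OF J]
 interpret Qm: module R ?Q by (rule quot_is_mod[OF J])
 interpret TQ: two_mods R ?T ?Q using Tm.module_axioms Qm.module_axioms by (simp add: two_mods_def)
 \<comment> \<open>The class of \<open>r\<close> acts on \<open>m\<close> modulo
   \<open>N + I M\<close>. A representative is chosen; another one changes the result by an element
   of \<open>I M\<close>.\<close>
 define b where "b m c = ?J +>\<^sub>M ((SOME r. r:cr R & c = ?I +>\<^sub>R r) \<odot>\<^sub>M m)" for m c
 have b: "b m (?I +>\<^sub>R r) = ?J +>\<^sub>M (r \<odot>\<^sub>M m)" if m: "m:cr M" and r: "r:cr R" for m r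
 proof -
 define s where "s = (SOME s. s:cr R & ?I +>\<^sub>R r = ?I +>\<^sub>R s)"
 have "s:cr R & ?I +>\<^sub>R r = ?I +>\<^sub>R s" unfolding s_def by (rule someI_ex) (use r in blast)
 hence s: "s:cr R" "s \<ominus> r:?I"
 using R.quotient_eq_iff_same_a_r_cos[OF Id, of s r] r by auto
 have "s \<odot>\<^sub>M m \<ominus>\<^sub>M r \<odot>\<^sub>M m = (s \<ominus> r) \<odot>\<^sub>M m"
 using s(1) r m by (simp add: a_minus_def smult_l_distr smult_l_minus)
 moreover have "(s \<ominus> r) \<odot>\<^sub>M m:?J" by (rule span_base) (use s(2) m in blast)
 ultimately show ?thesis
 unfolding b_def s_def[symmetric] using a_r_coset_eq_iff[OF J, of "s \<odot>\<^sub>M m" "r \<odot>\<^sub>M m"] s(1) r m by simp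
 qed
 have bil_b: "bilinear R M ka ?Q b"
 unfolding bilinear_def
 proof (intro conjI ballI linI)
 fix m c assume m: "m:cr M" and c: "c:cr ka"
 obtain r where r: "r:cr R" "c = ?I +>\<^sub>R r" using cosets[OF c] by blast
 show bc: "b m c:cr ?Q" unfolding r(2) b[OF m r(1)] by (rule linD(1)[OF q]) (use r m in simp)
 thus "b m c:cr ?Q" .
 fix s assume s: "s:cr R"
 have sm: "s \<odot>\<^sub>M m:cr M" "r \<odot>\<^sub>M m:cr M" using s r m by auto
 show "b m (s \<odot>\<^sub>ka c) = s \<odot>\<^sub>?Q b m c"
 unfolding r(2) coset_smult[OF s r(1)] b[OF m r(1)] b[OF m R.m_closed[OF s r(1)]]
 linD(3)[OF q s sm(2), symmetric] using s r(1) m by (simp add: smult_assoc1)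
 show "b (s \<odot>\<^sub>M m) c = s \<odot>\<^sub>?Q b m c"
 unfolding r(2) b[OF m r(1)] b[OF sm(1) r(1)] linD(3)[OF q s sm(2), symmetric]
 using s r(1) m by (simp add: smult_assoc1[symmetric] R.m_comm)
 next
 fix m c d assume m: "m:cr M" and c: "c:cr ka" "d:cr ka"
 obtain r s where r: "r:cr R" "c = ?I +>\<^sub>R r" "s:cr R" "d = ?I +>\<^sub>R s"
 using cosets[OF c(1)] cosets[OF c(2)] by blast
 have sm: "r \<odot>\<^sub>M m:cr M" "s \<odot>\<^sub>M m:cr M" using r m by auto
 show "b m (c \<oplus>\<^sub>ka d) = b m c \<oplus>\<^sub>?Q b m d"
 unfolding r(2,4) coset_add[OF r(1,3)] b[OF m r(1)] b[OF m r(3)] b[OF m R.a_closed[OF r(1,3)]]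
 linD(2)[OF q sm, symmetric] using r m by (simp add: smult_l_distr)
 next
 fix m m' c assume c: "c:cr ka" and m: "m:cr M" "m':cr M"
 obtain r where r: "r:cr R" "c = ?I +>\<^sub>R r" using cosets[OF c] by blast
 have sm: "r \<odot>\<^sub>M m:cr M" "r \<odot>\<^sub>M m':cr M" using r m by auto
 show "b (m \<oplus>\<^sub>M m') c = b m c \<oplus>\<^sub>?Q b m' c"
 unfolding r(2) b[OF m(1) r(1)] b[OF m(2) r(1)] b[OF M.a_closed[OF m] r(1)]
 linD(2)[OF q sm, symmetric] using r m by (simp add: smult_r_distr)
 qed
 obtain ph where ph: "ph:lin R ?T ?Q" "!x:cr M. !y:cr ka. ph (tensor_elem R M ka x y) = b x y"
 using T.tns_mod_lift[OF Qm.module_axioms bil_b] by blast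
 have b1: "ph (tensor_elem R M ka m \<one>\<^sub>ka) = ?J +>\<^sub>M m" if m: "m:cr M" for m
 using ph(2) m ka(3) b[OF m R.one_closed] by (simp add: ka(2))
 have zeroQ: "\<zero>\<^sub>?Q = ?J +>\<^sub>M \<zero>\<^sub>M" by (rule quot_zero[OF J])
 have iff: "?J +>\<^sub>M m = \<zero>\<^sub>?Q \<longleftrightarrow> m:?J" if m: "m:cr M" for m
 unfolding zeroQ a_r_coset_eq_iff[OF J m M.zero_closed] M.minus_zero_eq[OF m] ..
 have all: "ph t = \<zero>\<^sub>?Q" if t: "t:cr ?T" for t
 proof -
 have "ph t:{\<zero>\<^sub>?Q}"
 proof (rule TQ.lin_span[OF ph(1) Qm.zero_submod S])
 show "t:module_span R ?T ?S" using t gen by simp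
 fix s assume "s:?S"
 then obtain m where m: "m:G" "s = tensor_elem R M ka m \<one>\<^sub>ka" by blast
 have "m:?J" by (rule span_base) (use span_base[OF m(1)] in blast)
 thus "ph s:{\<zero>\<^sub>?Q}" using m b1 iff G by auto
 qed
 thus ?thesis by simp
 qed
 have "m:?J" if m: "m:cr M" for m
 using all[OF T.tns_elem_c[OF m ka(3)]] b1[OF m] iff[OF m] by simp
 hence MJ: "cr M = ?J" using span_sub[OF NIM] by blast
 show "?N = cr M"
 proof (rule nakayama[OF _ _ _ _ _ N MJ fg(1)])
 show "?I <= cr R" by blast
 show "\<mu> \<otimes> r:?I" if "\<mu>:?I" "r:cr R" for \<mu> r by (rule I.I_r_closed[OF that])
 show "\<mu> \<oplus> \<nu>:?I" if "\<mu>:?I" "\<nu>:?I" for \<mu> \<nu> by (rule I.a_closed[OF that])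
 show "\<zero>:?I" by (rule I.zero_closed)
 show "\<one> \<ominus> \<mu>:Units R" if "\<mu>:?I" for \<mu> using loc that unfolding local_ring_def by blast
 show "cr M = module_span R M (?N Un set ws)"
 proof (rule subset_antisym)
 show "cr M <= module_span R M (?N Un set ws)"
 using span_mono[of "set ws" "?N Un set ws"] unfolding fg(2)[symmetric] by blast
 show "module_span R M (?N Un set ws) <= cr M" by (rule span_sub) (use NM fg(1) in blast)
 qed
 qed
 qed
qed

context mpsh
begin

lemma base_locus_iff:
 assumes x: "x:pts" and loc: "local_ring (Ost x)"
 and S: "finite S" "S <= stk M x" "stk M x = spn M x S"
 shows "x:base_locus X M \<longleftrightarrow> ~ ggen M x"
proof -
 interpret Mx: module "Ost x" "Mst M x" by (rule Mst_mod[OF x])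
 obtain ws where ws: "S = set ws" using finite_list[OF S(1)] by blast
 have res: "residue_field X x = residue_mod (Ost x) (ostk x - Units (Ost x))"
 by (simp add: residue_field_def residue_mod_def maximal_ideal_def)
 have "fibre_value X M x ` sec M pts =
 (%m. tensor_elem (Ost x) (Mst M x) (residue_field X x) m \<one>\<^sub>(residue_field X x)) `
 gm M x pts ` sec M pts"
 by (simp add: fibre_value_def image_image)
 thus ?thesis
 using Mx.tns_residue_gen_iff[OF loc glob_germs_c[OF x] S(2,3)[unfolded ws]] x
 by (simp add: base_locus_def fibre_def gen_at_def glob_span_def res)
qed

end

subsection \<open>Locally finitely generated presheaves\<close>

text \<open>One finite family of sections generates the stalks at all points of a neighbourhood.
  Finite generation of a single stalk serves Nakayama, the neighbourhood serves the passage to the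
  generic point.\<close>

definition lfg where
 "lfg X M \<longleftrightarrow> (!x:points X. EX U S. openin (Top X) U & x:U & finite S & S <= cr (Msec M U) &
 (!z:U. cr (Mstalk X M z) = module_span (Ostalk X z) (Mstalk X M z) (Mgerm X M z U ` S)))"

context mpsh
begin

lemma loc_fg_within:
 assumes "lfg X M" and V: "opn V" "x:V"
 obtains U S where "opn U" "x:U" "U <= V" "finite S" "S <= sec M U"
 "!z:U. stk M z = spn M z (gm M z U ` S)"
proof -
 obtain U S where U: "opn U" "x:U" "finite S" "S <= sec M U"
 "!z:U. stk M z = spn M z (gm M z U ` S)"
 using bspec[OF assms(1)[unfolded lfg_def] points_mem[OF V]] by (elim exE conjE) (rule that)
 let ?W = "U Int V"
 have W: "opn ?W" "?W <= U" "x:?W" using U V by (auto intro: openin_Int)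
 show thesis
 proof (rule that[OF W(1,3) _ finite_imageI[OF U(3), of "Mres M U ?W"]])
 show "Mres M U ?W ` S <= sec M ?W" using M.res_c[OF U(1) W(1,2)] U(4) by blast
 show "!z:?W. stk M z = spn M z (gm M z ?W ` Mres M U ?W ` S)"
 proof
 fix z assume z: "z:?W"
 have eq: "gm M z ?W ` Mres M U ?W ` S = gm M z U ` S"
 unfolding image_image by (rule image_cong[OF refl]) (use gm_res[OF U(1) W(1,2) z] U(4) in blast)
 from z have "z:U" by blast
 from bspec[OF U(5) this]
 show "stk M z = spn M z (gm M z ?W ` Mres M U ?W ` S)"
 unfolding eq .
 qed
 qed simp
qed

lemma loc_fg_stalk:
 assumes "lfg X M" and x: "x:pts"
 obtains S where "finite S" "S <= stk M x"
 "stk M x = spn M x S"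
proof -
 obtain U S where U: "opn U" "x:U" "finite S" "S <= sec M U"
 "!z:U. stk M z = spn M z (gm M z U ` S)"
 using bspec[OF assms(1)[unfolded lfg_def] x] by (elim exE conjE) (rule that)
 show thesis
 by (rule that[OF finite_imageI[OF U(3)] _ U(5)[rule_format, OF U(2)]]) (use U(4) gm_c[OF U(1,2)] in blast)
qed

text \<open>\<open>et\<close> lies in every neighbourhood of \<open>x\<close>, so a germ at
  \<open>x\<close> determines a germ at \<open>et\<close>. Global germs go to global germs, and
  sections generating the stalks near \<open>x\<close> also generate the stalk at
  \<open>et\<close>.\<close>

lemma gen_at_generization:
 assumes et: "!W. opn W & W ~= {} --> et:W" and fg: "lfg X M" and x: "x:pts" and gen: "ggen M x"
 shows "ggen M et"
proof -
 have mem: "et:W" if "opn W" "x:W" for W using et that by blast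
 have etX: "et:pts" by (rule mem[OF openin_topspace x])
 interpret Mx: module "Ost x" "Mst M x" by (rule Mst_mod[OF x])
 note sub = module.submoduleE[OF Mst_mod[OF etX] gsp_sub[OF etX]]
 have sp: "gm M et U s = gm M et V t" if U: "opn U" "x:U" "s:sec M U" and V: "opn V" "x:V" "t:sec M V"
 and eq: "gm M x U s = gm M x V t" for U V s t
 proof -
 obtain W where W: "opn W" "x:W" "W <= U Int V" "Mres M U W s = Mres M V W t"
 using gm_eq_iff[OF U V] eq by blast
 hence "W <= U" "W <= V" by auto
 thus ?thesis
 using gm_res[OF U(1) W(1) _ mem[OF W(1,2)] U(3)] gm_res[OF V(1) W(1) _ mem[OF W(1,2)] V(3)] W(4)
 by simp
 qed
 \<comment> \<open>The map from the stalk at \<open>x\<close> to the stalk at \<open>et\<close> is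
   not defined as a function: \<open>?P\<close> speaks of all representatives, and \<open>PI\<close>
   reduces this to a single one.\<close>
 let ?P = "%G. !U s. opn U --> x:U --> s:sec M U --> G = gm M x U s --> gm M et U s:gsp M et"
 have PI: "?P G" if U: "opn U" "x:U" "s:sec M U" "G = gm M x U s" "gm M et U s:gsp M et" for G U s
 using sp[OF U(1-3)] U(4,5) by metis
 have P: "?P G" if "G:spn M x (gm M x pts ` sec M pts)" for G
 using that
 proof (induction rule: Mx.span_induct)
 case (base G)
 then obtain s where s: "s:sec M pts" "G = gm M x pts s" by blast
 show ?case
 using gm_c[OF openin_topspace x s(1)] PI[OF openin_topspace x s gsp_base[OF etX s(1)]] s(2) by blast
 next
 case zero
 interpret MX: module "OS pts" "Msec M pts" by (rule Msec_mod[OF openin_topspace])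
 show ?case
 by (rule PI[OF openin_topspace x MX.M.zero_closed Mst_zero[OF openin_topspace x]
 gsp_base[OF etX MX.M.zero_closed]])
 next
 case (add G H)
 obtain U s t where U: "opn U" "x:U" "s:sec M U" "t:sec M U" "G = gm M x U s" "H = gm M x U t"
 using add(1,2) by (rule stalks_common[OF psheaf psheaf])
 interpret MU: module "OS U" "Msec M U" by (rule Msec_mod[OF U(1)])
 have "gm M et U s:gsp M et" "gm M et U t:gsp M et"
 using add(3)[rule_format, OF U(1,2,3,5)] add(4)[rule_format, OF U(1,2,4,6)] by blast+
 from sub(5)[OF this] Mst_add[OF U(1) mem[OF U(1,2)] U(3,4)]
 have "gm M et U (s \<oplus>\<^sub>(Msec M U) t):gsp M et" by simp
 from PI[OF U(1,2) MU.M.a_closed[OF U(3,4)] _ this] Mst_add[OF U(1-4)] U(5,6)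
 show ?case by blast
 next
 case (smult r G)
 obtain V s where V: "opn V" "x:V" "s:sec M V" "G = gm M x V s" using smult(2) by (rule MstalkE)
 obtain U a where U: "opn U" "x:U" "U <= V" "a:osec U" "r = og x U a"
 using smult(1) V(1,2) by (rule Ost_within)
 note s' = M.res_c[OF V(1) U(1,3) V(3)] and etU = mem[OF U(1,2)]
 note g = gm_res[OF V(1) U(1,3) _ V(3)]
 interpret MU: module "OS U" "Msec M U" by (rule Msec_mod[OF U(1)])
 have "gm M et U (Mres M V U s):gsp M et"
 using smult(3)[rule_format, OF V] g[OF etU] by simp
 from sub(4)[OF og_c[OF U(1) etU U(4)] this] Mst_smult[OF U(1) etU U(4) s']
 have "gm M et U (a \<odot>\<^sub>(Msec M U) Mres M V U s):gsp M et" by simp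
 from PI[OF U(1,2) MU.smult_closed[OF U(4) s'] _ this] Mst_smult[OF U(1,2,4) s'] g[OF U(2)] U(5) V(4)
 show ?case by simp
 qed
 obtain U S where U: "opn U" "x:U" "U <= pts" "finite S" "S <= sec M U"
 "!z:U. stk M z = spn M z (gm M z U ` S)"
 using fg openin_topspace x by (rule loc_fg_within)
 show ?thesis
 proof (rule gen_atI[OF etX bspec[OF U(6) mem[OF U(1,2)]]])
 fix H assume "H:gm M et U ` S"
 then obtain s where s: "s:sec M U" "H = gm M et U s" using U(5) by blast
 have "gm M x U s:gsp M x"
 using gen gm_c[OF U(1,2) s(1)] unfolding gen_at_def by simp
 from P[OF this[unfolded glob_span_def]] show "H:gsp M et" using U(1,2) s by blast
 qed
qed

end

context rspace
begin

section \<open>Finite generation of tensor products and powers\<close>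

lemma tns_loc_fg:
 assumes M: "psh M" and N: "psh N" and fM: "lfg X M" and fN: "lfg X N"
 shows "lfg X (tns M N)"
 unfolding lfg_def
proof
 interpret M: mpsh X M by unfold_locales (rule M)
 interpret N: mpsh X N by unfold_locales (rule N)
 interpret T: mpsh X "tns M N" by unfold_locales (rule tns_psh[OF M N])
 fix x assume x: "x:pts"
 obtain V S where V: "opn V" "x:V" "V <= pts" "finite S" "S <= sec M V"
 "!z:V. stk M z = spn M z (gm M z V ` S)"
 using fM openin_topspace x by (rule M.loc_fg_within)
 obtain U S' where U: "opn U" "x:U" "U <= V" "finite S'" "S' <= sec N U"
 "!z:U. stk N z = spn N z (gm N z U ` S')"
 using fN V(1,2) by (rule N.loc_fg_within)
 let ?T = "(%(s, t). tsec X M N U (Mres M V U s) t) ` (S \<times> S')"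
 have sec: "tsec X M N U (Mres M V U s) t:sec (tns M N) U"
 if "s:S" "t:S'" for s t
 using tsec_c[OF M N U(1) M.M.res_c[OF V(1) U(1,3)]] that V(5) U(5) by blast
 have T: "?T <= sec (tns M N) U" using sec by auto
 have span: "stk (tns M N) z =
 spn (tns M N) z (gm (tns M N) z U ` ?T)"
 (is "?C = module_span _ _ ?G") if z: "z:U" for z
 proof -
 have zX: "z:pts" and zV: "z:V" using points_mem[OF U(1) z] z U(3) by auto
 interpret Tz: module "Ost z" "Mst (tns M N) z" by (rule T.Mst_mod[OF zX])
 have G: "?G <= ?C" using T.gm_c[OF U(1) z] T by blast
 note sub = Tz.span_submod[OF G] and bil = stn_bil[OF M N zX]
 have "stn M N z A B:spn (tns M N) z ?G"
 if "A:stk M z" "B:stk N z" for A B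
 proof (rule bil_span_subset[OF M.Mst_mod[OF zX] N.Mst_mod[OF zX] Tz.module_axioms bil
 _ bspec[OF V(6) zV] _ bspec[OF U(6) z] sub _ that])
 show "gm M z V ` S <= stk M z" "gm N z U ` S' <= stk N z"
 using M.gm_c[OF V(1) zV] N.gm_c[OF U(1) z] V(5) U(5) by blast+
 fix A B assume "A:gm M z V ` S" "B:gm N z U ` S'"
 then obtain s t where st: "s:S" "A = gm M z V s" "t:S'" "B = gm N z U t" by (elim imageE)
 have sV: "s:sec M V" and tU: "t:sec N U" using st V(5) U(5) by auto
 have "stn M N z A B = gm (tns M N) z U (tsec X M N U (Mres M V U s) t)"
 unfolding st M.gm_res[OF V(1) U(1,3) z sV, symmetric]
 by (rule stn_gm[OF M N U(1) z M.M.res_c[OF V(1) U(1,3) sV] tU])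
 also have "\<dots>:?G"
 by (rule imageI, rule image_eqI[of _ _ "(s, t)"], rule prod.case[symmetric], rule SigmaI[OF st(1,3)])
 finally show "stn M N z A B:spn (tns M N) z ?G"
 by (rule Tz.span_base)
 qed
 hence "spn (tns M N) z
 {stn M N z A B | A B. A:stk M z & B:stk N z} <=
 spn (tns M N) z ?G"
 by (intro Tz.span_least[OF sub]) blast
 thus ?thesis
 unfolding stn_span[OF M N zX, symmetric] using Tz.span_sub[OF G] by (rule subset_antisym)
 qed
 have fin: "finite ?T" by (rule finite_imageI[OF finite_cartesian_product[OF V(4) U(4)]])
 show "EX U S. opn U & x:U & finite S & S <= sec (tns M N) U &
 (!z:U. stk (tns M N) z =
 spn (tns M N) z (gm (tns M N) z U ` S))"
 by (intro exI[of _ U] exI[of _ ?T] conjI ballI U(1,2) fin T) (rule span)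
qed

lemma wpow_loc_fg:
 assumes M: "psh M" and fM: "lfg X M"
 shows "lfg X (wpw sy n M)"
 unfolding lfg_def
proof
 let ?W = "wpw sy n M"
 note W = wpow_psh[OF M, of sy n]
 interpret M: mpsh X M by unfold_locales (rule M)
 interpret W: mpsh X ?W by unfold_locales (rule W)
 fix x assume x: "x:pts"
 obtain U S where U: "opn U" "x:U" "U <= pts" "finite S" "S <= sec M U"
 "!z:U. stk M z = spn M z (gm M z U ` S)"
 using fM openin_topspace x by (rule M.loc_fg_within)
 let ?L = "{ss. set ss <= S & length ss = n}"
 have L: "ss:wsec n M U" if "ss:?L" for ss using that U(5) by (auto simp: words_def)
 let ?T = "wsct X sy n M U ` ?L"
 have T: "?T <= sec ?W U" using wsct_c[OF M U(1) L] by blast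
 have span: "stk ?W z = spn ?W z (gm ?W z U ` ?T)"
 (is "?C = module_span _ _ ?G") if z: "z:U" for z
 proof -
 have zX: "z:pts" by (rule points_mem[OF U(1) z])
 interpret Wz: module "Ost z" "Mst ?W z" by (rule W.Mst_mod[OF zX])
 interpret MW: two_mods "Ost z" "Mst M z" "Mst ?W z"
 using M.Mst_mod[OF zX] Wz.module_axioms by (simp add: two_mods_def)
 have G: "?G <= ?C" using W.gm_c[OF U(1) z] T by blast
 note sub = Wz.span_submod[OF G]
 have germs: "gm M z U ` S <= stk M z" using M.gm_c[OF U(1) z] U(5) by blast
 have "stw sy n M z ` wstk n M z <= spn ?W z ?G"
 proof (rule image_subsetI)
 fix gs assume gs: "gs:wstk n M z"
 show "stw sy n M z gs:spn ?W z ?G"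
 proof (rule MW.mlt_in_submod[OF germs bspec[OF U(6) z] stw_mlt[OF M zX] sub _ gs])
 fix hs assume hs: "length hs = n" "set hs <= gm M z U ` S"
 obtain ss where ss: "set ss <= S" "hs = mg M z U ss" using list_in_map_image[OF hs(2)] by blast
 hence ssL: "ss:?L" using hs(1) by simp
 have "stw sy n M z hs = gm ?W z U (wsct X sy n M U ss)"
 unfolding ss(2) by (rule stw_gm[OF M U(1) z L[OF ssL]])
 also have "\<dots>:?G" by (rule imageI[OF imageI[OF ssL]])
 finally show "stw sy n M z hs:spn ?W z ?G"
 by (rule Wz.span_base)
 qed
 qed
 from Wz.span_least[OF sub this] show ?thesis
 unfolding stw_span[OF M zX, symmetric] using Wz.span_sub[OF G] by (rule subset_antisym)
 qed
 have fin: "finite ?T" by (rule finite_imageI[OF finite_lists_length_eq[OF U(4)]])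
 show "EX U S. opn U & x:U & finite S & S <= sec ?W U &
 (!z:U. stk ?W z = spn ?W z (gm ?W z U ` S))"
 by (intro exI[of _ U] exI[of _ ?T] conjI ballI U(1,2) fin T) (rule span)
qed

end

section \<open>Vector bundles and ample line bundles\<close>

locale trivialisation = mpsh X M for X :: "('p, 'a) ringed" and M :: "('p, 'a, 'm) presheaf" +
 fixes U n ph
 assumes U: "openin (Top X) U"
 and ph: "ph:sheaf_homs X U M (free_sheaf X n)"
 and bij: "V:opens_below X U ==> bij_betw (ph V) (cr (Msec M V)) (cr (Msec (free_sheaf X n) V))"
begin

lemma free_cr: "sec (free_sheaf X n) V = {..<n} \<rightarrow>\<^sub>E osec V"
 by (simp add: free_sheaf_def)

lemma coord_c: "V:opb U ==> s:sec M V ==> i < n ==> ph V s i:osec V"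
 using bij_betwE[OF bij, of V] by (auto simp: free_cr)

lemma coord_add:
 assumes "V:opb U" "s:sec M V" "t:sec M V" "i < n"
 shows "ph V (s \<oplus>\<^sub>(Msec M V) t) i = ph V s i \<oplus>\<^sub>(OS V) ph V t i"
 using ph assms by (auto simp: sheaf_homs_def linear_maps_def PiE_def Pi_def free_sheaf_def)

lemma coord_smult:
 assumes "V:opb U" "r:osec V" "s:sec M V" "i < n"
 shows "ph V (r \<odot>\<^sub>(Msec M V) s) i = r \<otimes>\<^sub>(OS V) ph V s i"
 using ph assms by (auto simp: sheaf_homs_def linear_maps_def PiE_def Pi_def free_sheaf_def)

lemma coord_res:
 assumes "V:opb U" "W:opb V" "s:sec M V" "i < n"
 shows "ph W (Mres M V W s) i = Ores X V W (ph V s i)"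
 using ph assms by (auto simp: sheaf_homs_def free_sheaf_def)

lemma coord_eqI:
 assumes V: "V:opb U" and s: "s:sec M V" "t:sec M V"
 and eq: "!!i. i < n ==> ph V s i = ph V t i"
 shows "s = t"
proof -
 have "ph V s:{..<n} \<rightarrow>\<^sub>E osec V" "ph V t:{..<n} \<rightarrow>\<^sub>E osec V"
 using bij_betwE[OF bij[OF V]] s by (auto simp: free_cr)
 hence "ph V s = ph V t" by (rule PiE_ext) (use eq in simp)
 thus ?thesis using bij_betw_imp_inj_on[OF bij[OF V]] s by (meson inj_onD)
qed

text \<open>The standard frame, as preimages of the unit vectors. For \<open>i >= n\<close> the
  prescribed vector is zero, so \<open>e i\<close> is a section for every \<open>i\<close>.\<close>

definition e where
 "e i = inv_into (sec M U) (ph U) (\<lambda>j\<in>{..<n}. if j = i then \<one>\<^sub>(OS U) else \<zero>\<^sub>(OS U))"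

lemma U_below: "U:opb U"
 using U by (simp add: opens_below_def)

lemma e_closed: "e i:sec M U"
 and coord_e: "ph U (e i) = (\<lambda>j\<in>{..<n}. if j = i then \<one>\<^sub>(OS U) else \<zero>\<^sub>(OS U))"
proof -
 interpret R: cring "OS U" by (rule OS_cring[OF U])
 have "(\<lambda>j\<in>{..<n}. if j = i then \<one>\<^sub>(OS U) else \<zero>\<^sub>(OS U)):ph U ` sec M U"
 unfolding bij_betw_imp_surj_on[OF bij[OF U_below]] free_cr by auto
 thus "e i:sec M U" "ph U (e i) = (\<lambda>j\<in>{..<n}. if j = i then \<one>\<^sub>(OS U) else \<zero>\<^sub>(OS U))"
 unfolding e_def by (rule inv_into_into, rule f_inv_into_f)
qed

lemma coord_e_res:
 assumes V: "V:opb U" and j: "j < n"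
 shows "ph V (Mres M U V (e i)) j = (if j = i then \<one>\<^sub>(OS V) else \<zero>\<^sub>(OS V))"
 using coord_res[OF U_below V e_closed j] j Ores_one[OF U] Ores_zero[OF U] V
 by (simp add: coord_e opens_below_def)

text \<open>A section is reduced to zero by subtracting multiples of the frame, from the highest
  nonzero coordinate downwards.\<close>

lemma stalk_span:
 assumes z: "z:U"
 shows "stk M z = spn M z (gm M z U ` e ` {..<n})"
 (is "_ = module_span _ _ ?G")
proof
 interpret Mz: module "Ost z" "Mst M z" by (rule Mst_mod[OF points_mem[OF U z]])
 have G: "?G <= stk M z" using gm_c[OF U z e_closed] by blast
 note sub = Mz.span_submod[OF G]
 show "spn M z ?G <= stk M z" by (rule Mz.span_sub[OF G])
 have key: "gm M z V s:spn M z ?G"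
 if V: "V:opb U" "z:V" and "k <= n" "s:sec M V" "!j<n. k <= j --> ph V s j = \<zero>\<^sub>(OS V)"
 for V k s
 using that(3-5)
 proof (induction k arbitrary: s)
 note V' = opbD[OF V(1)]
 interpret R: cring "OS V" by (rule OS_cring[OF V'(1)])
 interpret MV: module "OS V" "Msec M V" by (rule Msec_mod[OF V'(1)])
 case 0
 have "s = \<zero>\<^sub>(Msec M V)"
 proof (rule coord_eqI[OF V(1) 0(2) MV.M.zero_closed])
 fix i assume i: "i < n"
 have "ph V \<zero>\<^sub>(Msec M V) i = ph V (\<zero>\<^sub>(OS V) \<odot>\<^sub>(Msec M V) \<zero>\<^sub>(Msec M V)) i" by simp
 also have "\<dots> = \<zero>\<^sub>(OS V)"
 using coord_smult[OF V(1) R.zero_closed MV.M.zero_closed i] coord_c[OF V(1) MV.M.zero_closed i] by simp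
 finally show "ph V s i = ph V \<zero>\<^sub>(Msec M V) i" using 0(3) i by simp
 qed
 hence "gm M z V s = \<zero>\<^sub>(Mst M z)" using Mst_zero[OF V'(1) V(2)] by simp
 thus ?case using Mz.submod_zero[OF sub] by simp
 next
 note V' = opbD[OF V(1)]
 interpret R: cring "OS V" by (rule OS_cring[OF V'(1)])
 interpret MV: module "OS V" "Msec M V" by (rule Msec_mod[OF V'(1)])
 case (Suc k)
 hence k: "k < n" and s: "s:sec M V" by simp_all
 let ?e = "Mres M U V (e k)" and ?a = "ph V s k"
 have e: "?e:sec M V" by (rule M.res_c[OF U V' e_closed])
 have a: "?a:osec V" by (rule coord_c[OF V(1) s k])
 define t where "t = s \<oplus>\<^sub>(Msec M V) (\<ominus>\<^sub>(OS V) ?a) \<odot>\<^sub>(Msec M V) ?e"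
 have ae: "(\<ominus>\<^sub>(OS V) ?a) \<odot>\<^sub>(Msec M V) ?e:sec M V" "?a \<odot>\<^sub>(Msec M V) ?e:sec M V"
 using a e by simp_all
 have t: "t:sec M V" unfolding t_def using s ae by simp
 have "ph V t j = \<zero>\<^sub>(OS V)" if "j < n" "k <= j" for j
 proof -
 have "ph V t j = ph V s j \<oplus>\<^sub>(OS V) (\<ominus>\<^sub>(OS V) ?a) \<otimes>\<^sub>(OS V) (if j = k then \<one>\<^sub>(OS V) else \<zero>\<^sub>(OS V))"
 unfolding t_def coord_add[OF V(1) s ae(1) that(1)] coord_smult[OF V(1) R.a_inv_closed[OF a] e that(1)]
 coord_e_res[OF V(1) that(1)] ..
 thus ?thesis using Suc.prems(3) that a by (cases "j = k") (simp_all add: R.r_neg)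
 qed
 hence IH: "gm M z V t:spn M z ?G"
 using Suc.IH[OF _ t] k by simp
 have "s = t \<oplus>\<^sub>(Msec M V) ?a \<odot>\<^sub>(Msec M V) ?e"
 unfolding t_def using s a e by (simp add: MV.M.a_assoc MV.smult_l_minus MV.M.l_neg)
 hence "gm M z V s = gm M z V t \<oplus>\<^sub>(Mst M z) og z V ?a \<odot>\<^sub>(Mst M z) gm M z U (e k)"
 unfolding gm_res[OF U V'(1,2) V(2) e_closed, symmetric] Mst_smult[OF V'(1) V(2) a e]
 Mst_add[OF V'(1) V(2) t ae(2)] by simp
 moreover have "og z V ?a \<odot>\<^sub>(Mst M z) gm M z U (e k):spn M z ?G"
 by (rule Mz.submoduleE(4)[OF sub og_c[OF V'(1) V(2) a] Mz.span_base]) (use k in blast)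
 ultimately show ?case using Mz.submoduleE(5)[OF sub IH] by simp
 qed
 show "stk M z <= spn M z ?G"
 proof
 fix G assume "G:stk M z"
 then obtain V s where V: "opn V" "z:V" "V <= U" "s:sec M V" "G = gm M z V s"
 using U z by (rule Mst_within)
 thus "G:spn M z ?G"
 using key[OF _ V(2) order.refl V(4)] by (simp add: opens_below_def)
 qed
qed

end

section \<open>Line bundles and their duals\<close>

locale line_triv = trivialisation X M U 1 ph
 for X :: "('p, 'a) ringed" and M :: "('p, 'a, 'm) presheaf" and U ph
begin

interpretation D: mpsh X dual by unfold_locales (rule dual_psh)

definition coord where
 "coord = (\<lambda>V\<in>opb U. \<lambda>s\<in>sec M V. ph V s 0)"

lemma coord_dual: "coord:sec dual U"
 unfolding coord_def
proof (rule dual_sctI)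
 show "(%s. ph V s 0):lin (OS V) (Msec M V) (regular (OS V))" if "V:opb U" for V
 by (rule linI) (simp_all add: coord_c[OF that] coord_add[OF that] coord_smult[OF that])
qed (simp add: coord_res)

lemma coord_pair:
 assumes z: "z:U"
 shows "spair z (gm dual z U coord) (gm M z U (e 0)) = \<one>\<^sub>(Ost z)"
proof -
 have "coord U (e 0) = ph U (e 0) 0" using U_below e_closed[of 0] unfolding coord_def by simp
 also have "\<dots> = \<one>\<^sub>(OS U)" unfolding coord_e by simp
 finally show ?thesis
 unfolding spair_germ[OF U z coord_dual e_closed] Ost_one[OF U z] by simp
qed

lemma sct_eq:
 assumes V: "V:opb U" and s: "s:sec M V"
 shows "s = ph V s 0 \<odot>\<^sub>(Msec M V) Mres M U V (e 0)"
proof -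
 note V' = opbD[OF V]
 interpret R: cring "OS V" by (rule OS_cring[OF V'(1)])
 interpret MV: module "OS V" "Msec M V" by (rule Msec_mod[OF V'(1)])
 have a: "ph V s 0:osec V" by (rule coord_c[OF V s]) simp
 have e: "Mres M U V (e 0):sec M V" by (rule M.res_c[OF U V' e_closed])
 show ?thesis
 by (rule coord_eqI[OF V s MV.smult_closed[OF a e]])
 (use coord_smult[OF V a e] coord_e_res[OF V] a in simp)
qed

text \<open>In rank one a functional is its value on the frame times the coordinate
  function.\<close>

lemma dual_stalk_span:
 assumes z: "z:U"
 shows "stk dual z = spn dual z (gm dual z U ` {coord})"
proof
 interpret Dz: module "Ost z" "Mst dual z" by (rule D.Mst_mod[OF points_mem[OF U z]])
 have G: "gm dual z U ` {coord} <= stk dual z" using D.gm_c[OF U z coord_dual] by simp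
 show "spn dual z (gm dual z U ` {coord}) <= stk dual z"
 by (rule Dz.span_sub[OF G])
 show "stk dual z <= spn dual z (gm dual z U ` {coord})"
 proof
 fix G assume "G:stk dual z"
 then obtain V ps where V: "opn V" "z:V" "V <= U" "ps:sec dual V" "G = gm dual z V ps"
 using U z by (rule D.Mst_within)
 have VU: "V:opb U" using V by (simp add: opens_below_def)
 interpret DV: module "OS V" "Msec dual V" by (rule D.Msec_mod[OF V(1)])
 let ?e = "Mres M U V (e 0)" and ?c = "Mres dual U V coord"
 have e: "?e:sec M V" by (rule M.res_c[OF U V(1,3) e_closed])
 define a where "a = ps V ?e"
 have a: "a:osec V"
 unfolding a_def by (rule dsec_c[OF V(4) opb_refl[OF V(1)] e])
 have c: "?c:sec dual V" by (rule D.M.res_c[OF U V(1,3) coord_dual])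
 have "ps = a \<odot>\<^sub>(Msec dual V) ?c"
 proof (rule dual_sct_eqI[OF V(4) DV.smult_closed[OF a c]])
 fix W s assume W: "W:opb V" and s: "s:sec M W"
 have WU: "W:opb U" using W V(3) by (auto simp: opens_below_def)
 note W' = opbD[OF W]
 interpret R: cring "OS W" by (rule OS_cring[OF W'(1)])
 have p: "ph W s 0:osec W" by (rule coord_c[OF WU s]) simp
 have eW: "Mres M U W (e 0):sec M W" by (rule M.res_c[OF U opbD[OF WU] e_closed])
 have "ps W (Mres M U W (e 0)) = Ores X V W a"
 using dual_sct_res[OF V(4) opb_refl[OF V(1)] W e] M.res_res[OF U V(1) W' V(3) e_closed]
 by (simp add: a_def)
 moreover have "Ores X V W a:osec W" by (rule O.res_c[OF V(1) W' a])
 moreover have "ps W s = ph W s 0 \<otimes>\<^sub>(OS W) ps W (Mres M U W (e 0))"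
 using arg_cong[OF sct_eq[OF WU s], of "ps W"] linD(3)[OF dual_sct_hom[OF V(4) W] p eW] by simp
 ultimately show "ps W s = (a \<odot>\<^sub>(Msec dual V) ?c) W s"
 using W WU s p by (simp add: dual_simps coord_def R.m_comm)
 qed
 hence "G = og z V a \<odot>\<^sub>(Mst dual z) gm dual z U coord"
 unfolding V(5) D.gm_res[OF U V(1,3,2) coord_dual, symmetric] D.Mst_smult[OF V(1,2) a c] by simp
 thus "G:spn dual z (gm dual z U ` {coord})"
 using Dz.submoduleE(4)[OF Dz.span_submod[OF G] og_c[OF V(1,2) a] Dz.span_base[of "gm dual z U coord"]]
 by simp
 qed
qed

end

context mpsh
begin

lemma vector_bundle_loc_fg:
 assumes "vector_bundle X M"
 shows "lfg X M"
 unfolding lfg_def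
proof
 fix x assume "x:pts"
 then obtain U n where O: "opn U" "x:U" "isomorphic_over X U M (free_sheaf X n)"
 using assms unfolding vector_bundle_def by blast
 then obtain ph where ph: "ph:sheaf_homs X U M (free_sheaf X n)"
 "!V:opb U. bij_betw (ph V) (sec M V) (sec (free_sheaf X n) V)"
 unfolding isomorphic_over_def by blast
 interpret trivialisation X M U n ph
 by unfold_locales (use O ph in auto)
 show "EX U S. opn U & x:U & finite S & S <= sec M U &
 (!z:U. stk M z = spn M z (gm M z U ` S))"
 by (intro exI[of _ U] exI[of _ "e ` {..<n}"] conjI ballI O(1,2) stalk_span) (use e_closed in auto)
qed

lemma lb_triv:
 assumes "line_bundle X M" "x:pts"
 obtains U ph where "x:U" "line_triv X M U ph"
proof -
 obtain U where O: "opn U" "x:U" "isomorphic_over X U M (free_sheaf X 1)"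
 using assms unfolding line_bundle_def by blast
 then obtain ph where ph: "ph:sheaf_homs X U M (free_sheaf X 1)"
 "!V:opb U. bij_betw (ph V) (sec M V) (sec (free_sheaf X 1) V)"
 unfolding isomorphic_over_def by blast
 have "line_triv X M U ph"
 by unfold_locales (use O ph in auto)
 with O(2) show thesis by (rule that)
qed

lemma lb_loc_fg:
 assumes L: "line_bundle X M"
 shows "lfg X M" "lfg X dual"
proof -
 show "lfg X M"
 unfolding lfg_def
 proof
 fix x assume "x:pts"
 with L obtain U ph where O: "x:U" "line_triv X M U ph" by (rule lb_triv)
 interpret line_triv X M U ph by (rule O(2))
 show "EX U S. opn U & x:U & finite S & S <= sec M U &
 (!z:U. stk M z = spn M z (gm M z U ` S))"
 by (intro exI[of _ U] exI[of _ "e ` {..<1}"] conjI ballI O(1) U stalk_span)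
 (use e_closed in auto)
 qed
 show "lfg X dual"
 unfolding lfg_def
 proof
 fix x assume "x:pts"
 with L obtain U ph where O: "x:U" "line_triv X M U ph" by (rule lb_triv)
 interpret line_triv X M U ph by (rule O(2))
 show "EX U S. opn U & x:U & finite S & S <= sec dual U &
 (!z:U. stk dual z = spn dual z (gm dual z U ` S))"
 by (intro exI[of _ U] exI[of _ "{coord}"] conjI ballI O(1) U dual_stalk_span)
 (use coord_dual in auto)
 qed
qed

lemma lb_stalk:
 assumes "line_bundle X M" "x:pts"
 obtains al be where "al:stk dual x" "be:stk M x"
 "spair x al be = \<one>\<^sub>(Ost x)" "stk M x = spn M x {be}"
proof -
 interpret D: mpsh X dual by unfold_locales (rule dual_psh)
 obtain U ph where O: "x:U" "line_triv X M U ph" using assms by (rule lb_triv)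
 interpret line_triv X M U ph by (rule O(2))
 have "{..<1::nat} = {0}" by auto
 hence "stk M x = spn M x {gm M x U (e 0)}"
 using stalk_span[OF O(1)] by (simp only: image_insert image_empty)
 from that[OF D.gm_c[OF U O(1) coord_dual] gm_c[OF U O(1) e_closed] coord_pair[OF O(1)] this]
 show thesis .
qed

lemma cyclic_wpow:
 assumes x: "x:pts" and be: "be:stk M x"
 "stk M x = spn M x {be}"
 shows "stk (wpw sy n M) x =
 spn (wpw sy n M) x {stw sy n M x (replicate n be)}"
proof -
 let ?W = "wpw sy n M"
 note M = psheaf
 interpret W: mpsh X ?W by unfold_locales (rule wpow_psh[OF M])
 interpret Wx: module "Ost x" "Mst ?W x" by (rule W.Mst_mod[OF x])
 interpret MW: two_mods "Ost x" "Mst M x" "Mst ?W x"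
 using Mst_mod[OF x] Wx.module_axioms by (simp add: two_mods_def)
 note m = stw_mlt[OF M x, of n sy]
 have w: "{stw sy n M x (replicate n be)} <= stk ?W x"
 using mltD(1)[OF m w_rep[OF be(1)]] by simp
 note sub = Wx.span_submod[OF w]
 have "stw sy n M x ` wstk n M x <=
 spn ?W x {stw sy n M x (replicate n be)}"
 proof (rule image_subsetI)
 fix gs assume gs: "gs:wstk n M x"
 have b: "{be} <= stk M x" using be(1) by simp
 show "stw sy n M x gs:spn ?W x {stw sy n M x (replicate n be)}"
 proof (rule MW.mlt_in_submod[OF b be(2) m sub _ gs])
 fix ss assume "length ss = n" "set ss <= {be}"
 hence "ss = replicate n be" by (metis replicate_length_same singletonD subsetD)
 thus "stw sy n M x ss:spn ?W x {stw sy n M x (replicate n be)}"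
 by (simp add: Wx.span_base)
 qed
 qed
 from Wx.span_least[OF sub this] show ?thesis
 unfolding stw_span[OF M x, symmetric] using Wx.span_sub[OF w] by (rule subset_antisym)
qed

text \<open>In a cyclic stalk the germ of \<open>s\<close> is \<open>r w\<close>. If
  \<open>r\<close> were not a unit, it would act as zero on the residue field and \<open>s\<close>
  would vanish in the fibre.\<close>

lemma nonvanishing_gen:
 assumes x: "x:pts" and loc: "local_ring (Ost x)" and w: "w:stk M x"
 and cyc: "stk M x = spn M x {w}"
 and s: "s:sec M pts" and nz: "x:nonvanishing_locus X M s"
 shows "ggen M x"
proof -
 let ?R = "Ost x" and ?M = "Mst M x" and ?I = "ostk x - Units (Ost x)"
 interpret Mx: module ?R ?M by (rule Mst_mod[OF x])
 note Id = Mx.R.local_ring_nonunits[OF loc]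
 interpret I: ideal ?I ?R by (rule Id)
 interpret Q: cring "?R Quot ?I" by (rule I.quotient_is_cring[OF Mx.R.is_cring])
 have res: "residue_field X x = residue_mod ?R ?I"
 by (simp add: residue_field_def residue_mod_def maximal_ideal_def)
 interpret T: two_mods ?R ?M "residue_field X x"
 using Mx.module_axioms Mx.R.residue_mod[OF Id] by (simp add: two_mods_def res)
 have "submodule {r \<odot>\<^sub>?M w | r. r:cr ?R} ?R ?M"
 proof (rule Mx.submod_if_c)
 show "\<zero>\<^sub>?M:{r \<odot>\<^sub>?M w | r. r:cr ?R}" using w by (force intro: exI[of _ "\<zero>\<^sub>?R"])
 fix G H assume "G:{r \<odot>\<^sub>?M w | r. r:cr ?R}" "H:{r \<odot>\<^sub>?M w | r. r:cr ?R}"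
 then obtain r t where "r:cr ?R" "t:cr ?R" "G = r \<odot>\<^sub>?M w" "H = t \<odot>\<^sub>?M w" by blast
 thus "G \<oplus>\<^sub>?M H:{r \<odot>\<^sub>?M w | r. r:cr ?R}"
 using w by (intro CollectI exI[of _ "r \<oplus>\<^sub>?R t"]) (simp add: Mx.smult_l_distr)
 next
 fix a G assume "a:cr ?R" "G:{r \<odot>\<^sub>?M w | r. r:cr ?R}"
 then obtain r where "a:cr ?R" "r:cr ?R" "G = r \<odot>\<^sub>?M w" by blast
 thus "a \<odot>\<^sub>?M G:{r \<odot>\<^sub>?M w | r. r:cr ?R}"
 using w by (intro CollectI exI[of _ "a \<otimes>\<^sub>?R r"]) (simp add: Mx.smult_assoc1)
 qed (use w in auto)
 hence "module_span ?R ?M {w} <= {r \<odot>\<^sub>?M w | r. r:cr ?R}"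
 by (rule Mx.span_least) (use w in \<open>force intro: exI[of _ "\<one>\<^sub>?R"]\<close>)
 moreover have sx: "gm M x pts s:module_span ?R ?M {w}"
 using gm_c[OF openin_topspace x s] unfolding cyc .
 ultimately obtain r where r: "r:cr ?R" "gm M x pts s = r \<odot>\<^sub>?M w" by blast
 have "r:Units ?R"
 proof (rule ccontr)
 assume "r ~: Units ?R"
 with r(1) have rI: "r:?I" by simp
 note bil = T.tns_elem_bil
 have one: "\<one>\<^sub>(residue_field X x):cr (residue_field X x)" "\<zero>\<^sub>(residue_field X x):cr (residue_field X x)"
 by (simp_all add: res)
 have "r \<odot>\<^sub>(residue_field X x) \<one>\<^sub>(residue_field X x) = ?I +>\<^sub>?R r"
 using ring_hom_closed[OF I.rcos_ring_hom r(1)] by (simp add: res)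
 also have "\<dots> = \<zero>\<^sub>(residue_field X x)"
 using I.a_rcos_const[OF rI] by (simp add: res FactRing_def)
 finally have "tensor_elem ?R ?M (residue_field X x) (r \<odot>\<^sub>?M w) \<one>\<^sub>(residue_field X x) =
 tensor_elem ?R ?M (residue_field X x) w \<zero>\<^sub>(residue_field X x)"
 using linD(3)[OF bilinearD(1)[OF bil w] r(1) one(1)] linD(3)[OF bilinearD(2)[OF bil one(1)] r(1) w] by simp
 also have "\<dots> = \<zero>\<^sub>(fibre X M x)"
 proof -
 interpret F: two_mods ?R "residue_field X x" "tensor_module ?R ?M (residue_field X x)"
 using T.N.module_axioms T.tns_mod_is_mod by (simp add: two_mods_def)
 show ?thesis unfolding fibre_def by (rule F.lin_zero[OF bilinearD(1)[OF bil w]])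
 qed
 finally show False using nz r(2) by (simp add: nonvanishing_locus_def fibre_value_def)
 qed
 hence inv: "inv\<^bsub>?R\<^esub> r:cr ?R" "inv\<^bsub>?R\<^esub> r \<otimes>\<^sub>?R r = \<one>\<^sub>?R"
 by (rule Mx.R.Units_inv_closed, rule Mx.R.Units_l_inv)
 have "w = inv\<^bsub>?R\<^esub> r \<odot>\<^sub>?M gm M x pts s"
 unfolding r(2) using Mx.smult_assoc1[OF inv(1) r(1) w] inv(2) w by simp
 hence "w:gsp M x"
 using Mx.submoduleE(4)[OF gsp_sub[OF x] inv(1) gsp_base[OF x s]] by simp
 thus ?thesis by (intro gen_atI[OF x cyc]) simp
qed

end

section \<open>Spectra\<close>

text \<open>Localisation at any multiplicative set, common to \<open>Spec\<close> and
  \<open>Proj\<close>. The set \<open>D\<close> in \<open>fraction_ring\<close> restricts the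
  carrier only, so the rules for computing with fractions hold for every \<open>D\<close>.\<close>

locale fractions = cring R for R (structure) +
 fixes S
 assumes S_sub: "S <= cr R" and S_one: "\<one>:S" and S_mult: "s:S ==> t:S ==> s \<otimes> t:S"
begin

lemma frac_mem: "(b, t):fraction R S a s \<longleftrightarrow> b:cr R & t:S & (EX u:S. u \<otimes> (a \<otimes> t) = u \<otimes> (b \<otimes> s))"
 by (simp add: fraction_def)

lemma frac_self: "a:cr R ==> s:S ==> (a, s):fraction R S a s"
 using S_one by (auto simp: frac_mem)

lemma frac_sym: "a:cr R ==> s:S ==> (b, t):fraction R S a s ==> (a, s):fraction R S b t"
 unfolding frac_mem by metis

lemma frac_trans:
 assumes a: "a:cr R" "s:S" and b: "(b, t):fraction R S a s" and c: "(c, w):fraction R S b t"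
 shows "(c, w):fraction R S a s"
proof -
 obtain u where u: "u:S" "u \<otimes> (a \<otimes> t) = u \<otimes> (b \<otimes> s)" and b': "b:cr R" "t:S"
 using b by (auto simp: frac_mem)
 obtain v where v: "v:S" "v \<otimes> (b \<otimes> w) = v \<otimes> (c \<otimes> t)" and c': "c:cr R" "w:S"
 using c by (auto simp: frac_mem)
 have R: "s:cr R" "t:cr R" "u:cr R" "v:cr R" "w:cr R"
 using S_sub a(2) b'(2) u(1) v(1) c'(2) by auto
 have "(u \<otimes> v \<otimes> t) \<otimes> (a \<otimes> w) = v \<otimes> w \<otimes> (u \<otimes> (a \<otimes> t))" using R a(1) by (simp add: m_ac)
 also have "\<dots> = u \<otimes> s \<otimes> (v \<otimes> (b \<otimes> w))" unfolding u(2) using R b'(1) by (simp add: m_ac)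
 also have "\<dots> = (u \<otimes> v \<otimes> t) \<otimes> (c \<otimes> s)" unfolding v(2) using R c'(1) by (simp add: m_ac)
 finally show ?thesis
 using S_mult[OF S_mult[OF u(1) v(1)] b'(2)] c' unfolding frac_mem by blast
qed

lemma frac_eq_iff:
 assumes "a:cr R" "s:S" "b:cr R" "t:S"
 shows "fraction R S a s = fraction R S b t \<longleftrightarrow> (EX u:S. u \<otimes> (a \<otimes> t) = u \<otimes> (b \<otimes> s))"
proof
 assume "fraction R S a s = fraction R S b t"
 hence "(b, t):fraction R S a s" using frac_self[OF assms(3,4)] by simp
 thus "EX u:S. u \<otimes> (a \<otimes> t) = u \<otimes> (b \<otimes> s)" by (simp add: frac_mem)
next
 assume "EX u:S. u \<otimes> (a \<otimes> t) = u \<otimes> (b \<otimes> s)"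
 hence 1: "(b, t):fraction R S a s" using assms by (simp add: frac_mem)
 note 2 = frac_sym[OF assms(1,2) 1]
 show "fraction R S a s = fraction R S b t"
 using frac_trans[OF assms(1,2) 1] frac_trans[OF assms(3,4) 2] by auto
qed

lemma frac_operation:
 assumes a: "a:cr R" "s:S" and b: "b:cr R" "t:S"
 and "!!a' s' b' t'. (a', s'):fraction R S a s ==> (b', t'):fraction R S b t ==> f a' s' b' t' = f a s b t"
 shows "(\<Union>(a', s')\<in>fraction R S a s. \<Union>(b', t')\<in>fraction R S b t. f a' s' b' t') = f a s b t"
proof -
 have "(\<Union>(b', t')\<in>fraction R S b t. f a' s' b' t') = f a s b t" if "(a', s'):fraction R S a s" for a' s'
 by (rule UN_constant_eq[OF frac_self[OF b]]) (use assms(5)[OF that] in auto)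
 thus ?thesis by (intro UN_constant_eq[OF frac_self[OF a]]) auto
qed

lemma frac_mult:
 assumes a: "a:cr R" "s:S" and b: "b:cr R" "t:S"
 shows "fraction R S a s \<otimes>\<^sub>(fraction_ring R S D) fraction R S b t = fraction R S (a \<otimes> b) (s \<otimes> t)"
 unfolding fraction_ring_def ring_record_simps monoid.simps
proof (rule frac_operation[OF a b])
 fix a' s' b' t' assume "(a', s'):fraction R S a s" "(b', t'):fraction R S b t"
 then obtain u v where u: "u:S" "u \<otimes> (a \<otimes> s') = u \<otimes> (a' \<otimes> s)" "a':cr R" "s':S"
 and v: "v:S" "v \<otimes> (b \<otimes> t') = v \<otimes> (b' \<otimes> t)" "b':cr R" "t':S"
 by (auto simp: frac_mem)
 have R: "s:cr R" "t:cr R" "s':cr R" "t':cr R" "u:cr R" "v:cr R"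
 using S_sub a b u v by auto
 have "(u \<otimes> v) \<otimes> ((a' \<otimes> b') \<otimes> (s \<otimes> t)) = (u \<otimes> (a' \<otimes> s)) \<otimes> (v \<otimes> (b' \<otimes> t))"
 using R a b u(3) v(3) by (simp add: m_ac)
 also have "\<dots> = (u \<otimes> v) \<otimes> ((a \<otimes> b) \<otimes> (s' \<otimes> t'))"
 unfolding u(2)[symmetric] v(2)[symmetric] using R a b u(3) v(3) by (simp add: m_ac)
 finally show "fraction R S (a' \<otimes> b') (s' \<otimes> t') = fraction R S (a \<otimes> b) (s \<otimes> t)"
 using S_mult[OF u(1) v(1)] S_mult[OF a(2) b(2)] S_mult[OF u(4) v(4)] a(1) b(1) u(3) v(3)
 by (subst frac_eq_iff) (simp_all, blast)
qed

lemma frac_add: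
 assumes a: "a:cr R" "s:S" and b: "b:cr R" "t:S"
 shows "fraction R S a s \<oplus>\<^sub>(fraction_ring R S D) fraction R S b t = fraction R S (a \<otimes> t \<oplus> b \<otimes> s) (s \<otimes> t)"
 unfolding fraction_ring_def ring_record_simps
proof (rule frac_operation[OF a b])
 fix a' s' b' t' assume "(a', s'):fraction R S a s" "(b', t'):fraction R S b t"
 then obtain u v where u: "u:S" "u \<otimes> (a \<otimes> s') = u \<otimes> (a' \<otimes> s)" "a':cr R" "s':S"
 and v: "v:S" "v \<otimes> (b \<otimes> t') = v \<otimes> (b' \<otimes> t)" "b':cr R" "t':S"
 by (auto simp: frac_mem)
 have R: "s:cr R" "t:cr R" "s':cr R" "t':cr R" "u:cr R" "v:cr R"
 using S_sub a b u v by auto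
 have "(u \<otimes> v) \<otimes> ((a' \<otimes> t' \<oplus> b' \<otimes> s') \<otimes> (s \<otimes> t)) =
 (u \<otimes> (a' \<otimes> s)) \<otimes> (v \<otimes> (t' \<otimes> t)) \<oplus> (v \<otimes> (b' \<otimes> t)) \<otimes> (u \<otimes> (s' \<otimes> s))"
 using R a b u(3) v(3) by (simp add: l_distr r_distr m_ac)
 also have "\<dots> = (u \<otimes> v) \<otimes> ((a \<otimes> t \<oplus> b \<otimes> s) \<otimes> (s' \<otimes> t'))"
 unfolding u(2)[symmetric] v(2)[symmetric] using R a b u(3) v(3) by (simp add: l_distr r_distr m_ac)
 finally show "fraction R S (a' \<otimes> t' \<oplus> b' \<otimes> s') (s' \<otimes> t') = fraction R S (a \<otimes> t \<oplus> b \<otimes> s) (s \<otimes> t)"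
 using S_mult[OF u(1) v(1)] S_mult[OF a(2) b(2)] S_mult[OF u(4) v(4)] a(1) b(1) u(3) v(3) R
 by (subst frac_eq_iff) (simp_all, blast)
qed

end

lemma (in primeideal) complement_fractions: "fractions R (cr R - I)"
proof
 show "\<one>:cr R - I" using I_notcarr one_imp_carrier by auto
 show "s \<otimes> t:cr R - I" if "s:cr R - I" "t:cr R - I" for s t
 using that I_prime by auto
qed auto

text \<open>\<open>H\<close> is the whole ring for \<open>Spec\<close> and the set of homogeneous
  elements for \<open>Proj\<close>. Intersections of open sets are given by products of elements, by
  primality.\<close>

lemma (in cring) istopology_primes:
 assumes H: "H <= cr R" "!!a b. a:H ==> b:H ==> a \<otimes> b:H" and prime: "!!p. P p ==> primeideal p R"
 shows "istopology (%U. EX E<=H. U = {p. P p & ~ E <= p})"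
 unfolding istopology_def
proof (intro conjI allI impI)
 fix U V assume "EX E<=H. U = {p. P p & ~ E <= p}" "EX E<=H. V = {p. P p & ~ E <= p}"
 then obtain E F where E: "E <= H" "U = {p. P p & ~ E <= p}" and F: "F <= H" "V = {p. P p & ~ F <= p}" by blast
 let ?G = "{e \<otimes> f | e f. e:E & f:F}"
 have c: "E <= cr R" "F <= cr R" using E(1) F(1) H(1) by blast+
 have "~ ?G <= p \<longleftrightarrow> ~ E <= p & ~ F <= p" if "P p" for p
 proof -
 interpret p: primeideal p R by (rule prime[OF that])
 have "e \<otimes> f:p \<longleftrightarrow> e:p | f:p" if "e:E" "f:F" for e f
 using c that p.I_r_closed[of e f] p.I_l_closed[of f e] p.I_prime[of e f] by blast
 thus ?thesis by blast
 qed
 hence "U Int V = {p. P p & ~ ?G <= p}" unfolding E(2) F(2) by blast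
 moreover have "?G <= H" using E(1) F(1) H(2) by blast
 ultimately show "EX E<=H. U Int V = {p. P p & ~ E <= p}" by (intro exI[of _ ?G] conjI)
next
 fix \<U> assume "!U:\<U>. EX E<=H. U = {p. P p & ~ E <= p}"
 from bchoice[OF this] obtain E where E: "!U:\<U>. E U <= H & U = {p. P p & ~ E U <= p}" ..
 have mem: "p:U \<longleftrightarrow> P p & ~ E U <= p" if "U:\<U>" for U p using bspec[OF E that] by blast
 have "\<Union> \<U> = {p. P p & ~ \<Union> (E ` \<U>) <= p}"
 using mem by (simp add: set_eq_iff UN_subset_iff)
 moreover have "\<Union> (E ` \<U>) <= H" by (rule UN_least) (rule conjunct1[OF bspec[OF E]])
 ultimately show "EX E<=H. \<Union> \<U> = {p. P p & ~ E <= p}" by (intro exI[of _ "\<Union> (E ` \<U>)"] conjI)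
qed

locale spectrum = cring R for R :: "'r ring" (structure)
begin

lemma openin_Spec:
 "openin (Spec_topology R) U \<longleftrightarrow> (EX E<=cr R. U = {p. primeideal p R & ~ E <= p})"
 unfolding Spec_topology_def by (subst topology_inverse'[OF istopology_primes]) simp_all

lemma Spec_points: "points (Spec R) = {p. primeideal p R}"
proof -
 have top: "Top (Spec R) = Spec_topology R" by (simp add: Spec_def function_space_def)
 have "openin (Spec_topology R) {p. primeideal p R}"
 unfolding openin_Spec
 by (intro exI[of _ "{\<one>}"]) (auto dest: primeideal.I_notcarr ideal.one_imp_carrier[OF primeideal.axioms(1)])
 thus ?thesis unfolding top topspace_def openin_Spec by blast
qed

definition Sfr where
 "Sfr V a s = (\<lambda>p\<in>V. fraction R (cr R - p) a s)"

lemma Spec_Osec: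
 "s:cr (Osec (Spec R) U) \<longleftrightarrow>
 s:Pi\<^sub>E U (%p. cr (fraction_ring R (cr R - p) (cr R \<times> (cr R - p)))) &
 locally_in (Spec_topology R) (%V. {%p. fraction R (cr R - p) a s | a s.
 a:cr R & s:cr R & (!p:V. s ~: p)}) U s"
 by (simp add: Spec_def function_space_def)

lemma Sfr_c:
 assumes V: "openin (Spec_topology R) V" and a: "a:cr R" "s:cr R" "!p:V. s ~: p"
 shows "Sfr V a s:cr (Osec (Spec R) V)"
 unfolding Spec_Osec locally_in_def
proof (intro conjI ballI)
 show "Sfr V a s:Pi\<^sub>E V (%p. cr (fraction_ring R (cr R - p) (cr R \<times> (cr R - p))))"
 using a by (auto simp: Sfr_def fraction_ring_def)
 fix x assume "x:V"
 thus "EX W. openin (Spec_topology R) W & x:W & W <= V & (EX t:{%p. fraction R (cr R - p) a s | a s.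
 a:cr R & s:cr R & (!p:W. s ~: p)}. !y:W. Sfr V a s y = t y)"
 using V a by (intro exI[of _ V]) (auto simp: Sfr_def)
qed

lemma Sfr_loc:
 assumes s: "s:cr (Osec (Spec R) V)" and p: "p:V"
 obtains W a g where "openin (Spec_topology R) W" "p:W" "W <= V" "a:cr R" "g:cr R" "!q:W. g ~: q"
 "Ores (Spec R) V W s = Sfr W a g"
proof -
 obtain W t where W: "openin (Spec_topology R) W" "p:W" "W <= V" "!y:W. s y = t y"
 "t:{%p. fraction R (cr R - p) a s | a s. a:cr R & s:cr R & (!p:W. s ~: p)}"
 using conjunct2[OF s[unfolded Spec_Osec], unfolded locally_in_def, rule_format, OF p]
 by (elim exE conjE bexE) (rule that)
 obtain a g where a: "a:cr R" "g:cr R" "!q:W. g ~: q" "t = (%p. fraction R (cr R - p) a g)"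
 using W(5) by (elim CollectE exE conjE) (rule that)
 have "Ores (Spec R) V W s = restrict s W" by (simp add: Spec_def function_space_def)
 also have "\<dots> = Sfr W a g" using W(4) a(4) by (auto simp: Sfr_def fun_eq_iff restrict_def)
 finally show thesis by (rule that[OF W(1-3) a(1-3)])
qed

lemma Sfr_prime:
 assumes V: "openin (Spec_topology R) V" and p: "p:V"
 shows "primeideal p R" "fractions R (cr R - p)"
 using V p primeideal.complement_fractions unfolding openin_Spec by auto

lemma Sfr_mult:
 assumes V: "openin (Spec_topology R) V" and a: "a:cr R" "s:cr R" "!p:V. s ~: p"
 and b: "b:cr R" "t:cr R" "!p:V. t ~: p"
 shows "Sfr V a s \<otimes>\<^sub>(Osec (Spec R) V) Sfr V b t = Sfr V (a \<otimes> b) (s \<otimes> t)"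
proof -
 have "fraction R (cr R - p) a s \<otimes>\<^sub>(fraction_ring R (cr R - p) D) fraction R (cr R - p) b t =
 fraction R (cr R - p) (a \<otimes> b) (s \<otimes> t)" if p: "p:V" for p D
 using fractions.frac_mult[OF Sfr_prime(2)[OF V p]] a b p by simp
 thus ?thesis by (auto simp: Spec_def function_space_def Sfr_def fun_eq_iff restrict_def)
qed

lemma Sfr_add:
 assumes V: "openin (Spec_topology R) V" and a: "a:cr R" "s:cr R" "!p:V. s ~: p"
 and b: "b:cr R" "t:cr R" "!p:V. t ~: p"
 shows "Sfr V a s \<oplus>\<^sub>(Osec (Spec R) V) Sfr V b t = Sfr V (a \<otimes> t \<oplus> b \<otimes> s) (s \<otimes> t)"
proof -
 have "fraction R (cr R - p) a s \<oplus>\<^sub>(fraction_ring R (cr R - p) D) fraction R (cr R - p) b t =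
 fraction R (cr R - p) (a \<otimes> t \<oplus> b \<otimes> s) (s \<otimes> t)" if p: "p:V" for p D
 using fractions.frac_add[OF Sfr_prime(2)[OF V p]] a b p by simp
 thus ?thesis by (auto simp: Spec_def function_space_def Sfr_def fun_eq_iff restrict_def)
qed

lemma Spec_one: "\<one>\<^sub>(Osec (Spec R) V) = Sfr V \<one> \<one>"
 by (simp add: Spec_def function_space_def Sfr_def fraction_ring_def)

lemma Sfr_eqI:
 assumes V: "openin (Spec_topology R) V" and a: "a:cr R" "s:cr R" "!p:V. s ~: p"
 and b: "b:cr R" "t:cr R" "!p:V. t ~: p" and eq: "a \<otimes> t = b \<otimes> s"
 shows "Sfr V a s = Sfr V b t"
proof -
 have "fraction R (cr R - p) a s = fraction R (cr R - p) b t" if p: "p:V" for p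
 proof -
 interpret fractions R "cr R - p" by (rule Sfr_prime(2)[OF V p])
 have st: "s:cr R - p" "t:cr R - p" using a b p by auto
 show ?thesis unfolding frac_eq_iff[OF a(1) st(1) b(1) st(2)] eq by (rule bexI[OF refl S_one])
 qed
 thus ?thesis by (auto simp: Sfr_def fun_eq_iff restrict_def)
qed

end

subsection \<open>Affine charts\<close>

locale affine_chart = rspace X + spectrum R
 for X :: "('p, 'a) ringed" and R :: "'a ring" (structure) +
 fixes U :: "'p set" and f :: "'p => 'a set" and ph :: "'a set set => ('a set => ('a \<times> 'a) set) => 'a"
 assumes open_U: "openin (Top X) U"
 and mor: "morphism (open_subspace X U) (Spec R) f ph"
 and homeo: "homeomorphic_map (subtopology (Top X) U) (Spec_topology R) f"
 and bij: "openin (Spec_topology R) V ==>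
 bij_betw (ph V) (cr (Osec (Spec R) V)) (cr (Osec X (f -` V Int U)))"
begin

abbreviation preimage where "preimage V == f -` V Int U"

lemma U_points: "U Int pts = U"
 using openin_points[OF open_U] by blast

lemma preimage_open:
 assumes "openin (Spec_topology R) V"
 shows "opn (preimage V)"
proof -
 have "openin (subtopology (Top X) U) {x:topspace (subtopology (Top X) U). f x:V}"
 using homeomorphic_imp_continuous_map[OF homeo] assms unfolding continuous_map_def by blast
 moreover have "{x:topspace (subtopology (Top X) U). f x:V} = preimage V"
 using U_points by (auto simp: topspace_subtopology)
 ultimately show ?thesis using openin_open_subtopology[OF open_U] by simp
qed

lemma image_open:
 assumes W: "opn W" "W <= U"
 shows "openin (Spec_topology R) (f ` W)" "preimage (f ` W) = W"
proof -
 have "openin (subtopology (Top X) U) W" using openin_open_subtopology[OF open_U] W by simp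
 thus "openin (Spec_topology R) (f ` W)"
 using homeomorphic_imp_open_map[OF homeo] unfolding open_map_def by blast
 have "inj_on f U"
 using homeomorphic_imp_injective_map[OF homeo] U_points by (simp add: topspace_subtopology Int_commute)
 thus "preimage (f ` W) = W" using W(2) by (auto dest: inj_onD)
qed

lemma sct_hom:
 assumes "openin (Spec_topology R) V"
 shows "ph V:ring_hom (Osec (Spec R) V) (OS (preimage V))"
proof -
 have "openin (Top (Spec R)) V" using assms by (simp add: Spec_def function_space_def)
 hence "ph V:ring_hom (Osec (Spec R) V) (Osec (open_subspace X U) (f -` V Int points (open_subspace X U)))"
 using mor unfolding morphism_def by blast
 thus ?thesis using U_points by (simp add: open_subspace_def topspace_subtopology Int_commute Int_left_commute)
qed

lemma sct_res:
 assumes V: "openin (Spec_topology R) V" "openin (Spec_topology R) W" "W <= V" and s: "s:cr (Osec (Spec R) V)"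
 shows "ph W (Ores (Spec R) V W s) = Ores X (preimage V) (preimage W) (ph V s)"
proof -
 have "openin (Top (Spec R)) V" "openin (Top (Spec R)) W" using V by (simp_all add: Spec_def function_space_def)
 hence "ph W (Ores (Spec R) V W s) =
 Ores (open_subspace X U) (f -` V Int points (open_subspace X U)) (f -` W Int points (open_subspace X U)) (ph V s)"
 using mor V(3) s unfolding morphism_def by blast
 thus ?thesis using U_points by (simp add: open_subspace_def topspace_subtopology Int_commute Int_left_commute)
qed

text \<open>Where neither \<open>a\<close> nor \<open>g\<close> lies in a point of \<open>W\<close>,
  the section \<open>g/a\<close> inverts \<open>a/g\<close>, and ring homomorphisms preserve
  units.\<close>

lemma germ_unit:
 assumes W: "openin (Spec_topology R) W" and x: "x:preimage W"
 and a: "a:cr R" "!p:W. a ~: p" and g: "g:cr R" "!p:W. g ~: p"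
 shows "og x (preimage W) (ph W (Sfr W a g)):Units (Ost x)"
proof -
 note O = preimage_open[OF W]
 interpret Ox: cring "Ost x" by (rule Ost_cring) (use openin_points[OF O] x in blast)
 note h = sct_hom[OF W] and gh = og_ring_hom[OF O x]
 let ?s = "Sfr W a g" and ?t = "Sfr W g a"
 have s: "?s:cr (Osec (Spec R) W)" by (rule Sfr_c[OF W a(1) g])
 have t: "?t:cr (Osec (Spec R) W)" by (rule Sfr_c[OF W g(1) a])
 have ag: "!p:W. a \<otimes> g ~: p" "!p:W. \<one> ~: p"
 using Sfr_prime(1)[OF W] primeideal.I_prime[of _ R a g] a g
 ideal.one_imp_carrier[OF primeideal.axioms(1)] by blast+
 have "?s \<otimes>\<^sub>(Osec (Spec R) W) ?t = \<one>\<^sub>(Osec (Spec R) W)"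
 unfolding Sfr_mult[OF W a(1) g g(1) a] Spec_one
 by (rule Sfr_eqI[OF W]) (use a(1) g(1) ag m_comm in auto)
 hence "ph W ?s \<otimes>\<^sub>(OS (preimage W)) ph W ?t = \<one>\<^sub>(OS (preimage W))"
 using ring_hom_mult[OF h s t] ring_hom_one[OF h] by simp
 note c = ring_hom_closed[OF h s] ring_hom_closed[OF h t]
 have "og x (preimage W) (ph W ?s) \<otimes>\<^sub>(Ost x) og x (preimage W) (ph W ?t) = \<one>\<^sub>(Ost x)"
 using ring_hom_mult[OF gh c] ring_hom_one[OF gh] \<open>ph W ?s \<otimes>\<^sub>(OS (preimage W)) ph W ?t = _\<close> by simp
 thus ?thesis
 using Ox.Units_factor[OF ring_hom_closed[OF gh c(1)] ring_hom_closed[OF gh c(2)]] Ox.Units_one_closed by simp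
qed

text \<open>The proof uses fractions on the chart and does not identify the stalk with a
  localisation. Near the point the germ is \<open>a/g\<close> with \<open>g\<close> outside the
  prime \<open>f x\<close>. If \<open>a\<close> is outside as well, \<open>a/g\<close> is a unit;
  otherwise \<open>g - a\<close> is outside and \<open>1 - a/g\<close> is a unit.\<close>

lemma stalk_local:
 assumes x: "x:U" and r: "r:ostk x"
 shows "r:Units (Ost x) | \<one>\<^sub>(Ost x) \<ominus>\<^sub>(Ost x) r:Units (Ost x)"
proof -
 interpret Ox: cring "Ost x" by (rule Ost_cring) (use openin_points[OF open_U] x in blast)
 obtain Y s where Y: "opn Y" "x:Y" "Y <= U" "s:osec Y" "r = og x Y s"
 using r open_U x by (rule Ost_within)
 note V = image_open[OF Y(1,3)]
 let ?V = "f ` Y" and ?p = "f x"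
 have "s:ph ?V ` cr (Osec (Spec R) ?V)"
 using Y(4) bij_betw_imp_surj_on[OF bij[OF V(1)]] unfolding V(2) by blast
 then obtain t where t: "t:cr (Osec (Spec R) ?V)" "s = ph ?V t" by blast
 have "?p:?V" using Y(2) by blast
 with t(1) obtain W a g where W: "openin (Spec_topology R) W" "?p:W" "W <= ?V" "a:cr R" "g:cr R"
 "!q:W. g ~: q" "Ores (Spec R) ?V W t = Sfr W a g"
 by (rule Sfr_loc)
 define b where "b = (if a:?p then g \<ominus> a else a)"
 interpret p: primeideal ?p R by (rule Sfr_prime(1)[OF W(1,2)])
 have b: "b:cr R" using W(4,5) by (simp add: b_def)
 have "b ~: ?p"
 proof (cases "a:?p")
 case True
 have "g = (g \<ominus> a) \<oplus> a" using W(4,5) by (simp add: a_minus_def a_assoc l_neg)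
 thus ?thesis using True W(2,6) p.a_closed[of "g \<ominus> a" a] by (auto simp: b_def)
 qed (simp add: b_def)
 define W' where "W' = W Int {p. primeideal p R & ~ {b} <= p}"
 have W'O: "openin (Spec_topology R) W'"
 unfolding W'_def by (rule openin_Int[OF W(1)]) (use b in \<open>auto simp: openin_Spec intro!: exI[of _ "{b}"]\<close>)
 have W': "?p:W'" "W' <= W" "W' <= ?V" "!q:W'. b ~: q" "!q:W'. g ~: q"
 using W \<open>b ~: ?p\<close> p.primeideal_axioms unfolding W'_def by auto
 note O = preimage_open[OF W'O] and h = sct_hom[OF W'O]
 have xW: "x:preimage W'" using W'(1) x by simp
 note gh = og_ring_hom[OF O xW]
 have "Ores (Spec R) ?V W' t = Sfr W' a g"
 proof -
 have "Ores (Spec R) ?V W' t = restrict (Ores (Spec R) ?V W t) W'"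
 using W'(2) by (auto simp: Spec_def function_space_def fun_eq_iff restrict_def)
 thus ?thesis unfolding W(7) using W'(2) by (auto simp: Sfr_def fun_eq_iff restrict_def)
 qed
 hence "ph W' (Sfr W' a g) = Ores X Y (preimage W') s"
 using sct_res[OF V(1) W'O W'(3) t(1)] unfolding V(2) t(2) by simp
 moreover have "preimage W' <= Y" using W'(3) V(2) by blast
 ultimately have r': "r = og x (preimage W') (ph W' (Sfr W' a g))"
 using og_res[OF Y(1) O _ xW Y(4)] Y(5) by simp
 have unit: "og x (preimage W') (ph W' (Sfr W' b g)):Units (Ost x)"
 by (rule germ_unit[OF W'O xW b W'(4) W(5) W'(5)])
 show ?thesis
 proof (cases "a:?p")
 case False
 thus ?thesis using unit r' by (simp add: b_def)
 next
 case True
 have s: "Sfr W' b g:cr (Osec (Spec R) W')" "Sfr W' a g:cr (Osec (Spec R) W')"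
 by (rule Sfr_c[OF W'O b W(5) W'(5)] Sfr_c[OF W'O W(4,5) W'(5)])+
 have one: "!p:W'. \<one> ~: p" "!p:W'. g \<otimes> g ~: p"
 using Sfr_prime(1)[OF W'O] primeideal.I_prime[of _ R g g] W(5) W'(5)
 ideal.one_imp_carrier[OF primeideal.axioms(1)] primeideal.I_notcarr by blast+
 have bg: "b = g \<ominus> a" using True by (simp add: b_def)
 have "b \<otimes> g \<oplus> a \<otimes> g = (b \<oplus> a) \<otimes> g" using b W(4,5) by (simp add: l_distr)
 also have "b \<oplus> a = g" unfolding bg using W(4,5) by (simp add: a_minus_def a_assoc l_neg)
 finally have "Sfr W' b g \<oplus>\<^sub>(Osec (Spec R) W') Sfr W' a g = \<one>\<^sub>(Osec (Spec R) W')"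
 unfolding Sfr_add[OF W'O b W(5) W'(5) W(4,5) W'(5)] Spec_one
 by (intro Sfr_eqI[OF W'O]) (use W(5) one in simp_all)
 hence "ph W' (Sfr W' b g) \<oplus>\<^sub>(OS (preimage W')) ph W' (Sfr W' a g) = \<one>\<^sub>(OS (preimage W'))"
 using ring_hom_add[OF h s] ring_hom_one[OF h] by simp
 hence sum: "og x (preimage W') (ph W' (Sfr W' b g)) \<oplus>\<^sub>(Ost x) r = \<one>\<^sub>(Ost x)"
 unfolding r' using ring_hom_add[OF gh ring_hom_closed[OF h s(1)] ring_hom_closed[OF h s(2)]] ring_hom_one[OF gh]
 by simp
 have u: "og x (preimage W') (ph W' (Sfr W' b g)):ostk x"
 by (rule ring_hom_closed[OF gh ring_hom_closed[OF h s(1)]])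
 have "\<one>\<^sub>(Ost x) \<ominus>\<^sub>(Ost x) r = og x (preimage W') (ph W' (Sfr W' b g))"
 unfolding sum[symmetric] using u r by (simp add: Ox.minus_eq Ox.a_assoc Ox.r_neg)
 thus ?thesis using unit by simp
 qed
qed

text \<open>The generic point of a chart is the kernel of \<open>R \<rightarrow> \<O>(U)\<close>.\<close>

lemma chart_generic:
 assumes dom: "domain (OS U)"
 obtains et where "et:U" "!!W. opn W ==> W <= U ==> W ~= {} ==> et:W"
proof -
 let ?T = "{p. primeideal p R}"
 interpret D: domain "OS U" by (rule dom)
 have "topspace (Spec_topology R) = ?T" using Spec_points by (simp add: Spec_def function_space_def)
 hence TO: "openin (Spec_topology R) ?T" using openin_topspace[of "Spec_topology R"] by (rule subst)
 have fU: "f ` U = ?T"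
 using homeomorphic_imp_surjective_map[OF homeo] U_points Spec_points
 by (simp add: Spec_def function_space_def topspace_subtopology Int_commute)
 hence pre: "preimage ?T = U" by blast
 note h = sct_hom[OF TO, unfolded pre]
 have not1: "!p:?T. \<one> ~: p"
 using ideal.one_imp_carrier[OF primeideal.axioms(1)] primeideal.I_notcarr by blast
 define ps where "ps a = ph ?T (Sfr ?T a \<one>)" for a
 have sc: "Sfr ?T a \<one>:cr (Osec (Spec R) ?T)" if "a:cr R" for a
 by (rule Sfr_c[OF TO that one_closed not1])
 have ps: "ps:ring_hom R (OS U)"
 proof (rule ring_hom_memI)
 show "ps a:osec U" if "a:cr R" for a
 unfolding ps_def by (rule ring_hom_closed[OF h sc[OF that]])
 show "ps (a \<otimes> b) = ps a \<otimes>\<^sub>(OS U) ps b" if "a:cr R" "b:cr R" for a b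
 using ring_hom_mult[OF h sc[OF that(1)] sc[OF that(2)]]
 Sfr_mult[OF TO that(1) one_closed not1 that(2) one_closed not1] by (simp add: ps_def)
 show "ps (a \<oplus> b) = ps a \<oplus>\<^sub>(OS U) ps b" if "a:cr R" "b:cr R" for a b
 using ring_hom_add[OF h sc[OF that(1)] sc[OF that(2)]] that
 Sfr_add[OF TO that(1) one_closed not1 that(2) one_closed not1] by (simp add: ps_def)
 show "ps \<one> = \<one>\<^sub>(OS U)" using ring_hom_one[OF h] by (simp add: ps_def Spec_one)
 qed
 have ps_hom: "ring_hom_ring R (OS U) ps" by (rule ring_hom_ringI2[OF ring_axioms D.ring_axioms ps])
 have ps_one: "ps \<one> = \<one>\<^sub>(OS U)" and ps_zero: "ps \<zero> = \<zero>\<^sub>(OS U)"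
 by (rule ring_hom_one[OF ps], rule ring_hom_zero[OF ps ring_axioms D.ring_axioms])
 let ?p = "a_kernel R (OS U) ps"
 have ker: "a:?p \<longleftrightarrow> a:cr R & ps a = \<zero>\<^sub>(OS U)" for a
 unfolding a_kernel_def' by (rule mem_Collect_eq)
 have p: "primeideal ?p R"
 proof (rule primeidealI[OF ring_hom_ring.kernel_is_ideal[OF ps_hom] is_cring])
 have "\<one> ~: ?p" unfolding ker ps_one using D.one_not_zero by blast
 thus "cr R ~= ?p" using one_closed by blast
 fix a b assume ab: "a:cr R" "b:cr R" "a \<otimes> b:?p"
 hence "ps (a \<otimes> b) = \<zero>\<^sub>(OS U)" unfolding ker by blast
 hence "ps a \<otimes>\<^sub>(OS U) ps b = \<zero>\<^sub>(OS U)" unfolding ring_hom_mult[OF ps ab(1,2)] .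
 from D.integral[OF this ring_hom_closed[OF ps ab(1)] ring_hom_closed[OF ps ab(2)]]
 show "a:?p | b:?p" unfolding ker using ab by blast
 qed
 have "?p:f ` U" unfolding fU mem_Collect_eq by (rule p)
 then obtain et where et: "et:U" "f et = ?p" by (rule imageE) (rule that, assumption, rule HOL.sym)
 show thesis
 proof (rule that[OF et(1)])
 fix W assume W: "opn W" "W <= U" "W ~= {}"
 obtain E where E: "E <= cr R" "f ` W = {p. primeideal p R & ~ E <= p}"
 using image_open(1)[OF W(1,2)] unfolding openin_Spec by blast
 obtain x where x: "x:W" using W(3) by blast
 hence "f x:{p. primeideal p R & ~ E <= p}" using E(2) by blast
 then obtain e where e: "primeideal (f x) R" "e:E" "e ~: f x" by blast
 interpret q: primeideal "f x" R by (rule e(1))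
 have eR: "e:cr R" using e(2) E(1) by blast
 have "e ~: ?p"
 proof
 \<comment> \<open>The chart is injective on sections, so \<open>e\<close> vanishes as a section and
   is killed by some \<open>u\<close> outside the prime \<open>f x\<close>; this forces
   \<open>e\<close> into \<open>f x\<close>.\<close>
 assume "e:?p"
 hence "ph ?T (Sfr ?T e \<one>) = ph ?T (Sfr ?T \<zero> \<one>)"
 using ps_zero unfolding ker ps_def by simp
 hence "Sfr ?T e \<one> = Sfr ?T \<zero> \<one>"
 using bij_betw_imp_inj_on[OF bij[OF TO]] sc[OF eR] sc[OF zero_closed] by (simp add: inj_on_eq_iff)
 hence eq: "fraction R (cr R - f x) e \<one> = fraction R (cr R - f x) \<zero> \<one>"
 using e(1) by (simp add: Sfr_def fun_eq_iff restrict_def) (metis e(1))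
 interpret fr: fractions R "cr R - f x" by (rule q.complement_fractions)
 obtain u where "u:cr R - f x" "u \<otimes> (e \<otimes> \<one>) = u \<otimes> (\<zero> \<otimes> \<one>)"
 using eq fr.frac_eq_iff[OF eR fr.S_one zero_closed fr.S_one] by blast
 hence "u \<otimes> e:f x" "u:cr R" "u ~: f x" using eR q.zero_closed by simp_all
 thus False using q.I_prime[of u e] eR e(3) by blast
 qed
 hence "~ E <= ?p" using e(2) by blast
 hence "f et:f ` W" unfolding E(2) et(2) using p by blast
 thus "et:W" using image_open(2)[OF W(1,2)] et(1) by blast
 qed
qed

end

context rspace
begin

lemma affine_open_chart:
 assumes "affine_open X U"
 obtains R f ph where "affine_chart X R U f ph"
proof -
 obtain R :: "'a ring" where R: "opn U" "cring R" "isomorphic_spaces (open_subspace X U) (Spec R)"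
 using assms unfolding affine_open_def by blast
 obtain f ph where f: "morphism (open_subspace X U) (Spec R) f ph"
 "homeomorphic_map (Top (open_subspace X U)) (Top (Spec R)) f"
 "!V. openin (Top (Spec R)) V -->
 bij_betw (ph V) (cr (Osec (Spec R) V)) (cr (Osec (open_subspace X U) (f -` V Int points (open_subspace X U))))"
 using R(3) unfolding isomorphic_spaces_def by blast
 have P: "points (open_subspace X U) = U"
 using openin_points[OF R(1)] by (auto simp: open_subspace_def topspace_subtopology)
 have "affine_chart X R U f ph"
 proof (intro affine_chart.intro affine_chart_axioms.intro spectrum.intro)
 show "rspace X" by (rule rspace_axioms)
 show "homeomorphic_map (subtopology (Top X) U) (Spec_topology R) f"
 using f(2) by (simp add: open_subspace_def Spec_def function_space_def)
 show "bij_betw (ph V) (cr (Osec (Spec R) V)) (osec (f -` V Int U))"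
 if "openin (Spec_topology R) V" for V
 using f(3)[rule_format, of V] that unfolding P by (simp add: open_subspace_def Spec_def function_space_def)
 qed (rule R f)+
 thus thesis by (rule that)
qed

end

section \<open>Integral schemes: local stalks and the generic point\<close>

locale integral_space = rspace X for X :: "('p, 'a) ringed" +
 assumes integral: "integral_scheme X"
begin

lemma sct_domain: "opn U ==> U ~= {} ==> domain (OS U)"
 using integral unfolding integral_scheme_def by blast

lemma chart_at:
 assumes "x:pts"
 obtains U R f ph where "x:U" "affine_chart X R U f ph"
proof -
 obtain U where "x:U" "affine_open X U"
 using integral assms unfolding integral_scheme_def is_scheme_def by blast
 from this(2) obtain R f ph where "affine_chart X R U f ph" by (rule affine_open_chart)
 with \<open>x:U\<close> show thesis by (rule that)
qed

lemma stalk_local_ring: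
 assumes x: "x:pts"
 shows "local_ring (Ost x)"
 unfolding local_ring_def
proof (intro conjI ballI)
 show "cring (Ost x)" by (rule Ost_cring[OF x])
 show "\<one>\<^sub>(Ost x) ~= \<zero>\<^sub>(Ost x)"
 proof
 interpret D: domain "OS pts" by (rule sct_domain[OF openin_topspace]) (use x in blast)
 assume "\<one>\<^sub>(Ost x) = \<zero>\<^sub>(Ost x)"
 then obtain W where W: "opn W" "x:W" "W <= pts Int pts"
 "Ores X pts W \<one>\<^sub>(OS pts) = Ores X pts W \<zero>\<^sub>(OS pts)"
 unfolding Ost_one[OF openin_topspace x] Ost_zero[OF openin_topspace x]
 og_eq_iff[OF openin_topspace x D.one_closed openin_topspace x D.zero_closed] by blast
 interpret DW: domain "OS W" by (rule sct_domain[OF W(1)]) (use W(2) in blast)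
 show False
 using W Ores_one[OF openin_topspace W(1)] Ores_zero[OF openin_topspace W(1)] DW.one_not_zero by simp
 qed
 fix r assume r: "r:ostk x"
 obtain U R f ph where U: "x:U" "affine_chart X R U f ph" using x by (rule chart_at)
 show "r:Units (Ost x) | \<one>\<^sub>(Ost x) \<ominus>\<^sub>(Ost x) r:Units (Ost x)"
 by (rule affine_chart.stalk_local[OF U(2,1) r])
qed

text \<open>On two disjoint nonempty open sets the sections 1 and 0 glue, in either order, to
  nonzero sections with product zero over the union, whose ring is a domain.\<close>

lemma irreducible:
 assumes U: "opn U" "U ~= {}" and V: "opn V" "V ~= {}"
 shows "U Int V ~= {}"
proof
 assume disj: "U Int V = {}"
 note sheaf = conjunct2[OF conjunct2[OF conjunct2[OF Osheaf[unfolded sheaf_of_sets_def]]]]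
 have unique: "EX! t. t:osec (\<Union>\<U>) & (!W:\<U>. Ores X (\<Union>\<U>) W t = s W)"
 if "!W:\<U>. opn W & s W:osec W"
 "!W:\<U>. !W':\<U>. Ores X W (W Int W') (s W) = Ores X W' (W Int W') (s W')" for \<U> s
 by (rule mp[OF spec[OF spec[OF sheaf]] conjI[OF that]])
 \<comment> \<open>The empty cover of the empty set has a unique gluing, so all sections over it
   agree.\<close>
 have empty: "a = b" if "a:cr (OS {})" "b:cr (OS {})" for a b
 using unique[of "{}" undefined] that by auto
 let ?W = "U Un V"
 have W: "opn ?W" "?W ~= {}" using U V by auto
 interpret DU: domain "OS U" by (rule sct_domain[OF U])
 interpret DV: domain "OS V" by (rule sct_domain[OF V])
 interpret DW: domain "OS ?W" by (rule sct_domain[OF W])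
 have UV: "U ~= V" using disj U(2) by blast
 have un: "\<Union> {U, V} = ?W" by simp
 have res_in: "Ores X Y {} s:cr (OS {})" if "opn Y" "s:osec Y" for Y s
 by (rule O.res_c[OF that(1) openin_empty _ that(2)]) simp
 have ex: "EX t:osec ?W. Ores X ?W U t = a & Ores X ?W V t = b"
 if a: "a:osec U" and b: "b:osec V" for a b
 proof -
 let ?s = "%Y. if Y = U then a else b"
 have 1: "!Y:{U, V}. opn Y & ?s Y:osec Y" using U V a b UV by auto
 have 2: "!Y:{U, V}. !Y':{U, V}. Ores X Y (Y Int Y') (?s Y) = Ores X Y' (Y Int Y') (?s Y')"
 using disj UV empty[OF res_in[OF U(1) a] res_in[OF V(1) b]] by (auto simp: Int_commute)
 from ex1_implies_ex[OF unique[OF 1 2]] show ?thesis unfolding un using UV by auto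
 qed
 obtain s where s: "s:osec ?W" "Ores X ?W U s = \<one>\<^sub>(OS U)" "Ores X ?W V s = \<zero>\<^sub>(OS V)"
 using ex[OF DU.one_closed DV.zero_closed] by blast
 obtain t where t: "t:osec ?W" "Ores X ?W U t = \<zero>\<^sub>(OS U)" "Ores X ?W V t = \<one>\<^sub>(OS V)"
 using ex[OF DU.zero_closed DV.one_closed] by blast
 have hU: "Ores X ?W U:ring_hom (OS ?W) (OS U)" and hV: "Ores X ?W V:ring_hom (OS ?W) (OS V)"
 using Ores_hom[OF W(1) U(1)] Ores_hom[OF W(1) V(1)] by auto
 let ?z = "%Y. if Y = U then \<zero>\<^sub>(OS U) else \<zero>\<^sub>(OS V)"
 have "EX! t. t:osec ?W & (!Y:{U, V}. Ores X ?W Y t = ?z Y)"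
 proof (rule unique[of "{U, V}" ?z, unfolded un])
 show "!Y:{U, V}. opn Y & ?z Y:osec Y" using U V UV by auto
 show "!Y:{U, V}. !Y':{U, V}. Ores X Y (Y Int Y') (?z Y) = Ores X Y' (Y Int Y') (?z Y')"
 using disj UV empty[OF res_in[OF U(1) DU.zero_closed] res_in[OF V(1) DV.zero_closed]] by (auto simp: Int_commute)
 qed
 moreover have "Ores X ?W U (s \<otimes>\<^sub>(OS ?W) t) = \<zero>\<^sub>(OS U)" "Ores X ?W V (s \<otimes>\<^sub>(OS ?W) t) = \<zero>\<^sub>(OS V)"
 using ring_hom_mult[OF hU s(1) t(1)] ring_hom_mult[OF hV s(1) t(1)] s t by simp_all
 moreover have "Ores X ?W U \<zero>\<^sub>(OS ?W) = \<zero>\<^sub>(OS U)" "Ores X ?W V \<zero>\<^sub>(OS ?W) = \<zero>\<^sub>(OS V)"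
 using Ores_zero[OF W(1) U(1)] Ores_zero[OF W(1) V(1)] by auto
 moreover have "s \<otimes>\<^sub>(OS ?W) t:osec ?W" using s(1) t(1) by simp
 ultimately have "s \<otimes>\<^sub>(OS ?W) t = \<zero>\<^sub>(OS ?W)" using UV by (auto simp: Ex1_def)
 hence "s = \<zero>\<^sub>(OS ?W) | t = \<zero>\<^sub>(OS ?W)" using DW.integral s(1) t(1) by blast
 thus False
 using s(2) t(3) Ores_zero[OF W(1) U(1)] Ores_zero[OF W(1) V(1)] DU.one_not_zero DV.one_not_zero by auto
qed

text \<open>The generic point of one chart works globally, as every nonempty open set meets the
  chart.\<close>

lemma generic_point:
 obtains et where "et:pts" "!!W. opn W ==> W ~= {} ==> et:W"
proof -
 obtain x where x: "x:pts" using integral unfolding integral_scheme_def by blast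
 obtain U R f ph where U: "x:U" "affine_chart X R U f ph" using x by (rule chart_at)
 interpret affine_chart X R U f ph by (rule U(2))
 have ne: "U ~= {}" using U(1) by blast
 obtain et where et: "et:U" "!!W. opn W ==> W <= U ==> W ~= {} ==> et:W"
 using sct_domain[OF open_U ne] by (rule chart_generic) (rule that)
 show thesis
 proof (rule that)
 show "et:pts" using et(1) openin_points[OF open_U] by blast
 fix W assume W: "opn W" "W ~= {}"
 have "et:U Int W"
 by (rule et(2)[OF openin_Int[OF open_U W(1)] Int_lower1 irreducible[OF open_U ne W]])
 thus "et:W" by blast
 qed
qed

end

subsection \<open>Constants on projective space\<close>

locale graded = cring R for R :: "'r ring" (structure) +
 fixes G :: "nat => 'r set"
 assumes G_sub: "G d <= cr R" and G_one: "\<one>:G 0"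
 and G_mult: "a:G d ==> b:G e ==> a \<otimes> b:G (d + e)"
begin

abbreviation homog where "homog == (\<Union>d. G d)"

lemma Proj_point_fractions:
 assumes "p:Proj_points R G"
 shows "fractions R (homog - p)"
proof -
 interpret p: primeideal p R using assms by (simp add: Proj_points_def)
 show ?thesis
 proof
 show "homog - p <= cr R" using G_sub by blast
 show "\<one>:homog - p" using G_one p.one_imp_carrier p.I_notcarr by blast
 fix s t assume st: "s:homog - p" "t:homog - p"
 then obtain d e where "s:G d" "t:G e" by blast
 thus "s \<otimes> t:homog - p" using st G_mult p.I_prime[of s t] G_sub by blast
 qed
qed

lemma openin_Proj:
 "openin (Proj_topology R G) U \<longleftrightarrow> (EX E<=homog. U = {p:Proj_points R G. ~ E <= p})"
proof -
 have "a \<otimes> b:homog" if "a:homog" "b:homog" for a b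
 using that G_mult by blast
 moreover have "homog <= cr R" using G_sub by blast
 ultimately have "istopology (%U. EX E<=homog. U = {p:Proj_points R G. ~ E <= p})"
 by (intro istopology_primes) (simp_all add: Proj_points_def)
 from topology_inverse'[OF this] show ?thesis unfolding Proj_topology_def by simp
qed

definition const_sct where
 "const_sct V c = (\<lambda>p\<in>V. fraction R (homog - p) c \<one>)"

lemma const_sct_c:
 assumes V: "openin (Proj_topology R G) V" and c: "c:G 0"
 shows "const_sct V c:cr (Osec (Proj R G) V)"
proof -
 have pts: "p:Proj_points R G" if "p:V" for p using V that unfolding openin_Proj by blast
 have one: "\<one> ~: p" if "p:V" for p
 using pts[OF that] ideal.one_imp_carrier[OF primeideal.axioms(1)] primeideal.I_notcarr
 unfolding Proj_points_def by blast
 have 1: "const_sct V c:Pi\<^sub>E V (%p. cr (fraction_ring R (homog - p) (\<Union>d. G d \<times> (G d - p))))"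
 using c G_one one by (fastforce simp: const_sct_def fraction_ring_def)
 have 2: "locally_in (Proj_topology R G) (%V. {%p. fraction R (homog - p) a s | a s d.
 a:G d & s:G d & (!p:V. s ~: p)}) V (const_sct V c)"
 unfolding locally_in_def
 proof
 fix x assume x: "x:V"
 show "EX W. openin (Proj_topology R G) W & x:W & W <= V & (EX t:{%p. fraction R (homog - p) a s | a s d.
 a:G d & s:G d & (!p:W. s ~: p)}. !y:W. const_sct V c y = t y)"
 proof (intro exI[of _ V] conjI bexI[of _ "%p. fraction R (homog - p) c \<one>"])
 show "(%p. fraction R (homog - p) c \<one>):{%p. fraction R (homog - p) a s | a s d.
 a:G d & s:G d & (!p:V. s ~: p)}"
 using c G_one one by (intro CollectI exI[of _ c] exI[of _ \<one>] exI[of _ 0]) simp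
 qed (use V x in \<open>simp_all add: const_sct_def\<close>)
 qed
 show ?thesis using 1 2 by (simp add: Proj_def function_space_def)
qed

lemma const_sct_add:
 assumes V: "openin (Proj_topology R G) V" and c: "c:G 0" "d:G 0"
 shows "const_sct V c \<oplus>\<^sub>(Osec (Proj R G) V) const_sct V d = const_sct V (c \<oplus> d)"
proof -
 have "fraction R (homog - p) c \<one> \<oplus>\<^sub>(fraction_ring R (homog - p) D) fraction R (homog - p) d \<one> =
 fraction R (homog - p) (c \<oplus> d) \<one>" if p: "p:V" for p D
 proof -
 interpret fractions R "homog - p" by (rule Proj_point_fractions) (use V p in \<open>auto simp: openin_Proj\<close>)
 have "c:cr R" "d:cr R" using c G_sub by auto
 thus ?thesis using frac_add[OF _ S_one _ S_one, of c d D] by simp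
 qed
 thus ?thesis by (auto simp: Proj_def function_space_def const_sct_def fun_eq_iff restrict_def)
qed

lemma const_sct_mult:
 assumes V: "openin (Proj_topology R G) V" and c: "c:G 0" "d:G 0"
 shows "const_sct V c \<otimes>\<^sub>(Osec (Proj R G) V) const_sct V d = const_sct V (c \<otimes> d)"
proof -
 have "fraction R (homog - p) c \<one> \<otimes>\<^sub>(fraction_ring R (homog - p) D) fraction R (homog - p) d \<one> =
 fraction R (homog - p) (c \<otimes> d) \<one>" if p: "p:V" for p D
 proof -
 interpret fractions R "homog - p" by (rule Proj_point_fractions) (use V p in \<open>auto simp: openin_Proj\<close>)
 have "c:cr R" "d:cr R" using c G_sub by auto
 thus ?thesis using frac_mult[OF _ S_one _ S_one, of c d D] by simp
 qed
 thus ?thesis by (auto simp: Proj_def function_space_def const_sct_def fun_eq_iff restrict_def)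
qed

lemma const_sct_one: "\<one>\<^sub>(Osec (Proj R G) V) = const_sct V \<one>"
 by (simp add: Proj_def function_space_def const_sct_def fraction_ring_def)

end

text \<open>Exponent vectors have different supports; summing over a common finite set makes degrees
  additive.\<close>

lemma degree_sum:
 fixes e :: "nat \<Rightarrow>\<^sub>0 nat"
 assumes "finite A" "Poly_Mapping.keys e <= A"
 shows "(\<Sum>i\<in>Poly_Mapping.keys e. Poly_Mapping.lookup e i) = (\<Sum>i\<in>A. Poly_Mapping.lookup e i)"
 by (rule sum.mono_neutral_left[OF assms]) (simp add: in_keys_iff)

lemma polynomial_ring_graded:
 "graded (polynomial_ring n :: ((nat \<Rightarrow>\<^sub>0 nat) \<Rightarrow>\<^sub>0 'k :: field) ring) (homogeneous_part n)"
proof -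
 let ?R = "polynomial_ring n :: ((nat \<Rightarrow>\<^sub>0 nat) \<Rightarrow>\<^sub>0 'k) ring"
 have keys_prod: "EX a:Poly_Mapping.keys f. EX b:Poly_Mapping.keys g. e = a + b"
 if "e:Poly_Mapping.keys (f * g)" for e and f g :: "(nat \<Rightarrow>\<^sub>0 nat) \<Rightarrow>\<^sub>0 'k"
 using that keys_mult[of f g] by blast
 have keys_sum: "Poly_Mapping.keys (a + b) <= {..n}"
 if "Poly_Mapping.keys a <= {..n}" "Poly_Mapping.keys b <= {..n}" for a b :: "nat \<Rightarrow>\<^sub>0 nat"
 using that keys_add[of a b] by blast
 have cr: "f:cr ?R \<longleftrightarrow> (!e:Poly_Mapping.keys f. Poly_Mapping.keys e <= {..n})" for f
 by (simp add: polynomial_ring_def)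
 have mult: "f * g:cr ?R" if f: "f:cr ?R" and g: "g:cr ?R" for f g
 unfolding cr
 proof
 fix e assume "e:Poly_Mapping.keys (f * g)"
 then obtain a b where ab: "a:Poly_Mapping.keys f" "b:Poly_Mapping.keys g" "e = a + b"
 using keys_prod by blast
 show "Poly_Mapping.keys e <= {..n}"
 unfolding ab(3) by (rule keys_sum[OF bspec[OF f[unfolded cr] ab(1)] bspec[OF g[unfolded cr] ab(2)]])
 qed
 have add: "f + g:cr ?R" if "f:cr ?R" "g:cr ?R" for f g
 using that subsetD[OF Poly_Mapping.keys_add[of f g]] unfolding cr by blast
 have ops: "f \<oplus>\<^sub>?R g = f + g" "f \<otimes>\<^sub>?R g = f * g" "\<zero>\<^sub>?R = 0" "\<one>\<^sub>?R = 1" for f g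
 by (simp_all add: polynomial_ring_def)
 have zero: "0:cr ?R" and one: "1:cr ?R" by (simp_all add: cr)
 have cring: "cring ?R"
 proof (rule cringI)
 show "abelian_group ?R"
 proof (rule abelian_groupI)
 fix f assume "f:cr ?R"
 thus "EX y:cr ?R. y \<oplus>\<^sub>?R f = \<zero>\<^sub>?R"
 by (intro bexI[of _ "- f"]) (simp_all add: ops cr)
 qed (simp_all add: ops add zero add.assoc add.commute)
 show "comm_monoid ?R"
 by (rule comm_monoidI) (simp_all add: ops mult one mult.assoc mult.commute)
 qed (simp add: ops distrib_right)
 have mult_deg: "f * g:homogeneous_part n (d + e)"
 if f: "f:homogeneous_part n d" and g: "g:homogeneous_part n e" for d e and f g :: "(nat \<Rightarrow>\<^sub>0 nat) \<Rightarrow>\<^sub>0 'k"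
 unfolding homogeneous_part_def
 proof (intro CollectI conjI ballI)
 show "f * g:cr ?R" using f g by (intro mult) (simp_all add: homogeneous_part_def)
 fix k assume "k:Poly_Mapping.keys (f * g)"
 then obtain a b where ab: "a:Poly_Mapping.keys f" "b:Poly_Mapping.keys g" "k = a + b"
 using keys_prod by blast
 have fg: "f:cr ?R" "g:cr ?R" using f g by (simp_all add: homogeneous_part_def)
 have s: "Poly_Mapping.keys a <= {..n}" "Poly_Mapping.keys b <= {..n}"
 using fg ab(1,2) by (auto simp: polynomial_ring_def)
 have d: "(\<Sum>i\<in>Poly_Mapping.keys a. Poly_Mapping.lookup a i) = d"
 "(\<Sum>i\<in>Poly_Mapping.keys b. Poly_Mapping.lookup b i) = e"
 using f g ab(1,2) by (auto simp: homogeneous_part_def)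
 show "(\<Sum>i\<in>Poly_Mapping.keys k. Poly_Mapping.lookup k i) = d + e"
 unfolding ab(3) degree_sum[OF finite_atMost keys_sum[OF s]]
 using d unfolding degree_sum[OF finite_atMost s(1)] degree_sum[OF finite_atMost s(2)]
 by (simp add: lookup_add sum.distrib)
 qed
 show ?thesis
 proof (intro graded.intro graded_axioms.intro)
 show "homogeneous_part n d <= cr ?R" for d by (auto simp: homogeneous_part_def)
 show "\<one>\<^sub>?R:homogeneous_part n 0"
 by (simp add: homogeneous_part_def polynomial_ring_def)
 show "f \<otimes>\<^sub>?R g:homogeneous_part n (d + e)"
 if "f:homogeneous_part n d" "g:homogeneous_part n e" for f g d e
 using mult_deg[OF that] by (simp add: polynomial_ring_def)
 qed (rule cring)
qed

text \<open>In characteristic zero the scalar \<open>m + 1\<close> has an inverse, so it gives an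
  invertible constant section of projective space. Pulled back along the morphism and passed to the
  germ at \<open>x\<close>, it becomes the \<open>m + 1\<close>-fold multiple of one.\<close>

lemma (in rspace) naturals_invertible:
 fixes K :: "'k :: {field, field_char_0} itself"
 assumes mor: "morphism X (projective_space K n) f ph" and x: "x:pts"
 shows "[Suc m] \<cdot>\<^sub>(Ost x) \<one>\<^sub>(Ost x):Units (Ost x)"
proof -
 let ?R = "polynomial_ring n :: ((nat \<Rightarrow>\<^sub>0 nat) \<Rightarrow>\<^sub>0 'k) ring"
 interpret graded ?R "homogeneous_part n" by (rule polynomial_ring_graded)
 interpret OX: cring "OS pts" by (rule OS_cring[OF openin_topspace])
 interpret Ox: cring "Ost x" by (rule Ost_cring[OF x])
 let ?V = "topspace (Proj_topology ?R (homogeneous_part n))"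
 have Y: "projective_space K n = Proj ?R (homogeneous_part n)" by (simp add: projective_space_def)
 have V: "openin (Proj_topology ?R (homogeneous_part n)) ?V" by (rule openin_topspace)
 have top: "Top (Proj ?R (homogeneous_part n)) = Proj_topology ?R (homogeneous_part n)"
 by (simp add: Proj_def function_space_def)
 note m = mor[unfolded Y morphism_def top]
 have "f ` pts <= ?V" by (rule continuous_map_image_subset_topspace[OF conjunct1[OF m]])
 hence pre: "f -` ?V Int pts = pts" by blast
 have h: "ph ?V:ring_hom (Osec (Proj ?R (homogeneous_part n)) ?V) (OS pts)"
 by (rule mp[OF spec[OF conjunct1[OF conjunct2[OF m]], of ?V] V, unfolded pre])
 define c where "c a = Poly_Mapping.single (0 :: nat \<Rightarrow>\<^sub>0 nat) a" for a :: 'k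
 have c0: "c a:homogeneous_part n 0" for a
 by (auto simp: c_def homogeneous_part_def polynomial_ring_def split: if_splits)
 have c_one: "c 1 = \<one>\<^sub>?R" by (simp add: c_def polynomial_ring_def)
 have c_add: "c (a + b) = c a \<oplus>\<^sub>?R c b" for a b by (simp add: c_def polynomial_ring_def single_add)
 have c_mult: "c (a * b) = c a \<otimes>\<^sub>?R c b" for a b by (simp add: c_def polynomial_ring_def mult_single)
 let ?c = "%a. ph ?V (const_sct ?V (c a))"
 note closed = const_sct_c[OF V c0]
 have one: "?c 1 = \<one>\<^sub>(OS pts)"
 unfolding c_one const_sct_one[symmetric] by (rule ring_hom_one[OF h])
 have suc: "?c (of_nat (Suc k)) = [Suc k] \<cdot>\<^sub>(OS pts) \<one>\<^sub>(OS pts)" for k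
 proof (induction k)
 case 0
 thus ?case using one by (simp add: OX.add_pow_nat)
 next
 case (Suc k)
 have "?c (of_nat (Suc (Suc k))) = ?c (of_nat (Suc k) + 1)" by (simp add: add.commute)
 also have "\<dots> = ?c (of_nat (Suc k)) \<oplus>\<^sub>(OS pts) ?c 1"
 unfolding c_add const_sct_add[OF V c0 c0, symmetric] by (rule ring_hom_add[OF h closed closed])
 finally show ?case unfolding Suc one OX.add_pow_nat(2)[of "Suc k"] .
 qed
 let ?a = "of_nat (Suc m) :: 'k"
 have "?c ?a \<otimes>\<^sub>(OS pts) ?c (inverse ?a) = ?c (?a * inverse ?a)"
 unfolding c_mult const_sct_mult[OF V c0 c0, symmetric] by (rule ring_hom_mult[OF h closed closed, symmetric])
 also have "?a * inverse ?a = 1" by (rule right_inverse) (rule of_nat_neq_0)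
 finally have prod: "?c ?a \<otimes>\<^sub>(OS pts) ?c (inverse ?a) = \<one>\<^sub>(OS pts)" unfolding one .
 note gh = og_ring_hom[OF openin_topspace x] and cc = ring_hom_closed[OF h closed]
 have germ: "og x pts ([k] \<cdot>\<^sub>(OS pts) \<one>\<^sub>(OS pts)) = [k] \<cdot>\<^sub>(Ost x) \<one>\<^sub>(Ost x)"
 for k :: nat
 proof (induction k)
 case 0
 thus ?case using Ost_zero[OF openin_topspace x] by (simp add: OX.add_pow_nat Ox.add_pow_nat)
 next
 case (Suc k)
 thus ?case
 using ring_hom_add[OF gh OX.add_pow_nat_c[OF OX.one_closed] OX.one_closed] ring_hom_one[OF gh]
 by (simp add: OX.add_pow_nat(2) Ox.add_pow_nat(2))
 qed
 have "og x pts (?c ?a) \<otimes>\<^sub>(Ost x) og x pts (?c (inverse ?a)):Units (Ost x)"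
 unfolding ring_hom_mult[OF gh cc cc, symmetric] prod ring_hom_one[OF gh] by simp
 hence "og x pts (?c ?a):Units (Ost x)"
 by (rule Ox.Units_factor[OF ring_hom_closed[OF gh cc] ring_hom_closed[OF gh cc]])
 thus ?thesis unfolding suc germ .
qed

section \<open>Base loci of tensor products\<close>

text \<open>\<open>naturals\<close> is what the later arguments retain of characteristic zero:
  positive integers are invertible in the stalks.\<close>

locale polarised = integral_space X + A: mpsh X A
 for X :: "('p, 'a) ringed" and A :: "('p, 'a, 'l) presheaf" +
 assumes ample: "ample_line_bundle X A"
 and naturals: "x:points X ==> [Suc n] \<cdot>\<^sub>(Ostalk X x) \<one>\<^sub>(Ostalk X x):Units (Ostalk X x)"
begin

abbreviation "ptwist q m V ==
 tns (spw m (spw q V)) (tpw m A)"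

abbreviation "ntwist q m V ==
 tns (spw m (spw q V)) (tpw m A.dual)"

lemma line: "line_bundle X A"
 using ample by (simp add: ample_line_bundle_def)

lemma twist_psh:
 assumes "psh V"
 shows "psh (ptwist q m V)" "psh (ntwist q m V)"
 by (rule tns_psh[OF nst_psh[OF assms] wpow_psh[OF A.psheaf]]
 tns_psh[OF nst_psh[OF assms] wpow_psh[OF A.dual_psh]])+

lemma twist_loc_fg:
 assumes V: "psh V" "lfg X V"
 shows "lfg X (ptwist q m V)" "lfg X (ntwist q m V)"
 by (rule tns_loc_fg[OF nst_psh[OF V(1)] wpow_psh[OF A.psheaf]
 wpow_loc_fg[OF wpow_psh[OF V(1)] wpow_loc_fg[OF V]]
 wpow_loc_fg[OF A.psheaf A.lb_loc_fg(1)[OF line]]]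
 tns_loc_fg[OF nst_psh[OF V(1)] wpow_psh[OF A.dual_psh]
 wpow_loc_fg[OF wpow_psh[OF V(1)] wpow_loc_fg[OF V]]
 wpow_loc_fg[OF A.dual_psh A.lb_loc_fg(2)[OF line]]])+

section \<open>Base loci as failure of generation of stalks\<close>

lemma base_locus_gen:
 assumes M: "psh M" "lfg X M" and x: "x:pts"
 shows "x:base_locus X M \<longleftrightarrow> ~ ggen M x"
proof -
 interpret M: mpsh X M by unfold_locales (rule M(1))
 obtain S where "finite S" "S <= stk M x"
 "stk M x = spn M x S"
 using M(2) x by (rule M.loc_fg_stalk)
 thus ?thesis by (rule M.base_locus_iff[OF x stalk_local_ring[OF x]])
qed

lemma abl_iff:
 assumes V: "psh V" "lfg X V" and x: "x:pts"
 shows "x:augmented_base_locus X A V \<longleftrightarrow> (ALL q>=1. ALL m>=1. ~ ggen (ntwist q m V) x)"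
 unfolding augmented_base_locus_def sym_power_eq tns_power_eq
 using base_locus_gen[OF twist_psh(2)[OF V(1)] twist_loc_fg(2)[OF V] x] by auto

lemma dbl_iff:
 assumes V: "psh V" "lfg X V" and x: "x:pts"
 shows "x:diminished_base_locus X A V \<longleftrightarrow> (EX q>=1. ALL m>=1. ~ ggen (ptwist q m V) x)"
 unfolding diminished_base_locus_def sym_power_eq tns_power_eq
 using base_locus_gen[OF twist_psh(1)[OF V(1)] twist_loc_fg(1)[OF V] x] by auto

lemma base_loci_points: "augmented_base_locus X A V <= pts" "diminished_base_locus X A V <= pts"
 by (force simp: augmented_base_locus_def diminished_base_locus_def base_locus_def)+

text \<open>The lengths \<open>N\<close> and \<open>n\<close> are variables tied by equations, so
  that the same number may be presented in another arithmetical form when the factors are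
  combined.\<close>

lemma pure_tensors_eventually:
 assumes V: "psh V" "lfg X V" and C: "psh C" and x: "x:pts"
 and gen: "ggen (tns (spw m (spw q V)) (tpw m C)) x"
 and pos: "1 <= m" "1 <= q"
 shows "EX a0. ALL a>a0. !N n es cs. N = a * (m * q) --> n = a * m --> es:wstk N V x -->
 cs:wstk n C x --> ptn N V n C x es cs:gsp (twd N V n C) x"
proof -
 interpret V: mpsh X V by unfold_locales (rule V(1))
 obtain S where S: "finite S" "S <= stk V x"
 "stk V x = spn V x S"
 using V(2) x by (rule V.loc_fg_stalk)
 have m: "0 < m" "0 < q" using pos by simp_all
 show ?thesis
 by (intro exI[of _ "card S * (card S * (m * q))"] allI impI, hypsubst,
 rule pure_tensors_glob[OF V(1) C x naturals[OF x] gen m S])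
qed

lemma line_stalk:
 assumes "x:pts"
 obtains al be where "al:stk A.dual x" "be:stk A x"
 "A.spair x al be = \<one>\<^sub>(Ost x)"
 using line assms by (rule A.lb_stalk)

text \<open>By ampleness some power of \<open>A\<close> has a section that does not vanish at
  \<open>x\<close>, and in rank one such a section generates the stalk.\<close>

lemma ample_power_gen:
 assumes x: "x:pts"
 obtains k where "1 <= k" "ggen (tpw k A) x"
proof -
 obtain k s where k: "1 <= k" "s:sec (tpw k A) pts"
 "x:nonvanishing_locus X (tpw k A) s"
 using ample x unfolding ample_line_bundle_def tns_power_eq by blast
 interpret W: mpsh X "tpw k A" by unfold_locales (rule wpow_psh[OF A.psheaf])
 obtain al be where be: "be:stk A x" "stk A x = spn A x {be}"
 using line x by (rule A.lb_stalk)
 have "tw k A x (replicate k be):stk (tpw k A) x"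
 by (rule mltD(1)[OF stw_mlt[OF A.psheaf x] w_rep[OF be(1)]])
 from W.nonvanishing_gen[OF x stalk_local_ring[OF x] this A.cyclic_wpow[OF x be] k(2,3)]
 show thesis by (rule that[OF k(1)])
qed

text \<open>The factor 2 creates the margin: in tensor degree \<open>2 q M\<close> the bundle
  \<open>E\<close>, whose ratio is fixed by \<open>q\<close>, carries the twist \<open>-2 M\<close>,
  while \<open>F\<close>, taken with \<open>2 q\<close>, carries \<open>+M\<close>. The sum
  \<open>-M\<close> is what \<open>S^M S^(2q)\<close> requires.\<close>

lemma tns_negative_gen:
 assumes E: "psh E" "lfg X E" and F: "psh F" "lfg X F"
 and x: "x:pts"
 and gE: "EX q>=1. EX m>=1. ggen (ntwist q m E) x"
 and gF: "ALL q>=1. EX m>=1. ggen (ptwist q m F) x"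
 shows "EX q>=1. EX m>=1. ggen (ntwist q m (tns E F)) x"
proof -
 obtain q m where q: "1 <= q" "1 <= m" "ggen (ntwist q m E) x" using gE by blast
 have "1 <= 2 * q" using q(1) by simp
 then obtain m' where m': "1 <= m'" "ggen (ptwist (2 * q) m' F) x" using gF by blast
 obtain a1 where a1: "!!a N n es cs. a > a1 ==> N = a * (m * q) ==> n = a * m ==> es:wstk N E x ==>
 cs:wstk n A.dual x ==> ptn N E n A.dual x es cs:gsp (twd N E n A.dual) x"
 using pure_tensors_eventually[OF E A.dual_psh x q(3,2,1)] by metis
 obtain a2 where a2: "!!a N n es cs. a > a2 ==> N = a * (m' * (2 * q)) ==> n = a * m' ==> es:wstk N F x ==>
 cs:wstk n A x ==> ptn N F n A x es cs:gsp (twd N F n A) x"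
 using pure_tensors_eventually[OF F A.psheaf x m'(2,1) \<open>1 <= 2 * q\<close>] by metis
 \<comment> \<open>\<open>M = m m' b\<close> is reached from \<open>E\<close> with
   \<open>a = 2 m' b\<close> and from \<open>F\<close> with \<open>a = m b\<close>; \<open>b\<close>
   exceeds both thresholds.\<close>
 define b where "b = Suc (a1 + a2)"
 have b: "a1 < 2 * m' * b" "a2 < m * b"
 proof -
 have "b <= m' * b" "b <= m * b" using m'(1) q(2) by simp_all
 thus "a1 < 2 * m' * b" "a2 < m * b" unfolding b_def by linarith+
 qed
 obtain al be where albe: "al:stk A.dual x" "be:stk A x"
 "A.spair x al be = \<one>\<^sub>(Ost x)" using x by (rule line_stalk)
 let ?M = "m * m' * b"
 have "ggen (ntwist (2 * q) ?M (tns E F)) x"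
 proof (rule A.tns_gen_negative[OF E(1) F(1) x albe, where n = ?M])
 show "ptn (?M * (2 * q)) E (?M + ?M) A.dual x es cs :
 gsp (twd (?M * (2 * q)) E (?M + ?M) A.dual) x"
 if "es:wstk (?M * (2 * q)) E x" "cs:wstk (?M + ?M) A.dual x" for es cs
 using b(1) _ _ that by (rule a1) (simp_all add: algebra_simps)
 show "ptn (?M * (2 * q)) F ?M A x fs ds:gsp (twd (?M * (2 * q)) F ?M A) x"
 if "fs:wstk (?M * (2 * q)) F x" "ds:wstk ?M A x" for fs ds
 using b(2) _ _ that by (rule a2) (simp_all add: algebra_simps)
 qed
 moreover have "0 < b" by (simp add: b_def)
 hence "1 <= ?M" using q(2) m'(1) by (simp add: Suc_le_eq)
 ultimately show ?thesis using \<open>1 <= 2 * q\<close> by blast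
qed

text \<open>Both factors are taken with \<open>2 q\<close>, so that in tensor degree
  \<open>2 n q\<close> each carries the twist \<open>n\<close>; together they give
  \<open>2 n\<close>, which is what \<open>S^(2n) S^q\<close> requires.\<close>

lemma tns_positive_gen:
 assumes E: "psh E" "lfg X E" and F: "psh F" "lfg X F"
 and x: "x:pts"
 and gE: "ALL q>=1. EX m>=1. ggen (ptwist q m E) x"
 and gF: "ALL q>=1. EX m>=1. ggen (ptwist q m F) x"
 shows "ALL q>=1. EX m>=1. ggen (ptwist q m (tns E F)) x"
proof (intro allI impI)
 fix q :: nat assume q: "1 <= q"
 hence q2: "1 <= 2 * q" by simp
 obtain m where m: "1 <= m" "ggen (ptwist (2 * q) m E) x" using gE q2 by blast
 obtain m' where m': "1 <= m'" "ggen (ptwist (2 * q) m' F) x" using gF q2 by blast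
 obtain a1 where a1: "!!a N n es cs. a > a1 ==> N = a * (m * (2 * q)) ==> n = a * m ==> es:wstk N E x ==>
 cs:wstk n A x ==> ptn N E n A x es cs:gsp (twd N E n A) x"
 using pure_tensors_eventually[OF E A.psheaf x m(2,1) q2] by metis
 obtain a2 where a2: "!!a N n es cs. a > a2 ==> N = a * (m' * (2 * q)) ==> n = a * m' ==> es:wstk N F x ==>
 cs:wstk n A x ==> ptn N F n A x es cs:gsp (twd N F n A) x"
 using pure_tensors_eventually[OF F A.psheaf x m'(2,1) q2] by metis
 define b where "b = Suc (a1 + a2)"
 have b: "a1 < m' * b" "a2 < m * b"
 proof -
 have "b <= m' * b" "b <= m * b" using m'(1) m(1) by simp_all
 thus "a1 < m' * b" "a2 < m * b" unfolding b_def by linarith+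
 qed
 let ?n = "m * m' * b"
 have "ggen (ptwist q (?n + ?n) (tns E F)) x"
 proof (rule A.tns_gen_positive[OF E(1) F(1) x])
 show "ptn ((?n + ?n) * q) E ?n A x es cs:gsp (twd ((?n + ?n) * q) E ?n A) x"
 if "es:wstk ((?n + ?n) * q) E x" "cs:wstk ?n A x" for es cs
 using b(1) _ _ that by (rule a1) (simp_all add: algebra_simps)
 show "ptn ((?n + ?n) * q) F ?n A x fs ds:gsp (twd ((?n + ?n) * q) F ?n A) x"
 if "fs:wstk ((?n + ?n) * q) F x" "ds:wstk ?n A x" for fs ds
 using b(2) _ _ that by (rule a2) (simp_all add: algebra_simps)
 qed
 moreover have "0 < b" by (simp add: b_def)
 hence "1 <= ?n + ?n" using m(1) m'(1) by (simp add: Suc_le_eq)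
 ultimately show "EX m>=1. ggen (ptwist q m (tns E F)) x" by blast
qed

text \<open>The twist of \<open>E\<close> is already the one required, so the twist of
  \<open>F\<close> has to disappear: it is contracted against a power of \<open>A\<close> that is
  generated at \<open>x\<close>.\<close>

lemma tns_big_gen:
 assumes E: "psh E" "lfg X E" and F: "psh F" "lfg X F"
 and x: "x:pts"
 and gE: "EX q>=1. EX m>=1. ggen (ntwist q m E) x"
 and gF: "EX q>=1. EX m>=1. ggen (ntwist q m F) x"
 shows "EX q>=1. EX m>=1. ggen (ntwist q m (tns E F)) x"
proof -
 obtain q m where q: "1 <= q" "1 <= m" "ggen (ntwist q m E) x" using gE by blast
 obtain q' m' where q': "1 <= q'" "1 <= m'" "ggen (ntwist q' m' F) x" using gF by blast
 obtain k where k: "1 <= k" "ggen (tpw k A) x" using x by (rule ample_power_gen)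
 obtain a1 where a1: "!!a N n es cs. a > a1 ==> N = a * (m * q) ==> n = a * m ==> es:wstk N E x ==>
 cs:wstk n A.dual x ==> ptn N E n A.dual x es cs:gsp (twd N E n A.dual) x"
 using pure_tensors_eventually[OF E A.dual_psh x q(3,2,1)] by metis
 obtain a2 where a2: "!!a N n es cs. a > a2 ==> N = a * (m' * q') ==> n = a * m' ==> es:wstk N F x ==>
 cs:wstk n A.dual x ==> ptn N F n A.dual x es cs:gsp (twd N F n A.dual) x"
 using pure_tensors_eventually[OF F A.dual_psh x q'(3,2,1)] by metis
 define b where "b = Suc (a1 + a2)"
 have b: "a1 < q' * m' * k * b" "a2 < q * m * k * b"
 proof -
 have "b <= q' * m' * k * b" "b <= q * m * k * b" using q q' k(1) by simp_all
 thus "a1 < q' * m' * k * b" "a2 < q * m * k * b" unfolding b_def by linarith+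
 qed
 obtain al be where albe: "al:stk A.dual x" "be:stk A x"
 "A.spair x al be = \<one>\<^sub>(Ost x)" using x by (rule line_stalk)
 \<comment> \<open>\<open>E\<close> is used with \<open>a = q' m' k b\<close> and \<open>F\<close>
   with \<open>a = q m k b\<close>. Both give tensor degree \<open>?M q\<close>; the twist of
   \<open>F\<close> is \<open>-?n\<close>, and \<open>?n\<close> is a multiple of \<open>k\<close>,
   so powers of the \<open>k\<close>-th power of \<open>A\<close> cancel it.\<close>
 let ?M = "q' * m' * k * b * m" and ?n = "q * m * b * m' * k"
 have "ggen (ntwist q ?M (tns E F)) x"
 proof (rule A.tns_gen_negative[OF E(1) F(1) x albe, where n = 0])
 show "ptn (?M * q) E (?M + 0) A.dual x es cs:gsp (twd (?M * q) E (?M + 0) A.dual) x"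
 if "es:wstk (?M * q) E x" "cs:wstk (?M + 0) A.dual x" for es cs
 using b(1) _ _ that by (rule a1) (simp_all add: algebra_simps)
 show "ptn (?M * q) F 0 A x fs ds:gsp (twd (?M * q) F 0 A) x"
 if fs: "fs:wstk (?M * q) F x" and ds: "ds:wstk 0 A x" for fs ds
 proof -
 have "ptn (?M * q) F 0 A x fs []:gsp (twd (?M * q) F 0 A) x"
 proof (rule A.untwist_glob[OF F(1) x albe fs])
 show "ptn (?M * q) F ?n A.dual x fs cs:gsp (twd (?M * q) F ?n A.dual) x"
 if "cs:wstk ?n A.dual x" for cs
 using b(2) _ _ fs that by (rule a2) (simp_all add: algebra_simps)
 show "ptn 0 F ?n A x [] ds:gsp (twd 0 F ?n A) x"
 if "ds:wstk ?n A x" for ds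
 by (rule A.powers_glob[OF F(1) x k(2) that])
 qed
 thus ?thesis using ds by simp
 qed
 qed
 moreover have "0 < b" by (simp add: b_def)
 hence "1 <= ?M" using q(1,2) q'(1,2) k(1) by (simp add: Suc_le_eq)
 ultimately show ?thesis using q(1) by blast
qed

section \<open>V-big and V-psef bundles at the generic point\<close>

context
 fixes et assumes et: "et:pts" "!W. opn W & W ~= {} --> et:W"
begin

text \<open>The point outside the locus may depend on the bundle. Generation there passes to the
  generic point, which gives one point for \<open>E\<close> and \<open>F\<close> at once.\<close>

lemma V_big_iff:
 assumes V: "psh V" "lfg X V"
 shows "V_big X A V \<longleftrightarrow> (EX q>=1. EX m>=1. ggen (ntwist q m V) et)"
proof
 assume "V_big X A V"
 then obtain x where x: "x:pts" "x ~: augmented_base_locus X A V"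
 using base_loci_points(1)[of V] unfolding V_big_def by blast
 then obtain q m where q: "1 <= q" "1 <= m" "ggen (ntwist q m V) x"
 using abl_iff[OF V x(1)] by blast
 have "ggen (ntwist q m V) et"
 by (rule mpsh.gen_at_generization[OF mpsh.intro[OF rspace_axioms mpsh_axioms.intro[OF twist_psh(2)[OF V(1)]]] et(2) twist_loc_fg(2)[OF V] x(1) q(3)])
 thus "EX q>=1. EX m>=1. ggen (ntwist q m V) et" using q(1,2) by blast
next
 assume "EX q>=1. EX m>=1. ggen (ntwist q m V) et"
 hence "et ~: augmented_base_locus X A V" using abl_iff[OF V et(1)] by blast
 thus "V_big X A V" using et(1) unfolding V_big_def by blast
qed

lemma V_psef_iff:
 assumes V: "psh V" "lfg X V"
 shows "V_psef X A V \<longleftrightarrow> (ALL q>=1. EX m>=1. ggen (ptwist q m V) et)"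
proof
 assume "V_psef X A V"
 then obtain x where x: "x:pts" "x ~: diminished_base_locus X A V"
 using base_loci_points(2)[of V] unfolding V_psef_def by blast
 show "ALL q>=1. EX m>=1. ggen (ptwist q m V) et"
 proof (intro allI impI)
 fix q :: nat assume "1 <= q"
 then obtain m where m: "1 <= m" "ggen (ptwist q m V) x"
 using x(2) dbl_iff[OF V x(1)] by blast
 have "ggen (ptwist q m V) et"
 by (rule mpsh.gen_at_generization[OF mpsh.intro[OF rspace_axioms mpsh_axioms.intro[OF twist_psh(1)[OF V(1)]]] et(2) twist_loc_fg(1)[OF V] x(1) m(2)])
 thus "EX m>=1. ggen (ptwist q m V) et" using m(1) by blast
 qed
next
 assume "ALL q>=1. EX m>=1. ggen (ptwist q m V) et"
 hence "et ~: diminished_base_locus X A V" using dbl_iff[OF V et(1)] by blast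
 thus "V_psef X A V" using et(1) unfolding V_psef_def by blast
qed

end

theorem base_loci_tns:
 assumes E: "psh E" "lfg X E" and F: "psh F" "lfg X F"
 shows "augmented_base_locus X A (tns E F) <= augmented_base_locus X A E Un diminished_base_locus X A F"
 and "diminished_base_locus X A (tns E F) <= diminished_base_locus X A E Un diminished_base_locus X A F"
 and "V_big X A E ==> V_big X A F ==> V_big X A (tns E F)"
 and "V_psef X A E ==> V_psef X A F ==> V_psef X A (tns E F)"
 and "V_big X A E ==> V_psef X A F ==> V_big X A (tns E F)"
proof -
 note T = tns_psh[OF E(1) F(1)] tns_loc_fg[OF E(1) F(1) E(2) F(2)]
 show "augmented_base_locus X A (tns E F) <= augmented_base_locus X A E Un diminished_base_locus X A F"
 proof
 fix x assume x: "x:augmented_base_locus X A (tns E F)"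
 hence p: "x:pts" using base_loci_points(1) by blast
 have "~ (EX q>=1. EX m>=1. ggen (ntwist q m (tns E F)) x)"
 using x abl_iff[OF T p] by blast
 thus "x:augmented_base_locus X A E Un diminished_base_locus X A F"
 using tns_negative_gen[OF E F p] abl_iff[OF E p] dbl_iff[OF F p] by blast
 qed
 show "diminished_base_locus X A (tns E F) <= diminished_base_locus X A E Un diminished_base_locus X A F"
 proof
 fix x assume x: "x:diminished_base_locus X A (tns E F)"
 hence p: "x:pts" using base_loci_points(2) by blast
 have "~ (ALL q>=1. EX m>=1. ggen (ptwist q m (tns E F)) x)"
 using x dbl_iff[OF T p] by blast
 thus "x:diminished_base_locus X A E Un diminished_base_locus X A F"
 using tns_positive_gen[OF E F p] dbl_iff[OF E p] dbl_iff[OF F p] by blast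
 qed
 obtain et where generic: "et:pts" "!!W. opn W ==> W ~= {} ==> et:W"
 by (rule generic_point) (rule that)
 have et: "et:pts" "!W. opn W & W ~= {} --> et:W" using generic by blast+
 note big = V_big_iff[OF et] and psef = V_psef_iff[OF et]
 show "V_big X A (tns E F)" if "V_big X A E" "V_big X A F"
 by (rule iffD2[OF big[OF T] tns_big_gen[OF E F et(1) iffD1[OF big[OF E] that(1)] iffD1[OF big[OF F] that(2)]]])
 show "V_psef X A (tns E F)" if "V_psef X A E" "V_psef X A F"
 by (rule iffD2[OF psef[OF T]
 tns_positive_gen[OF E F et(1) iffD1[OF psef[OF E] that(1)] iffD1[OF psef[OF F] that(2)]]])
 show "V_big X A (tns E F)" if "V_big X A E" "V_psef X A F"
 by (rule iffD2[OF big[OF T]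
 tns_negative_gen[OF E F et(1) iffD1[OF big[OF E] that(1)] iffD1[OF psef[OF F] that(2)]]])
qed

end

theorem lemma2p18:
  fixes X :: "('p, 'a) ringed"
    and A :: "('p, 'a, 'l) presheaf"
    and E :: "('p, 'a, 'e) presheaf"
    and F :: "('p, 'a, 'f) presheaf"
  assumes "projective_variety TYPE('k :: {alg_closed_field, field_char_0}) X"
    and "ample_line_bundle X A"
    and "vector_bundle X E" and "vector_bundle X F"
  shows
    "augmented_base_locus X A (tensor_sheaf X E F)
       \<subseteq> augmented_base_locus X A E \<union> diminished_base_locus X A F \<and>
     diminished_base_locus X A (tensor_sheaf X E F)
       \<subseteq> diminished_base_locus X A E \<union> diminished_base_locus X A F \<and>
     (V_big X A E \<and> V_big X A F \<longrightarrow> V_big X A (tensor_sheaf X E F)) \<and>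
     (V_psef X A E \<and> V_psef X A F \<longrightarrow> V_psef X A (tensor_sheaf X E F)) \<and>
     (V_big X A E \<and> V_psef X A F \<longrightarrow> V_big X A (tensor_sheaf X E F))"
proof -
 from assms(1) obtain n f ph where integral: "integral_scheme X"
 and f: "closed_immersion X (projective_space TYPE('k) n) f ph"
 unfolding projective_variety_def by blast
 have mor: "morphism X (projective_space TYPE('k) n) f ph"
 using f unfolding closed_immersion_def local_morphism_def by blast
 have "ringed_space X" using integral unfolding integral_scheme_def is_scheme_def by blast
 then interpret rspace X by unfold_locales
 have A: "psheaf X A"
 using assms(2) unfolding ample_line_bundle_def line_bundle_def by (blast intro: mod_sheaf_imp_psh)
 \<comment> \<open>Characteristic zero enters here, through the constants pulled back along the
   immersion into projective space.\<close>
 interpret polarised X A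
 by unfold_locales (rule integral A assms(2) naturals_invertible[OF mor], assumption?)+
 have E: "psheaf X E" and F: "psheaf X F"
 using assms(3,4) unfolding vector_bundle_def by (blast intro: mod_sheaf_imp_psh)+
 interpret E: mpsh X E by unfold_locales (rule E)
 interpret F: mpsh X F by unfold_locales (rule F)
 note 1 = base_loci_tns[OF E E.vector_bundle_loc_fg[OF assms(3)] F F.vector_bundle_loc_fg[OF assms(4)]]
 show ?thesis by (intro conjI impI 1) simp_all
qed

end
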